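(* Assume that there are real constants $\sigma^2>0$ and $\rho$ with $|\rho|<\sigma^2$ such that, for all $n\ge p-1$: (i) for every $k\in\mathbb{G}_{n+1}$, $\varepsilon_k\in L^2$, $\mathbb{E}[\varepsilon_k\mid\mathcal{F}_n]=0$ and $\mathbb{E}[\varepsilon_k^2\mid\mathcal{F}_n]=\sigma^2$ a.s.; (ii) for all different $k,l\in\mathbb{G}_{n+1}$, if $[k/2]=[l/2]$ then $\mathbb{E}[\varepsilon_k\varepsilon_l\mid\mathcal{F}_n]=\rho$ a.s., and otherwise $\varepsilon_k$ and $\varepsilon_l$ are conditionally independent given $\mathcal{F}_n$. Assume also that (iii) $\varepsilon_k\in L^4$ for all $k\in\mathbb{G}_{n+1}$, $n\ge p-1$, and $\sup_{n\ge p-1}\sup_{k\in\mathbb{G}_{n+1}}\mathbb{E}[\varepsilon_k^4\mid\mathcal{F}_n]<\infty$ a.s.; (iv) there are $\tau^4>0$ and $\nu^2<\tau^4$ such that for all $n\ge p-1$, $\mathbb{E}[\varepsilon_k^4\mid\mathcal{F}_n]=\tau^4$ a.s. for all $k\in\mathbb{G}_{n+1}$, and $\mathbb{E}[\varepsilon_k^2\varepsilon_l^2\mid\mathcal{F}_n]=\nu^2$ a.s. for all different $k,l\in\mathbb{G}_{n+1}$ with $[k/2]=[l/2]$; and (v) $\varepsilon_k\in L^8$ for all $k\in\mathbb{G}_{n+1}$, $n\ge p-1$, and $\sup_{n\ge p-1}\sup_{k\in\mathbb{G}_{n+1}}\mathbb{E}[\varepsilon_k^8\mid\mathcal{F}_n]<\infty$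 a.s. Then, as $n\to\infty$, the following convergences in distribution hold: $$\sqrt{|\mathbb{T}_{n-1}|}\,(\widehat\theta_n-\theta)\longrightarrow\mathcal{N}(0,\Gamma\otimes L^{-1}),$$ $$\sqrt{|\mathbb{T}_{n-1}|}\,(\widehat\sigma_n^2-\sigma^2)\longrightarrow\mathcal{N}\Big(0,\frac{\tau^4-2\sigma^4+\nu^2}{2}\Big),$$ $$\sqrt{|\mathbb{T}_{n-1}|}\,(\widehat\rho_n-\rho)\longrightarrow\mathcal{N}(0,\nu^2-\rho^2).$$
   Context: Fix an integer $p\ge1$. For $n\ge0$ let $\mathbb{G}_n=\{2^n,\dots,2^{n+1}-1\}$, $\mathbb{T}_n=\bigcup_{k=0}^n\mathbb{G}_k$, and for an integer $q\geq 0$ let $\mathbb{T}_{n,q}=\{k\in\mathbb{T}_n:k\ge2^q\}$; $|E|$ denotes cardinality, so $|\mathbb{G}_n|=2^n$, $|\mathbb{T}_n|=2^{n+1}-1$. $[x]$ is the integer part of $x$. The asymmetric BAR($p$) process consists of real random variables $(X_n)_{n\ge1}$ and $(\varepsilon_n)_{n\ge2^p}$ such that for all $n\ge2^{p-1}$ $$X_{2n}=a_0+\sum_{k=1}^pa_kX_{[n/2^{k-1}]}+\varepsilon_{2n},\qquad X_{2n+1}=b_0+\sum_{k=1}^pb_kX_{[n/2^{k-1}]}+\varepsilon_{2n+1},$$ with real parameters $a_0,\dots,a_p,b_0,\dots,b_p$. The initial states satisfy $\mathbb{E}[X_k^8]<\infty$ for $1\le k\le2^p-1$. For $n\ge2^{p-1}$,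 $\mathbb{X}_n=(X_n,X_{[n/2]},\dots,X_{[n/2^{p-1}]})^t\in\mathbb{R}^p$. $A$ (resp. $B$) is the $p\times p$ companion matrix with first row $(a_1,\dots,a_p)$ (resp. $(b_1,\dots,b_p)$), ones on the subdiagonal and zeros elsewhere. It is assumed that $\beta=\max\{\|A\|,\|B\|\}<1$, where $\|A\|=\sup\{\|Au\|:u\in\mathbb{R}^p,\|u\|=1\}$ is the operator norm induced by a norm on $\mathbb{R}^p$. $\mathcal{F}_n=\sigma\{X_k:k\in\mathbb{T}_n\}$. $Y_n=(1,\mathbb{X}_n^t)^t\in\mathbb{R}^{p+1}$, $Z_n=(X_{2n},X_{2n+1})^t$ and, for $n\ge p-1$, $S_n=\sum_{k\in\mathbb{T}_{n,p-1}}Y_kY_k^t$, with the convention that when $S_n$ is not invertible it is replaced by $S_n+I_{p+1}$. The parameter is $\theta=(a_0,\dots,a_p,b_0,\dots,b_p)^t\in\mathbb{R}^{2(p+1)}$ and the least squares estimator is, for $n\ge p$, $\widehat\theta_n=\mathrm{vec}\big(S_{n-1}^{-1}\sum_{k\in\mathbb{T}_{n-1,p-1}}Y_kZ_k^t\big)$ (vec stacks columns), whose entries are written $(\widehat a_{0,n},\dots,\widehat a_{p,n},\widehat b_{0,n},\dots,\widehat b_{p,n})^t$; $\widehat\theta_{p-1}$ is given an arbitrary fixed initial value. For all $n\ge p-1$ and $k\in\mathbb{G}_n$, $$\widehat\varepsilon_{2k}=X_{2k}-\widehat a_{0,n}-\sum_{i=1}^p\widehat a_{i,n}X_{[k/2^{i-1}]},\qquad\widehat\varepsilon_{2k+1}=X_{2k+1}-\widehat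 b_{0,n}-\sum_{i=1}^p\widehat b_{i,n}X_{[k/2^{i-1}]}.$$ Define $$\widehat\sigma_n^2=\frac1{2|\mathbb{T}_{n-1}|}\sum_{k\in\mathbb{T}_{n-1,p-1}}(\widehat\varepsilon_{2k}^2+\widehat\varepsilon_{2k+1}^2),\qquad\widehat\rho_n=\frac1{|\mathbb{T}_{n-1}|}\sum_{k\in\mathbb{T}_{n-1,p-1}}\widehat\varepsilon_{2k}\widehat\varepsilon_{2k+1}.$$ $\Gamma=\begin{pmatrix}\sigma^2&\rho\\ \rho&\sigma^2\end{pmatrix}$, $\otimes$ is the Kronecker product, and $L=\begin{pmatrix}1&\lambda^t\\ \lambda&\ell\end{pmatrix}$ (a positive definite matrix), where, with $e_1=(1,0,\dots,0)^t\in\mathbb{R}^p$, $\overline a=(a_0+b_0)/2$, $\overline{a^2}=(a_0^2+b_0^2)/2$, $\overline A=(A+B)/2$, one sets $\lambda=\overline a(I_p-\overline A)^{-1}e_1$ and $\ell$ is the unique solution of $\ell=T+\frac12(A\ell A^t+B\ell B^t)$ with $$T=(\sigma^2+\overline{a^2})e_1e_1^t+\tfrac12\big(a_0(A\lambda e_1^t+e_1\lambda^tA^t)+b_0(B\lambda e_1^t+e_1\lambda^tB^t)\big).$$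
   Formalization: In (ii), instead of conditional independence of any two non-sister noises, the sister pairs (ε_{2j}, ε_{2j+1}), j∈G_n, are assumed mutually conditionally independent given F_n; with only two-by-two independence the limit law can fail. *)

theory Defs
  imports "HOL-Probability.Probability"
begin

section \<open>The binary tree\<close>

definition gen :: "nat \<Rightarrow> nat set" where
  "gen n = {2 ^ n ..< 2 ^ (n + 1)}"

definition tree :: "nat \<Rightarrow> nat set" where
  "tree n = (\<Union>k\<le>n. gen k)"

definition tree_from :: "nat \<Rightarrow> nat \<Rightarrow> nat set" where
  "tree_from n q = {k \<in> tree n. 2 ^ q \<le> k}"

definition generation_of :: "nat \<Rightarrow> nat" where
  "generation_of k = (THE n. k \<in> gen n)"


section \<open>Vectors and matrices\<close>

text \<open>
  The order \<open>p\<close> of the process is \<open>CARD('p)\<close> for a finite linearly ordered index type \<open>'p\<close>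
  (such types exist for every \<open>p \<ge> 1\<close>, e.g. the numeral types), and \<open>pos\<close> is the increasing
  bijection from \<open>'p\<close> onto \<open>{1..p}\<close>.

  Vectors in dimension \<open>p + 1\<close> are indexed by \<open>'p option\<close>, where \<open>None\<close> is the position of the
  intercept.  Vectors in dimension \<open>2 (p + 1)\<close> are indexed by \<open>2 \<times> 'p option\<close>: the first component
  selects the block (\<open>1\<close> for the \<open>a\<close>'s, \<open>2\<close> for the \<open>b\<close>'s), the second one the position in the block.
\<close>

definition pos :: "'p::{finite,linorder} \<Rightarrow> nat" where
  "pos i = card {j. j \<le> i}"

definition e1 :: "real ^ ('p::{finite,linorder})" where
  "e1 = (\<chi> i. if pos i = 1 then 1 else 0)"

definition companion :: "(nat \<Rightarrow> real) \<Rightarrow> real ^ ('p::{finite,linorder}) ^ ('p::{finite,linorder})" where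
  "companion c = (\<chi> i j. if pos i = 1 then c (pos j) else if pos i = pos j + 1 then 1 else 0)"

definition outer :: "real ^ 'n \<Rightarrow> real ^ 'm \<Rightarrow> real ^ 'm ^ 'n" where
  "outer u v = (\<chi> i j. u $ i * v $ j)"

definition kronecker :: "real ^ 'n ^ 'm \<Rightarrow> real ^ 'l ^ 'k \<Rightarrow> real ^ ('n \<times> 'l) ^ ('m \<times> 'k)" where
  "kronecker A B = (\<chi> i j. A $ fst i $ fst j * B $ snd i $ snd j)"

text \<open>Stacking of the columns: the column index is the leading one.\<close>

definition vec_stack :: "real ^ 'n ^ 'm \<Rightarrow> real ^ ('n \<times> 'm)" where
  "vec_stack A = (\<chi> i. A $ snd i $ fst i)"

definition is_norm :: "(real ^ 'n \<Rightarrow> real) \<Rightarrow> bool" where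
  "is_norm N \<longleftrightarrow>
     (\<forall>u. 0 \<le> N u) \<and> (\<forall>u. N u = 0 \<longleftrightarrow> u = 0) \<and>
     (\<forall>c u. N (c *\<^sub>R u) = \<bar>c\<bar> * N u) \<and> (\<forall>u v. N (u + v) \<le> N u + N v)"

definition op_norm :: "(real ^ 'n \<Rightarrow> real) \<Rightarrow> real ^ 'n ^ 'n \<Rightarrow> real" where
  "op_norm N A = (SUP u \<in> {u. N u = 1}. N (A *v u))"


section \<open>Conditioning\<close>

text \<open>The \<open>\<sigma>\<close>-algebra \<open>\<F>\<^sub>n\<close> generated by \<open>X k\<close>, \<open>k \<in> tree n\<close>.\<close>

definition tree_sigma :: "'w measure \<Rightarrow> (nat \<Rightarrow> 'w \<Rightarrow> real) \<Rightarrow> nat \<Rightarrow> 'w measure" where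
  "tree_sigma M X n =
     sigma (space M) {X k -` S \<inter> space M | k S. k \<in> tree n \<and> S \<in> sets borel}"

definition prob_given :: "'w measure \<Rightarrow> 'w measure \<Rightarrow> 'w set \<Rightarrow> 'w \<Rightarrow> real" where
  "prob_given M F E = real_cond_exp M F (indicator E)"

text \<open>Independence of the family \<open>Y i\<close>, \<open>i \<in> I\<close>, conditionally on the sub-\<open>\<sigma>\<close>-algebra \<open>F\<close>; compare
  \<^const>\<open>prob_space.indep_vars\<close>.  It is applied to the pairs of sister noises
  \<open>(\<epsilon> (2 * j), \<epsilon> (2 * j + 1))\<close>, \<open>j \<in> gen n\<close>: the noises of a generation are conditionally independent
  except within a pair.  This is independence of the whole family of pairs; independence of any two
  non-sister noises only would not be enough for a central limit theorem.\<close>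

definition cond_indep_vars ::
  "'w measure \<Rightarrow> 'w measure \<Rightarrow> 'b measure \<Rightarrow> ('i \<Rightarrow> 'w \<Rightarrow> 'b) \<Rightarrow> 'i set \<Rightarrow> bool" where
  "cond_indep_vars M F N Y I \<longleftrightarrow>
     (\<forall>i\<in>I. Y i \<in> measurable M N) \<and>
     (\<forall>J B. J \<subseteq> I \<and> J \<noteq> {} \<and> finite J \<and> (\<forall>j\<in>J. B j \<in> sets N) \<longrightarrow>
        (AE \<omega> in M. prob_given M F {\<omega> \<in> space M. \<forall>j\<in>J. Y j \<omega> \<in> B j} \<omega> =
                    (\<Prod>j\<in>J. prob_given M F {\<omega> \<in> space M. Y j \<omega> \<in> B j} \<omega>)))"


section \<open>Normal distributions and convergence in distribution\<close>

text \<open>Affine images of standard normal distributions, so that degenerate (co)variances are covered.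
  The law in \<open>mv_normal\<close> does not depend on the choice of the square root.\<close>

definition normal_dist :: "real \<Rightarrow> real \<Rightarrow> real measure" where
  "normal_dist m v = distr std_normal_distribution borel (\<lambda>z. m + sqrt v * z)"

definition mv_std_normal :: "(real ^ 'n) measure" where
  "mv_std_normal = density lborel (\<lambda>z. ennreal (\<Prod>i\<in>UNIV. std_normal_density (z $ i)))"

definition mv_normal :: "real ^ 'n \<Rightarrow> real ^ 'n ^ 'n \<Rightarrow> (real ^ 'n) measure" where
  "mv_normal m V =
     distr mv_std_normal borel (\<lambda>z. m + (SOME C :: real ^ 'n ^ 'n. C ** transpose C = V) *v z)"

text \<open>The library's \<^const>\<open>weak_conv_m\<close> is restricted to the real line.\<close>

definition weak_conv_vec :: "(nat \<Rightarrow> (real ^ 'n) measure) \<Rightarrow> (real ^ 'n) measure \<Rightarrow> bool" where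
  "weak_conv_vec \<mu> \<nu> \<longleftrightarrow>
     (\<forall>f :: real ^ 'n \<Rightarrow> real. continuous_on UNIV f \<and> bounded (range f) \<longrightarrow>
        (\<lambda>n. \<integral>x. f x \<partial>\<mu> n) \<longlonglongrightarrow> (\<integral>x. f x \<partial>\<nu>))"


section \<open>The least squares estimators\<close>

text \<open>
  All of these are functions of a trajectory \<open>x :: nat \<Rightarrow> real\<close> of the process; \<open>x 0\<close> is never used.
  The vector \<open>\<theta>0\<close> is the arbitrary value given to the estimator of the parameter before time \<open>p\<close>.
\<close>

definition state_vec :: "(nat \<Rightarrow> real) \<Rightarrow> nat \<Rightarrow> real ^ ('p::{finite,linorder})" where
  "state_vec x n = (\<chi> i. x (n div 2 ^ (pos i - 1)))"

definition Yvec :: "(nat \<Rightarrow> real) \<Rightarrow> nat \<Rightarrow> real ^ ('p::{finite,linorder} option)" where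
  "Yvec x n = (\<chi> i. case i of None \<Rightarrow> 1 | Some j \<Rightarrow> state_vec x n $ j)"

definition Zvec :: "(nat \<Rightarrow> real) \<Rightarrow> nat \<Rightarrow> real ^ 2" where
  "Zvec x n = vector [x (2 * n), x (2 * n + 1)]"

definition Smat ::
  "(nat \<Rightarrow> real) \<Rightarrow> nat \<Rightarrow> real ^ ('p::{finite,linorder} option) ^ ('p option)" where
  "Smat x n =
     (let S = (\<Sum>k \<in> tree_from n (CARD('p) - 1). outer (Yvec x k) (Yvec x k))
      in if invertible S then S else S + mat 1)"

definition theta_hat ::
  "real ^ (2 \<times> 'p::{finite,linorder} option) \<Rightarrow> (nat \<Rightarrow> real) \<Rightarrow> nat \<Rightarrow> real ^ (2 \<times> 'p option)" where
  "theta_hat \<theta>0 x n =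
     (if n < CARD('p) then \<theta>0
      else vec_stack (matrix_inv (Smat x (n - 1)) **
             (\<Sum>k \<in> tree_from (n - 1) (CARD('p) - 1). outer (Yvec x k) (Zvec x k))))"

definition theta ::
  "(nat \<Rightarrow> real) \<Rightarrow> (nat \<Rightarrow> real) \<Rightarrow> real ^ (2 \<times> 'p::{finite,linorder} option)" where
  "theta a b = (\<chi> i. (if fst i = 1 then a else b) (case snd i of None \<Rightarrow> 0 | Some j \<Rightarrow> pos j))"

text \<open>The residual at the vertex \<open>j\<close> (with mother \<open>k = j div 2\<close>) uses the estimator computed at the
  generation of \<open>k\<close>, hence changes from one generation to the next.\<close>

definition eps_hat ::
  "real ^ (2 \<times> 'p::{finite,linorder} option) \<Rightarrow> (nat \<Rightarrow> real) \<Rightarrow> nat \<Rightarrow> real" where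
  "eps_hat \<theta>0 x j =
     (let k = j div 2; t = theta_hat \<theta>0 x (generation_of k); c = (if even j then 1 else 2)
      in x j - t $ (c, None) - (\<Sum>i\<in>UNIV. t $ (c, Some i) * x (k div 2 ^ (pos i - 1))))"

definition sigma2_hat ::
  "real ^ (2 \<times> 'p::{finite,linorder} option) \<Rightarrow> (nat \<Rightarrow> real) \<Rightarrow> nat \<Rightarrow> real" where
  "sigma2_hat \<theta>0 x n =
     1 / (2 * real (card (tree (n - 1)))) *
     (\<Sum>k \<in> tree_from (n - 1) (CARD('p) - 1).
        (eps_hat \<theta>0 x (2 * k))\<^sup>2 + (eps_hat \<theta>0 x (2 * k + 1))\<^sup>2)"

definition rho_hat ::
  "real ^ (2 \<times> 'p::{finite,linorder} option) \<Rightarrow> (nat \<Rightarrow> real) \<Rightarrow> nat \<Rightarrow> real" where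
  "rho_hat \<theta>0 x n =
     1 / real (card (tree (n - 1))) *
     (\<Sum>k \<in> tree_from (n - 1) (CARD('p) - 1). eps_hat \<theta>0 x (2 * k) * eps_hat \<theta>0 x (2 * k + 1))"


section \<open>The limiting covariance\<close>

definition Gamma_mat :: "real \<Rightarrow> real \<Rightarrow> real ^ 2 ^ 2" where
  "Gamma_mat s \<rho> = vector [vector [s, \<rho>], vector [\<rho>, s]]"

definition lambda_vec ::
  "(nat \<Rightarrow> real) \<Rightarrow> (nat \<Rightarrow> real) \<Rightarrow> real ^ ('p::{finite,linorder})" where
  "lambda_vec a b =
     ((a 0 + b 0) / 2) *\<^sub>R
       (matrix_inv (mat 1 - (1 / 2) *\<^sub>R (companion a + companion b)) *v e1)"

definition T_mat ::
  "(nat \<Rightarrow> real) \<Rightarrow> (nat \<Rightarrow> real) \<Rightarrow> real \<Rightarrow> real ^ ('p::{finite,linorder}) ^ ('p::{finite,linorder})" where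
  "T_mat a b s =
     (let A = companion a; B = companion b; l = lambda_vec a b in
      (s + ((a 0)\<^sup>2 + (b 0)\<^sup>2) / 2) *\<^sub>R outer e1 e1 +
      (1 / 2) *\<^sub>R (a 0 *\<^sub>R (outer (A *v l) e1 + outer e1 (A *v l)) +
                 b 0 *\<^sub>R (outer (B *v l) e1 + outer e1 (B *v l))))"

definition ell_mat ::
  "(nat \<Rightarrow> real) \<Rightarrow> (nat \<Rightarrow> real) \<Rightarrow> real \<Rightarrow> real ^ ('p::{finite,linorder}) ^ ('p::{finite,linorder})" where
  "ell_mat a b s =
     (THE l. l = T_mat a b s +
        (1 / 2) *\<^sub>R (companion a ** l ** transpose (companion a) +
                   companion b ** l ** transpose (companion b)))"

definition L_mat ::
  "(nat \<Rightarrow> real) \<Rightarrow> (nat \<Rightarrow> real) \<Rightarrow> real \<Rightarrow>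
     real ^ ('p::{finite,linorder} option) ^ ('p option)" where
  "L_mat a b s =
     (\<chi> i j. case (i, j) of
        (None, None) \<Rightarrow> 1
      | (None, Some v) \<Rightarrow> lambda_vec a b $ v
      | (Some u, None) \<Rightarrow> lambda_vec a b $ u
      | (Some u, Some v) \<Rightarrow> ell_mat a b s $ u $ v)"

end

theory Submission
  imports Defs
begin

text \<open>
  Order the vertices of the tree linearly and let one step of the filtration reveal the two daughters
  of a vertex.  The scores \<open>\<Sum>\<^sub>k \<epsilon>\<^bsub>2k+c\<^esub> Y\<^sub>k\<close> and the centred sums of \<open>\<epsilon>\<^bsub>2k\<^esub>\<^sup>2 + \<epsilon>\<^bsub>2k+1\<^esub>\<^sup>2\<close>
  and \<open>\<epsilon>\<^bsub>2k\<^esub> \<epsilon>\<^bsub>2k+1\<^esub>\<close> are then martingales for this filtration; conditional independence of the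
  pairs of sisters ensures that the conditional moments given the finer filtration are those given
  the past generations.  Contraction by the companion matrices turns the smallness of averaged noise
  into a law of large numbers, \<open>S\<^sub>n / |T\<^sub>n| \<rightarrow> L\<close>, and a martingale central limit theorem gives the
  limits of the scores.  The estimation error of the least squares estimator is \<open>S\<^sub>n\<close> inverse times
  the scores, and replacing \<open>\<epsilon>\<close> by the residuals changes the sums defining the variance and
  covariance estimators by \<open>o(|T\<^sub>n|\<^bsup>1/2\<^esup>)\<close>.
\<close>

text \<open>Three obstacles shape the proof. The hypotheses condition on whole generations, whereas
  the martingale reveals one pair of sisters at a time; \<open>real_cond_exp_enlarge\<close> bridges
  the two. The law of large numbers and the residual estimates are deterministic once the noise sums
  are under control, so they are proved for a single trajectory, in locales whose assumptions hold
  almost surely; even the definiteness of \<open>L\<close> is read off from one good trajectory.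
  Finally, the estimation error is small only relative to the scores, and the normalised scores are
  controlled in L^2, not along trajectories; hence the weighted form of Slutsky's lemma. Convergence
  in distribution goes through characteristic functions; in dimension 2 (p + 1) the continuity
  theorem comes from Gaussian smoothing. The growth rate 5/2 of the squared scores is a free choice
  strictly between 2, the rate that orthogonality gives, and 2 sqrt 2, the rate that the residuals
  tolerate: generation l then contributes an error of order (5/4)^l, which is below 2^(l/2).\<close>

section \<open>Normal laws and their characteristic functions\<close>

text \<open>Fubini for Lebesgue measure, seen as the image of a finite product of copies of the real
  line. Values in a normed field allow both real densities and complex exponentials.\<close>

lemma integral_lborel_prod_Basis:
  fixes f :: "'a::euclidean_space \<Rightarrow> real \<Rightarrow> 'b::{real_normed_field,banach,second_countable_topology}"
  assumes int: "\<And>b. b \<in> Basis \<Longrightarrow> integrable lborel (f b)"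
  shows "integrable lborel (\<lambda>x::'a. \<Prod>b\<in>Basis. f b (x \<bullet> b))"
    and "(\<integral>x. (\<Prod>b\<in>Basis. f b (x \<bullet> b)) \<partial>(lborel::'a measure)) = (\<Prod>b\<in>Basis. \<integral>x. f b x \<partial>lborel)"
proof -
  interpret product_sigma_finite "\<lambda>_::'a. lborel :: real measure" ..
  have [measurable]: "b \<in> Basis \<Longrightarrow> f b \<in> borel_measurable borel" for b
    using int by (auto dest: borel_measurable_integrable)
  let ?T = "\<lambda>g::'a \<Rightarrow> real. \<Sum>b\<in>Basis. g b *\<^sub>R b"
  have T: "?T \<in> measurable (\<Pi>\<^sub>M b\<in>(Basis::'a set). (lborel::real measure)) borel"
    by measurable
  have F: "(\<lambda>x::'a. \<Prod>b\<in>Basis. f b (x \<bullet> b)) \<in> borel_measurable borel"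
    by measurable
  have eq: "(\<Prod>b\<in>Basis. f b (?T g \<bullet> b)) = (\<Prod>b\<in>Basis. f b (g b))" for g
    by (intro prod.cong refl) (simp add: inner_sum_left inner_Basis if_distrib sum.delta cong: if_cong)
  show "integrable lborel (\<lambda>x::'a. \<Prod>b\<in>Basis. f b (x \<bullet> b))"
    by (subst lborel_eq, subst integrable_distr_eq[OF T F], unfold eq, rule product_integrable_prod)
       (use int in auto)
  show "(\<integral>x. (\<Prod>b\<in>Basis. f b (x \<bullet> b)) \<partial>(lborel::'a measure)) = (\<Prod>b\<in>Basis. \<integral>x. f b x \<partial>lborel)"
    by (subst lborel_eq, subst integral_distr[OF T F], unfold eq, rule product_integral_prod)
       (use int in auto)
qed

lemma Basis_vec_eq: "(Basis :: (real ^ 'n) set) = range (\<lambda>i. axis i 1)"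
  by (auto simp: Basis_vec_def)

lemma integral_lborel_prod_vec:
  fixes f :: "'n::finite \<Rightarrow> real \<Rightarrow> 'b::{real_normed_field,banach,second_countable_topology}"
  assumes int: "\<And>i. integrable lborel (f i)"
  shows "integrable lborel (\<lambda>x::real^'n. \<Prod>i\<in>UNIV. f i (x $ i))"
    and "(\<integral>x. (\<Prod>i\<in>UNIV. f i (x $ i)) \<partial>(lborel::(real^'n) measure)) = (\<Prod>i\<in>UNIV. \<integral>x. f i x \<partial>lborel)"
proof -
  define g where "g = (\<lambda>b::real^'n. f (THE i. b = axis i 1))"
  have inj: "inj (\<lambda>i::'n. axis i (1::real))" by (auto simp: inj_def axis_eq_axis)
  have g: "g (axis i 1) = f i" for i by (simp add: g_def axis_eq_axis)
  have eq: "(\<Prod>b\<in>Basis. h b) = (\<Prod>i\<in>UNIV. h (axis i 1))" for h :: "real^'n \<Rightarrow> 'b"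
    unfolding Basis_vec_eq by (subst prod.reindex[OF inj]) simp
  have "integrable lborel (g b)" if "b \<in> Basis" for b
    using that int by (auto simp: Basis_vec_eq g)
  note * = integral_lborel_prod_Basis[of g, OF this]
  show "integrable lborel (\<lambda>x::real^'n. \<Prod>i\<in>UNIV. f i (x $ i))"
    using *(1) by (simp add: eq g inner_axis)
  show "(\<integral>x. (\<Prod>i\<in>UNIV. f i (x $ i)) \<partial>(lborel::(real^'n) measure)) = (\<Prod>i\<in>UNIV. \<integral>x. f i x \<partial>lborel)"
    using *(2) by (simp add: eq g inner_axis)
qed

lemma sets_mv_std_normal [simp, measurable_cong]: "sets mv_std_normal = sets borel"
  by (simp add: mv_std_normal_def)

lemma space_mv_std_normal [simp]: "space mv_std_normal = UNIV"
  by (simp add: mv_std_normal_def)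

lemma mv_std_normal_density_nonneg: "0 \<le> (\<Prod>i\<in>UNIV. std_normal_density ((z::real^'n) $ i))"
  by (intro prod_nonneg) auto

lemma prob_space_mv_std_normal: "prob_space (mv_std_normal :: (real^'n) measure)"
proof
  have i: "integrable lborel (\<lambda>z::real^'n. \<Prod>i\<in>UNIV. std_normal_density (z $ i))"
    by (rule integral_lborel_prod_vec) simp
  have "emeasure (mv_std_normal :: (real^'n) measure) (space mv_std_normal)
      = (\<integral>\<^sup>+z. ennreal (\<Prod>i\<in>UNIV. std_normal_density ((z::real^'n) $ i)) \<partial>lborel)"
    by (simp add: mv_std_normal_def emeasure_density)
  also have "\<dots> = ennreal (\<integral>z. (\<Prod>i\<in>UNIV. std_normal_density ((z::real^'n) $ i)) \<partial>lborel)"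
    by (rule nn_integral_eq_integral[OF i]) (simp add: mv_std_normal_density_nonneg)
  also have "\<dots> = 1"
    by (subst integral_lborel_prod_vec(2)) (auto simp: integral_normal_density)
  finally show "emeasure (mv_std_normal :: (real^'n) measure) (space mv_std_normal) = 1" .
qed

lemma integral_mv_std_normal:
  fixes f :: "real ^ 'n \<Rightarrow> 'b::{banach, second_countable_topology}"
  assumes [measurable]: "f \<in> borel_measurable borel"
  shows "integral\<^sup>L mv_std_normal f = (\<integral>z. (\<Prod>i\<in>UNIV. std_normal_density (z $ i)) *\<^sub>R f z \<partial>lborel)"
  unfolding mv_std_normal_def
  by (rule integral_density) (auto simp: mv_std_normal_density_nonneg)

lemma char_mv_std_normal:
  fixes u :: "real ^ 'n"
  shows "(\<integral>z. iexp (u \<bullet> z) \<partial>mv_std_normal) = exp (- of_real ((norm u)\<^sup>2) / 2)"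
proof -
  let ?f = "\<lambda>i x. complex_of_real (std_normal_density x) * iexp (u $ i * x)"
  have one: "integrable lborel (?f i)" for i
    by (rule Bochner_Integration.integrable_bound[of _ "std_normal_density"])
       (auto simp: norm_mult)
  have "(\<integral>z. iexp (u \<bullet> z) \<partial>mv_std_normal)
     = (\<integral>z. (\<Prod>i\<in>UNIV. std_normal_density ((z::real^'n) $ i)) *\<^sub>R iexp (u \<bullet> z) \<partial>lborel)"
    by (rule integral_mv_std_normal) simp
  also have "\<dots> = (\<integral>z. (\<Prod>i\<in>UNIV. ?f i (z $ i)) \<partial>lborel)"
    by (intro Bochner_Integration.integral_cong refl)
       (simp add: prod.distrib inner_vec_def scaleR_conv_of_real sum_distrib_left flip: exp_sum)
  also have "\<dots> = (\<Prod>i\<in>UNIV. \<integral>x. ?f i x \<partial>lborel)"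
    by (rule integral_lborel_prod_vec) (rule one)
  also have "\<dots> = (\<Prod>i\<in>UNIV. exp (- complex_of_real ((u $ i)\<^sup>2) / 2))"
  proof (rule prod.cong[OF refl])
    fix i
    have "(\<integral>x. ?f i x \<partial>lborel) = (\<integral>x. std_normal_density x *\<^sub>R iexp (u $ i * x) \<partial>lborel)"
      by (simp add: scaleR_conv_of_real)
    also have "\<dots> = char std_normal_distribution (u $ i)"
      unfolding char_def by (rule integral_density[symmetric]) auto
    also have "\<dots> = exp (- of_real ((u $ i)\<^sup>2) / 2)"
      by (simp add: char_std_normal_distribution flip: exp_of_real)
    finally show "(\<integral>x. ?f i x \<partial>lborel) = exp (- of_real ((u $ i)\<^sup>2) / 2)" .
  qed
  also have "(\<Prod>i\<in>UNIV. exp (- complex_of_real ((u $ i)\<^sup>2) / 2)) = exp (- of_real ((norm u)\<^sup>2) / 2)"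
    unfolding power2_norm_eq_inner inner_vec_def
    by (simp add: exp_sum sum_negf sum_divide_distrib power2_eq_square flip: exp_sum)
  finally show ?thesis .
qed

text \<open>The Gaussian is its own Fourier transform up to a constant. This turns the smoothing
  kernel into an average of characters, so that its integral against a measure sees the measure only
  through its characteristic function.\<close>

lemma mv_std_normal_density_eq:
  fixes w :: "real ^ 'n"
  shows "complex_of_real (\<Prod>i\<in>UNIV. std_normal_density (w $ i))
    = of_real (1 / sqrt (2 * pi) ^ CARD('n)) * (\<integral>z. iexp (w \<bullet> z) \<partial>mv_std_normal)"
proof -
  have "(\<Prod>i\<in>UNIV. std_normal_density (w $ i)) = 1 / sqrt (2 * pi) ^ CARD('n) * exp (- (norm w)\<^sup>2 / 2)"
    unfolding power2_norm_eq_inner inner_vec_def normal_density_def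
    by (simp add: prod.distrib exp_sum sum_negf sum_divide_distrib power2_eq_square prod_dividef flip: exp_sum)
  then show ?thesis unfolding char_mv_std_normal by (simp flip: exp_of_real)
qed

text \<open>Symmetric Gaussian elimination: each pivot splits off a rank one matrix, and positive
  semidefiniteness survives because the remaining form is the minimum of the old one along the axis
  of the pivot.\<close>

lemma psd_sqrt_exists:
  fixes V :: "real ^ 'n ^ 'n"
  assumes sym: "transpose V = V" and psd: "\<And>x. 0 \<le> x \<bullet> (V *v x)"
  shows "\<exists>C :: real ^ 'n ^ 'n. C ** transpose C = V"
proof -
  define symm where "symm = (\<lambda>W::real^'n^'n. \<forall>i j. W $ i $ j = W $ j $ i)"
  define quad where "quad = (\<lambda>(W::real^'n^'n) x. \<Sum>i\<in>UNIV. \<Sum>j\<in>UNIV. x i * W $ i $ j * x j)"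
  have quad: "x \<bullet> (W *v x) = quad W (\<lambda>i. x $ i)" for x W
    by (simp add: quad_def inner_vec_def matrix_vector_mult_def sum_distrib_left mult_ac)
  have quad_nn: "0 \<le> quad V x" for x
    using psd[of "\<chi> i. x i"] by (simp add: quad)
  have symV: "symm V" unfolding symm_def using sym by (metis transpose_def vec_lambda_beta)
  \<comment> \<open>\<open>I\<close> is the set of pivots already eliminated, \<open>W\<close> what
    is left of \<open>V\<close>, and \<open>c k\<close> the column of the root contributed by pivot
    \<open>k\<close>.\<close>
  have "\<exists>c W. symm W \<and> (\<forall>x. 0 \<le> quad W x) \<and> (\<forall>i\<in>I. \<forall>j. W $ i $ j = 0) \<and>
      (\<forall>i j. V $ i $ j = W $ i $ j + (\<Sum>k\<in>I. c k i * c k j))" if "finite I" for I :: "'n set"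
    using that
  proof (induction I)
    case empty
    then show ?case using symV quad_nn by auto
  next
    case (insert m I)
    then obtain c W where W: "symm W" "\<And>x. 0 \<le> quad W x" "\<And>i j. i \<in> I \<Longrightarrow> W $ i $ j = 0"
      "\<And>i j. V $ i $ j = W $ i $ j + (\<Sum>k\<in>I. c k i * c k j)" by blast
    define d where "d = W $ m $ m"
    define w where "w = (\<lambda>x. \<Sum>j\<in>UNIV. W $ m $ j * x j)"
    \<comment> \<open>Expansion of the form along the axis of the pivot \<open>m\<close>; both cases
      below consist in a good choice of \<open>t\<close>.\<close>
    have exp: "quad W (\<lambda>i. x i - (if i = m then t else 0)) = quad W x - 2 * t * w x + t\<^sup>2 * d" for x t
    proof -
      have "quad W (\<lambda>i. x i - (if i = m then t else 0)) =
         (\<Sum>i\<in>UNIV. \<Sum>j\<in>UNIV. x i * W $ i $ j * x j - (if i = m then t * (W $ m $ j * x j) else 0)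
           - (if j = m then t * (W $ m $ i * x i) else 0) + (if j = m then (if i = m then t * t * d else 0) else 0))"
        unfolding quad_def using W(1) by (intro sum.cong refl) (auto simp: algebra_simps d_def symm_def)
      also have "\<dots> = quad W x - (\<Sum>i\<in>UNIV. \<Sum>j\<in>UNIV. (if i = m then t * (W $ m $ j * x j) else 0))
           - (\<Sum>i\<in>UNIV. t * (W $ m $ i * x i)) + t * t * d"
        by (simp add: sum.distrib sum_subtractf quad_def)
      also have "(\<Sum>i\<in>UNIV. \<Sum>j\<in>UNIV. (if i = m then t * (W $ m $ j * x j) else 0)) = (\<Sum>j\<in>UNIV. t * (W $ m $ j * x j))"
        by (subst sum.swap) simp
      finally show ?thesis by (simp add: w_def sum_distrib_left[symmetric] power2_eq_square)
    qed
    have d0: "0 \<le> d"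
    proof -
      have "quad W (\<lambda>i. 0) = 0" "w (\<lambda>i. 0) = 0" by (auto simp: quad_def w_def)
      then show ?thesis using W(2)[of "\<lambda>i. 0 - (if i = m then 1 else 0)"] exp[of "\<lambda>i. 0" 1] by auto
    qed
    show ?case
    proof (cases "d = 0")
      case True
      have z: "W $ m $ j = 0" for j
      proof (rule ccontr)
        assume nz: "W $ m $ j \<noteq> 0"
        let ?x = "\<lambda>i. if i = j then 1 else 0 :: real"
        have wj: "w ?x = W $ m $ j" by (simp add: w_def if_distrib[where f="\<lambda>x. _ * x"] cong: if_cong)
        \<comment> \<open>With a zero diagonal entry the expansion is affine in \<open>t\<close>;
          this \<open>t\<close> makes it equal to -1, which contradicts semidefiniteness.\<close>
        show False using W(2)[of "\<lambda>i. ?x i - (if i = m then (quad W ?x + 1) / (2 * w ?x) else 0)"]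
          exp[of ?x "(quad W ?x + 1) / (2 * w ?x)"] True nz unfolding wj by (simp add: field_simps)
      qed
      show ?thesis
        using W z insert.hyps by (intro exI[of _ "c(m := (\<lambda>_. 0))"] exI[of _ W])
          (auto intro!: sum.cong)
    next
      case False
      with d0 have d: "d > 0" by simp
      define W' where "W' = (\<chi> i j. W $ i $ j - W $ m $ i * W $ m $ j / d)"
      \<comment> \<open>Completing the square: \<open>w x / d\<close> minimises the expansion in
        \<open>t\<close>, and the minimum is the form of the Schur complement
        \<open>W'\<close>.\<close>
      have q': "quad W' x = quad W (\<lambda>i. x i - (if i = m then w x / d else 0))" for x
      proof -
        have "quad W' x = (\<Sum>i\<in>UNIV. \<Sum>j\<in>UNIV. x i * W $ i $ j * x j - (W $ m $ i * x i) * (W $ m $ j * x j) / d)"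
          unfolding quad_def W'_def by (simp add: algebra_simps diff_divide_distrib)
        also have "\<dots> = quad W x - w x * w x / d"
          by (simp add: sum_subtractf quad_def w_def sum_product sum_divide_distrib)
        finally show ?thesis unfolding exp using d by (simp add: field_simps power2_eq_square)
      qed
      define c' where "c' = c(m := (\<lambda>i. W $ m $ i / sqrt d))"
      have cI: "(\<Sum>k\<in>I. c' k i * c' k j) = (\<Sum>k\<in>I. c k i * c k j)" for i j
        using insert.hyps by (intro sum.cong) (auto simp: c'_def)
      show ?thesis
      proof (intro exI[of _ c'] exI[of _ W'] conjI allI ballI)
        show "symm W'" using W(1) by (simp add: symm_def W'_def)
        show "0 \<le> quad W' x" for x using q' W(2) by simp
        show "W' $ i $ j = 0" if "i \<in> insert m I" for i j
        proof (cases "i = m")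
          case True then show ?thesis using d by (simp add: W'_def d_def)
        next
          case False
          then have "W $ i $ j = 0" "W $ i $ m = 0" using that W(3) by auto
          then show ?thesis using W(1) by (simp add: W'_def symm_def)
        qed
        show "V $ i $ j = W' $ i $ j + (\<Sum>k\<in>insert m I. c' k i * c' k j)" for i j
        proof -
          have "(\<Sum>k\<in>insert m I. c' k i * c' k j) = c' m i * c' m j + (\<Sum>k\<in>I. c k i * c k j)"
            using insert.hyps by (simp add: cI)
          moreover have "c' m i * c' m j = W $ m $ i * W $ m $ j / d"
            using d by (simp add: c'_def)
          ultimately show ?thesis using W(4)[of i j] by (simp add: W'_def)
        qed
      qed
    qed
  qed
  from this[of UNIV, OF finite] obtain c :: "'n \<Rightarrow> 'n \<Rightarrow> real" and W
    where "\<forall>i\<in>UNIV. \<forall>j. (W::real^'n^'n) $ i $ j = 0"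
      "\<forall>i j. V $ i $ j = W $ i $ j + (\<Sum>k\<in>UNIV. c k i * c k j)" by blast
  then have "(\<chi> i k. c k i) ** transpose (\<chi> i k. c k i) = V"
    by (simp add: vec_eq_iff matrix_matrix_mult_def transpose_def)
  then show ?thesis by blast
qed

text \<open>Existence of some root is all that matters: the characteristic function depends on the
  chosen \<open>C\<close> only through the squared norm of its transpose applied to
  \<open>u\<close>, which is u . V u.\<close>

lemma mv_normal_props:
  fixes V :: "real ^ 'n ^ 'n"
  assumes "\<exists>C :: real ^ 'n ^ 'n. C ** transpose C = V"
  shows "prob_space (mv_normal 0 V)" "sets (mv_normal 0 V) = sets borel"
    "(\<integral>z. iexp (u \<bullet> z) \<partial>mv_normal 0 V) = exp (- of_real (u \<bullet> (V *v u)) / 2)"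
proof -
  define C where "C = (SOME C :: real ^ 'n ^ 'n. C ** transpose C = V)"
  have C: "C ** transpose C = V" unfolding C_def using assms by (rule someI_ex)
  have m: "(\<lambda>z. 0 + C *v z) \<in> borel_measurable mv_std_normal"
    by (auto intro!: borel_measurable_continuous_onI continuous_intros matrix_vector_mult_linear_continuous_on
        simp: measurable_cong_sets[OF sets_mv_std_normal refl])
  show "prob_space (mv_normal 0 V)" unfolding mv_normal_def C_def[symmetric]
    by (rule prob_space.prob_space_distr[OF prob_space_mv_std_normal m])
  show "sets (mv_normal 0 V) = sets borel" by (simp add: mv_normal_def)
  have "(\<integral>z. iexp (u \<bullet> z) \<partial>mv_normal 0 V) = (\<integral>z. iexp (u \<bullet> (0 + C *v z)) \<partial>mv_std_normal)"
    unfolding mv_normal_def C_def[symmetric] by (rule integral_distr[OF m]) simp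
  also have "\<dots> = (\<integral>z. iexp ((transpose C *v u) \<bullet> z) \<partial>mv_std_normal)"
    by (simp add: dot_lmul_matrix[symmetric] vector_transpose_matrix flip: transpose_matrix_vector)
  also have "\<dots> = exp (- of_real (u \<bullet> (V *v u)) / 2)"
    unfolding char_mv_std_normal power2_norm_eq_inner C[symmetric]
    by (simp add: dot_lmul_matrix[symmetric] matrix_vector_mul_assoc[symmetric] flip: transpose_matrix_vector)
  finally show "(\<integral>z. iexp (u \<bullet> z) \<partial>mv_normal 0 V) = exp (- of_real (u \<bullet> (V *v u)) / 2)" .
qed

lemma normal_dist_props:
  assumes v: "0 \<le> v"
  shows "real_distribution (normal_dist 0 v)" "char (normal_dist 0 v) t = exp (- of_real (t\<^sup>2 * v) / 2)"
proof -
  interpret real_distribution std_normal_distribution by (rule real_dist_normal_dist)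
  have m: "(\<lambda>z. 0 + sqrt v * z) \<in> borel_measurable std_normal_distribution" by simp
  show "real_distribution (normal_dist 0 v)"
    unfolding normal_dist_def by (intro real_distribution_distr) simp
  have "char (normal_dist 0 v) t = (\<integral>z. iexp (t * (0 + sqrt v * z)) \<partial>std_normal_distribution)"
    unfolding normal_dist_def char_def by (rule integral_distr[OF m]) simp
  also have "\<dots> = char std_normal_distribution (t * sqrt v)" by (simp add: char_def mult_ac)
  finally show "char (normal_dist 0 v) t = exp (- of_real (t\<^sup>2 * v) / 2)"
    using v by (simp add: char_std_normal_distribution power_mult_distrib flip: exp_of_real of_real_power)
qed

section \<open>Gaussian smoothing and the continuity theorem in R^n\<close>

text \<open>Convolution of \<open>f\<close> with the centred Gaussian of covariance s^2 I.\<close>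

definition smooth :: "real \<Rightarrow> (real^'n \<Rightarrow> real) \<Rightarrow> real^'n \<Rightarrow> real" where
  "smooth s f y = (\<integral>z. f (y + s *\<^sub>R z) \<partial>mv_std_normal)"

text \<open>The Lebesgue density of that Gaussian, written through the standard density so that its
  Fourier formula applies after rescaling.\<close>

definition gkernel :: "real \<Rightarrow> real^'n \<Rightarrow> real" where
  "gkernel s w = (1 / s) ^ CARD('n) * (\<Prod>i\<in>UNIV. std_normal_density ((w /\<^sub>R s) $ i))"

lemma borel_measurable_gkernel [measurable]: "gkernel s \<in> borel_measurable borel"
  unfolding gkernel_def vector_scaleR_component by measurable

lemma smooth_eq_kernel:
  fixes f :: "real^'n \<Rightarrow> real"
  assumes [measurable]: "f \<in> borel_measurable borel" and s: "s > 0"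
  shows "smooth s f y = (\<integral>x. f x * gkernel s (x - y) \<partial>lborel)"
proof -
  have "smooth s f y = (\<integral>z. (\<Prod>i\<in>UNIV. std_normal_density (z $ i)) * f (y + s *\<^sub>R z) \<partial>lborel)"
    unfolding smooth_def by (subst integral_mv_std_normal) auto
  also have "\<dots> = (\<integral>z. s ^ CARD('n) * (f (y + s *\<^sub>R z) * gkernel s ((y + s *\<^sub>R z) - y)) \<partial>lborel)"
    using s by (intro Bochner_Integration.integral_cong refl) (simp add: gkernel_def field_simps)
  also have "\<dots> = s ^ CARD('n) * (\<integral>z. f (y + s *\<^sub>R z) * gkernel s ((y + s *\<^sub>R z) - y) \<partial>lborel)"
    by simp
  also have "(\<integral>x. f x * gkernel s (x - y) \<partial>lborel) = s ^ CARD('n) * (\<integral>z. f (y + s *\<^sub>R z) * gkernel s ((y + s *\<^sub>R z) - y) \<partial>lborel)"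
    using s by (subst lborel_affine[of s y]) (auto simp: integral_density integral_distr)
  finally show ?thesis by simp
qed

lemma gkernel_char:
  fixes w :: "real^'n"
  shows "complex_of_real (gkernel s w) =
    of_real ((1 / s) ^ CARD('n) * (1 / sqrt (2 * pi) ^ CARD('n))) * (\<integral>z. iexp ((w /\<^sub>R s) \<bullet> z) \<partial>mv_std_normal)"
  unfolding gkernel_def of_real_mult mv_std_normal_density_eq by simp

text \<open>The upper bound is the value at the origin: in the Fourier formula the characters have
  modulus 1.\<close>

lemma gkernel_bounds:
  fixes w :: "real^'n"
  assumes "s > 0"
  shows "0 \<le> gkernel s w" "gkernel s w \<le> (1 / s) ^ CARD('n) * (1 / sqrt (2 * pi) ^ CARD('n))"
proof -
  show *: "0 \<le> gkernel s w" using assms unfolding gkernel_def by (intro mult_nonneg_nonneg prod_nonneg) auto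
  interpret prob_space "mv_std_normal :: (real^'n) measure" by (rule prob_space_mv_std_normal)
  let ?c = "(1 / s) ^ CARD('n) * (1 / sqrt (2 * pi) ^ CARD('n))"
  have "gkernel s w = norm (complex_of_real (gkernel s w))" using * by simp
  also have "\<dots> = ?c * norm (\<integral>z. iexp ((w /\<^sub>R s) \<bullet> z) \<partial>mv_std_normal)"
    unfolding gkernel_char norm_mult norm_of_real using assms by (subst abs_of_nonneg) auto
  also have "\<dots> \<le> ?c * 1"
    using assms by (intro mult_left_mono integral_norm_bound[THEN order_trans]) (auto simp: prob_space)
  finally show "gkernel s w \<le> ?c" by simp
qed

text \<open>A Parseval identity, by Fubini: the smoothed density of \<open>\<mu>\<close> is a
  Gaussian average of the characteristic function of \<open>\<mu>\<close>. Pointwise convergence of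
  characteristic functions thus passes to the smoothed densities by dominated convergence.\<close>

lemma integral_gkernel_char:
  fixes \<mu> :: "(real^'n) measure"
  assumes \<mu>: "prob_space \<mu>" and sets: "sets \<mu> = sets borel"
  shows "complex_of_real (\<integral>y. gkernel s (x - y) \<partial>\<mu>) =
    of_real ((1 / s) ^ CARD('n) * (1 / sqrt (2 * pi) ^ CARD('n))) *
      (\<integral>z. iexp ((x /\<^sub>R s) \<bullet> z) * (\<integral>y. iexp ((- z /\<^sub>R s) \<bullet> y) \<partial>\<mu>) \<partial>mv_std_normal)"
proof -
  interpret \<mu>: prob_space \<mu> by fact
  interpret G: prob_space "mv_std_normal :: (real^'n) measure" by (rule prob_space_mv_std_normal)
  interpret P: pair_sigma_finite "mv_std_normal :: (real^'n) measure" \<mu> ..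
  interpret PP: pair_prob_space "mv_std_normal :: (real^'n) measure" \<mu> ..
  note [measurable_cong] = sets
  let ?h = "\<lambda>z y. iexp (((x - y) /\<^sub>R s) \<bullet> z) :: complex"
  have [measurable]: "case_prod ?h \<in> borel_measurable (mv_std_normal \<Otimes>\<^sub>M \<mu>)" by measurable
  have int: "integrable (mv_std_normal \<Otimes>\<^sub>M \<mu>) (case_prod ?h)"
    by (rule PP.P.integrable_const_bound[of _ 1]) auto
  have "complex_of_real (\<integral>y. gkernel s (x - y) \<partial>\<mu>) = (\<integral>y. complex_of_real (gkernel s (x - y)) \<partial>\<mu>)"
    by simp
  also have "\<dots> = of_real ((1 / s) ^ CARD('n) * (1 / sqrt (2 * pi) ^ CARD('n))) *
     (\<integral>y. (\<integral>z. ?h z y \<partial>mv_std_normal) \<partial>\<mu>)"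
    unfolding gkernel_char by simp
  also have "(\<integral>y. (\<integral>z. ?h z y \<partial>mv_std_normal) \<partial>\<mu>) = (\<integral>z. (\<integral>y. ?h z y \<partial>\<mu>) \<partial>mv_std_normal)"
    by (rule P.Fubini_integral[OF int])
  also have "(\<lambda>z. (\<integral>y. ?h z y \<partial>\<mu>)) = (\<lambda>z. iexp ((x /\<^sub>R s) \<bullet> z) * (\<integral>y. iexp ((- z /\<^sub>R s) \<bullet> y) \<partial>\<mu>))"
  proof
    fix z
    have "?h z y = iexp ((x /\<^sub>R s) \<bullet> z) * iexp ((- z /\<^sub>R s) \<bullet> y)" for y
      by (simp add: scaleR_diff_right inner_diff_left algebra_simps inner_commute flip: exp_add)
    then show "(\<integral>y. ?h z y \<partial>\<mu>) = iexp ((x /\<^sub>R s) \<bullet> z) * (\<integral>y. iexp ((- z /\<^sub>R s) \<bullet> y) \<partial>\<mu>)"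
      by simp
  qed
  finally show ?thesis .
qed

text \<open>Smoothing is moved from the test function to the measure. Fubini against Lebesgue
  measure requires \<open>f\<close> to be integrable, which is why test functions of compact support
  are treated first.\<close>

lemma integral_smooth:
  fixes \<mu> :: "(real^'n) measure" and f :: "real^'n \<Rightarrow> real"
  assumes \<mu>: "prob_space \<mu>" and sets: "sets \<mu> = sets borel"
    and f: "integrable lborel f" and s: "s > 0"
  shows "(\<integral>y. smooth s f y \<partial>\<mu>) = (\<integral>x. f x * (\<integral>y. gkernel s (x - y) \<partial>\<mu>) \<partial>lborel)"
proof -
  interpret \<mu>: prob_space \<mu> by fact
  interpret P: pair_sigma_finite "lborel :: (real^'n) measure" \<mu> ..
  note [measurable_cong] = sets
  have [measurable]: "f \<in> borel_measurable borel" using borel_measurable_integrable[OF f] by simp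
  let ?c = "(1 / s) ^ CARD('n) * (1 / sqrt (2 * pi) ^ CARD('n))"
  have b: "norm (f x * gkernel s (x - y)) \<le> norm (?c * f x)" for x y :: "real^'n"
  proof -
    have "\<bar>gkernel s (x - y)\<bar> \<le> ?c" using gkernel_bounds[OF s, of "x - y"] by simp
    then have "\<bar>f x\<bar> * \<bar>gkernel s (x - y)\<bar> \<le> \<bar>f x\<bar> * ?c" by (rule mult_left_mono) simp
    moreover have "0 \<le> ?c" using s by simp
    ultimately show ?thesis unfolding real_norm_def abs_mult[of _ "f x"] abs_mult[of "f x"] by (simp only: abs_of_nonneg mult.commute)
  qed
  have [measurable]: "(\<lambda>(x, y). f x * gkernel s (x - y)) \<in> borel_measurable (lborel \<Otimes>\<^sub>M \<mu>)"
    by measurable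
  have int1: "integrable \<mu> (\<lambda>y. f x * gkernel s (x - y))" for x
    by (rule \<mu>.integrable_const_bound[of _ "norm (?c * f x)"]) (use b in auto)
  have int: "integrable (lborel \<Otimes>\<^sub>M \<mu>) (\<lambda>(x, y). f x * gkernel s (x - y))"
  proof (rule P.Fubini_integrable)
    show "integrable lborel (\<lambda>x. \<integral>y. norm (case (x, y) of (x, y) \<Rightarrow> f x * gkernel s (x - y)) \<partial>\<mu>)"
    proof (rule Bochner_Integration.integrable_bound[of _ "\<lambda>x. ?c * f x"])
      show "integrable lborel (\<lambda>x. ?c * f x)" using f by simp
      have "(\<integral>y. norm (f x * gkernel s (x - y)) \<partial>\<mu>) \<le> (\<integral>y. norm (?c * f x) \<partial>\<mu>)" for x
        by (intro integral_mono integrable_norm int1 b) auto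
      then show "AE x in lborel. norm (\<integral>y. norm (case (x, y) of (x, y) \<Rightarrow> f x * gkernel s (x - y)) \<partial>\<mu>) \<le> norm (?c * f x)"
        by (auto simp: \<mu>.prob_space)
    qed measurable
  qed (use int1 in auto)
  have "(\<integral>y. smooth s f y \<partial>\<mu>) = (\<integral>y. (\<integral>x. f x * gkernel s (x - y) \<partial>lborel) \<partial>\<mu>)"
    by (subst smooth_eq_kernel) (auto simp: s)
  also have "\<dots> = (\<integral>x. (\<integral>y. f x * gkernel s (x - y) \<partial>\<mu>) \<partial>lborel)"
    by (rule P.Fubini_integral[OF int])
  finally show ?thesis by simp
qed

lemma smooth_close:
  fixes f :: "real^'n \<Rightarrow> real"
  assumes uc: "uniformly_continuous_on UNIV f" and B: "\<And>x. \<bar>f x\<bar> \<le> B" and \<eta>: "\<eta> > 0"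
  shows "\<exists>s>0. \<forall>y. \<bar>smooth s f y - f y\<bar> \<le> \<eta>"
proof -
  interpret G: prob_space "mv_std_normal :: (real^'n) measure" by (rule prob_space_mv_std_normal)
  have [measurable]: "f \<in> borel_measurable borel"
    by (intro borel_measurable_continuous_onI uniformly_continuous_imp_continuous uc)
  obtain d where d: "d > 0" "\<And>x y. norm (x - y) < d \<Longrightarrow> \<bar>f x - f y\<bar> \<le> \<eta> / 2"
    using uc \<eta> unfolding uniformly_continuous_on_def dist_norm
    by (metis UNIV_I half_gt_zero less_imp_le norm_minus_commute real_norm_def)
  have B0: "0 \<le> B" using B[of 0] by linarith
  \<comment> \<open>\<open>?g m\<close> bounds the oscillation of \<open>f\<close> on the tail of
    the Gaussian, and its mean vanishes as \<open>m\<close> grows. With s = 1 / (m + 1), the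
    complement of the tail is exactly where s z has norm below \<open>d\<close>.\<close>
  let ?g = "\<lambda>m z::real^'n. if norm z < d * real (Suc m) then 0 else 2 * B"
  have "(\<lambda>m. \<integral>z. ?g m z \<partial>mv_std_normal) \<longlonglongrightarrow> (\<integral>z. 0 \<partial>(mv_std_normal :: (real^'n) measure))"
  proof (rule integral_dominated_convergence[where w = "\<lambda>_. 2 * B"])
    show "AE z in (mv_std_normal :: (real^'n) measure). (\<lambda>m. ?g m z) \<longlonglongrightarrow> 0"
    proof (rule AE_I2)
      fix z :: "real^'n"
      obtain k where k: "norm z / d < real k" using reals_Archimedean2 by blast
      have "norm z < d * real (Suc m)" if "m \<ge> k" for m
      proof -
        have "norm z < d * real k" using k d(1) by (simp add: field_simps)
        also have "\<dots> \<le> d * real (Suc m)" using that d(1) by simp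
        finally show ?thesis .
      qed
      then have "eventually (\<lambda>m. ?g m z = 0) sequentially"
        by (auto simp: eventually_sequentially)
      then show "(\<lambda>m. ?g m z) \<longlonglongrightarrow> 0" by (rule tendsto_eventually)
    qed
  qed (use B0 in auto)
  then have "eventually (\<lambda>m. (\<integral>z. ?g m z \<partial>mv_std_normal) < \<eta> / 2) sequentially"
    by (rule order_tendstoD(2)) (use \<eta> in simp)
  then obtain m where m: "(\<integral>z. ?g m z \<partial>mv_std_normal) < \<eta> / 2" by (auto simp: eventually_sequentially)
  define s where "s = 1 / real (Suc m)"
  have s: "s > 0" by (simp add: s_def)
  have gi: "integrable mv_std_normal (?g m)"
    by (rule G.integrable_const_bound[of _ "2 * B"]) (use B0 in auto)
  have fi: "integrable mv_std_normal (\<lambda>z. f (y + s *\<^sub>R z))" for y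
    by (rule G.integrable_const_bound[of _ B]) (use B in auto)
  have "\<bar>smooth s f y - f y\<bar> \<le> \<eta>" for y
  proof -
    have "smooth s f y - f y = (\<integral>z. f (y + s *\<^sub>R z) - f y \<partial>mv_std_normal)"
      unfolding smooth_def using fi G.prob_space by (subst Bochner_Integration.integral_diff) auto
    also have "\<bar>\<dots>\<bar> \<le> (\<integral>z. \<bar>f (y + s *\<^sub>R z) - f y\<bar> \<partial>mv_std_normal)"
      by (rule integral_abs_bound)
    also have "\<dots> \<le> (\<integral>z. \<eta> / 2 + ?g m z \<partial>mv_std_normal)"
    proof (intro integral_mono)
      show "integrable mv_std_normal (\<lambda>z. \<bar>f (y + s *\<^sub>R z) - f y\<bar>)"
        by (intro integrable_abs Bochner_Integration.integrable_diff fi) auto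
      show "integrable mv_std_normal (\<lambda>z. \<eta> / 2 + ?g m z)" using gi by auto
      fix z :: "real^'n"
      show "\<bar>f (y + s *\<^sub>R z) - f y\<bar> \<le> \<eta> / 2 + ?g m z"
      proof (cases "norm z < d * real (Suc m)")
        case True
        then have "norm ((y + s *\<^sub>R z) - y) < d" by (simp add: s_def field_simps)
        from d(2)[OF this] True show ?thesis by simp
      next
        case False
        show ?thesis using False B[of "y + s *\<^sub>R z"] B[of y] \<eta> by simp
      qed
    qed
    also have "\<dots> = \<eta> / 2 + (\<integral>z. ?g m z \<partial>mv_std_normal)"
      using gi G.prob_space by (subst Bochner_Integration.integral_add) auto
    finally show ?thesis using m by linarith
  qed
  with s show ?thesis by blast
qed

text \<open>Compact support serves twice: \<open>f\<close> is uniformly continuous, hence uniformly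
  close to its smoothing, and it is Lebesgue integrable, so that the integrals of the smoothing
  converge by dominated convergence in the smoothed densities.\<close>

lemma weak_conv_compact_support:
  fixes \<mu> :: "nat \<Rightarrow> (real^'n) measure" and f :: "real^'n \<Rightarrow> real"
  assumes \<mu>: "\<And>n. prob_space (\<mu> n)" "\<And>n. sets (\<mu> n) = sets borel"
    and \<nu>: "prob_space \<nu>" "sets \<nu> = sets borel"
    and conv: "\<And>u. (\<lambda>n. \<integral>x. iexp (u \<bullet> x) \<partial>\<mu> n) \<longlonglongrightarrow> (\<integral>x. iexp (u \<bullet> x) \<partial>\<nu>)"
    and f: "continuous_on UNIV f" and supp: "\<And>x. x \<notin> cball 0 R \<Longrightarrow> f x = 0"
  shows "(\<lambda>n. \<integral>x. f x \<partial>\<mu> n) \<longlonglongrightarrow> (\<integral>x. f x \<partial>\<nu>)"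
proof -
  interpret G: prob_space "mv_std_normal :: (real^'n) measure" by (rule prob_space_mv_std_normal)
  have [measurable]: "f \<in> borel_measurable borel" by (intro borel_measurable_continuous_onI f)
  have "compact (f ` cball 0 R)" by (intro compact_continuous_image continuous_on_subset[OF f]) auto
  then obtain B' where B': "\<And>x. x \<in> cball 0 R \<Longrightarrow> \<bar>f x\<bar> \<le> B'"
    by (metis bounded_iff compact_imp_bounded imageI real_norm_def)
  define B where "B = max B' 0"
  have B: "\<bar>f x\<bar> \<le> B" for x using B'[of x] supp[of x] by (cases "x \<in> cball 0 R") (auto simp: B_def)
  have uc: "uniformly_continuous_on UNIV f"
    unfolding uniformly_continuous_on_def
  proof (intro allI impI)
    fix e :: real assume e: "e > 0"
    \<comment> \<open>The margin 1, together with \<open>min d 1\<close> below, ensures that two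
      close points either both lie in the larger ball or both lie outside the support.\<close>
    have "uniformly_continuous_on (cball 0 (R + 1)) f"
      by (intro compact_uniformly_continuous continuous_on_subset[OF f]) auto
    then obtain d where d: "d > 0" "\<And>x y. x \<in> cball 0 (R + 1) \<Longrightarrow> y \<in> cball 0 (R + 1) \<Longrightarrow> dist y x < d \<Longrightarrow> dist (f y) (f x) < e"
      using e unfolding uniformly_continuous_on_def by metis
    show "\<exists>d>0. \<forall>x\<in>UNIV. \<forall>x'\<in>UNIV. dist x' x < d \<longrightarrow> dist (f x') (f x) < e"
    proof (intro exI[of _ "min d 1"] conjI ballI impI)
      fix x x' :: "real^'n" assume xx: "dist x' x < min d 1"
      show "dist (f x') (f x) < e"
      proof (cases "x \<in> cball 0 (R + 1) \<and> x' \<in> cball 0 (R + 1)")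
        case True then show ?thesis using d(2) xx by auto
      next
        case False
        have "\<bar>norm x - norm x'\<bar> < 1"
          using xx norm_triangle_ineq3[of x x'] by (simp add: dist_norm norm_minus_commute)
        with False have "f x = 0" "f x' = 0" by (auto intro!: supp)
        then show ?thesis using e by simp
      qed
    qed (use d in auto)
  qed
  have fint: "integrable lborel f"
  proof (rule Bochner_Integration.integrable_bound[of _ "\<lambda>x. B * indicator (cball 0 R) x"])
    show "integrable lborel (\<lambda>x::real^'n. B * indicator (cball 0 R) x)"
      by (intro integrable_mult_right integrable_real_indicator) (use emeasure_bounded_finite[OF bounded_cball, of "0::real^'n" R] in auto)
    show "AE x in lborel. norm (f x) \<le> norm (B * indicator (cball 0 R) x)"
      using B supp by (auto simp: indicator_def B_def)
  qed simp
  have sm: "(\<lambda>n. \<integral>y. smooth s f y \<partial>\<mu> n) \<longlonglongrightarrow> (\<integral>y. smooth s f y \<partial>\<nu>)" if s: "s > 0" for s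
  proof -
    let ?c = "(1 / s) ^ CARD('n) * (1 / sqrt (2 * pi) ^ CARD('n))"
    have k: "(\<lambda>n. \<integral>y. gkernel s (x - y) \<partial>\<mu> n) \<longlonglongrightarrow> (\<integral>y. gkernel s (x - y) \<partial>\<nu>)" for x
    proof -
      have "(\<lambda>n. complex_of_real (\<integral>y. gkernel s (x - y) \<partial>\<mu> n)) \<longlonglongrightarrow> complex_of_real (\<integral>y. gkernel s (x - y) \<partial>\<nu>)"
        unfolding integral_gkernel_char[OF \<mu>] integral_gkernel_char[OF \<nu>]
      proof (intro tendsto_mult tendsto_const, rule integral_dominated_convergence[where w = "\<lambda>_. 1"])
        have cm: "(\<lambda>z. \<integral>y. iexp ((- z /\<^sub>R s) \<bullet> y) \<partial>\<kappa>) \<in> borel_measurable mv_std_normal"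
          if "prob_space \<kappa>" "sets \<kappa> = sets borel" for \<kappa> :: "(real^'n) measure"
        proof -
          interpret prob_space \<kappa> by fact
          note [measurable_cong] = that(2)
          show ?thesis by measurable
        qed
        show "(\<lambda>z. iexp ((x /\<^sub>R s) \<bullet> z) * (\<integral>y. iexp ((- z /\<^sub>R s) \<bullet> y) \<partial>\<nu>)) \<in> borel_measurable mv_std_normal"
          using cm[OF \<nu>] by measurable
        show "(\<lambda>z. iexp ((x /\<^sub>R s) \<bullet> z) * (\<integral>y. iexp ((- z /\<^sub>R s) \<bullet> y) \<partial>\<mu> n)) \<in> borel_measurable mv_std_normal" for n
          using cm[OF \<mu>] by measurable
        show "AE z in mv_std_normal. (\<lambda>n. iexp ((x /\<^sub>R s) \<bullet> z) * (\<integral>y. iexp ((- z /\<^sub>R s) \<bullet> y) \<partial>\<mu> n))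
           \<longlonglongrightarrow> iexp ((x /\<^sub>R s) \<bullet> z) * (\<integral>y. iexp ((- z /\<^sub>R s) \<bullet> y) \<partial>\<nu>)"
          by (intro AE_I2 tendsto_mult tendsto_const conv)
        show "AE z in mv_std_normal. norm (iexp ((x /\<^sub>R s) \<bullet> z) * (\<integral>y. iexp ((- z /\<^sub>R s) \<bullet> y) \<partial>\<mu> n)) \<le> 1" for n
        proof (intro AE_I2)
          fix z :: "real^'n"
          interpret prob_space "\<mu> n" by (rule \<mu>)
          have "norm (\<integral>y. iexp ((- z /\<^sub>R s) \<bullet> y) \<partial>\<mu> n) \<le> (\<integral>y. norm (iexp ((- z /\<^sub>R s) \<bullet> y)) \<partial>\<mu> n)"
            by (rule integral_norm_bound)
          then show "norm (iexp ((x /\<^sub>R s) \<bullet> z) * (\<integral>y. iexp ((- z /\<^sub>R s) \<bullet> y) \<partial>\<mu> n)) \<le> 1"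
            by (simp add: norm_mult prob_space)
        qed
      qed auto
      then show ?thesis by (simp only: tendsto_of_real_iff)
    qed
    have gm: "(\<lambda>x. \<integral>y. gkernel s (x - y) \<partial>\<kappa>) \<in> borel_measurable borel"
      "\<And>x. \<bar>\<integral>y. gkernel s (x - y) \<partial>\<kappa>\<bar> \<le> ?c"
      if "prob_space \<kappa>" "sets \<kappa> = sets borel" for \<kappa> :: "(real^'n) measure"
    proof -
      interpret prob_space \<kappa> by fact
      note [measurable_cong] = that(2)
      show "(\<lambda>x. \<integral>y. gkernel s (x - y) \<partial>\<kappa>) \<in> borel_measurable borel" by measurable
      fix x
      have "norm (gkernel s (w::real^'n)) \<le> ?c" for w using gkernel_bounds[OF s, of w] by simp
      then have i: "integrable \<kappa> (\<lambda>y. gkernel s (x - y))"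
        by (intro integrable_const_bound[of _ ?c] AE_I2) auto
      have "(\<integral>y. gkernel s (x - y) \<partial>\<kappa>) \<le> ?c"
        using integral_mono[OF i, of "\<lambda>_. ?c"] gkernel_bounds(2)[OF s, of "x - _"] by (simp add: prob_space)
      moreover have "0 \<le> (\<integral>y. gkernel s (x - y) \<partial>\<kappa>)"
        by (intro Bochner_Integration.integral_nonneg gkernel_bounds(1)[OF s])
      ultimately show "\<bar>\<integral>y. gkernel s (x - y) \<partial>\<kappa>\<bar> \<le> ?c" by simp
    qed
    show ?thesis
      unfolding integral_smooth[OF \<mu> fint s] integral_smooth[OF \<nu> fint s]
    proof (rule integral_dominated_convergence[where w = "\<lambda>x. ?c * \<bar>f x\<bar>"])
      show "AE x in lborel. (\<lambda>n. f x * (\<integral>y. gkernel s (x - y) \<partial>\<mu> n)) \<longlonglongrightarrow> f x * (\<integral>y. gkernel s (x - y) \<partial>\<nu>)"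
        by (intro AE_I2 tendsto_mult tendsto_const k)
      show "AE x in lborel. norm (f x * (\<integral>y. gkernel s (x - y) \<partial>\<mu> n)) \<le> ?c * \<bar>f x\<bar>" for n
      proof (intro AE_I2)
        fix x
        show "norm (f x * (\<integral>y. gkernel s (x - y) \<partial>\<mu> n)) \<le> ?c * \<bar>f x\<bar>"
          unfolding real_norm_def abs_mult mult.commute[of ?c] by (intro mult_left_mono gm(2)[OF \<mu>]) simp
      qed
    qed (use gm(1)[OF \<mu>] gm(1)[OF \<nu>] fint in auto)
  qed
  show ?thesis
  proof (rule LIMSEQ_I)
    fix e :: real assume e: "e > 0"
    obtain s where s: "s > 0" "\<And>y. \<bar>smooth s f y - f y\<bar> \<le> e / 4"
      using smooth_close[OF uc B, of "e / 4"] e by auto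
    have smm: "smooth s f \<in> borel_measurable borel"
      unfolding smooth_def by measurable
    have cl: "\<bar>(\<integral>y. smooth s f y \<partial>\<kappa>) - (\<integral>y. f y \<partial>\<kappa>)\<bar> \<le> e / 4"
      if "prob_space \<kappa>" "sets \<kappa> = sets borel" for \<kappa> :: "(real^'n) measure"
    proof -
      interpret prob_space \<kappa> by fact
      note [measurable_cong] = that(2)
      note [measurable] = smm
      have fi: "integrable \<kappa> f" by (rule integrable_const_bound[of _ B]) (use B in auto)
      have "\<bar>smooth s f y\<bar> \<le> B + e / 4" for y using s(2)[of y] B[of y] by linarith
      then have si: "integrable \<kappa> (smooth s f)" by (intro integrable_const_bound[of _ "B + e / 4"]) auto
      have "\<bar>(\<integral>y. smooth s f y \<partial>\<kappa>) - (\<integral>y. f y \<partial>\<kappa>)\<bar> = \<bar>\<integral>y. smooth s f y - f y \<partial>\<kappa>\<bar>"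
        using fi si by simp
      also have "\<dots> \<le> (\<integral>y. \<bar>smooth s f y - f y\<bar> \<partial>\<kappa>)" by (rule integral_abs_bound)
      also have "\<dots> \<le> (\<integral>y. e / 4 \<partial>\<kappa>)" using fi si s(2) by (intro integral_mono) auto
      finally show ?thesis by (simp add: prob_space)
    qed
    obtain n0 where n0: "\<And>n. n \<ge> n0 \<Longrightarrow> norm ((\<integral>y. smooth s f y \<partial>\<mu> n) - (\<integral>y. smooth s f y \<partial>\<nu>)) < e / 4"
      using LIMSEQ_D[OF sm[OF s(1)], of "e / 4"] e by auto
    have "norm ((\<integral>x. f x \<partial>\<mu> n) - (\<integral>x. f x \<partial>\<nu>)) < e" if "n \<ge> n0" for n
      using n0[OF that] cl[OF \<mu>, of n] cl[OF \<nu>] e unfolding real_norm_def by linarith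
    then show "\<exists>n0. \<forall>n\<ge>n0. norm ((\<integral>x. f x \<partial>\<mu> n) - (\<integral>x. f x \<partial>\<nu>)) < e" by blast
  qed
qed

text \<open>Since the limit is given as a law, tightness comes for free: the cut-offs
  \<open>h\<close> are compactly supported, so their integrals converge, and almost all the mass of
  \<open>\<mu> n\<close> eventually lies where that of \<open>\<nu>\<close> does. Multiplying a
  bounded test function by a cut-off reduces it to the compactly supported case.\<close>

theorem weak_conv_vec_char:
  fixes \<mu> :: "nat \<Rightarrow> (real^'n) measure"
  assumes \<mu>: "\<And>n. prob_space (\<mu> n)" "\<And>n. sets (\<mu> n) = sets borel"
    and \<nu>: "prob_space \<nu>" "sets \<nu> = sets borel"
    and conv: "\<And>u. (\<lambda>n. \<integral>x. iexp (u \<bullet> x) \<partial>\<mu> n) \<longlonglongrightarrow> (\<integral>x. iexp (u \<bullet> x) \<partial>\<nu>)"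
  shows "weak_conv_vec \<mu> \<nu>"
  unfolding weak_conv_vec_def
proof (intro allI impI)
  fix f :: "real^'n \<Rightarrow> real" assume "continuous_on UNIV f \<and> bounded (range f)"
  then have f: "continuous_on UNIV f" and "bounded (range f)" by auto
  then obtain B where B: "\<And>x. \<bar>f x\<bar> \<le> B" by (auto simp: bounded_iff)
  have B0: "0 \<le> B" using B[of 0] by linarith
  have fm: "f \<in> borel_measurable borel" by (intro borel_measurable_continuous_onI f)
  define h where "h = (\<lambda>R x::real^'n. max 0 (min 1 (R + 1 - norm x)))"
  have h: "0 \<le> h R x" "h R x \<le> 1" for R x by (auto simp: h_def)
  have hc: "continuous_on UNIV (h R)" for R unfolding h_def by (intro continuous_intros)
  have hm: "h R \<in> borel_measurable borel" for R by (intro borel_measurable_continuous_onI hc)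
  have hs: "h R x = 0" if "x \<notin> cball 0 (R + 1)" for R x using that by (auto simp: h_def)
  interpret \<nu>: prob_space \<nu> by fact
  note [measurable_cong] = \<nu>(2)
  note [measurable] = fm hm
  have "(\<lambda>m. \<integral>x. h (real m) x \<partial>\<nu>) \<longlonglongrightarrow> (\<integral>x. 1 \<partial>\<nu>)"
  proof (rule integral_dominated_convergence[where w = "\<lambda>_. 1"])
    show "AE x in \<nu>. (\<lambda>m. h (real m) x) \<longlonglongrightarrow> 1"
    proof (rule AE_I2)
      fix x :: "real^'n"
      obtain k where "norm x < real k" using reals_Archimedean2 by blast
      then have "h (real m) x = 1" if "m \<ge> k" for m using that by (auto simp: h_def)
      then show "(\<lambda>m. h (real m) x) \<longlonglongrightarrow> 1"
        by (intro tendsto_eventually) (auto simp: eventually_sequentially)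
    qed
  qed (use h in auto)
  then have h1: "(\<lambda>m. \<integral>x. h (real m) x \<partial>\<nu>) \<longlonglongrightarrow> 1" by (simp add: \<nu>.prob_space)
  show "(\<lambda>n. \<integral>x. f x \<partial>\<mu> n) \<longlonglongrightarrow> (\<integral>x. f x \<partial>\<nu>)"
  proof (rule LIMSEQ_I)
    fix e :: real assume e: "e > 0"
    \<comment> \<open>The mass allowed to escape the cut-off. It costs at most \<open>B * d\<close>,
      which is below \<open>e / 4\<close>; the summand 1 covers \<open>B = 0\<close>.\<close>
    define d where "d = e / (4 * (B + 1))"
    have d: "d > 0" using e B0 by (simp add: d_def)
    have Bd: "B * d < e / 4" using e B0 by (simp add: d_def field_simps)
    obtain m where m: "(\<integral>x. h (real m) x \<partial>\<nu>) > 1 - d"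
      using order_tendstoD(1)[OF h1, of "1 - d"] d by (auto simp: eventually_sequentially)
    have c1: "(\<lambda>n. \<integral>x. h (real m) x \<partial>\<mu> n) \<longlonglongrightarrow> (\<integral>x. h (real m) x \<partial>\<nu>)"
      by (rule weak_conv_compact_support[OF \<mu> \<nu> conv hc, where R = "real m + 1"]) (use hs in auto)
    have c2: "(\<lambda>n. \<integral>x. f x * h (real m) x \<partial>\<mu> n) \<longlonglongrightarrow> (\<integral>x. f x * h (real m) x \<partial>\<nu>)"
      by (rule weak_conv_compact_support[OF \<mu> \<nu> conv, where R = "real m + 1"])
         (use hs in \<open>auto intro!: continuous_intros f hc\<close>)
    have cl: "\<bar>(\<integral>x. f x \<partial>\<kappa>) - (\<integral>x. f x * h (real m) x \<partial>\<kappa>)\<bar> \<le> B * d"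
      if "prob_space \<kappa>" "sets \<kappa> = sets borel" "(\<integral>x. h (real m) x \<partial>\<kappa>) > 1 - d" for \<kappa> :: "(real^'n) measure"
    proof -
      interpret prob_space \<kappa> by fact
      note [measurable_cong] = that(2)
      have fi: "integrable \<kappa> f" by (rule integrable_const_bound[of _ B]) (use B in auto)
      have hi: "integrable \<kappa> (h (real m))" by (rule integrable_const_bound[of _ 1]) (use h in auto)
      have fhb: "\<bar>f x * h (real m) x\<bar> \<le> B * 1" for x
        unfolding abs_mult using h[of "real m" x] B[of x] B0 by (intro mult_mono) auto
      have fhi: "integrable \<kappa> (\<lambda>x. f x * h (real m) x)"
        by (rule integrable_const_bound[of _ "B * 1"]) (use fhb in auto)
      have "\<bar>(\<integral>x. f x \<partial>\<kappa>) - (\<integral>x. f x * h (real m) x \<partial>\<kappa>)\<bar> = \<bar>\<integral>x. f x - f x * h (real m) x \<partial>\<kappa>\<bar>"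
        using fi fhi by simp
      also have "\<dots> \<le> (\<integral>x. \<bar>f x - f x * h (real m) x\<bar> \<partial>\<kappa>)" by (rule integral_abs_bound)
      also have "\<dots> \<le> (\<integral>x. B * (1 - h (real m) x) \<partial>\<kappa>)"
      proof (intro integral_mono)
        fix x
        have "\<bar>f x - f x * h (real m) x\<bar> = \<bar>f x\<bar> * (1 - h (real m) x)"
          using h(2)[of "real m" x] abs_mult[of "f x" "1 - h (real m) x"] by (simp add: algebra_simps)
        then show "\<bar>f x - f x * h (real m) x\<bar> \<le> B * (1 - h (real m) x)"
          using B[of x] h(2)[of "real m" x] by (auto intro!: mult_right_mono)
      qed (use fi fhi hi in auto)
      also have "\<dots> = B * (1 - (\<integral>x. h (real m) x \<partial>\<kappa>))" using hi by (simp add: prob_space)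
      also have "\<dots> \<le> B * d" using that(3) B0 by (intro mult_left_mono) auto
      finally show ?thesis .
    qed
    have ev1: "eventually (\<lambda>n. (\<integral>x. h (real m) x \<partial>\<mu> n) > 1 - d) sequentially"
      by (rule order_tendstoD(1)[OF c1 m])
    have ev2: "eventually (\<lambda>n. dist (\<integral>x. f x * h (real m) x \<partial>\<mu> n) (\<integral>x. f x * h (real m) x \<partial>\<nu>) < e / 4) sequentially"
      by (rule tendstoD[OF c2]) (use e in simp)
    from ev1 ev2 have "eventually (\<lambda>n. norm ((\<integral>x. f x \<partial>\<mu> n) - (\<integral>x. f x \<partial>\<nu>)) < e) sequentially"
    proof eventually_elim
      case (elim n)
      then show ?case using cl[OF \<mu>, of n] cl[OF \<nu> m] Bd e
        unfolding dist_real_def real_norm_def by linarith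
    qed
    then show "\<exists>n0. \<forall>n\<ge>n0. norm ((\<integral>x. f x \<partial>\<mu> n) - (\<integral>x. f x \<partial>\<nu>)) < e"
      by (simp add: eventually_sequentially)
  qed
qed

section \<open>A martingale central limit theorem\<close>

text \<open>Second order Taylor expansion of both exponentials. The subtracted terms, linear in
  \<open>x\<close> and in v - x^2, are those that vanish in conditional expectation when
  \<open>x\<close> has conditional mean 0 and variance \<open>v\<close>. The cubic remainder is
  traded for second and fourth powers, the only ones whose moments are controlled;
  \<open>\<eta>\<close> will be small.\<close>

lemma norm_iexp_minus_exp_le:
  fixes t x v \<eta> :: real
  assumes v: "0 \<le> v" and \<eta>: "0 < \<eta>"
  shows "norm (iexp (t * x) - exp (- (t\<^sup>2 * v / 2))
      - (\<i> * of_real t * of_real x + of_real (t\<^sup>2 / 2) * of_real (v - x\<^sup>2)))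
    \<le> \<bar>t\<bar> ^ 3 / 6 * (\<eta> * x\<^sup>2 + x ^ 4 / \<eta>) + t ^ 4 / 8 * v\<^sup>2"
proof -
  have 1: "norm (iexp (t * x) - (1 + \<i> * of_real (t * x) - of_real ((t * x)\<^sup>2 / 2))) \<le> \<bar>t * x\<bar> ^ 3 / 6"
  proof -
    have "(\<Sum>k\<le>2. (\<i> * complex_of_real (t * x)) ^ k / fact k) = 1 + \<i> * of_real (t * x) - of_real ((t * x)\<^sup>2 / 2)"
      by (simp add: numeral_2_eq_2 power_mult_distrib)
    then show ?thesis using iexp_approx1[of "t * x" 2] by (simp add: numeral_3_eq_3 fact_numeral)
  qed
  have 2: "\<bar>exp (- y) - 1 + y\<bar> \<le> y\<^sup>2 / 2" if "0 \<le> y" for y :: real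
  proof -
    have lo: "exp (- y) \<ge> 1 + (- y)" by (rule exp_ge_add_one_self)
    have up: "exp (- y) \<le> 1 - y + y\<^sup>2 / 2"
    proof -
      define f where "f = (\<lambda>y::real. 1 - y + y\<^sup>2 / 2 - exp (- y))"
      have "f 0 \<le> f y"
      proof (rule DERIV_nonneg_imp_nondecreasing[OF that])
        fix x :: real assume "0 \<le> x" "x \<le> y"
        have "(f has_real_derivative (- 1 + x + exp (- x))) (at x)"
          unfolding f_def by (auto intro!: derivative_eq_intros)
        moreover have "0 \<le> - 1 + x + exp (- x)" using exp_ge_add_one_self[of "- x"] by simp
        ultimately show "\<exists>z. (f has_real_derivative z) (at x) \<and> 0 \<le> z" by blast
      qed
      then show ?thesis by (simp add: f_def)
    qed
    show ?thesis using lo up by (auto simp: abs_le_iff)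
  qed
  have 3: "norm (complex_of_real (exp (- (t\<^sup>2 * v / 2)) - 1 + t\<^sup>2 * v / 2)) \<le> t ^ 4 / 8 * v\<^sup>2"
    using 2[of "t\<^sup>2 * v / 2"] v unfolding norm_of_real by (simp add: power_mult_distrib power_divide flip: power_mult)
  have 4: "\<bar>x\<bar> ^ 3 \<le> \<eta> * x\<^sup>2 + x ^ 4 / \<eta>"
  proof -
    have "\<bar>x\<bar> \<le> \<eta> + x\<^sup>2 / \<eta>"
    proof (cases "\<bar>x\<bar> \<le> \<eta>")
      case True
      have "0 \<le> x\<^sup>2 / \<eta>" using \<eta> by simp
      with True show ?thesis by linarith
    next
      case False
      then have "\<bar>x\<bar> * \<eta> \<le> \<bar>x\<bar> * \<bar>x\<bar>" by (intro mult_left_mono) auto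
      then have "\<bar>x\<bar> \<le> x\<^sup>2 / \<eta>" using \<eta> by (simp add: field_simps power2_eq_square)
      then show ?thesis using \<eta> by linarith
    qed
    then have "x\<^sup>2 * \<bar>x\<bar> \<le> x\<^sup>2 * (\<eta> + x\<^sup>2 / \<eta>)" by (rule mult_left_mono) simp
    moreover have "\<bar>x\<bar> ^ 3 = x\<^sup>2 * \<bar>x\<bar>" by (simp add: power3_eq_cube power2_eq_square)
    moreover have "x\<^sup>2 * (\<eta> + x\<^sup>2 / \<eta>) = \<eta> * x\<^sup>2 + x ^ 4 / \<eta>" by (simp add: algebra_simps power4_eq_xxxx power2_eq_square)
    ultimately show ?thesis by simp
  qed
  have "iexp (t * x) - exp (- (t\<^sup>2 * v / 2))
      - (\<i> * of_real t * of_real x + of_real (t\<^sup>2 / 2) * of_real (v - x\<^sup>2))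
    = (iexp (t * x) - (1 + \<i> * of_real (t * x) - of_real ((t * x)\<^sup>2 / 2)))
      - of_real (exp (- (t\<^sup>2 * v / 2)) - 1 + t\<^sup>2 * v / 2)"
    by (simp add: field_simps power_mult_distrib flip: exp_of_real)
  also have "norm \<dots> \<le> \<bar>t * x\<bar> ^ 3 / 6 + t ^ 4 / 8 * v\<^sup>2"
    by (rule order_trans[OF norm_triangle_ineq4]) (intro add_mono 1 3)
  also have "\<bar>t * x\<bar> ^ 3 / 6 \<le> \<bar>t\<bar> ^ 3 / 6 * (\<eta> * x\<^sup>2 + x ^ 4 / \<eta>)"
    using mult_left_mono[OF 4, of "\<bar>t\<bar> ^ 3 / 6"] by (simp add: abs_mult power_mult_distrib)
  finally show ?thesis by simp
qed

lemma iexp_mult_add: "iexp (t * (x + y)) = iexp (t * x) * iexp (t * y)" for t x y :: real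
  by (simp add: distrib_left exp_add)

lemma exp_half_cancel:
  "exp (complex_of_real (s * (x + y) / 2)) * exp (complex_of_real (- (s * y / 2))) = exp (complex_of_real (s * x / 2))"
  by (simp only: exp_add[symmetric] of_real_add[symmetric]) (simp add: field_simps)

locale filtered_prob_space = prob_space M for M :: "'w measure" +
  fixes H :: "nat \<Rightarrow> 'w measure"
  assumes sub: "subalgebra M (H k)" and H_mono: "j \<le> k \<Longrightarrow> sets (H j) \<subseteq> sets (H k)"
begin

lemma finite_measure_subalgebra_H: "finite_measure_subalgebra M (H k)"
  by unfold_locales (rule sub)

lemma sigma_finite_subalgebra_H: "sigma_finite_subalgebra M (H k)"
  by (rule finite_measure_subalgebra_is_sigma_finite[OF finite_measure_subalgebra_H])

lemma measurable_H_M: "f \<in> measurable (H k) N \<Longrightarrow> f \<in> measurable M N"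
  by (rule measurable_from_subalg[OF sub])

lemma measurable_H_mono: "f \<in> measurable (H j) N \<Longrightarrow> j \<le> k \<Longrightarrow> f \<in> measurable (H k) N"
  by (rule measurable_from_subalg[of "H k" "H j"])
     (use sub H_mono in \<open>auto simp: subalgebra_def\<close>)

lemma cond_exp_intg:
  assumes ae: "AE x in M. real_cond_exp M (H k) f x = c x" and c: "c \<in> borel_measurable M"
    and int: "integrable M (\<lambda>x. g x * f x)" and g: "g \<in> borel_measurable (H k)" and f: "f \<in> borel_measurable M"
  shows "integrable M (\<lambda>x. g x * c x)" "(\<integral>x. g x * c x \<partial>M) = (\<integral>x. g x * f x \<partial>M)"
proof -
  interpret F: sigma_finite_subalgebra M "H k" by (rule sigma_finite_subalgebra_H)
  note * = F.real_cond_exp_intg[OF int g f]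
  note [measurable] = c measurable_H_M[OF g]
  have ae': "AE x in M. g x * real_cond_exp M (H k) f x = g x * c x" using ae by eventually_elim simp
  show "integrable M (\<lambda>x. g x * c x)"
    by (rule integrable_cong_AE_imp[OF *(1)]) (use ae' in auto)
  show "(\<integral>x. g x * c x \<partial>M) = (\<integral>x. g x * f x \<partial>M)"
    unfolding *(2)[symmetric] by (rule integral_cong_AE) (use ae' in auto)
qed

text \<open>A bounded predictable weight does not destroy conditional centring.
  \<open>real_cond_exp\<close> is real valued, so the complex weight is split into real and
  imaginary parts.\<close>

lemma integral_cond_exp_zero_complex:
  fixes W :: "'w \<Rightarrow> complex"
  assumes ae: "AE x in M. real_cond_exp M (H k) f x = 0" and f: "integrable M f"
    and W: "W \<in> borel_measurable (H k)" and b: "\<And>x. x \<in> space M \<Longrightarrow> norm (W x) \<le> B"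
  shows "integrable M (\<lambda>x. W x * of_real (f x))" "(\<integral>x. W x * of_real (f x) \<partial>M) = 0"
proof -
  note [measurable] = measurable_H_M[OF W] borel_measurable_integrable[OF f]
  have le: "norm (W x * of_real (f x)) \<le> norm (B * f x)" if "x \<in> space M" for x
  proof -
    have "0 \<le> B" using b[OF that] norm_ge_zero order_trans by blast
    then show ?thesis using b[OF that] by (auto simp: norm_mult abs_mult intro!: mult_right_mono)
  qed
  show int: "integrable M (\<lambda>x. W x * of_real (f x))"
    by (rule Bochner_Integration.integrable_bound[OF integrable_mult_right[OF f, of B]])
       (measurable, rule AE_I2, rule le)
  have WR: "(\<lambda>x. Re (W x)) \<in> borel_measurable (H k)" "(\<lambda>x. Im (W x)) \<in> borel_measurable (H k)"
    using W by auto
  have iR: "integrable M (\<lambda>x. Re (W x) * f x)" using integrable_Re[OF int] by simp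
  have iI: "integrable M (\<lambda>x. Im (W x) * f x)" using integrable_Im[OF int] by simp
  have "(\<integral>x. Re (W x) * f x \<partial>M) = 0"
    using cond_exp_intg(2)[OF ae _ iR WR(1)] by simp
  moreover have "(\<integral>x. Im (W x) * f x \<partial>M) = 0"
    using cond_exp_intg(2)[OF ae _ iI WR(2)] by simp
  ultimately show "(\<integral>x. W x * of_real (f x) \<partial>M) = 0"
    using integral_Re[OF int] integral_Im[OF int] by (simp add: complex_eq_iff)
qed

end

text \<open>\<open>v\<close> is a version of the conditional variance and \<open>r\<close> a
  predictable bound on the conditional fourth moment. The inequality between v^2 and
  \<open>r\<close>, which conditional Jensen gives almost surely, is required at every point so that
  truncation and the remainder v^2 of the Taylor estimate can be handled pointwise.\<close>

locale mart_diff = filtered_prob_space M H for M :: "'w measure" and H +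
  fixes D v r :: "nat \<Rightarrow> 'w \<Rightarrow> real"
  assumes D_meas: "D k \<in> borel_measurable (H (Suc k))"
    and v_meas: "v k \<in> borel_measurable (H k)" and r_meas: "r k \<in> borel_measurable (H k)"
    and v_nonneg: "0 \<le> v k x" and v_r: "(v k x)\<^sup>2 \<le> r k x"
    and D4: "integrable M (\<lambda>x. D k x ^ 4)"
    and cond1: "AE x in M. real_cond_exp M (H k) (D k) x = 0"
    and cond2: "AE x in M. real_cond_exp M (H k) (\<lambda>x. (D k x)\<^sup>2) x = v k x"
    and cond4: "AE x in M. real_cond_exp M (H k) (\<lambda>x. D k x ^ 4) x \<le> r k x"
begin

lemma r_nonneg: "0 \<le> r k x"
  using v_r[of k x] zero_le_power2 order_trans by blast

lemma D_meas_M [measurable]: "D k \<in> borel_measurable M"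
  using D_meas by (rule measurable_H_M)
lemma v_meas_M [measurable]: "v k \<in> borel_measurable M"
  using v_meas by (rule measurable_H_M)
lemma r_meas_M [measurable]: "r k \<in> borel_measurable M"
  using r_meas by (rule measurable_H_M)

lemma D2: "integrable M (\<lambda>x. (D k x)\<^sup>2)"
proof (rule Bochner_Integration.integrable_bound[of _ "\<lambda>x. 1 + D k x ^ 4"])
  show "AE x in M. norm ((D k x)\<^sup>2) \<le> norm (1 + D k x ^ 4)"
  proof (rule AE_I2)
    fix x
    have "0 \<le> ((D k x)\<^sup>2 - 1)\<^sup>2" by simp
    also have "\<dots> = (D k x) ^ 4 - 2 * (D k x)\<^sup>2 + 1" by (simp add: power2_eq_square power4_eq_xxxx algebra_simps)
    finally have "(D k x)\<^sup>2 \<le> 1 + D k x ^ 4" using zero_le_power2[of "D k x"] by linarith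
    then show "norm ((D k x)\<^sup>2) \<le> norm (1 + D k x ^ 4)" by (simp add: abs_le_iff)
  qed
qed (use D4 in auto)

lemma D1: "integrable M (D k)"
proof (rule Bochner_Integration.integrable_bound[of _ "\<lambda>x. 1 + (D k x)\<^sup>2"])
  show "AE x in M. norm (D k x) \<le> norm (1 + (D k x)\<^sup>2)"
  proof (rule AE_I2)
    fix x
    have "0 \<le> (\<bar>D k x\<bar> - 1)\<^sup>2" by simp
    then have "\<bar>D k x\<bar> * 2 \<le> 1 + (D k x)\<^sup>2" by (simp add: power2_diff)
    then show "norm (D k x) \<le> norm (1 + (D k x)\<^sup>2)" by auto
  qed
qed (use D2 in auto)

text \<open>The exponential of i t times the sum, compensated by t^2 / 2 times the bracket, is
  almost a martingale. One step changes its mean only by the Taylor remainder, and the bound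
  \<open>K\<close> on the bracket keeps the compensator bounded. The second moments of all steps add
  up to at most \<open>K\<close>, the fourth moments to at most the sum of the means of
  \<open>r\<close>.\<close>

lemma bounded_telescope:
  assumes vK: "\<And>x. x \<in> space M \<Longrightarrow> (\<Sum>k<m. v k x) \<le> K" and r1: "\<And>k x. x \<in> space M \<Longrightarrow> r k x \<le> 1"
    and \<eta>: "0 < \<eta>"
  shows "norm ((\<integral>x. iexp (t * (\<Sum>k<m. D k x)) * exp (of_real (t\<^sup>2 * (\<Sum>k<m. v k x) / 2)) \<partial>M) - 1)
    \<le> exp (t\<^sup>2 * K / 2) * (\<bar>t\<bar> ^ 3 / 6 * (\<eta> * K + (\<integral>x. (\<Sum>k<m. r k x) \<partial>M) / \<eta>)
        + t ^ 4 / 8 * (\<integral>x. (\<Sum>k<m. r k x) \<partial>M))"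
proof -
  define c where "c = exp (t\<^sup>2 * K / 2)"
  define T where "T = (\<lambda>n x. iexp (t * (\<Sum>k<n. D k x)) * exp (complex_of_real (t\<^sup>2 * (\<Sum>k<n. v k x) / 2)))"
  define e where "e = (\<lambda>k. \<bar>t\<bar> ^ 3 / 6 * (\<eta> * (\<integral>x. v k x \<partial>M) + (\<integral>x. r k x \<partial>M) / \<eta>) + t ^ 4 / 8 * (\<integral>x. r k x \<partial>M))"
  have c0: "0 < c" by (simp add: c_def)
  have vle: "(\<Sum>k<n. v k x) \<le> K" if "n \<le> m" "x \<in> space M" for n x
    using sum_mono2[of "{..<m}" "{..<n}" "\<lambda>k. v k x"] that v_nonneg vK[OF that(2)] by auto
  have ve: "exp (t\<^sup>2 * (\<Sum>k<n. v k x) / 2) \<le> c" if "n \<le> m" "x \<in> space M" for n x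
    using vle[OF that] by (auto simp: c_def intro!: mult_left_mono)
  have Tm [measurable]: "T n \<in> borel_measurable M" for n unfolding T_def by measurable
  have Tint: "integrable M (T n)" if "n \<le> m" for n
    by (rule integrable_const_bound[of _ c]) (use ve[OF that] in \<open>auto simp: T_def norm_mult\<close>)
  have rint: "integrable M (r k)" for k
    by (rule integrable_const_bound[of _ 1]) (use r1 r_nonneg in auto)
  have vint: "integrable M (v k)" and vE: "(\<integral>x. v k x \<partial>M) = (\<integral>x. (D k x)\<^sup>2 \<partial>M)" for k
    using cond_exp_intg[OF cond2, of k "\<lambda>_. 1"] D2[of k] by auto
  have rE: "(\<integral>x. D k x ^ 4 \<partial>M) \<le> (\<integral>x. r k x \<partial>M)" for k
  proof -
    interpret F: sigma_finite_subalgebra M "H k" by (rule sigma_finite_subalgebra_H)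
    have "(\<integral>x. D k x ^ 4 \<partial>M) = (\<integral>x. real_cond_exp M (H k) (\<lambda>x. D k x ^ 4) x \<partial>M)"
      using F.real_cond_exp_int[OF D4] by simp
    also have "\<dots> \<le> (\<integral>x. r k x \<partial>M)"
      by (intro integral_mono_AE F.real_cond_exp_int D4 rint cond4)
    finally show ?thesis .
  qed
  have step: "norm ((\<integral>x. T (Suc n) x \<partial>M) - (\<integral>x. T n x \<partial>M)) \<le> c * e n" if n: "n < m" for n
  proof -
    \<comment> \<open>\<open>W\<close> already contains the compensator of step \<open>n\<close>,
      which is predictable. It is therefore measurable for \<open>H n\<close>, and both
      \<open>T n\<close> and \<open>T (Suc n)\<close> are \<open>W\<close> times a factor of step
      \<open>n\<close> alone.\<close>
    define W where "W = (\<lambda>x. iexp (t * (\<Sum>k<n. D k x)) * exp (complex_of_real (t\<^sup>2 * (\<Sum>k<Suc n. v k x) / 2)))"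
    have WH: "W \<in> borel_measurable (H n)"
    proof -
      have [measurable]: "D k \<in> borel_measurable (H n)" if "k \<in> {..<n}" for k
        by (rule measurable_H_mono[OF D_meas]) (use that in auto)
      have [measurable]: "v k \<in> borel_measurable (H n)" if "k \<in> {..<Suc n}" for k
        by (rule measurable_H_mono[OF v_meas]) (use that in auto)
      show ?thesis unfolding W_def by measurable
    qed
    note [measurable] = measurable_H_M[OF WH]
    have Wb: "norm (W x) \<le> c" if "x \<in> space M" for x
      using ve[of "Suc n" x] n that by (auto simp: W_def norm_mult)
    define R where "R = (\<lambda>x. iexp (t * D n x) - exp (complex_of_real (- (t\<^sup>2 * v n x / 2)))
      - (\<i> * of_real t * of_real (D n x) + of_real (t\<^sup>2 / 2) * of_real (v n x - (D n x)\<^sup>2)))"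
    have Rb: "norm (R x) \<le> \<bar>t\<bar> ^ 3 / 6 * (\<eta> * (D n x)\<^sup>2 + (D n x) ^ 4 / \<eta>) + t ^ 4 / 8 * r n x" for x
    proof -
      have "norm (R x) \<le> \<bar>t\<bar> ^ 3 / 6 * (\<eta> * (D n x)\<^sup>2 + (D n x) ^ 4 / \<eta>) + t ^ 4 / 8 * (v n x)\<^sup>2"
        using norm_iexp_minus_exp_le[OF v_nonneg \<eta>, of t "D n x" n x] unfolding R_def by (simp flip: exp_of_real)
      also have "t ^ 4 / 8 * (v n x)\<^sup>2 \<le> t ^ 4 / 8 * r n x" by (intro mult_left_mono v_r) auto
      finally show ?thesis by simp
    qed
    interpret F: sigma_finite_subalgebra M "H n" by (rule sigma_finite_subalgebra_H)
    have z2: "AE x in M. real_cond_exp M (H n) (\<lambda>x. v n x - (D n x)\<^sup>2) x = 0"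
      using F.real_cond_exp_diff[OF vint[of n] D2[of n]] F.real_cond_exp_F_meas[OF vint[of n] v_meas[of n]] cond2[of n]
      by eventually_elim simp
    note i1 = integral_cond_exp_zero_complex[OF cond1 D1 WH Wb]
    note i2 = integral_cond_exp_zero_complex[OF z2 _ WH Wb]
    have int2: "integrable M (\<lambda>x. v n x - (D n x)\<^sup>2)" using vint D2 by auto
    have Rm [measurable]: "R \<in> borel_measurable M" unfolding R_def by measurable
    let ?b = "\<lambda>x. c * (\<bar>t\<bar> ^ 3 / 6 * (\<eta> * (D n x)\<^sup>2 + (D n x) ^ 4 / \<eta>) + t ^ 4 / 8 * r n x)"
    have bint: "integrable M ?b" using D2 D4 rint by auto
    have WRb: "norm (W x * R x) \<le> ?b x" if "x \<in> space M" for x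
      unfolding norm_mult using Wb[OF that] Rb[of x] c0 by (intro mult_mono) auto
    have WRint: "integrable M (\<lambda>x. W x * R x)"
      by (rule Bochner_Integration.integrable_bound[OF bint], measurable, intro AE_I2)
         (unfold real_norm_def, rule order_trans[OF WRb abs_ge_self])
    have TT: "T (Suc n) x - T n x = W x * R x + \<i> * of_real t * (W x * of_real (D n x))
        + of_real (t\<^sup>2 / 2) * (W x * of_real (v n x - (D n x)\<^sup>2))" for x
    proof -
      have a: "T (Suc n) x = W x * iexp (t * D n x)"
        unfolding T_def W_def sum.lessThan_Suc[of "\<lambda>k. D k x"] iexp_mult_add by (simp only: mult_ac)
      have b: "T n x = W x * exp (complex_of_real (- (t\<^sup>2 * v n x / 2)))"
        unfolding T_def W_def sum.lessThan_Suc mult.assoc exp_half_cancel ..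
      show ?thesis unfolding a b R_def by (simp add: algebra_simps)
    qed
    have "(\<integral>x. T (Suc n) x \<partial>M) - (\<integral>x. T n x \<partial>M) = (\<integral>x. T (Suc n) x - T n x \<partial>M)"
      using Tint[of "Suc n"] Tint[of n] n by simp
    also have "\<dots> = (\<integral>x. W x * R x \<partial>M)"
      unfolding TT using i1 i2[OF int2] WRint by simp
    finally have "norm ((\<integral>x. T (Suc n) x \<partial>M) - (\<integral>x. T n x \<partial>M)) \<le> (\<integral>x. norm (W x * R x) \<partial>M)"
      by simp
    also have "\<dots> \<le> (\<integral>x. ?b x \<partial>M)" by (intro integral_mono WRb integrable_norm WRint bint)
    also have "\<dots> = c * (\<bar>t\<bar> ^ 3 / 6 * (\<eta> * (\<integral>x. v n x \<partial>M) + (\<integral>x. (D n x) ^ 4 \<partial>M) / \<eta>) + t ^ 4 / 8 * (\<integral>x. r n x \<partial>M))"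
      using D2[of n] D4[of n] rint[of n] by (simp add: vE)
    also have "\<dots> \<le> c * e n"
      unfolding e_def using rE[of n] \<eta> c0 by (intro mult_left_mono add_mono divide_right_mono) auto
    finally show ?thesis .
  qed
  have ind: "norm ((\<integral>x. T n x \<partial>M) - 1) \<le> c * (\<Sum>k<n. e k)" if "n \<le> m" for n
    using that
  proof (induction n)
    case 0
    show ?case by (simp add: T_def prob_space)
  next
    case (Suc n)
    have "norm ((\<integral>x. T (Suc n) x \<partial>M) - 1) \<le> norm ((\<integral>x. T (Suc n) x \<partial>M) - (\<integral>x. T n x \<partial>M)) + norm ((\<integral>x. T n x \<partial>M) - 1)"
      using norm_triangle_ineq[of "(\<integral>x. T (Suc n) x \<partial>M) - (\<integral>x. T n x \<partial>M)" "(\<integral>x. T n x \<partial>M) - 1"] by simp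
    then show ?case using Suc step[of n] by (simp add: algebra_simps)
  qed
  have vs: "(\<Sum>k<m. (\<integral>x. v k x \<partial>M)) \<le> K"
  proof -
    have "(\<Sum>k<m. (\<integral>x. v k x \<partial>M)) = (\<integral>x. (\<Sum>k<m. v k x) \<partial>M)" using vint by simp
    also have "\<dots> \<le> (\<integral>x. K \<partial>M)" using vint vK by (intro integral_mono) auto
    finally show ?thesis by (simp add: prob_space)
  qed
  have "(\<Sum>k<m. e k) = \<bar>t\<bar> ^ 3 / 6 * (\<eta> * (\<Sum>k<m. (\<integral>x. v k x \<partial>M)) + (\<Sum>k<m. (\<integral>x. r k x \<partial>M)) / \<eta>) + t ^ 4 / 8 * (\<Sum>k<m. (\<integral>x. r k x \<partial>M))"
    by (simp add: e_def sum.distrib flip: sum_distrib_left sum_divide_distrib)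
  also have "\<dots> \<le> \<bar>t\<bar> ^ 3 / 6 * (\<eta> * K + (\<Sum>k<m. (\<integral>x. r k x \<partial>M)) / \<eta>) + t ^ 4 / 8 * (\<Sum>k<m. (\<integral>x. r k x \<partial>M))"
    by (rule add_right_mono, rule mult_left_mono, rule add_right_mono, rule mult_left_mono[OF vs]) (use \<eta> in auto)
  finally have "c * (\<Sum>k<m. e k) \<le> c * (\<bar>t\<bar> ^ 3 / 6 * (\<eta> * K + (\<Sum>k<m. (\<integral>x. r k x \<partial>M)) / \<eta>) + t ^ 4 / 8 * (\<Sum>k<m. (\<integral>x. r k x \<partial>M)))"
    using c0 by (intro mult_left_mono) auto
  note * = order_trans[OF ind[OF order_refl] this]
  have rs: "(\<integral>x. (\<Sum>k<m. r k x) \<partial>M) = (\<Sum>k<m. (\<integral>x. r k x \<partial>M))" using rint by simp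
  show ?thesis using * unfolding T_def c_def rs .
qed

end

context mart_diff
begin

text \<open>Predictable truncation: \<open>v\<close> and \<open>r\<close> are predictable, so the truncated differences are again
  martingale differences, now with a bounded bracket.\<close>

definition keep :: "real \<Rightarrow> real \<Rightarrow> nat \<Rightarrow> 'w \<Rightarrow> real" where
  "keep c K k x = (if c\<^sup>2 * (\<Sum>j\<le>k. v j x) \<le> K \<and> c ^ 4 * (\<Sum>j\<le>k. r j x) \<le> 1 then 1 else 0)"

lemma keep_meas: "keep c K k \<in> borel_measurable (H k)"
proof -
  have [measurable]: "v j \<in> borel_measurable (H k)" "r j \<in> borel_measurable (H k)" if "j \<in> {..k}" for j
    using that by (auto intro: measurable_H_mono[OF v_meas] measurable_H_mono[OF r_meas])
  show ?thesis unfolding keep_def by measurable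
qed

lemma keep_cases: "keep c K k x = 0 \<or> keep c K k x = 1"
  by (simp add: keep_def)

lemma keep_antimono:
  assumes "j \<le> k" "keep c K k x = 1" shows "keep c K j x = 1"
proof -
  have "(\<Sum>i\<le>j. v i x) \<le> (\<Sum>i\<le>k. v i x)" "(\<Sum>i\<le>j. r i x) \<le> (\<Sum>i\<le>k. r i x)"
    using assms(1) by (auto intro!: sum_mono2 v_nonneg r_nonneg)
  then have "c\<^sup>2 * (\<Sum>i\<le>j. v i x) \<le> c\<^sup>2 * (\<Sum>i\<le>k. v i x)" "c ^ 4 * (\<Sum>i\<le>j. r i x) \<le> c ^ 4 * (\<Sum>i\<le>k. r i x)"
    by (auto intro!: mult_left_mono)
  then show ?thesis using assms(2) by (auto simp: keep_def split: if_splits)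
qed

text \<open>By \<open>keep_antimono\<close> the indicator never returns from 0 to 1, so the
  truncated sum is the full sum up to the last retained index, where the bound is available.\<close>

lemma keep_sum:
  assumes "0 \<le> B" "\<And>k. keep c K k x = 1 \<Longrightarrow> (\<Sum>j\<le>k. w j) \<le> B"
  shows "(\<Sum>k<m. keep c K k x * w k) \<le> B"
proof (induction m)
  case 0 then show ?case using assms(1) by simp
next
  case (Suc m)
  show ?case
  proof (cases "keep c K m x = 1")
    case True
    have "(\<Sum>k<Suc m. keep c K k x * w k) = (\<Sum>k\<le>m. w k)"
      unfolding lessThan_Suc_atMost by (intro sum.cong) (use keep_antimono[OF _ True] in auto)
    then show ?thesis using assms(2)[OF True] by simp
  next
    case False
    then show ?thesis using Suc keep_cases[of c K m x] by simp
  qed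
qed

lemma mart_diff_keep:
  "mart_diff M H (\<lambda>k x. keep c K k x * (c * D k x)) (\<lambda>k x. keep c K k x * (c\<^sup>2 * v k x)) (\<lambda>k x. keep c K k x * (c ^ 4 * r k x))"
proof unfold_locales
  fix k x
  interpret F: sigma_finite_subalgebra M "H k" by (rule sigma_finite_subalgebra_H)
  note kS = measurable_H_mono[OF keep_meas le_SucI[OF order_refl]]
  note [measurable] = measurable_H_M[OF keep_meas]
  have pow: "keep c K k x ^ 2 = keep c K k x" "keep c K k x ^ 4 = keep c K k x" for x
    using keep_cases[of c K k x] by auto
  have kb: "\<bar>keep c K k x\<bar> \<le> 1" for x using keep_cases[of c K k x] by auto
  have im: "integrable M (\<lambda>x. (keep c K k x * d) * f x)" if "integrable M f" for d f
  proof (rule Bochner_Integration.integrable_bound[OF integrable_mult_right[OF that, of d]])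
    show "AE x in M. norm ((keep c K k x * d) * f x) \<le> norm (d * f x)"
      using kb mult_left_mono[OF kb, of "\<bar>d * f _\<bar>"] by (auto simp: abs_mult mult_ac)
    show "(\<lambda>x. (keep c K k x * d) * f x) \<in> borel_measurable M"
      using borel_measurable_integrable[OF that] by measurable
  qed
  have cm: "AE x in M. real_cond_exp M (H k) (\<lambda>x. (keep c K k x * d) * f x) x = (keep c K k x * d) * real_cond_exp M (H k) f x"
    if "integrable M f" for d f
    by (rule F.real_cond_exp_mult) (use that im[OF that] keep_meas in auto)
  show "(\<lambda>x. keep c K k x * (c * D k x)) \<in> borel_measurable (H (Suc k))"
    using kS D_meas by measurable
  show "(\<lambda>x. keep c K k x * (c\<^sup>2 * v k x)) \<in> borel_measurable (H k)"
    using keep_meas v_meas by measurable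
  show "(\<lambda>x. keep c K k x * (c ^ 4 * r k x)) \<in> borel_measurable (H k)"
    using keep_meas r_meas by measurable
  show "0 \<le> keep c K k x * (c\<^sup>2 * v k x)" using keep_cases[of c K k x] v_nonneg[of k x] by auto
  show "(keep c K k x * (c\<^sup>2 * v k x))\<^sup>2 \<le> keep c K k x * (c ^ 4 * r k x)"
    unfolding power_mult_distrib pow using keep_cases[of c K k x] v_r[of k x]
    by (auto intro!: mult_left_mono simp flip: power_mult)
  have e4: "(keep c K k x * (c * D k x)) ^ 4 = (keep c K k x * c ^ 4) * D k x ^ 4" for x
    unfolding power_mult_distrib pow by simp
  have e2: "(keep c K k x * (c * D k x)) ^ 2 = (keep c K k x * c ^ 2) * D k x ^ 2" for x
    unfolding power_mult_distrib pow by simp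
  show "integrable M (\<lambda>x. (keep c K k x * (c * D k x)) ^ 4)"
    unfolding e4 by (rule im[OF D4])
  show "AE x in M. real_cond_exp M (H k) (\<lambda>x. keep c K k x * (c * D k x)) x = 0"
    using cm[OF D1[of k], of c] cond1[of k] unfolding mult.assoc by eventually_elim simp
  show "AE x in M. real_cond_exp M (H k) (\<lambda>x. (keep c K k x * (c * D k x))\<^sup>2) x = keep c K k x * (c\<^sup>2 * v k x)"
    unfolding e2 using cm[OF D2[of k], of "c\<^sup>2"] cond2[of k] by eventually_elim simp
  show "AE x in M. real_cond_exp M (H k) (\<lambda>x. (keep c K k x * (c * D k x)) ^ 4) x \<le> keep c K k x * (c ^ 4 * r k x)"
    unfolding e4 using cm[OF D4[of k], of "c ^ 4"] cond4[of k]
  proof eventually_elim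
    case (elim x)
    then show ?case using keep_cases[of c K k x] by (auto intro!: mult_left_mono)
  qed
qed

text \<open>Truncating the bracket at a level above its limit makes it bounded and, almost surely,
  changes nothing for large \<open>n\<close>. For the truncated array the compensated exponential
  has mean tending to 1, and replacing the compensator by its deterministic limit costs nothing by
  dominated convergence.\<close>

theorem martingale_clt:
  fixes a :: "nat \<Rightarrow> real" and m :: "nat \<Rightarrow> nat"
  assumes V: "AE x in M. (\<lambda>n. (a n)\<^sup>2 * (\<Sum>k<m n. v k x)) \<longlonglongrightarrow> s2"
    and R: "AE x in M. (\<lambda>n. (a n) ^ 4 * (\<Sum>k<m n. r k x)) \<longlonglongrightarrow> 0"
  shows "(\<lambda>n. \<integral>x. iexp (t * (a n * (\<Sum>k<m n. D k x))) \<partial>M) \<longlonglongrightarrow> of_real (exp (- (t\<^sup>2 * s2 / 2)))"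
proof -
  \<comment> \<open>Any level strictly above the limit of the bracket would do; strictness makes the
    truncation eventually inactive.\<close>
  define K where "K = \<bar>s2\<bar> + 1"
  have K: "0 < K" "s2 < K" by (auto simp: K_def)
  define g where "g = (\<lambda>n. keep (a n) K)"
  define D' where "D' = (\<lambda>n k x. g n k x * (a n * D k x))"
  define v' where "v' = (\<lambda>n k x. g n k x * ((a n)\<^sup>2 * v k x))"
  define r' where "r' = (\<lambda>n k x. g n k x * ((a n) ^ 4 * r k x))"
  interpret I: mart_diff M H "D' n" "v' n" "r' n" for n
    unfolding D'_def v'_def r'_def g_def by (rule mart_diff_keep)
  have vK: "(\<Sum>k<m. v' n k x) \<le> K" for n m x
    unfolding v'_def g_def
    by (rule keep_sum) (use K in \<open>auto simp: keep_def split: if_splits simp flip: sum_distrib_left\<close>)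
  have rK: "(\<Sum>k<m. r' n k x) \<le> 1" for n m x
    unfolding r'_def g_def
    by (rule keep_sum) (use K in \<open>auto simp: keep_def split: if_splits simp flip: sum_distrib_left\<close>)
  have r1: "r' n k x \<le> 1" for n k x
  proof -
    have "r' n k x \<le> (\<Sum>j<Suc k. r' n j x)" using I.r_nonneg by (intro member_le_sum) auto
    also have "\<dots> \<le> 1" by (rule rK)
    finally show ?thesis .
  qed
  have g1: "AE x in M. eventually (\<lambda>n. \<forall>k<m n. g n k x = 1) sequentially"
    using V R
  proof eventually_elim
    case (elim x)
    have "eventually (\<lambda>n. (a n)\<^sup>2 * (\<Sum>k<m n. v k x) < K) sequentially"
      "eventually (\<lambda>n. (a n) ^ 4 * (\<Sum>k<m n. r k x) < 1) sequentially"
      using order_tendstoD(2)[OF elim(1) K(2)] order_tendstoD(2)[OF elim(2), of 1] by auto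
    then show ?case
    proof eventually_elim
      case (elim n)
      show ?case
      proof (intro allI impI)
        fix k assume k: "k < m n"
        have "(\<Sum>i\<le>k. v i x) \<le> (\<Sum>i<m n. v i x)" "(\<Sum>i\<le>k. r i x) \<le> (\<Sum>i<m n. r i x)"
          using k by (auto intro!: sum_mono2 v_nonneg r_nonneg)
        then have "(a n)\<^sup>2 * (\<Sum>i\<le>k. v i x) \<le> (a n)\<^sup>2 * (\<Sum>i<m n. v i x)" "(a n) ^ 4 * (\<Sum>i\<le>k. r i x) \<le> (a n) ^ 4 * (\<Sum>i<m n. r i x)"
          by (auto intro!: mult_left_mono)
        then show "g n k x = 1" using elim unfolding g_def keep_def by auto
      qed
    qed
  qed
  define c where "c = exp (t\<^sup>2 * K / 2)"
  have c: "0 < c" by (simp add: c_def)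
  define X where "X = (\<lambda>n x. iexp (t * (\<Sum>k<m n. D' n k x)) * exp (complex_of_real (t\<^sup>2 * (\<Sum>k<m n. v' n k x) / 2)))"
  define \<rho> where "\<rho> = (\<lambda>n. \<integral>x. (\<Sum>k<m n. r' n k x) \<partial>M)"
  have Xm [measurable]: "X n \<in> borel_measurable M" for n unfolding X_def by measurable
  have Xb: "norm (X n x) \<le> c" for n x
    by (auto simp: X_def c_def norm_mult intro!: mult_left_mono vK)
  have "\<rho> \<longlonglongrightarrow> (\<integral>x. 0 \<partial>M)"
    unfolding \<rho>_def
  proof (rule integral_dominated_convergence[where w = "\<lambda>_. 1"])
    show "AE x in M. (\<lambda>n. \<Sum>k<m n. r' n k x) \<longlonglongrightarrow> 0"
      using g1 R
    proof eventually_elim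
      case (elim x)
      have "eventually (\<lambda>n. (a n) ^ 4 * (\<Sum>k<m n. r k x) = (\<Sum>k<m n. r' n k x)) sequentially"
        using elim(1) by eventually_elim (simp add: r'_def sum_distrib_left)
      from Lim_transform_eventually[OF elim(2) this] show ?case .
    qed
    show "AE x in M. norm (\<Sum>k<m n. r' n k x) \<le> 1" for n
      using rK I.r_nonneg by (auto simp: sum_nonneg)
  qed auto
  then have \<rho>0: "\<rho> \<longlonglongrightarrow> 0" by simp
  have X1: "(\<lambda>n. \<integral>x. X n x \<partial>M) \<longlonglongrightarrow> 1"
  proof (rule LIMSEQ_I)
    fix e :: real assume e: "0 < e"
    define L where "L = c * (\<bar>t\<bar> ^ 3 / 6 * K)"
    have L: "0 \<le> L" using c K by (simp add: L_def)
    \<comment> \<open>As \<open>\<rho> n\<close> vanishes, the telescoping bound tends to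
      \<open>\<eta> * L\<close>, and this choice puts the limit below \<open>e\<close>.\<close>
    define \<eta> where "\<eta> = e / (L + 1)"
    have \<eta>: "0 < \<eta>" using e L by (simp add: \<eta>_def)
    have "(\<lambda>n. c * (\<bar>t\<bar> ^ 3 / 6 * (\<eta> * K + \<rho> n / \<eta>) + t ^ 4 / 8 * \<rho> n)) \<longlonglongrightarrow> c * (\<bar>t\<bar> ^ 3 / 6 * (\<eta> * K + 0 / \<eta>) + t ^ 4 / 8 * 0)"
      by (intro tendsto_intros \<rho>0) (use \<eta> in auto)
    moreover have "c * (\<bar>t\<bar> ^ 3 / 6 * (\<eta> * K + 0 / \<eta>) + t ^ 4 / 8 * 0) < e"
    proof -
      have "c * (\<bar>t\<bar> ^ 3 / 6 * (\<eta> * K + 0 / \<eta>) + t ^ 4 / 8 * 0) = e * (L / (L + 1))"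
        by (simp add: L_def \<eta>_def)
      also have "\<dots> < e * 1" using e L by (intro mult_strict_left_mono) auto
      finally show ?thesis by simp
    qed
    ultimately have "eventually (\<lambda>n. c * (\<bar>t\<bar> ^ 3 / 6 * (\<eta> * K + \<rho> n / \<eta>) + t ^ 4 / 8 * \<rho> n) < e) sequentially"
      by (rule order_tendstoD(2))
    then obtain n0 where n0: "\<And>n. n \<ge> n0 \<Longrightarrow> c * (\<bar>t\<bar> ^ 3 / 6 * (\<eta> * K + \<rho> n / \<eta>) + t ^ 4 / 8 * \<rho> n) < e"
      by (auto simp: eventually_sequentially)
    have "norm ((\<integral>x. X n x \<partial>M) - 1) < e" if "n \<ge> n0" for n
      using n0[OF that] unfolding X_def c_def \<rho>_def by (rule le_less_trans[OF I.bounded_telescope[OF vK r1 \<eta>]])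
    then show "\<exists>n0. \<forall>n\<ge>n0. norm ((\<integral>x. X n x \<partial>M) - 1) < e" by blast
  qed
  define z where "z = exp (- (t\<^sup>2 * s2 / 2))"
  define Y where "Y = (\<lambda>n x. iexp (t * (a n * (\<Sum>k<m n. D k x))))"
  have Ym [measurable]: "Y n \<in> borel_measurable M" for n unfolding Y_def by measurable
  have Yb: "norm (Y n x) = 1" for n x by (simp add: Y_def)
  have Yi: "integrable M (Y n)" for n by (rule integrable_const_bound[of _ 1]) (auto simp: Yb)
  have Xi: "integrable M (X n)" for n by (rule integrable_const_bound[of _ c]) (auto simp: Xb)
  \<comment> \<open>Where the truncation is inactive, the integrand has the modulus of 1 - z exp
    (t^2 V_n / 2) with V_n the scaled bracket. This vanishes as V_n tends to \<open>s2\<close>, and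
    the truncated bracket gives the domination.\<close>
  have "(\<lambda>n. \<integral>x. Y n x - of_real z * X n x \<partial>M) \<longlonglongrightarrow> (\<integral>x. 0 \<partial>M)"
  proof (rule integral_dominated_convergence[where w = "\<lambda>_. 1 + \<bar>z\<bar> * c"])
    show "AE x in M. norm (Y n x - of_real z * X n x) \<le> 1 + \<bar>z\<bar> * c" for n
    proof (rule AE_I2)
      fix x
      have "norm (Y n x - of_real z * X n x) \<le> norm (Y n x) + norm (of_real z * X n x)" by (rule norm_triangle_ineq4)
      also have "norm (of_real z * X n x) \<le> \<bar>z\<bar> * c" unfolding norm_mult norm_of_real by (intro mult_left_mono Xb) simp
      finally show "norm (Y n x - of_real z * X n x) \<le> 1 + \<bar>z\<bar> * c" by (simp add: Yb)
    qed
    show "AE x in M. (\<lambda>n. Y n x - of_real z * X n x) \<longlonglongrightarrow> 0"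
      using g1 V
    proof eventually_elim
      case (elim x)
      have ev: "eventually (\<lambda>n. norm (1 - z * exp (t\<^sup>2 * ((a n)\<^sup>2 * (\<Sum>k<m n. v k x)) / 2)) = norm (Y n x - of_real z * X n x)) sequentially"
        using elim(1)
      proof eventually_elim
        case (elim n)
        have "(\<Sum>k<m n. D' n k x) = a n * (\<Sum>k<m n. D k x)" "(\<Sum>k<m n. v' n k x) = (a n)\<^sup>2 * (\<Sum>k<m n. v k x)"
          using elim by (simp_all add: D'_def v'_def sum_distrib_left)
        then have "Y n x - of_real z * X n x = Y n x * of_real (1 - z * exp (t\<^sup>2 * ((a n)\<^sup>2 * (\<Sum>k<m n. v k x)) / 2))"
          unfolding X_def Y_def by (simp add: algebra_simps flip: exp_of_real)
        then show ?case by (simp only: norm_mult Yb norm_of_real real_norm_def mult_1)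
      qed
      have "(\<lambda>n. norm (1 - z * exp (t\<^sup>2 * ((a n)\<^sup>2 * (\<Sum>k<m n. v k x)) / 2))) \<longlonglongrightarrow> norm (1 - z * exp (t\<^sup>2 * s2 / 2))"
        by (intro tendsto_intros elim(2)) auto
      also have "norm (1 - z * exp (t\<^sup>2 * s2 / 2)) = 0" by (simp add: z_def flip: exp_add)
      finally have "(\<lambda>n. norm (Y n x - of_real z * X n x)) \<longlonglongrightarrow> 0"
        by (rule Lim_transform_eventually[OF _ ev])
      then show ?case by (simp only: tendsto_norm_zero_iff)
    qed
  qed auto
  then have "(\<lambda>n. (\<integral>x. Y n x - of_real z * X n x \<partial>M) + of_real z * (\<integral>x. X n x \<partial>M)) \<longlonglongrightarrow> 0 + of_real z * 1"
    by (intro tendsto_intros X1) simp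
  moreover have "(\<integral>x. Y n x - of_real z * X n x \<partial>M) + of_real z * (\<integral>x. X n x \<partial>M) = (\<integral>x. Y n x \<partial>M)" for n
    using Yi Xi by simp
  ultimately show ?thesis by (simp add: Y_def z_def)
qed

end

section \<open>Almost sure growth of martingales along the generations\<close>

text \<open>Geometric decay of the means makes the series of the \<open>f n\<close> integrable,
  hence almost surely convergent, so its terms vanish.\<close>

lemma AE_tendsto_zero_if_summable:
  fixes f :: "nat \<Rightarrow> 'w \<Rightarrow> real"
  assumes nn: "\<And>n x. 0 \<le> f n x" and int: "\<And>n. integrable M (f n)"
    and le: "\<And>n. (\<integral>x. f n x \<partial>M) \<le> C * q ^ n" and q: "0 \<le> q" "q < 1"
  shows "AE x in M. (\<lambda>n. f n x) \<longlonglongrightarrow> 0"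
proof -
  have [measurable]: "f n \<in> borel_measurable M" for n using int by auto
  have C: "0 \<le> C" using order_trans[OF Bochner_Integration.integral_nonneg[of M "f 0"] le[of 0]] nn by simp
  have "(\<integral>\<^sup>+x. (\<Sum>n. ennreal (f n x)) \<partial>M) = (\<Sum>n. \<integral>\<^sup>+x. ennreal (f n x) \<partial>M)"
    by (rule nn_integral_suminf) measurable
  also have "\<dots> \<le> (\<Sum>n. ennreal (C * q ^ n))"
    using nn int le by (intro suminf_le) (auto simp: nn_integral_eq_integral ennreal_leI)
  also have "\<dots> = ennreal (\<Sum>n. C * q ^ n)"
    using q C by (intro suminf_ennreal2) (auto intro!: summable_mult summable_geometric)
  finally have "(\<integral>\<^sup>+x. (\<Sum>n. ennreal (f n x)) \<partial>M) \<noteq> \<infinity>" by (auto simp: top_unique)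
  then have "AE x in M. (\<Sum>n. ennreal (f n x)) \<noteq> \<infinity>"
    by (intro nn_integral_PInf_AE) auto
  then show ?thesis
  proof eventually_elim
    case (elim x)
    then have "summable (\<lambda>n. f n x)" by (intro summable_suminf_not_top nn) auto
    then show ?case by (rule summable_LIMSEQ_zero)
  qed
qed

lemma integrable_mult_sq:
  fixes f g :: "'w \<Rightarrow> real"
  assumes [measurable]: "f \<in> borel_measurable M" "g \<in> borel_measurable M"
    and "integrable M (\<lambda>x. (f x)\<^sup>2)" "integrable M (\<lambda>x. (g x)\<^sup>2)"
  shows "integrable M (\<lambda>x. f x * g x)"
proof (rule Bochner_Integration.integrable_bound[of _ "\<lambda>x. (f x)\<^sup>2 + (g x)\<^sup>2"])
  show "integrable M (\<lambda>x. (f x)\<^sup>2 + (g x)\<^sup>2)" using assms by auto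
  show "AE x in M. norm (f x * g x) \<le> norm ((f x)\<^sup>2 + (g x)\<^sup>2)"
  proof (rule AE_I2)
    fix x
    have "0 \<le> (\<bar>f x\<bar> - \<bar>g x\<bar>)\<^sup>2" by simp
    then have "2 * (\<bar>f x\<bar> * \<bar>g x\<bar>) \<le> (f x)\<^sup>2 + (g x)\<^sup>2" by (simp add: power2_diff)
    moreover have "0 \<le> \<bar>f x\<bar> * \<bar>g x\<bar>" by simp
    moreover have "norm ((f x)\<^sup>2 + (g x)\<^sup>2) = (f x)\<^sup>2 + (g x)\<^sup>2" by simp
    ultimately show "norm (f x * g x) \<le> norm ((f x)\<^sup>2 + (g x)\<^sup>2)"
      unfolding real_norm_def abs_mult by linarith
  qed
qed measurable

context filtered_prob_space
begin

lemma orthogonal_sum: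
  fixes D :: "nat \<Rightarrow> 'w \<Rightarrow> real"
  assumes m: "\<And>k. D k \<in> borel_measurable (H (Suc k))" and sq: "\<And>k. integrable M (\<lambda>x. (D k x)\<^sup>2)"
    and c: "\<And>k. AE x in M. real_cond_exp M (H k) (D k) x = 0" and A: "finite A"
  shows "integrable M (\<lambda>x. (\<Sum>k\<in>A. D k x)\<^sup>2)" "(\<integral>x. (\<Sum>k\<in>A. D k x)\<^sup>2 \<partial>M) = (\<Sum>k\<in>A. \<integral>x. (D k x)\<^sup>2 \<partial>M)"
proof -
  have mM [measurable]: "D k \<in> borel_measurable M" for k by (rule measurable_H_M[OF m])
  have int: "integrable M (\<lambda>x. D j x * D k x)" for j k by (rule integrable_mult_sq[OF mM mM sq sq])
  have lt: "(\<integral>x. D j x * D k x \<partial>M) = 0" if "j < k" for j k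
    using cond_exp_intg(2)[OF c[of k] _ int[of j k] measurable_H_mono[OF m[of j]] mM[of k]] that by simp
  have ne: "(\<integral>x. D j x * D k x \<partial>M) = 0" if "j \<noteq> k" for j k
    using lt[of j k] lt[of k j] that by (cases "j < k") (auto simp: mult.commute)
  have e: "(\<Sum>k\<in>A. D k x)\<^sup>2 = (\<Sum>j\<in>A. \<Sum>k\<in>A. D j x * D k x)" for x
    by (simp add: power2_eq_square sum_product)
  show "integrable M (\<lambda>x. (\<Sum>k\<in>A. D k x)\<^sup>2)" unfolding e using int by auto
  have "(\<integral>x. (\<Sum>k\<in>A. D k x)\<^sup>2 \<partial>M) = (\<Sum>j\<in>A. \<Sum>k\<in>A. \<integral>x. D j x * D k x \<partial>M)"
    unfolding e using int by simp
  also have "\<dots> = (\<Sum>j\<in>A. \<Sum>k\<in>A. if k = j then (\<integral>x. (D j x)\<^sup>2 \<partial>M) else 0)"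
    by (intro sum.cong refl) (auto simp: ne power2_eq_square)
  also have "\<dots> = (\<Sum>k\<in>A. \<integral>x. (D k x)\<^sup>2 \<partial>M)" using A by simp
  finally show "(\<integral>x. (\<Sum>k\<in>A. D k x)\<^sup>2 \<partial>M) = (\<Sum>k\<in>A. \<integral>x. (D k x)\<^sup>2 \<partial>M)" .
qed

text \<open>Orthogonality bounds the second moment of a sum of at most 2^(l+1) differences by a
  multiple of 2^l; any weight q^l with q < 1/2 then makes these moments summable. The index sets are
  arbitrary so that single generations and whole subtrees are both covered.\<close>

lemma martingale_growth:
  fixes D :: "nat \<Rightarrow> 'w \<Rightarrow> real"
  assumes m: "\<And>k. D k \<in> borel_measurable (H (Suc k))" and sq: "\<And>k. integrable M (\<lambda>x. (D k x)\<^sup>2)"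
    and c: "\<And>k. AE x in M. real_cond_exp M (H k) (D k) x = 0"
    and C: "\<And>k. (\<integral>x. (D k x)\<^sup>2 \<partial>M) \<le> C"
    and A: "\<And>l. A l \<subseteq> {..<2 ^ Suc l}" and q: "0 < q" "q < 1 / 2"
  shows "AE x in M. (\<lambda>l. (\<Sum>k\<in>A l. D k x)\<^sup>2 * q ^ l) \<longlonglongrightarrow> 0"
proof (rule AE_tendsto_zero_if_summable[where C = "2 * C" and q = "2 * q"])
  have fin: "finite (A l)" and crd: "real (card (A l)) \<le> 2 ^ Suc l" for l
  proof -
    show "finite (A l)" using A[of l] finite_subset by blast
    have "card (A l) \<le> 2 ^ Suc l" using card_mono[OF _ A[of l]] by simp
    then show "real (card (A l)) \<le> 2 ^ Suc l" by (metis of_nat_le_iff of_nat_numeral of_nat_power)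
  qed
  note o = orthogonal_sum[OF m sq c fin]
  show "integrable M (\<lambda>x. (\<Sum>k\<in>A n. D k x)\<^sup>2 * q ^ n)" for n using o(1)[of n] by simp
  have C0: "0 \<le> C" using order_trans[OF Bochner_Integration.integral_nonneg C] by simp
  show "(\<integral>x. (\<Sum>k\<in>A n. D k x)\<^sup>2 * q ^ n \<partial>M) \<le> 2 * C * (2 * q) ^ n" for n
  proof -
    have "(\<integral>x. (\<Sum>k\<in>A n. D k x)\<^sup>2 * q ^ n \<partial>M) = (\<Sum>k\<in>A n. \<integral>x. (D k x)\<^sup>2 \<partial>M) * q ^ n"
      using o(1)[of n] o(2)[of n] by simp
    also have "\<dots> \<le> (real (card (A n)) * C) * q ^ n"
      using C q by (intro mult_right_mono sum_bounded_above) auto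
    also have "\<dots> \<le> (2 ^ Suc n * C) * q ^ n"
      using crd q C0 by (intro mult_right_mono) auto
    finally show ?thesis by (simp add: power_mult_distrib mult_ac)
  qed
qed (use q in auto)

end

text \<open>Given \<open>F\<close>, the variable \<open>Y k\<close> is independent of the variables \<open>Y j\<close>, \<open>j \<in> Js\<close>; hence
  enlarging \<open>F\<close> by the latter does not change conditional expectations of functions of \<open>Y k\<close>.\<close>

lemma (in prob_space) real_cond_exp_enlarge:
  fixes Y :: "'i \<Rightarrow> 'a \<Rightarrow> 'b" and g :: "'b \<Rightarrow> real"
  assumes F: "subalgebra M F" and H: "subalgebra M H"
    and indep: "cond_indep_vars M F N Y I" and k: "k \<in> I" and Js: "Js \<subseteq> I" "k \<notin> Js"
    and FH: "sets F \<subseteq> sets H" and gen: "sets H \<subseteq> sigma_sets (space M)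
      {A \<inter> {\<omega> \<in> space M. \<forall>j\<in>J. Y j \<omega> \<in> B j} | A J B. A \<in> sets F \<and> J \<subseteq> Js \<and> finite J \<and> (\<forall>j\<in>J. B j \<in> sets N)}"
    and g: "g \<in> borel_measurable N" and int: "integrable M (\<lambda>\<omega>. g (Y k \<omega>))"
  shows "AE \<omega> in M. real_cond_exp M H (\<lambda>\<omega>. g (Y k \<omega>)) \<omega> = real_cond_exp M F (\<lambda>\<omega>. g (Y k \<omega>)) \<omega>"
proof -
  interpret F: finite_measure_subalgebra M F by unfold_locales (rule F)
  interpret H: finite_measure_subalgebra M H by unfold_locales (rule H)
  have spF: "space F = space M" and setF: "\<And>A. A \<in> sets F \<Longrightarrow> A \<in> sets M" using F by (auto simp: subalgebra_def)
  have setH: "\<And>A. A \<in> sets H \<Longrightarrow> A \<in> sets M" using H by (auto simp: subalgebra_def)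
  have Y: "Y i \<in> measurable M N" if "i \<in> I" for i using indep that by (auto simp: cond_indep_vars_def)
  note [measurable] = Y[OF k]
  define Q where "Q = (\<lambda>J B. {\<omega> \<in> space M. \<forall>j\<in>J. Y j \<omega> \<in> B j})"
  have Qm: "Q J B \<in> sets M" if "finite J" "J \<subseteq> I" "\<And>j. j \<in> J \<Longrightarrow> B j \<in> sets N" for J and B :: "'i \<Rightarrow> 'b set"
  proof -
    have "Q J B = (\<Inter>j\<in>J. Y j -` B j \<inter> space M) \<inter> space M" by (auto simp: Q_def)
    also have "\<dots> \<in> sets M"
    proof (cases "J = {}")
      case False
      have "(\<Inter>j\<in>J. Y j -` B j \<inter> space M) \<in> sets M"
        by (rule sets.finite_INT[OF that(1) False]) (use that Y in \<open>auto intro!: measurable_sets\<close>)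
      then show ?thesis by auto
    qed auto
    finally show ?thesis .
  qed
  define p where "p = (\<lambda>E. real_cond_exp M F (indicator E :: 'a \<Rightarrow> real))"
  have p_eq: "p E = real_cond_exp M F (indicator E)" for E by (simp add: p_def)
  have pF [measurable]: "p E \<in> borel_measurable F" for E by (simp add: p_def)
  have pM [measurable]: "p E \<in> borel_measurable M" for E by (simp add: p_def)
  have ind: "AE x in M. p {\<omega> \<in> space M. \<forall>j\<in>J. Y j \<omega> \<in> B j} x = (\<Prod>j\<in>J. p {\<omega> \<in> space M. Y j \<omega> \<in> B j} x)"
    if "J \<subseteq> I" "J \<noteq> {}" "finite J" "\<forall>j\<in>J. B j \<in> sets N" for J and B :: "'i \<Rightarrow> 'b set"
    using indep that unfolding cond_indep_vars_def p_def prob_given_def by blast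
  have indi: "integrable M (indicator E :: 'a \<Rightarrow> real)" if "E \<in> sets M" for E
    using that by (simp add: integrable_real_indicator emeasure_eq_measure)
  have pint: "integrable M (p E)" if "E \<in> sets M" for E
    unfolding p_def by (rule F.real_cond_exp_int[OF indi[OF that]])
  have iint: "integrable M (\<lambda>x. indicator A x * f x)" if "A \<in> sets M" "integrable M f" for A and f :: "'a \<Rightarrow> real"
    using integrable_mult_indicator[OF that] by simp
  have iint': "integrable M (\<lambda>x. f x * indicator A x)" if "A \<in> sets M" "integrable M f" for A and f :: "'a \<Rightarrow> real"
    using iint[OF that] by (simp add: mult.commute)
  have bd: "AE x in M. \<bar>p E x\<bar> \<le> 1" if "E \<in> sets M" for E
    using F.real_cond_exp_ge_c[OF indi[OF that], of 0] F.real_cond_exp_le_c[OF indi[OF that], of 1]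
    by (auto simp: p_def indicator_def)
  have qint: "integrable M (\<lambda>x. p E x * f x)" if "E \<in> sets M" "integrable M f" for E f
  proof (rule Bochner_Integration.integrable_bound[OF that(2)])
    show "(\<lambda>x. p E x * f x) \<in> borel_measurable M" using that(2) by measurable
    show "AE x in M. norm (p E x * f x) \<le> norm (f x)"
      using bd[OF that(1)] by eventually_elim (use mult_right_mono in \<open>fastforce simp: abs_mult\<close>)
  qed
  define S where "S = (\<lambda>B. Y k -` B \<inter> space M)"
  have Sm: "S B \<in> sets M" if "B \<in> sets N" for B unfolding S_def using that by measurable
  \<comment> \<open>The defect of the event \<open>S B\<close>. For indicators, the claim is that it
    integrates to 0 over every set of \<open>H\<close>; this is checked on the generating
    intersections and extended by Dynkin's argument.\<close>
  define d where "d = (\<lambda>B x. indicator (S B) x - p (S B) x)"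
  have dint: "integrable M (d B)" if "B \<in> sets N" for B
    unfolding d_def using indi[OF Sm[OF that]] pint[OF Sm[OF that]] by auto
  define G where "G = {A \<inter> Q J B | A J B. A \<in> sets F \<and> J \<subseteq> Js \<and> finite J \<and> (\<forall>j\<in>J. B j \<in> sets N)}"
  have G1: "(\<integral>x. indicator E x * d B0 x \<partial>M) = 0" if E: "E \<in> G" and B0: "B0 \<in> sets N" for E B0
  proof -
    obtain A J B where A: "A \<in> sets F" and J: "J \<subseteq> Js" "finite J" and B: "\<forall>j\<in>J. B j \<in> sets N" and EE: "E = A \<inter> Q J B"
      using E by (auto simp: G_def)
    have AM: "A \<in> sets M" by (rule setF[OF A])
    have JI: "J \<subseteq> I" "k \<notin> J" using J Js by auto
    have QM: "Q J B \<in> sets M" using Qm[OF J(2) JI(1)] B by auto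
    define B' where "B' = B(k := B0)"
    have QJ': "Q J B' = Q J B" unfolding Q_def B'_def using JI(2) by auto
    have Qi: "Q (insert k J) B' = S B0 \<inter> Q J B" unfolding Q_def B'_def S_def using JI(2) by auto
    have pp: "AE x in M. p (S B0 \<inter> Q J B) x = p (S B0) x * p (Q J B) x"
    \<comment> \<open>\<open>cond_indep_vars\<close> gives the product formula for non-empty index
      sets only. For empty \<open>J\<close> the factor is the conditional probability of the whole
      space.\<close>
    proof (cases "J = {}")
      case True
      have "p (space M) = (\<lambda>x. p (space M) x)" by simp
      have "AE x in M. real_cond_exp M F (indicator (space M)) x = indicator (space M) x"
      proof (rule F.real_cond_exp_F_meas[OF indi])
        have "space M \<in> sets F" using sets.top[of F] by (simp add: spF)
        then show "(indicator (space M) :: 'a \<Rightarrow> real) \<in> borel_measurable F" by measurable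
      qed auto
      moreover have "Q J B = space M" using True by (auto simp: Q_def)
      moreover have "S B0 \<inter> space M = S B0" by (auto simp: S_def)
      ultimately show ?thesis unfolding p_def using AE_space[of M] by (auto elim!: eventually_mono simp: indicator_def)
    next
      case False
      have B'N: "\<forall>j\<in>insert k J. B' j \<in> sets N" using B B0 by (auto simp: B'_def)
      have "AE x in M. p (Q (insert k J) B') x = (\<Prod>j\<in>insert k J. p {\<omega> \<in> space M. Y j \<omega> \<in> B' j} x)"
        unfolding Q_def by (rule ind) (use JI k J(2) B'N in auto)
      moreover have "AE x in M. p (Q J B') x = (\<Prod>j\<in>J. p {\<omega> \<in> space M. Y j \<omega> \<in> B' j} x)"
        unfolding Q_def by (rule ind) (use JI k J(2) B'N False in auto)
      ultimately show ?thesis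
      proof eventually_elim
        case (elim x)
        have "{\<omega> \<in> space M. Y k \<omega> \<in> B' k} = S B0" by (auto simp: S_def B'_def)
        then show ?case using elim J(2) JI(2) by (simp add: Qi QJ')
      qed
    qed
    have SQ: "S B0 \<inter> Q J B \<in> sets M" using Sm[OF B0] QM by auto
    have iA [measurable]: "(indicator A :: 'a \<Rightarrow> real) \<in> borel_measurable F" using A by measurable
    note [measurable] = AM QM SQ
    have "(\<integral>x. indicat_real E x * indicat_real (S B0) x \<partial>M) = (\<integral>x. indicator A x * indicator (S B0 \<inter> Q J B) x \<partial>M)"
      unfolding EE by (intro Bochner_Integration.integral_cong refl) (auto simp: indicator_def)
    also have "\<dots> = (\<integral>x. indicator A x * p (S B0 \<inter> Q J B) x \<partial>M)"
      unfolding p_def by (rule F.real_cond_exp_intg(2)[symmetric]) (use iint[OF AM indi[OF SQ]] SQ in auto)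
    also have "\<dots> = (\<integral>x. (indicator A x * p (S B0) x) * p (Q J B) x \<partial>M)"
      by (rule integral_cong_AE) (measurable, use pp in \<open>auto elim!: eventually_mono\<close>)
    also have "\<dots> = (\<integral>x. (indicator A x * p (S B0) x) * indicator (Q J B) x \<partial>M)"
      unfolding p_eq[of "Q J B"]
      by (rule F.real_cond_exp_intg(2)) (use iint'[OF QM iint[OF AM pint[OF Sm[OF B0]]]] QM in auto)
    also have "\<dots> = (\<integral>x. indicator E x * p (S B0) x \<partial>M)"
      unfolding EE by (intro Bochner_Integration.integral_cong refl) (auto simp: indicator_def)
    finally have "(\<integral>x. indicat_real E x * indicat_real (S B0) x \<partial>M) = (\<integral>x. indicator E x * p (S B0) x \<partial>M)" .
    moreover have "E \<in> sets M" unfolding EE using AM QM by auto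
    ultimately show ?thesis
      unfolding d_def right_diff_distrib using iint indi[OF Sm[OF B0]] pint[OF Sm[OF B0]] by simp
  qed
  have Gs: "G \<subseteq> sets M"
  proof
    fix E assume "E \<in> G"
    then obtain A J B where A: "A \<in> sets F" and J: "J \<subseteq> Js" "finite J" and B: "\<forall>j\<in>J. B j \<in> sets N" and EE: "E = A \<inter> Q J B"
      by (auto simp: G_def)
    show "E \<in> sets M" unfolding EE using setF[OF A] Qm[OF J(2)] J(1) Js(1) B by blast
  qed
  have Gi: "Int_stable G"
  proof (rule Int_stableI)
    fix E E' assume "E \<in> G" "E' \<in> G"
    then obtain A J B A' J' B' where A: "A \<in> sets F" "A' \<in> sets F" and J: "J \<subseteq> Js" "finite J" "J' \<subseteq> Js" "finite J'"
      and B: "\<forall>j\<in>J. B j \<in> sets N" "\<forall>j\<in>J'. B' j \<in> sets N" and EE: "E = A \<inter> Q J B" "E' = A' \<inter> Q J' B'"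
      by (auto simp: G_def)
    \<comment> \<open>Each family of events is padded by the whole space, so that both become
      families over the union of the index sets.\<close>
    define B'' where "B'' = (\<lambda>j. (if j \<in> J then B j else space N) \<inter> (if j \<in> J' then B' j else space N))"
    have YN: "Y j x \<in> space N" if "x \<in> space M" "j \<in> Js" for x j
      using measurable_space[OF Y that(1)] that(2) Js(1) by auto
    have B'': "(y \<in> B'' j) = (y \<in> space N \<and> (j \<in> J \<longrightarrow> y \<in> B j) \<and> (j \<in> J' \<longrightarrow> y \<in> B' j))" if "j \<in> J \<union> J'" for y j
      using that B sets.sets_into_space[of "B j" N] sets.sets_into_space[of "B' j" N] by (auto simp: B''_def)
    have "E \<inter> E' = (A \<inter> A') \<inter> Q (J \<union> J') B''"
      unfolding EE Q_def using B'' YN J by blast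
    moreover have "\<forall>j\<in>J \<union> J'. B'' j \<in> sets N" using B by (auto simp: B''_def)
    ultimately show "E \<inter> E' \<in> G" unfolding G_def using A J by blast
  qed
  have H0: "(\<integral>x. indicator E x * d B0 x \<partial>M) = 0" if E: "E \<in> sets H" and B0: "B0 \<in> sets N" for E B0
  proof -
    have E': "E \<in> sigma_sets (space M) G" using gen E by (auto simp: G_def Q_def)
    have sM: "\<And>A. A \<in> sigma_sets (space M) G \<Longrightarrow> A \<in> sets M" using sets.sigma_sets_subset[OF Gs] by auto
    have Gp: "G \<subseteq> Pow (space M)" using Gs sets.sets_into_space by blast
    show ?thesis
      using Gi Gp E'
    proof (induction rule: sigma_sets_induct_disjoint)
      case (basic A)
      then show ?case by (rule G1[OF _ B0])
    next
      case empty
      then show ?case by simp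
    next
      case (compl A)
      have AM: "A \<in> sets M" by (rule sM[OF compl(1)])
      have spG: "space M \<in> G"
      proof -
        have "space M = space M \<inter> Q {} (\<lambda>_. {})" by (auto simp: Q_def)
        moreover have "space M \<in> sets F" using sets.top[of F] by (simp add: spF)
        ultimately show ?thesis unfolding G_def by blast
      qed
      have "(\<integral>x. indicator (space M - A) x * d B0 x \<partial>M) = (\<integral>x. indicator (space M) x * d B0 x - indicator A x * d B0 x \<partial>M)"
        by (intro Bochner_Integration.integral_cong refl) (auto simp: indicator_def)
      also have "\<dots> = (\<integral>x. indicator (space M) x * d B0 x \<partial>M) - (\<integral>x. indicator A x * d B0 x \<partial>M)"
        by (intro Bochner_Integration.integral_diff iint dint B0 AM) auto
      finally show ?case using G1[OF spG B0] compl(2) by simp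
    next
      case (union A)
      have AM: "A i \<in> sets M" for i using union(2) sM by auto
      have "(LINT x:(\<Union>i. A i)|M. d B0 x) = (\<Sum>i. LINT x:(A i)|M. d B0 x)"
        by (rule lebesgue_integral_countable_add)
           (use AM union(1) dint[OF B0] iint in \<open>auto simp: disjoint_family_on_def set_integrable_def\<close>)
      then show ?case using union(3) by (simp add: set_lebesgue_integral_def)
    qed
  qed
  \<comment> \<open>Passing from indicators to a general \<open>g\<close> needs no approximation:
    the roles are exchanged, and for fixed \<open>E\<close> in \<open>H\<close> the defect of
    \<open>E\<close> is shown to have conditional expectation 0 given the variable
    \<open>Y k\<close>.\<close>
  define G' where "G' = vimage_algebra (space M) (Y k) N"
  have G'sub: "subalgebra M G'"
    unfolding G'_def subalgebra_def using measurable_space[OF Y[OF k]]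
    by (auto simp: sets_vimage_algebra2 Pi_iff)
  interpret G': finite_measure_subalgebra M G' by unfold_locales (rule G'sub)
  have gY: "(\<lambda>x. g (Y k x)) \<in> borel_measurable G'"
  proof -
    have "Y k \<in> measurable G' N" unfolding G'_def
      by (rule measurable_vimage_algebra1) (use measurable_space[OF Y[OF k]] in auto)
    then show ?thesis using g by measurable
  qed
  have gYM [measurable]: "(\<lambda>x. g (Y k x)) \<in> borel_measurable M" using int by auto
  let ?c = "real_cond_exp M F (\<lambda>\<omega>. g (Y k \<omega>))"
  show ?thesis
  proof (rule H.real_cond_exp_charact)
    fix E assume E: "E \<in> sets H"
    have EM [measurable]: "E \<in> sets M" by (rule setH[OF E])
    define u where "u = (\<lambda>x. indicator E x - p E x)"
    have uint: "integrable M u" unfolding u_def using indi[OF EM] pint[OF EM] by auto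
    have u0: "(\<integral>x. indicator (S B) x * u x \<partial>M) = 0" if B: "B \<in> sets N" for B
    proof -
      note [measurable] = Sm[OF B]
      \<comment> \<open>Conditional expectation given \<open>F\<close> is self-adjoint: it is moved
        from \<open>S B\<close> to \<open>E\<close> through the product of the two conditional
        probabilities.\<close>
      have "(\<integral>x. indicat_real E x * indicat_real (S B) x \<partial>M) = (\<integral>x. p (S B) x * indicator E x \<partial>M)"
        using H0[OF E B] iint[OF EM indi[OF Sm[OF B]]] iint[OF EM pint[OF Sm[OF B]]]
        unfolding d_def right_diff_distrib by (simp add: mult.commute)
      also have "\<dots> = (\<integral>x. p (S B) x * p E x \<partial>M)"
        unfolding p_eq[of E] by (rule F.real_cond_exp_intg(2)[symmetric]) (use iint'[OF EM pint[OF Sm[OF B]]] in auto)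
      also have "\<dots> = (\<integral>x. p E x * p (S B) x \<partial>M)" by (simp add: mult.commute)
      also have "\<dots> = (\<integral>x. p E x * indicator (S B) x \<partial>M)"
        unfolding p_eq[of "S B"] by (rule F.real_cond_exp_intg(2)) (use iint'[OF Sm[OF B] pint[OF EM]] in auto)
      finally show ?thesis
        unfolding u_def right_diff_distrib
        using iint[OF Sm[OF B] indi[OF EM]] iint[OF Sm[OF B] pint[OF EM]] by (simp add: mult.commute)
    qed
    have "AE x in M. real_cond_exp M G' u x = 0"
    proof (rule G'.real_cond_exp_charact)
      fix A assume "A \<in> sets G'"
      then obtain B where "B \<in> sets N" "A = S B"
        unfolding G'_def S_def using measurable_space[OF Y[OF k]] by (auto simp: sets_vimage_algebra2 Pi_iff)
      then show "(LINT x:A|M. u x) = (LINT x:A|M. 0)" using u0 by (simp add: set_lebesgue_integral_def)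
    qed (use uint in auto)
    then have "(\<integral>x. g (Y k x) * u x \<partial>M) = 0"
    proof -
      have i: "integrable M (\<lambda>x. g (Y k x) * u x)"
        unfolding u_def right_diff_distrib using iint'[OF EM int] qint[OF EM int] by (simp add: mult.commute)
      have "(\<integral>x. g (Y k x) * u x \<partial>M) = (\<integral>x. g (Y k x) * real_cond_exp M G' u x \<partial>M)"
        by (rule G'.real_cond_exp_intg(2)[symmetric]) (use i gY uint in auto)
      also have "\<dots> = (\<integral>x. 0 \<partial>M)"
        by (rule integral_cong_AE) (measurable, use \<open>AE x in M. real_cond_exp M G' u x = 0\<close> in auto)
      finally show ?thesis by simp
    qed
    then have "(\<integral>x. indicator E x * g (Y k x) \<partial>M) = (\<integral>x. p E x * g (Y k x) \<partial>M)"
      unfolding u_def right_diff_distrib using iint'[OF EM int] qint[OF EM int] by (simp add: mult.commute)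
    also have "\<dots> = (\<integral>x. p E x * ?c x \<partial>M)"
      by (rule F.real_cond_exp_intg(2)[symmetric]) (use qint[OF EM int] in auto)
    also have "\<dots> = (\<integral>x. ?c x * p E x \<partial>M)" by (simp add: mult.commute)
    also have "\<dots> = (\<integral>x. ?c x * indicator E x \<partial>M)"
      unfolding p_def by (rule F.real_cond_exp_intg(2)) (use iint'[OF EM F.real_cond_exp_int(1)[OF int]] in auto)
    finally show "(LINT x:E|M. g (Y k x)) = (LINT x:E|M. ?c x)" by (simp add: set_lebesgue_integral_def mult.commute)
  next
    show "?c \<in> borel_measurable H"
      by (rule measurable_from_subalg[of H F]) (use F H FH in \<open>auto simp: subalgebra_def\<close>)
  qed (use int F.real_cond_exp_int(1)[OF int] in auto)
qed

section \<open>Positions and companion matrices\<close>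

lemma pos_strict_mono: "i < j \<Longrightarrow> pos i < pos (j :: 'p::{finite,linorder})"
proof -
  assume "i < j"
  then have "{k. k \<le> i} \<subseteq> {k. k \<le> j}" "j \<in> {k. k \<le> j}" "j \<notin> {k. k \<le> i}" by auto
  then have "{k. k \<le> i} \<subset> {k. k \<le> j}" by blast
  then show ?thesis unfolding pos_def by (intro psubset_card_mono) auto
qed

lemma inj_pos: "inj (pos :: 'p::{finite,linorder} \<Rightarrow> nat)"
proof (rule injI)
  fix x y :: 'p assume e: "pos x = pos y"
  show "x = y"
  proof (rule ccontr)
    assume "x \<noteq> y"
    then have "x < y \<or> y < x" by auto
    then show False using pos_strict_mono[of x y] pos_strict_mono[of y x] e by auto
  qed
qed

lemma pos_eq_iff [simp]: "pos i = pos j \<longleftrightarrow> i = (j :: 'p::{finite,linorder})"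
  using inj_pos by (auto simp: inj_def)

lemma pos_ge_1 [simp]: "Suc 0 \<le> pos (i :: 'p::{finite,linorder})"
proof -
  have "{i} \<subseteq> {j. j \<le> i}" by auto
  then have "card {i} \<le> card {j. j \<le> i}" by (intro card_mono) auto
  then show ?thesis by (simp add: pos_def)
qed

lemma pos_le_CARD [simp]: "pos (i :: 'p::{finite,linorder}) \<le> CARD('p)"
  unfolding pos_def by (intro card_mono) auto

lemma range_pos: "range (pos :: 'p::{finite,linorder} \<Rightarrow> nat) = {1..CARD('p)}"
proof (rule card_subset_eq)
  show "card (range (pos :: 'p \<Rightarrow> nat)) = card {1..CARD('p)}"
    by (simp add: card_image[OF inj_pos])
qed auto

lemma pos_obtain:
  assumes "1 \<le> m" "m \<le> CARD('p::{finite,linorder})"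
  obtains i :: "'p::{finite,linorder}" where "pos i = m"
  using assms range_pos[where 'p='p] by (metis atLeastAtMost_iff imageE)

lemma sum_pos: "(\<Sum>i\<in>UNIV. f (pos (i :: 'p::{finite,linorder}))) = (\<Sum>k = 1..CARD('p). f k)"
  by (subst range_pos[where 'p='p, symmetric], subst sum.reindex[OF inj_pos]) simp

lemma one_le_CARD: "1 \<le> CARD('p::finite)" by (simp add: Suc_leI)

lemma outer_nth [simp]: "outer u v $ i $ j = u $ i * v $ j" by (simp add: outer_def)

lemma companion_mult_nth:
  fixes v :: "real ^ 'p::{finite,linorder}"
  shows "pos i = 1 \<Longrightarrow> (companion c *v v) $ i = (\<Sum>j\<in>UNIV. c (pos j) * v $ j)"
    and "pos i = pos j + 1 \<Longrightarrow> (companion c *v v) $ i = v $ j"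
proof -
  show "pos i = 1 \<Longrightarrow> (companion c *v v) $ i = (\<Sum>j\<in>UNIV. c (pos j) * v $ j)"
    by (simp add: companion_def matrix_vector_mult_def)
  assume i: "pos i = pos j + 1"
  then have "pos i \<noteq> 1" using pos_ge_1[of j] by linarith
  moreover have "(pos i = pos j' + 1) = (j' = j)" for j' using i by auto
  ultimately show "(companion c *v v) $ i = v $ j"
    by (simp add: companion_def matrix_vector_mult_def if_distrib[where f="\<lambda>x. x * _"] cong: if_cong)
qed

lemma inner_transpose_left: "(transpose A *v u) \<bullet> x = u \<bullet> (A *v x)" for A :: "real ^ 'n ^ 'm"
  unfolding transpose_matrix_vector dot_lmul_matrix ..

section \<open>Arbitrary norms on R^n and the induced bounds on bilinear forms\<close>

locale vec_norm =
  fixes N :: "real ^ 'n \<Rightarrow> real"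
  assumes is_norm: "is_norm N"
begin

lemma N_nonneg: "0 \<le> N u" and N_zero: "N u = 0 \<longleftrightarrow> u = 0" and N_scale: "N (c *\<^sub>R u) = \<bar>c\<bar> * N u"
  and N_add: "N (u + v) \<le> N u + N v"
  using is_norm by (auto simp: is_norm_def)

lemma N_0 [simp]: "N 0 = 0" by (simp add: N_zero)

lemma N_minus: "N (u - v) = N (v - u)"
  using N_scale[of "- 1" "u - v"] by simp

lemma N_sum: "N (\<Sum>i\<in>A. f i) \<le> (\<Sum>i\<in>A. N (f i))"
proof (induction A rule: infinite_finite_induct)
  case (insert x F)
  then show ?case using N_add[of "f x" "sum f F"] by simp
qed (auto simp: N_zero)

lemma N_upper: obtains C where "0 < C" "\<And>u. N u \<le> C * norm u"
proof
  let ?C = "(\<Sum>i\<in>UNIV. N (axis i 1)) + 1"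
  have s: "0 \<le> (\<Sum>i\<in>UNIV. N (axis i 1))" by (intro sum_nonneg N_nonneg)
  then show "0 < ?C" by linarith
  fix u :: "real ^ 'n"
  have "u = (\<Sum>i\<in>UNIV. (u $ i) *\<^sub>R axis i 1)"
    by (simp add: vec_eq_iff axis_def if_distrib cong: if_cong)
  then have "N u \<le> (\<Sum>i\<in>UNIV. N ((u $ i) *\<^sub>R axis i 1))" using N_sum by metis
  also have "\<dots> \<le> (\<Sum>i\<in>UNIV. norm u * N (axis i 1))"
    unfolding N_scale by (intro sum_mono mult_right_mono N_nonneg component_le_norm_cart)
  also have "\<dots> \<le> ?C * norm u" by (simp add: sum_distrib_left algebra_simps)
  finally show "N u \<le> ?C * norm u" .
qed

lemma N_continuous: "continuous_on UNIV N"
proof -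
  obtain C where C: "0 < C" "\<And>u. N u \<le> C * norm u" using N_upper by blast
  have lip: "\<bar>N u - N v\<bar> \<le> C * norm (u - v)" for u v
    using N_add[of "u - v" v] N_add[of "v - u" u] N_minus[of u v] C(2)[of "u - v"] by (simp add: abs_le_iff)
  show ?thesis
  proof (rule continuous_onI)
    fix x e assume e: "(0::real) < e"
    show "\<exists>d>0. \<forall>x'\<in>UNIV. dist x' x < d \<longrightarrow> dist (N x') (N x) \<le> e"
    proof (intro exI[of _ "e / C"] conjI ballI impI)
      fix x' assume "dist x' x < e / C"
      then have "C * norm (x' - x) < e" using C by (simp add: dist_norm field_simps)
      then show "dist (N x') (N x) \<le> e" using lip[of x' x] by (simp add: dist_real_def)
    qed (use e C in simp)
  qed
qed

lemma N_lower: obtains c where "0 < c" "\<And>u. c * norm u \<le> N u"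
proof -
  have cont: "continuous_on (sphere 0 1) N" using N_continuous by (rule continuous_on_subset) simp
  have ne: "sphere (0 :: real ^ 'n) 1 \<noteq> {}" by simp
  obtain w where w: "w \<in> sphere 0 1" "\<And>u. u \<in> sphere 0 1 \<Longrightarrow> N w \<le> N u"
    using continuous_attains_inf[OF compact_sphere ne cont] by blast
  have w0: "0 < N w" using w(1) N_zero[of w] N_nonneg[of w] by force
  have "N w * norm u \<le> N u" for u
  proof (cases "u = 0")
    case False
    then have "N w \<le> N ((1 / norm u) *\<^sub>R u)" by (intro w(2)) simp
    then show ?thesis using False unfolding N_scale by (simp add: field_simps)
  qed (simp add: N_zero)
  with w0 that show thesis by blast
qed

lemma N_op_norm: "N (A *v u) \<le> op_norm N A * N u"
proof (cases "u = 0")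
  case False
  obtain C where C: "0 < C" "\<And>u. N u \<le> C * norm u" using N_upper by blast
  obtain c where c: "0 < c" "\<And>u. c * norm u \<le> N u" using N_lower by blast
  obtain B where B: "\<And>v. norm (A *v v) \<le> B * norm v" "0 < B"
    using bounded_linear.pos_bounded[OF matrix_vector_mul_bounded_linear[of A]] by (auto simp: mult.commute)
  \<comment> \<open>A real supremum is meaningful only for a bounded set; boundedness follows from
    the equivalence of \<open>N\<close> with the Euclidean norm.\<close>
  have bdd: "bdd_above ((\<lambda>u. N (A *v u)) ` {u. N u = 1})"
  proof (rule bdd_aboveI2)
    fix v assume "v \<in> {u. N u = 1}"
    then have v: "c * norm v \<le> 1" using c(2)[of v] by simp
    have "N (A *v v) \<le> C * (B * norm v)" using C(1) C(2)[of "A *v v"] mult_left_mono[OF B(1)[of v], of C] by linarith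
    also have "\<dots> = (C * B / c) * (c * norm v)" using c(1) by simp
    also have "\<dots> \<le> (C * B / c) * 1" using v C B c by (intro mult_left_mono) auto
    finally show "N (A *v v) \<le> C * B / c" by simp
  qed
  have Nu: "0 < N u" using False N_zero[of u] N_nonneg[of u] by linarith
  have "N (A *v ((1 / N u) *\<^sub>R u)) \<le> op_norm N A"
    unfolding op_norm_def using Nu by (intro cSUP_upper bdd) (simp add: N_scale)
  then show ?thesis using Nu unfolding matrix_vector_mult_scaleR N_scale by (simp add: field_simps)
qed (simp add: N_zero)

text \<open>The unit ball of the dual norm of \<open>N\<close>. A map W to A W A^t acts on test
  vectors through the transpose of \<open>A\<close>, and contraction for \<open>N\<close> becomes
  contraction for the dual norm.\<close>

definition dual_ball :: "(real ^ 'n) set" where "dual_ball = {u. \<forall>x. \<bar>u \<bullet> x\<bar> \<le> N x}"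

text \<open>The norm of \<open>W\<close> as a bilinear form on the dual space is at most
  \<open>c\<close>. In this norm, unlike the Euclidean one, conjugation by a contraction for
  \<open>N\<close> is itself a contraction.\<close>

definition bounded_form :: "real ^ 'n ^ 'n \<Rightarrow> real \<Rightarrow> bool" where
  "bounded_form W c \<longleftrightarrow> (\<forall>u\<in>dual_ball. \<forall>v\<in>dual_ball. \<bar>u \<bullet> (W *v v)\<bar> \<le> c)"

lemma bounded_form_add: "bounded_form W c \<Longrightarrow> bounded_form W' c' \<Longrightarrow> bounded_form (W + W') (c + c')"
  unfolding bounded_form_def
  by (fastforce simp: matrix_vector_mult_add_rdistrib inner_add_right intro: order_trans[OF abs_triangle_ineq add_mono])

lemma bounded_form_scaleR: "bounded_form W c \<Longrightarrow> bounded_form (r *\<^sub>R W) (\<bar>r\<bar> * c)"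
  unfolding bounded_form_def by (auto simp: scaleR_matrix_vector_assoc[symmetric] abs_mult intro!: mult_left_mono)

lemma bounded_form_norm: obtains K where "0 < K" "\<And>W. bounded_form W (K * norm W)"
proof -
  obtain C where C: "0 < C" "\<And>u. N u \<le> C * norm u" using N_upper by blast
  have db: "norm u \<le> C" if "u \<in> dual_ball" for u
  proof (cases "u = 0")
    case False
    have "norm u * norm u \<le> C * norm u"
      using that C(2)[of u] by (auto simp: dual_ball_def norm_eq_sqrt_inner dest!: spec[of _ u])
    then show ?thesis using False by simp
  qed (use C in simp)
  let ?n = "real CARD('n)"
  have "\<bar>u \<bullet> (W *v v)\<bar> \<le> ?n * ?n * C * C * norm W" if "u \<in> dual_ball" "v \<in> dual_ball" for u v W
  proof -
    have "\<bar>u \<bullet> (W *v v)\<bar> = \<bar>\<Sum>i\<in>UNIV. \<Sum>j\<in>UNIV. u $ i * (W $ i $ j * v $ j)\<bar>"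
      by (simp add: inner_vec_def matrix_vector_mult_def sum_distrib_left)
    also have "\<dots> \<le> (\<Sum>i\<in>UNIV. \<Sum>j\<in>UNIV. \<bar>u $ i * (W $ i $ j * v $ j)\<bar>)"
      by (intro order_trans[OF sum_abs] sum_mono) simp
    also have "\<dots> \<le> (\<Sum>i\<in>(UNIV::'n set). \<Sum>j\<in>(UNIV::'n set). C * (norm W * C))"
    proof (intro sum_mono)
      fix i j
      have "\<bar>W $ i $ j\<bar> \<le> norm W"
        using component_le_norm_cart[of "W $ i" j] order_trans[OF _ Finite_Cartesian_Product.norm_nth_le] by auto
      moreover have "\<bar>u $ i\<bar> \<le> C" "\<bar>v $ j\<bar> \<le> C"
        using component_le_norm_cart[of u i] component_le_norm_cart[of v j] db that by (auto intro: order_trans)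
      ultimately show "\<bar>u $ i * (W $ i $ j * v $ j)\<bar> \<le> C * (norm W * C)"
        unfolding abs_mult using C(1) by (intro mult_mono) auto
    qed
    finally show ?thesis by (simp add: mult_ac)
  qed
  then have "bounded_form W ((?n * ?n * C * C) * norm W)" for W unfolding bounded_form_def by auto
  moreover have "0 < ?n * ?n * C * C" using C by simp
  ultimately show thesis using that by blast
qed

text \<open>Small multiples of the coordinate vectors lie in the dual ball, so the entries of
  \<open>W\<close> are, up to a factor, values of the form. With \<open>bounded_form_norm\<close>
  this compares the form norm with the Euclidean one in both directions.\<close>

lemma bounded_form_entry: obtains K where "0 < K" "\<And>W c i j. bounded_form W c \<Longrightarrow> \<bar>W $ i $ j\<bar> \<le> K * c"
proof -
  obtain c0 where c0: "0 < c0" "\<And>u. c0 * norm u \<le> N u" using N_lower by blast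
  have ax: "c0 *\<^sub>R axis i 1 \<in> dual_ball" for i
  proof -
    have "\<bar>(c0 *\<^sub>R axis i 1) \<bullet> x\<bar> \<le> c0 * norm x" for x :: "real ^ 'n"
      using c0(1) component_le_norm_cart[of x i] by (simp add: inner_axis' abs_mult)
    then show ?thesis using c0(2) unfolding dual_ball_def by (auto intro: order_trans)
  qed
  have "\<bar>W $ i $ j\<bar> \<le> (1 / c0\<^sup>2) * c" if "bounded_form W c" for W c i j
  proof -
    have h1: "\<bar>(c0 *\<^sub>R axis i 1) \<bullet> (W *v (c0 *\<^sub>R axis j 1))\<bar> \<le> c"
      using that ax unfolding bounded_form_def by blast
    have h2: "(c0 *\<^sub>R axis i 1) \<bullet> (W *v (c0 *\<^sub>R axis j 1)) = c0\<^sup>2 * W $ i $ j"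
      by (simp add: matrix_vector_mult_scaleR inner_axis' power2_eq_square matrix_vector_mult_basis column_def)
    show ?thesis using h1 c0(1) unfolding h2 by (simp add: abs_mult field_simps)
  qed
  then show thesis using that[of "1 / c0\<^sup>2"] c0(1) by simp
qed

text \<open>By duality the transpose of \<open>A\<close> maps the dual ball into
  \<open>\<beta>\<close> times itself, and it is applied in both arguments of the form.\<close>

lemma bounded_form_conj:
  assumes \<beta>: "0 < \<beta>" "\<And>u. N (A *v u) \<le> \<beta> * N u" and W: "bounded_form W c"
  shows "bounded_form (A ** W ** transpose A) (\<beta>\<^sup>2 * c)"
  unfolding bounded_form_def
proof (intro ballI)
  fix u v assume uv: "u \<in> dual_ball" "v \<in> dual_ball"
  have tr: "(1 / \<beta>) *\<^sub>R (transpose A *v u) \<in> dual_ball" if "u \<in> dual_ball" for u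
    unfolding dual_ball_def
  proof (safe)
    fix x
    have "\<bar>(transpose A *v u) \<bullet> x\<bar> = \<bar>u \<bullet> (A *v x)\<bar>"
      unfolding inner_transpose_left ..
    also have "\<dots> \<le> \<beta> * N x" using that \<beta>(2)[of x] unfolding dual_ball_def by (auto intro: order_trans)
    finally show "\<bar>((1 / \<beta>) *\<^sub>R (transpose A *v u)) \<bullet> x\<bar> \<le> N x" using \<beta>(1) by (simp add: field_simps)
  qed
  have "u \<bullet> ((A ** W ** transpose A) *v v) = (transpose A *v u) \<bullet> (W *v (transpose A *v v))"
    unfolding inner_transpose_left by (simp only: matrix_vector_mul_assoc[symmetric])
  also have "\<dots> = \<beta>\<^sup>2 * (((1 / \<beta>) *\<^sub>R (transpose A *v u)) \<bullet> (W *v ((1 / \<beta>) *\<^sub>R (transpose A *v v))))"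
    using \<beta>(1) by (simp add: matrix_vector_mult_scaleR power2_eq_square)
  also have "\<bar>\<dots>\<bar> = \<beta>\<^sup>2 * \<bar>((1 / \<beta>) *\<^sub>R (transpose A *v u)) \<bullet> (W *v ((1 / \<beta>) *\<^sub>R (transpose A *v v)))\<bar>"
    by (simp add: abs_mult)
  also have "\<dots> \<le> \<beta>\<^sup>2 * c"
    using W tr[OF uv(1)] tr[OF uv(2)] unfolding bounded_form_def by (intro mult_left_mono) auto
  finally show "\<bar>u \<bullet> ((A ** W ** transpose A) *v v)\<bar> \<le> \<beta>\<^sup>2 * c" .
qed

end

text \<open>Every law of large numbers below is an instance: passing from one generation to the next
  is a contraction up to a vanishing error. The recursion need only hold from some \<open>m\<close>
  on, since the model starts at generation p - 1.\<close>

lemma contraction_tendsto_zero: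
  fixes u d :: "nat \<Rightarrow> real"
  assumes r: "0 \<le> r" "r < 1" and nn: "\<And>n. n \<ge> m \<Longrightarrow> 0 \<le> u n"
    and rec: "\<And>n. n \<ge> m \<Longrightarrow> u (Suc n) \<le> r * u n + d n" and d: "d \<longlonglongrightarrow> 0"
  shows "u \<longlonglongrightarrow> 0"
proof (rule LIMSEQ_I)
  fix e :: real assume e: "0 < e"
  \<comment> \<open>The map u to r u + f has fixed point e / 2, so errors below \<open>f\<close>
    keep the sequence within a geometric term of e / 2.\<close>
  define f where "f = e / 2 * (1 - r)"
  have f: "0 < f" using e r by (simp add: f_def)
  obtain n1 where n1: "\<And>n. n \<ge> n1 \<Longrightarrow> \<bar>d n\<bar> < f" using LIMSEQ_D[OF d f] by auto
  define n0 where "n0 = max n1 m"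
  have b: "u (n0 + k) \<le> r ^ k * u n0 + e / 2" for k
  proof (induction k)
    case 0 show ?case using e by simp
  next
    case (Suc k)
    have "u (n0 + Suc k) \<le> r * u (n0 + k) + f" 
    proof -
      have "u (Suc (n0 + k)) \<le> r * u (n0 + k) + d (n0 + k)" by (rule rec) (simp add: n0_def)
      moreover have "\<bar>d (n0 + k)\<bar> < f" by (rule n1) (simp add: n0_def)
      ultimately show ?thesis by simp
    qed
    also have "\<dots> \<le> r * (r ^ k * u n0 + e / 2) + f" using Suc r by (intro add_right_mono mult_left_mono) auto
    also have "\<dots> = r ^ Suc k * u n0 + e / 2" by (simp add: f_def field_simps)
    finally show ?case .
  qed
  have "(\<lambda>k. r ^ k * u n0) \<longlonglongrightarrow> 0 * u n0" using r by (intro tendsto_intros LIMSEQ_power_zero) auto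
  then obtain k0 where k0: "\<And>k. k \<ge> k0 \<Longrightarrow> \<bar>r ^ k * u n0\<bar> < e / 2"
    using LIMSEQ_D[of "\<lambda>k. r ^ k * u n0" 0 "e / 2"] e by auto
  have "norm (u n - 0) < e" if "n \<ge> n0 + k0" for n
  proof -
    define k where "k = n - n0"
    have k: "n = n0 + k" "k \<ge> k0" using that by (auto simp: k_def)
    have "0 \<le> u n" using nn[of n] k by (simp add: n0_def)
    then show ?thesis using b[of k] k0[OF k(2)] k(1) by simp
  qed
  then show "\<exists>n0. \<forall>n\<ge>n0. norm (u n - 0) < e" by blast
qed

section \<open>Sums over the tree\<close>

lemma finite_gen [simp]: "finite (gen n)" by (simp add: gen_def)
lemma card_gen [simp]: "card (gen n) = 2 ^ n" by (simp add: gen_def)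
lemma gen_subset: "gen n \<subseteq> {..<2 ^ Suc n}" by (auto simp: gen_def)

lemma tree_eq: "tree n = {1..<2 ^ (n + 1)}"
proof (induction n)
  case (Suc n)
  have "tree (Suc n) = tree n \<union> gen (Suc n)" by (auto simp: tree_def le_Suc_eq)
  also have "\<dots> = {1..<2 ^ (Suc n + 1)}"
  proof -
    have "(1::nat) \<le> 2 ^ (n + 1)" "(2::nat) ^ (n + 1) \<le> 2 ^ (Suc n + 1)" by auto
    then show ?thesis unfolding Suc gen_def by (auto simp: ivl_disj_un)
  qed
  finally show ?case .
qed (auto simp: tree_def gen_def)

lemma card_tree: "card (tree n) = 2 ^ (n + 1) - 1" by (simp add: tree_eq)

lemma tree_from_eq: "tree_from n q = {2 ^ q..<2 ^ (n + 1)}"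
proof -
  have "1 \<le> x" if "2 ^ q \<le> x" for x :: nat
    by (rule order_trans[OF _ that]) simp
  then show ?thesis unfolding tree_from_def tree_eq by auto
qed

lemma finite_tree_from [simp]: "finite (tree_from n q)" by (simp add: tree_from_eq)
lemma tree_from_subset: "tree_from n q \<subseteq> {..<2 ^ Suc n}" by (auto simp: tree_from_eq)

lemma sum_tree_from_Suc:
  assumes "q \<le> Suc n"
  shows "sum f (tree_from (Suc n) q) = sum f (tree_from n q) + sum f (gen (Suc n))"
proof -
  have "(2::nat) ^ q \<le> 2 ^ Suc n" using assms by (intro power_increasing) auto
  then have "tree_from (Suc n) q = tree_from n q \<union> gen (Suc n)" "tree_from n q \<inter> gen (Suc n) = {}"
    unfolding tree_from_eq gen_def by auto
  then show ?thesis by (simp add: sum.union_disjoint)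
qed

lemma sum_tree_from_gen:
  assumes "q \<le> Suc n" shows "sum f (tree_from n q) = (\<Sum>l = q..n. sum f (gen l))"
  using assms
proof (induction n)
  case 0
  show ?case
  proof (cases "q = 0")
    case True then show ?thesis by (simp add: tree_from_eq gen_def)
  next
    case False with 0 have "q = 1" by simp
    then show ?thesis by (simp add: tree_from_eq)
  qed
next
  case (Suc n)
  show ?case
  proof (cases "q \<le> Suc n")
    case True
    then show ?thesis using Suc.IH by (simp add: sum_tree_from_Suc)
  next
    case False
    with Suc.prems have "q = Suc (Suc n)" by simp
    then show ?thesis by (simp add: tree_from_eq)
  qed
qed

lemma generation_of_eq: "k \<in> gen n \<Longrightarrow> generation_of k = n"
  unfolding generation_of_def
proof (rule the_equality)
  fix m assume k: "k \<in> gen n" "k \<in> gen m"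
  have *: "\<not> a < b" if "k \<in> gen a" "k \<in> gen b" for a b
  proof
    assume "a < b"
    then have "(2::nat) ^ (a + 1) \<le> 2 ^ b" by (intro power_increasing) auto
    then show False using that by (auto simp: gen_def)
  qed
  show "m = n" using *[OF k(1) k(2)] *[OF k(2) k(1)] by linarith
qed

lemma gen_Suc_iff: "j \<in> gen (Suc n) \<longleftrightarrow> j div 2 \<in> gen n"
proof -
  have "(2 * m \<le> j \<and> j < 2 * (2 * m)) = (m \<le> j div 2 \<and> j div 2 < 2 * m)" for m :: nat by linarith
  from this[of "2 ^ n"] show ?thesis by (simp add: gen_def)
qed

lemma sum_gen_Suc: "sum f (gen (Suc n)) = (\<Sum>k\<in>gen n. f (2 * k) + f (2 * k + 1))"
proof -
  have "gen (Suc n) = (\<lambda>k. 2 * k) ` gen n \<union> (\<lambda>k. 2 * k + 1) ` gen n"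
  proof (intro set_eqI iffI)
    fix j assume j: "j \<in> gen (Suc n)"
    then have "j div 2 \<in> gen n" by (simp add: gen_Suc_iff)
    moreover have "j = 2 * (j div 2) \<or> j = 2 * (j div 2) + 1" by linarith
    ultimately show "j \<in> (\<lambda>k. 2 * k) ` gen n \<union> (\<lambda>k. 2 * k + 1) ` gen n" by blast
  qed (auto simp: gen_Suc_iff)
  moreover have "(\<lambda>k. 2 * k) ` gen n \<inter> (\<lambda>k. 2 * k + 1) ` gen n = {}" by (auto; presburger)
  ultimately have "sum f (gen (Suc n)) = sum f ((\<lambda>k. 2 * k) ` gen n) + sum f ((\<lambda>k. 2 * k + 1) ` gen n)"
    by (simp add: sum.union_disjoint)
  also have "\<dots> = (\<Sum>k\<in>gen n. f (2 * k)) + (\<Sum>k\<in>gen n. f (2 * k + 1))"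
    by (simp add: sum.reindex inj_on_def)
  finally show ?thesis by (simp add: sum.distrib)
qed

section \<open>Averages over a generation\<close>

definition gen_mean :: "(nat \<Rightarrow> 'a::real_vector) \<Rightarrow> nat \<Rightarrow> 'a" where
  "gen_mean f n = (1 / 2 ^ n) *\<^sub>R (\<Sum>k\<in>gen n. f k)"

lemma gen_mean_Suc: "gen_mean f (Suc n) = (1 / 2) *\<^sub>R (gen_mean (\<lambda>k. f (2 * k)) n + gen_mean (\<lambda>k. f (2 * k + 1)) n)"
  unfolding gen_mean_def sum_gen_Suc sum.distrib scaleR_add_right[symmetric] by simp

lemma gen_mean_add: "gen_mean (\<lambda>k. f k + g k) n = gen_mean f n + gen_mean g n"
  by (simp add: gen_mean_def sum.distrib scaleR_add_right)

lemma gen_mean_scaleR: "gen_mean (\<lambda>k. c *\<^sub>R f k) n = c *\<^sub>R gen_mean f n"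
  unfolding gen_mean_def scaleR_sum_right[symmetric] by (rule scaleR_left_commute)

lemma gen_mean_mult: "gen_mean (\<lambda>k. c * f k) n = c * gen_mean f n" for c :: real
  by (simp add: gen_mean_def sum_distrib_left)

lemma gen_mean_const: "gen_mean (\<lambda>k. c) n = c"
  by (simp add: gen_mean_def sum_constant_scaleR)

lemma gen_mean_linear: "linear h \<Longrightarrow> gen_mean (\<lambda>k. h (f k)) n = h (gen_mean f n)"
  by (simp add: gen_mean_def linear_sum linear_cmul)

lemma gen_mean_nth: "gen_mean f n $ i = gen_mean (\<lambda>k. f k $ i) n"
  by (simp add: gen_mean_def)

lemma gen_mean_cong: "(\<And>k. k \<in> gen n \<Longrightarrow> f k = g k) \<Longrightarrow> gen_mean f n = gen_mean g n"
  by (simp add: gen_mean_def)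

text \<open>The last generation makes up half of the tree, so the tree average is halfway between
  the previous tree average and the new generation average: a contraction by 1/2. Dividing by
  2^(n+1) instead of the number of vertices makes this recursion exact, and the starting generation
  is forgotten.\<close>

lemma tendsto_tree_mean:
  fixes f :: "nat \<Rightarrow> real"
  assumes "gen_mean f \<longlonglongrightarrow> r"
  shows "(\<lambda>n. (\<Sum>k\<in>tree_from n q. f k) / 2 ^ (n + 1)) \<longlonglongrightarrow> r"
proof -
  define u where "u = (\<lambda>n. \<bar>(\<Sum>k\<in>tree_from n q. f k) / 2 ^ (n + 1) - r\<bar>)"
  have "u \<longlonglongrightarrow> 0"
  proof (rule contraction_tendsto_zero[where r = "1/2" and m = q and d = "\<lambda>n. 1 / 2 * \<bar>gen_mean f (Suc n) - r\<bar>"])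
    have "(\<lambda>n. gen_mean f (Suc n) - r) \<longlonglongrightarrow> r - r"
      by (rule tendsto_diff[OF LIMSEQ_Suc[OF assms] tendsto_const])
    then have "(\<lambda>n. 1 / 2 * \<bar>gen_mean f (Suc n) - r\<bar>) \<longlonglongrightarrow> 1 / 2 * \<bar>r - r\<bar>"
      by (intro tendsto_mult tendsto_rabs tendsto_const)
    then show "(\<lambda>n. 1 / 2 * \<bar>gen_mean f (Suc n) - r\<bar>) \<longlonglongrightarrow> 0" by simp
    fix n assume "n \<ge> q"
    then have eq: "(\<Sum>k\<in>tree_from (Suc n) q. f k) / 2 ^ (Suc n + 1) - r
       = 1 / 2 * ((\<Sum>k\<in>tree_from n q. f k) / 2 ^ (n + 1) - r) + 1 / 2 * (gen_mean f (Suc n) - r)"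
      by (simp add: sum_tree_from_Suc gen_mean_def field_simps)
    show "u (Suc n) \<le> 1 / 2 * u n + 1 / 2 * \<bar>gen_mean f (Suc n) - r\<bar>"
      unfolding u_def eq by (rule order_trans[OF abs_triangle_ineq]) (simp add: abs_mult)
  qed (auto simp: u_def)
  then show ?thesis unfolding u_def by (simp add: tendsto_rabs_zero_iff LIM_zero_iff)
qed

lemma tendsto_outer:
  fixes f :: "'a \<Rightarrow> real ^ 'm" and g :: "'a \<Rightarrow> real ^ 'n"
  assumes "(f \<longlongrightarrow> x) F" "(g \<longlongrightarrow> y) F" shows "((\<lambda>n. outer (f n) (g n)) \<longlongrightarrow> outer x y) F"
  by (intro vec_tendstoI) (simp, intro tendsto_intros assms)

lemma tendsto_matrix_vector:
  fixes A :: "real ^ 'n ^ 'm"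
  assumes "(f \<longlongrightarrow> x) F" shows "((\<lambda>n. A *v f n) \<longlongrightarrow> A *v x) F"
  by (rule bounded_linear.tendsto[OF matrix_vector_mul_bounded_linear assms])

lemma outer_conj: "A ** outer u v ** transpose B = outer (A *v u) (B *v v)"
  for A :: "real ^ 'n ^ 'm"
proof -
  have "(\<Sum>l\<in>UNIV. (\<Sum>k\<in>UNIV. A $ i $ k * (u $ k * v $ l)) * B $ j $ l)
      = (\<Sum>k\<in>UNIV. A $ i $ k * u $ k) * (\<Sum>l\<in>UNIV. B $ j $ l * v $ l)" for i j
  proof -
    have "(\<Sum>k\<in>UNIV. A $ i $ k * (u $ k * v $ l)) * B $ j $ l = (\<Sum>k\<in>UNIV. A $ i $ k * u $ k) * (B $ j $ l * v $ l)" for l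
      unfolding sum_distrib_right by (intro sum.cong refl) (simp only: mult_ac)
    then show ?thesis unfolding sum_distrib_left[of "\<Sum>k\<in>UNIV. A $ i $ k * u $ k"] by (intro sum.cong refl)
  qed
  then show ?thesis
    by (simp add: vec_eq_iff matrix_matrix_mult_def matrix_vector_mult_def transpose_def)
qed

lemma linear_matrix_conj: "linear (\<lambda>W :: real ^ 'n ^ 'n. A ** W ** transpose A)"
  by (rule linearI)
     (simp_all add: vec_eq_iff matrix_matrix_mult_def distrib_left distrib_right sum.distrib sum_distrib_left mult_ac)

lemma outer_add_scaled:
  "outer (u + c *\<^sub>R w) (u + c *\<^sub>R w) = outer u u + c *\<^sub>R (outer u w + outer w u) + c\<^sup>2 *\<^sub>R outer w w"
  by (simp add: vec_eq_iff algebra_simps power2_eq_square)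

lemma linear_outer_left: "linear (\<lambda>u. outer u w)" and linear_outer_right: "linear (\<lambda>u. outer w u)"
  by (auto intro!: linearI simp: vec_eq_iff algebra_simps)

lemma matrix_inv_mult:
  fixes M :: "real ^ 'n ^ 'n"
  assumes "invertible M" shows "M ** matrix_inv M = mat 1" "matrix_inv M ** M = mat 1"
  using someI_ex[OF assms[unfolded invertible_def]] unfolding matrix_inv_def by auto

section \<open>The fixed point equations for the limiting moments\<close>

locale bar_coef = vec_norm N for N :: "real ^ 'p::{finite,linorder} \<Rightarrow> real" +
  fixes a b :: "nat \<Rightarrow> real" and s2 :: real
  assumes stable: "max (op_norm N (companion a)) (op_norm N (companion b)) < 1"
begin

abbreviation A :: "((real, 'p) vec, 'p) vec" where "A \<equiv> companion a"
abbreviation B :: "((real, 'p) vec, 'p) vec" where "B \<equiv> companion b"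
abbreviation lam :: "(real, 'p) vec" where "lam \<equiv> lambda_vec a b"
abbreviation ell :: "((real, 'p) vec, 'p) vec" where "ell \<equiv> ell_mat a b s2"
abbreviation L :: "real ^ ('p option) ^ ('p option)" where "L \<equiv> L_mat a b s2"

text \<open>The floor 1/2 keeps \<open>\<beta>\<close> positive, as the rescaling by 1 / beta in
  \<open>bounded_form_conj\<close> requires; both operator norms vanish when p = 1 and a_1 = b_1 =
  0.\<close>

definition \<beta> :: real where "\<beta> = max (1 / 2) (max (op_norm N A) (op_norm N B))"

lemma \<beta>_bounds: "0 < \<beta>" "\<beta> < 1"
  using stable by (auto simp: \<beta>_def less_max_iff_disj)

lemma N_A: "N (A *v u) \<le> \<beta> * N u" and N_B: "N (B *v u) \<le> \<beta> * N u"
  by (auto simp: \<beta>_def intro!: order_trans[OF N_op_norm] mult_right_mono N_nonneg)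

definition \<Phi> :: "((real, 'p) vec, 'p) vec \<Rightarrow> ((real, 'p) vec, 'p) vec" where
  "\<Phi> W = (1 / 2) *\<^sub>R (A ** W ** transpose A + B ** W ** transpose B)"

lemma linear_\<Phi>: "linear \<Phi>"
proof (rule linearI)
  note l = linear_matrix_conj[of A] linear_matrix_conj[of B]
  show "\<Phi> (W + W') = \<Phi> W + \<Phi> W'" for W W'
    unfolding \<Phi>_def using linear_add[OF l(1), of W W'] linear_add[OF l(2), of W W'] by (simp add: scaleR_add_right)
  show "\<Phi> (c *\<^sub>R W) = c *\<^sub>R \<Phi> W" for c W
    unfolding \<Phi>_def using linear_cmul[OF l(1), of c W] linear_cmul[OF l(2), of c W] by (simp add: scaleR_add_right)
qed

lemma bounded_form_\<Phi>: assumes "bounded_form W c" shows "bounded_form (\<Phi> W) (\<beta>\<^sup>2 * c)"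
proof -
  have "bounded_form (A ** W ** transpose A + B ** W ** transpose B) (\<beta>\<^sup>2 * c + \<beta>\<^sup>2 * c)"
    by (intro bounded_form_add bounded_form_conj assms \<beta>_bounds N_A N_B)
  from bounded_form_scaleR[OF this, of "1 / 2"] show ?thesis by (simp add: \<Phi>_def mult.commute)
qed

text \<open>The inverse in \<open>lambda_vec\<close> is genuine: the average of two contractions for
  \<open>N\<close> is a contraction, so it has no fixed vector except 0.\<close>

lemma lambda_fix: "lam = (1 / 2) *\<^sub>R (A *v lam + B *v lam) + ((a 0 + b 0) / 2) *\<^sub>R e1"
proof -
  let ?M = "mat 1 - (1 / 2) *\<^sub>R (A + B)"
  have mult: "?M *v v = v - (1 / 2) *\<^sub>R (A *v v + B *v v)" for v
    by (simp add: matrix_vector_mult_diff_rdistrib matrix_vector_mult_add_rdistrib scaleR_matrix_vector_assoc[symmetric])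
  have "v = 0" if "?M *v v = 0" for v
  proof -
    have v: "v = (1 / 2) *\<^sub>R (A *v v + B *v v)" using that by (simp add: mult)
    have "N v = (1 / 2) * N (A *v v + B *v v)" by (subst v, subst N_scale) simp
    also have "\<dots> \<le> (1 / 2) * (\<beta> * N v + \<beta> * N v)"
      by (intro mult_left_mono order_trans[OF N_add] add_mono N_A N_B) auto
    finally have "(1 - \<beta>) * N v \<le> 0" by (simp add: algebra_simps)
    then have "N v \<le> 0" using \<beta>_bounds by (simp add: mult_le_0_iff)
    then show ?thesis using N_nonneg[of v] N_zero[of v] by linarith
  qed
  then have "invertible ?M" by (simp add: invertible_left_inverse matrix_left_invertible_ker)
  then have "?M ** matrix_inv ?M = mat 1" by (rule matrix_inv_mult)
  then have "?M *v lam = ((a 0 + b 0) / 2) *\<^sub>R e1"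
    unfolding lambda_vec_def by (simp add: matrix_vector_mult_scaleR matrix_vector_mul_assoc)
  then show ?thesis unfolding mult by (simp add: algebra_simps)
qed

text \<open>\<open>ell_mat\<close> is a definite description, so existence and uniqueness are due.
  Contraction of \<open>\<Phi>\<close> makes identity minus \<open>\<Phi>\<close> injective, and in
  finite dimension injective linear maps are onto.\<close>

lemma ell_fix: "ell = T_mat a b s2 + \<Phi> ell"
proof -
  have lin: "linear (\<lambda>W. W - \<Phi> W)" by (intro linear_compose_sub linear_\<Phi> linear_id[unfolded id_def])
  have zero: "W = 0" if W: "W = \<Phi> W" for W
  proof -
    obtain K where K: "0 < K" "\<And>W. bounded_form W (K * norm W)" using bounded_form_norm by blast
    obtain K' where K': "0 < K'" "\<And>W c i j. bounded_form W c \<Longrightarrow> \<bar>W $ i $ j\<bar> \<le> K' * c" using bounded_form_entry by blast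
    \<comment> \<open>A fixed matrix may be replaced by its image any number of times, and each time
      the bound shrinks by the square of \<open>\<beta>\<close>.\<close>
    have bf: "bounded_form W ((\<beta>\<^sup>2) ^ n * (K * norm W))" for n
    proof (induction n)
      case (Suc n)
      from bounded_form_\<Phi>[OF Suc] show ?case using W by (simp add: mult.assoc)
    qed (simp add: K)
    have "\<beta>\<^sup>2 < 1" using \<beta>_bounds by (simp add: power_less_one_iff)
    then have "(\<lambda>n. K' * ((\<beta>\<^sup>2) ^ n * (K * norm W))) \<longlonglongrightarrow> K' * (0 * (K * norm W))"
      by (intro tendsto_intros LIMSEQ_power_zero) simp
    then have "\<bar>W $ i $ j\<bar> \<le> 0" for i j
      using K'(2)[OF bf] by (intro LIMSEQ_le_const[of _ 0]) auto
    then show ?thesis by (simp add: vec_eq_iff)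
  qed
  have inj: "inj (\<lambda>W. W - \<Phi> W)"
    unfolding linear_injective_0[OF lin] using zero by simp
  then have "surj (\<lambda>W. W - \<Phi> W)" by (rule linear_inj_imp_surj[OF lin])
  then obtain W0 where W0: "T_mat a b s2 = W0 - \<Phi> W0" by (metis surjD)
  have "\<exists>!W. W = T_mat a b s2 + \<Phi> W"
  proof (rule ex1I[of _ W0])
    show "W0 = T_mat a b s2 + \<Phi> W0" using W0 by simp
    fix W assume "W = T_mat a b s2 + \<Phi> W"
    then have "W - \<Phi> W = W0 - \<Phi> W0" using W0 by (simp add: algebra_simps)
    then show "W = W0" using inj by (auto dest: injD)
  qed
  from theI'[OF this] show ?thesis unfolding ell_mat_def \<Phi>_def .
qed

end

section \<open>Laws of large numbers along one trajectory\<close>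

text \<open>One trajectory \<open>x\<close> with its noise \<open>e\<close>. No measure occurs here
  or in the locales built on it; the probabilistic input enters through limits that hold for almost
  every outcome.\<close>

locale bar_path = bar_coef N a b s2
  for N :: "real ^ 'p::{finite,linorder} \<Rightarrow> real" and a b :: "nat \<Rightarrow> real" and s2 :: real +
  fixes x e :: "nat \<Rightarrow> real"
  assumes even: "\<And>n. n \<ge> 2 ^ (CARD('p) - 1) \<Longrightarrow>
      x (2 * n) = a 0 + (\<Sum>k = 1..CARD('p). a k * x (n div 2 ^ (k - 1))) + e (2 * n)"
    and odd: "\<And>n. n \<ge> 2 ^ (CARD('p) - 1) \<Longrightarrow>
      x (2 * n + 1) = b 0 + (\<Sum>k = 1..CARD('p). b k * x (n div 2 ^ (k - 1))) + e (2 * n + 1)"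
begin

abbreviation XX :: "nat \<Rightarrow> (real, 'p) vec" where "XX \<equiv> state_vec x"
abbreviation YY :: "nat \<Rightarrow> real ^ ('p option)" where "YY \<equiv> Yvec x"

lemma state_children:
  assumes m: "m \<in> {2 * n, 2 * n + 1}"
    and x: "x m = c 0 + (\<Sum>k = 1..CARD('p). c k * x (n div 2 ^ (k - 1))) + e m"
  shows "XX m = companion c *v XX n + (c 0 + e m) *\<^sub>R e1"
proof (subst vec_eq_iff, rule allI)
  fix i :: 'p
  show "XX m $ i = (companion c *v XX n + (c 0 + e m) *\<^sub>R e1) $ i"
  proof (cases "pos i = 1")
    case True
    have "(\<Sum>k = 1..CARD('p). c k * x (n div 2 ^ (k - 1))) = (\<Sum>j\<in>UNIV. c (pos (j::'p)) * XX n $ j)"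
      by (subst sum_pos[symmetric]) (simp add: state_vec_def)
    then show ?thesis using True x by (simp add: companion_mult_nth(1) e1_def state_vec_def)
  next
    case False
    have h: "1 \<le> pos i - 1" "pos i - 1 \<le> CARD('p)"
      using False pos_ge_1[of i] pos_le_CARD[of i] by linarith+
    obtain j :: 'p where j: "pos j = pos i - 1" using h by (rule pos_obtain)
    then have ij: "pos i = pos j + 1" using h by linarith
    have "m div 2 ^ (pos i - 1) = m div 2 div 2 ^ (pos j - 1)"
      using pos_ge_1[of j] unfolding ij by (cases "pos j") (auto simp: div_mult2_eq)
    moreover have "m div 2 = n" using m by auto
    ultimately show ?thesis using False unfolding plus_vec_def by (simp add: companion_mult_nth(2)[OF ij] e1_def state_vec_def)
  qed
qed

lemma state_even: "n \<ge> 2 ^ (CARD('p) - 1) \<Longrightarrow> XX (2 * n) = A *v XX n + (a 0 + e (2 * n)) *\<^sub>R e1"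
  and state_odd: "n \<ge> 2 ^ (CARD('p) - 1) \<Longrightarrow> XX (2 * n + 1) = B *v XX n + (b 0 + e (2 * n + 1)) *\<^sub>R e1"
  using state_children[of _ n] even[of n] odd[of n] by auto

lemma gen_ge: "k \<in> gen l \<Longrightarrow> l \<ge> (CARD('p) - 1) \<Longrightarrow> 2 ^ (CARD('p) - 1) \<le> k"
  unfolding gen_def by (auto intro: order_trans[OF power_increasing])

text \<open>One generation of the recursion for an arbitrary observable \<open>h\<close>. Writing
  \<open>2 * k + 0\<close> keeps both daughters instances of \<open>2 * k + c\<close>, the form in
  which the noise limits are stated.\<close>

lemma gen_mean_XX_Suc:
  assumes l: "l \<ge> CARD('p) - 1"
  shows "gen_mean (\<lambda>k. h (XX k)) (Suc l) = (1 / 2) *\<^sub>R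
    (gen_mean (\<lambda>k. h (A *v XX k + (a 0 + e (2 * k + 0)) *\<^sub>R e1)) l
     + gen_mean (\<lambda>k. h (B *v XX k + (b 0 + e (2 * k + 1)) *\<^sub>R e1)) l)"
proof -
  have "gen_mean (\<lambda>k. h (XX (2 * k))) l = gen_mean (\<lambda>k. h (A *v XX k + (a 0 + e (2 * k + 0)) *\<^sub>R e1)) l"
    by (rule gen_mean_cong) (simp add: state_even[OF gen_ge[OF _ l]])
  moreover have "gen_mean (\<lambda>k. h (XX (2 * k + 1))) l = gen_mean (\<lambda>k. h (B *v XX k + (b 0 + e (2 * k + 1)) *\<^sub>R e1)) l"
    by (rule gen_mean_cong) (simp only: state_odd[OF gen_ge[OF _ l]])
  ultimately show ?thesis unfolding gen_mean_Suc by simp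
qed

end

text \<open>Vanishing averages of noise times regressor and of centred squared noise are all that
  the limits of the first two moments need. The intercept coordinate of \<open>noise1\<close> is the
  law of large numbers for the noise itself.\<close>

locale bar_path_lln = bar_path N a b s2 x e
  for N :: "real ^ 'p::{finite,linorder} \<Rightarrow> real" and a b :: "nat \<Rightarrow> real" and s2 :: real and x e :: "nat \<Rightarrow> real" +
  assumes noise1: "\<And>c. c \<in> {0, 1} \<Longrightarrow> gen_mean (\<lambda>k. e (2 * k + c) *\<^sub>R (Yvec x k :: real ^ ('p option))) \<longlonglongrightarrow> 0"
    and noise2: "\<And>c. c \<in> {0, 1} \<Longrightarrow> gen_mean (\<lambda>k. (e (2 * k + c))\<^sup>2 - s2) \<longlonglongrightarrow> 0"
begin

lemma noise_mean: assumes "c \<in> {0, 1}" shows "gen_mean (\<lambda>k. e (2 * k + c)) \<longlonglongrightarrow> 0"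
proof -
  show ?thesis
    using tendsto_vec_nth[OF noise1[OF assms], of None] by (simp add: gen_mean_nth Yvec_def)
qed

lemma noise_state: assumes "c \<in> {0, 1}" shows "gen_mean (\<lambda>k. e (2 * k + c) *\<^sub>R XX k) \<longlonglongrightarrow> 0"
proof (rule vec_tendstoI)
  fix i
  show "(\<lambda>l. gen_mean (\<lambda>k. e (2 * k + c) *\<^sub>R XX k) l $ i) \<longlonglongrightarrow> 0 $ i"
    using tendsto_vec_nth[OF noise1[OF assms], of "Some i"] by (simp add: gen_mean_nth Yvec_def)
qed

text \<open>By \<open>lambda_fix\<close>, the deviation of the generation mean from
  \<open>lam\<close> is multiplied by the average of \<open>A\<close> and \<open>B\<close> at each
  step, up to the mean noise of the generation; in the norm \<open>N\<close> this is a
  contraction.\<close>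

lemma state_mean: "gen_mean XX \<longlonglongrightarrow> lam"
proof -
  define d where "d = (\<lambda>l. gen_mean XX l - lam)"
  define \<eta> where "\<eta> = (\<lambda>l. gen_mean (\<lambda>k. e (2 * k + 0)) l + gen_mean (\<lambda>k. e (2 * k + 1)) l)"
  have \<eta>: "(\<lambda>l. N e1 * \<bar>\<eta> l / 2\<bar>) \<longlonglongrightarrow> 0"
    using tendsto_mult_right_zero[OF tendsto_rabs_zero[OF tendsto_divide_zero[OF tendsto_add_zero[OF noise_mean[of 0] noise_mean[of 1]]]], of "N e1" 2]
    by (simp add: \<eta>_def)
  have rec: "d (Suc l) = (1 / 2) *\<^sub>R (A *v d l + B *v d l) + (\<eta> l / 2) *\<^sub>R e1" if l: "l \<ge> (CARD('p) - 1)" for l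
  proof -
    have g: "gen_mean (\<lambda>k. C *v XX k + (c0 + f k) *\<^sub>R e1) l = C *v gen_mean XX l + (c0 + gen_mean f l) *\<^sub>R e1"
      for C :: "((real, 'p) vec, 'p) vec" and c0 f
    proof -
      have "linear (\<lambda>c. c *\<^sub>R (e1 :: (real, 'p) vec))" by (rule bounded_linear.linear[OF bounded_linear_scaleR_left])
      then show ?thesis
        using gen_mean_linear[OF matrix_vector_mul_linear, of C XX l] gen_mean_linear[of "\<lambda>c. c *\<^sub>R e1" "\<lambda>k. c0 + f k" l]
        by (simp add: gen_mean_add gen_mean_const)
    qed
    have "gen_mean XX (Suc l) = (1 / 2) *\<^sub>R (gen_mean (\<lambda>k. A *v XX k + (a 0 + e (2 * k + 0)) *\<^sub>R e1) l
        + gen_mean (\<lambda>k. B *v XX k + (b 0 + e (2 * k + 1)) *\<^sub>R e1) l)"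
      by (rule gen_mean_XX_Suc[OF l, where h = "\<lambda>v. v"])
    also have "\<dots> = (1 / 2) *\<^sub>R (A *v gen_mean XX l + B *v gen_mean XX l) + ((a 0 + b 0) / 2) *\<^sub>R e1 + (\<eta> l / 2) *\<^sub>R e1"
      unfolding g \<eta>_def by (simp add: scaleR_add_right scaleR_add_left add_divide_distrib)
    finally have "d (Suc l) = (1 / 2) *\<^sub>R (A *v gen_mean XX l + B *v gen_mean XX l) + ((a 0 + b 0) / 2) *\<^sub>R e1 + (\<eta> l / 2) *\<^sub>R e1
        - ((1 / 2) *\<^sub>R (A *v lam + B *v lam) + ((a 0 + b 0) / 2) *\<^sub>R e1)"
      unfolding d_def using lambda_fix by simp
    then show ?thesis unfolding d_def
      by (simp add: matrix_vector_mult_diff_distrib scaleR_add_right scaleR_diff_right)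
  qed
  have "(\<lambda>l. N (d l)) \<longlonglongrightarrow> 0"
  proof (rule contraction_tendsto_zero[OF _ \<beta>_bounds(2) N_nonneg _ \<eta>, where m = "CARD('p) - 1"])
    show "0 \<le> \<beta>" using \<beta>_bounds by simp
    fix l assume l: "l \<ge> (CARD('p) - 1)"
    have "N (d (Suc l)) \<le> N ((1 / 2) *\<^sub>R (A *v d l + B *v d l)) + N ((\<eta> l / 2) *\<^sub>R e1)"
      unfolding rec[OF l] by (rule N_add)
    also have "\<dots> \<le> \<beta> * N (d l) + N e1 * \<bar>\<eta> l / 2\<bar>"
      unfolding N_scale using N_add[of "A *v d l" "B *v d l"] N_A[of "d l"] N_B[of "d l"] by (simp add: mult.commute[of "N e1"])
    finally show "N (d (Suc l)) \<le> \<beta> * N (d l) + N e1 * \<bar>\<eta> l / 2\<bar>" .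
  qed
  moreover obtain c where c: "0 < c" "\<And>u. c * norm u \<le> N u" using N_lower by blast
  ultimately have "(\<lambda>l. N (d l) / c) \<longlonglongrightarrow> 0" by (intro tendsto_divide_zero)
  then have "d \<longlonglongrightarrow> 0"
    by (rule tendsto_0_le[where K = 1]) (use c in \<open>auto simp: field_simps intro!: always_eventually order_trans[OF _ abs_ge_self]\<close>)
  then show ?thesis unfolding d_def by (rule LIM_zero_cancel)
qed

text \<open>The same scheme one order higher: expanding the outer square of a daughter's state gives
  \<open>\<Phi>\<close> of the previous second moment, plus terms that involve only first moments
  and noise averages and tend to \<open>T_mat\<close>.\<close>

lemma outer_mean: "gen_mean (\<lambda>k. outer (XX k) (XX k)) \<longlonglongrightarrow> ell"
proof -
  define Q where "Q = gen_mean (\<lambda>k. outer (XX k) (XX k))"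
  define g where "g = (\<lambda>c0 c l. c0 *\<^sub>R gen_mean XX l + gen_mean (\<lambda>k. e (2 * k + c) *\<^sub>R XX k) l)"
  define \<kappa> where "\<kappa> = (\<lambda>c0 c l. c0\<^sup>2 + s2 + 2 * c0 * gen_mean (\<lambda>k. e (2 * k + c)) l + gen_mean (\<lambda>k. (e (2 * k + c))\<^sup>2 - s2) l)"
  \<comment> \<open>What one daughter contributes besides the conjugated second moment: the cross
    terms and the squared input. Its average \<open>F\<close> over the two daughters tends to
    \<open>T_mat\<close>.\<close>
  define G where "G = (\<lambda>(C :: ((real, 'p) vec, 'p) vec) c0 c l. outer (C *v g c0 c l) e1 + outer e1 (C *v g c0 c l) + \<kappa> c0 c l *\<^sub>R outer e1 (e1 :: (real, 'p) vec))"
  define F where "F = (\<lambda>l. (1 / 2) *\<^sub>R (G A (a 0) 0 l + G B (b 0) 1 l))"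
  have glim: "g c0 c \<longlonglongrightarrow> c0 *\<^sub>R lam" if "c \<in> {0, 1}" for c0 c
  proof -
    have "g c0 c \<longlonglongrightarrow> c0 *\<^sub>R lam + 0" unfolding g_def by (intro tendsto_intros state_mean noise_state that)
    then show ?thesis by simp
  qed
  have \<kappa>lim: "\<kappa> c0 c \<longlonglongrightarrow> c0\<^sup>2 + s2" if "c \<in> {0, 1}" for c0 c
  proof -
    have "\<kappa> c0 c \<longlonglongrightarrow> c0\<^sup>2 + s2 + 2 * c0 * 0 + 0" unfolding \<kappa>_def by (intro tendsto_intros noise_mean noise2 that)
    then show ?thesis by simp
  qed
  have Glim: "G C c0 c \<longlonglongrightarrow> outer (C *v (c0 *\<^sub>R lam)) e1 + outer e1 (C *v (c0 *\<^sub>R lam)) + (c0\<^sup>2 + s2) *\<^sub>R outer e1 e1"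
    if "c \<in> {0, 1}" for C c0 c
    unfolding G_def by (intro tendsto_intros tendsto_outer tendsto_matrix_vector glim \<kappa>lim that)
  let ?T = "(1 / 2) *\<^sub>R ((outer (A *v (a 0 *\<^sub>R lam)) e1 + outer e1 (A *v (a 0 *\<^sub>R lam)) + ((a 0)\<^sup>2 + s2) *\<^sub>R outer e1 e1)
     + (outer (B *v (b 0 *\<^sub>R lam)) e1 + outer e1 (B *v (b 0 *\<^sub>R lam)) + ((b 0)\<^sup>2 + s2) *\<^sub>R outer e1 e1))"
  have T: "?T = T_mat a b s2"
    unfolding T_mat_def Let_def by (simp add: vec_eq_iff matrix_vector_mult_scaleR field_simps)
  have "F \<longlonglongrightarrow> ?T"
    unfolding F_def by (intro tendsto_intros Glim) auto
  then have FT: "(\<lambda>l. F l - T_mat a b s2) \<longlonglongrightarrow> 0" unfolding T by (simp add: LIM_zero_iff)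
  have child: "gen_mean (\<lambda>k. outer (C *v XX k + (c0 + e (2 * k + c)) *\<^sub>R e1) (C *v XX k + (c0 + e (2 * k + c)) *\<^sub>R e1)) l
      = C ** Q l ** transpose C + G C c0 c l" for C :: "((real, 'p) vec, 'p) vec" and c0 c l
  proof -
    have 1: "outer (C *v XX k + h *\<^sub>R e1) (C *v XX k + h *\<^sub>R e1)
        = C ** outer (XX k) (XX k) ** transpose C + (outer (C *v (h *\<^sub>R XX k)) e1 + outer e1 (C *v (h *\<^sub>R XX k))) + h\<^sup>2 *\<^sub>R outer e1 e1" for k h
      unfolding outer_add_scaled outer_conj matrix_vector_mult_scaleR by (simp add: vec_eq_iff algebra_simps)
    have 2: "gen_mean (\<lambda>k. C ** outer (XX k) (XX k) ** transpose C) l = C ** Q l ** transpose C"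
      unfolding Q_def by (rule gen_mean_linear[OF linear_matrix_conj])
    have l3: "linear (\<lambda>v. outer (C *v v) e1 + outer e1 (C *v v))"
      by (intro linear_compose_add linear_compose[OF matrix_vector_mul_linear linear_outer_left, unfolded o_def]
          linear_compose[OF matrix_vector_mul_linear linear_outer_right, unfolded o_def])
    have g: "gen_mean (\<lambda>k. (c0 + e (2 * k + c)) *\<^sub>R XX k) l = g c0 c l"
      unfolding g_def by (simp add: scaleR_add_left gen_mean_add gen_mean_scaleR)
    have 3: "gen_mean (\<lambda>k. outer (C *v ((c0 + e (2 * k + c)) *\<^sub>R XX k)) e1 + outer e1 (C *v ((c0 + e (2 * k + c)) *\<^sub>R XX k))) l
        = outer (C *v g c0 c l) e1 + outer e1 (C *v g c0 c l)"
      using gen_mean_linear[OF l3, of "\<lambda>k. (c0 + e (2 * k + c)) *\<^sub>R XX k" l] unfolding g .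
    have "(c0 + e (2 * k + c))\<^sup>2 = (c0\<^sup>2 + s2) + (2 * c0) * e (2 * k + c) + ((e (2 * k + c))\<^sup>2 - s2)" for k
      by (simp add: power2_eq_square algebra_simps)
    then have \<kappa>: "gen_mean (\<lambda>k. (c0 + e (2 * k + c))\<^sup>2) l = \<kappa> c0 c l"
      by (simp only: gen_mean_add gen_mean_mult gen_mean_const \<kappa>_def)
    have 4: "gen_mean (\<lambda>k. (c0 + e (2 * k + c))\<^sup>2 *\<^sub>R outer e1 (e1 :: (real, 'p) vec)) l = \<kappa> c0 c l *\<^sub>R outer e1 e1"
      using gen_mean_linear[OF bounded_linear.linear[OF bounded_linear_scaleR_left[of "outer e1 (e1 :: (real, 'p) vec)"]], of "\<lambda>k. (c0 + e (2 * k + c))\<^sup>2" l] unfolding \<kappa> .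
    show ?thesis unfolding 1 gen_mean_add[of "\<lambda>k. _ k + _ k"] gen_mean_add 
      using 2 3 4 by (simp add: G_def gen_mean_add)
  qed
  have rec: "Q (Suc l) - ell = \<Phi> (Q l - ell) + (F l - T_mat a b s2)" if l: "l \<ge> (CARD('p) - 1)" for l
  proof -
    have "Q (Suc l) = (1 / 2) *\<^sub>R (gen_mean (\<lambda>k. outer (A *v XX k + (a 0 + e (2 * k + 0)) *\<^sub>R e1) (A *v XX k + (a 0 + e (2 * k + 0)) *\<^sub>R e1)) l
        + gen_mean (\<lambda>k. outer (B *v XX k + (b 0 + e (2 * k + 1)) *\<^sub>R e1) (B *v XX k + (b 0 + e (2 * k + 1)) *\<^sub>R e1)) l)"
      unfolding Q_def by (rule gen_mean_XX_Suc[OF l, where h = "\<lambda>v. outer v v"])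
    also have "\<dots> = \<Phi> (Q l) + F l" unfolding child \<Phi>_def F_def by (simp add: scaleR_add_right)
    finally have "Q (Suc l) - ell = \<Phi> (Q l) + F l - (T_mat a b s2 + \<Phi> ell)" using ell_fix by simp
    then show ?thesis by (simp add: linear_diff[OF linear_\<Phi>])
  qed
  obtain K where K: "0 < K" "\<And>W :: ((real, 'p) vec, 'p) vec. bounded_form W (K * norm W)" using bounded_form_norm by blast
  obtain K' where K': "0 < K'" "\<And>W c i j. bounded_form W c \<Longrightarrow> \<bar>W $ i $ j\<bar> \<le> K' * c" using bounded_form_entry by blast
  \<comment> \<open>\<open>bounded_form\<close> is a relation, so an explicit sequence of bounds is
    carried along; it starts at generation p - 1, hence the shift of indices.\<close>
  define U where "U = rec_nat (K * norm (Q (CARD('p) - 1) - ell)) (\<lambda>n u. \<beta>\<^sup>2 * u + K * norm (F ((CARD('p) - 1) + n) - T_mat a b s2))"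
  have U: "U 0 = K * norm (Q (CARD('p) - 1) - ell)" "U (Suc n) = \<beta>\<^sup>2 * U n + K * norm (F ((CARD('p) - 1) + n) - T_mat a b s2)" for n
    by (simp_all add: U_def)
  have Unn: "0 \<le> U n" for n using K by (induction n) (auto simp: U)
  have Ub: "bounded_form (Q ((CARD('p) - 1) + n) - ell) (U n)" for n
  proof (induction n)
    case (Suc n)
    have "bounded_form (\<Phi> (Q ((CARD('p) - 1) + n) - ell) + (F ((CARD('p) - 1) + n) - T_mat a b s2)) (U (Suc n))"
      unfolding U by (intro bounded_form_add bounded_form_\<Phi> Suc K)
    then show ?case using rec[of "(CARD('p) - 1) + n"] by simp
  qed (simp add: U K)
  have "U \<longlonglongrightarrow> 0"
  proof (rule contraction_tendsto_zero[where r = "\<beta>\<^sup>2" and m = 0 and d = "\<lambda>n. K * norm (F (n + (CARD('p) - 1)) - T_mat a b s2)"])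
    show "\<beta>\<^sup>2 < 1" using \<beta>_bounds by (simp add: power_less_one_iff)
    show "(\<lambda>n. K * norm (F (n + (CARD('p) - 1)) - T_mat a b s2)) \<longlonglongrightarrow> 0"
      by (intro tendsto_mult_right_zero tendsto_norm_zero LIMSEQ_ignore_initial_segment[OF FT])
  qed (auto simp: U Unn add.commute)
  then have KU: "(\<lambda>n. K' * U n) \<longlonglongrightarrow> 0" by (rule tendsto_mult_right_zero)
  have "(\<lambda>n. Q (n + (CARD('p) - 1))) \<longlonglongrightarrow> ell"
  proof (intro vec_tendstoI)
    fix i j
    have "(\<lambda>n. (Q (n + (CARD('p) - 1)) - ell) $ i $ j) \<longlonglongrightarrow> 0"
      by (rule tendsto_0_le[OF KU, where K = 1])
         (use K'(2)[OF Ub] Unn K'(1) in \<open>auto simp: add.commute intro!: always_eventually order_trans[OF _ abs_ge_self]\<close>)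
    then show "(\<lambda>n. Q (n + (CARD('p) - 1)) $ i $ j) \<longlonglongrightarrow> ell $ i $ j" by (simp add: LIM_zero_iff)
  qed
  then show ?thesis unfolding Q_def by (rule LIMSEQ_offset)
qed

lemma Y_mean: "gen_mean (\<lambda>k. YY k $ i * YY k $ j) \<longlonglongrightarrow> L $ i $ j"
proof -
  have s: "gen_mean (\<lambda>k. XX k $ u) \<longlonglongrightarrow> lam $ u" for u
    using tendsto_vec_nth[OF state_mean, of u] by (simp add: gen_mean_nth[abs_def])
  have o: "gen_mean (\<lambda>k. XX k $ u * XX k $ v) \<longlonglongrightarrow> ell $ u $ v" for u v
    using tendsto_vec_nth[OF tendsto_vec_nth[OF outer_mean, of u], of v] by (simp add: gen_mean_nth[abs_def])
  have c: "gen_mean (\<lambda>k. 1 :: real) \<longlonglongrightarrow> 1" by (simp add: gen_mean_const[abs_def])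
  show ?thesis
    using s o c by (cases i; cases j) (simp_all add: Yvec_def L_mat_def)
qed

lemma Y_form_mean: "gen_mean (\<lambda>k. (u \<bullet> YY k) * (w \<bullet> YY k)) \<longlonglongrightarrow> u \<bullet> (L *v w)"
proof -
  have "(u \<bullet> YY k) * (w \<bullet> YY k) = (\<Sum>i\<in>UNIV. \<Sum>j\<in>UNIV. (u $ i * w $ j) * (YY k $ i * YY k $ j))" for k
    by (simp add: inner_vec_def sum_product mult_ac)
  then have "gen_mean (\<lambda>k. (u \<bullet> YY k) * (w \<bullet> YY k)) = (\<lambda>l. \<Sum>i\<in>UNIV. \<Sum>j\<in>UNIV. (u $ i * w $ j) * gen_mean (\<lambda>k. YY k $ i * YY k $ j) l)"
    by (simp add: gen_mean_def sum.swap[of _ UNIV "gen _"] sum_distrib_left sum_divide_distrib fun_eq_iff mult_ac)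
  moreover have "(\<lambda>l. \<Sum>i\<in>UNIV. \<Sum>j\<in>UNIV. (u $ i * w $ j) * gen_mean (\<lambda>k. YY k $ i * YY k $ j) l)
      \<longlonglongrightarrow> (\<Sum>i\<in>UNIV. \<Sum>j\<in>UNIV. (u $ i * w $ j) * L $ i $ j)"
    by (intro tendsto_intros Y_mean)
  moreover have "(\<Sum>i\<in>UNIV. \<Sum>j\<in>UNIV. (u $ i * w $ j) * L $ i $ j) = u \<bullet> (L *v w)"
    by (simp add: inner_vec_def matrix_vector_mult_def sum_distrib_left mult_ac)
  ultimately show ?thesis by simp
qed

end

lemma sum_option: "(\<Sum>i\<in>UNIV. f (i :: 'p::finite option)) = f None + (\<Sum>i\<in>UNIV. f (Some i))"
  unfolding UNIV_option_conv by (subst sum.insert) (auto simp: sum.reindex)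

lemma inner_Yvec:
  fixes v :: "real ^ ('p::{finite,linorder} option)"
  shows "v \<bullet> Yvec x k = v $ None + (\<chi> i. v $ Some i) \<bullet> state_vec x k"
  by (simp add: inner_vec_def sum_option Yvec_def)

lemma outer_mult_vec: "outer u w *v v = (w \<bullet> v) *\<^sub>R u"
  by (simp add: vec_eq_iff matrix_vector_mult_def inner_vec_def sum_distrib_left mult_ac)

lemma sum_matrix_vector_mult: "(\<Sum>k\<in>I. W k) *v v = (\<Sum>k\<in>I. W k *v v)" for W :: "'i \<Rightarrow> real ^ 'n ^ 'm"
  by (induction I rule: infinite_finite_induct) (auto simp: matrix_vector_mult_add_rdistrib)

lemma norm_matrix_vector_mult_le: "norm (D *v v) \<le> real CARD('m) * real CARD('n) * norm D * norm v"
  for D :: "real ^ 'n ^ 'm"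
proof -
  have "norm (D *v v) \<le> (\<Sum>i\<in>UNIV. \<bar>(D *v v) $ i\<bar>)" by (rule norm_le_l1_cart)
  also have "\<dots> \<le> (\<Sum>i\<in>(UNIV::'m set). \<Sum>j\<in>(UNIV::'n set). norm D * norm v)"
  proof (intro sum_mono)
    fix i
    have "\<bar>(D *v v) $ i\<bar> \<le> (\<Sum>j\<in>UNIV. \<bar>D $ i $ j * v $ j\<bar>)"
      unfolding matrix_vector_mult_def by simp
    also have "\<dots> \<le> (\<Sum>j\<in>(UNIV::'n set). norm D * norm v)"
    proof (intro sum_mono)
      fix j
      have "\<bar>D $ i $ j\<bar> \<le> norm D"
        using component_le_norm_cart[of "D $ i" j] order_trans[OF _ Finite_Cartesian_Product.norm_nth_le] by auto
      then show "\<bar>D $ i $ j * v $ j\<bar> \<le> norm D * norm v"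
        unfolding abs_mult by (intro mult_mono component_le_norm_cart) auto
    qed
    finally show "\<bar>(D *v v) $ i\<bar> \<le> (\<Sum>j\<in>(UNIV::'n set). norm D * norm v)" .
  qed
  finally show ?thesis by (simp add: mult_ac)
qed

lemma eventually_le_imp_all_le:
  fixes f h :: "nat \<Rightarrow> real"
  assumes "eventually (\<lambda>n. f n \<le> K * h n) sequentially" and h: "\<And>n. 0 < h n"
  shows "\<exists>K'\<ge>0. \<forall>n. f n \<le> K' * h n"
proof -
  obtain n0 where n0: "\<And>n. n \<ge> n0 \<Longrightarrow> f n \<le> K * h n" using assms(1) by (auto simp: eventually_sequentially)
  define K' where "K' = \<bar>K\<bar> + (\<Sum>m<n0. \<bar>f m\<bar> / h m)"
  have s0: "0 \<le> (\<Sum>m<n0. \<bar>f m\<bar> / h m)" using h by (intro sum_nonneg) (simp add: less_imp_le)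
  have "f n \<le> K' * h n" for n
  proof (cases "n \<ge> n0")
    case True
    then have "f n \<le> K * h n" by (rule n0)
    also have "\<dots> \<le> K' * h n" using s0 h[of n] by (intro mult_right_mono) (auto simp: K'_def)
    finally show ?thesis .
  next
    case False
    have "\<bar>f n\<bar> / h n \<le> (\<Sum>m<n0. \<bar>f m\<bar> / h m)"
      using False h by (intro member_le_sum) (auto simp: less_imp_le)
    then have "\<bar>f n\<bar> / h n \<le> K'" by (simp add: K'_def)
    then show ?thesis using h[of n] by (simp add: divide_le_eq)
  qed
  moreover have "0 \<le> K'" using s0 by (simp add: K'_def)
  ultimately show ?thesis by blast
qed

lemma sq_growth_bound:
  fixes f :: "nat \<Rightarrow> real"
  assumes nn: "\<And>n. 0 \<le> f n" and lim: "(\<lambda>n. (f n)\<^sup>2 * (2 / 5) ^ n) \<longlonglongrightarrow> 0"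
  shows "\<exists>K\<ge>0. \<forall>n. f n \<le> K * sqrt (5 / 2) ^ n"
proof (rule eventually_le_imp_all_le[where K = 1])
  have "eventually (\<lambda>n. (f n)\<^sup>2 * (2 / 5) ^ n < 1) sequentially" using order_tendstoD(2)[OF lim] by simp
  then show "eventually (\<lambda>n. f n \<le> 1 * sqrt (5 / 2) ^ n) sequentially"
  proof eventually_elim
    case (elim n)
    have "(f n)\<^sup>2 \<le> (5 / 2) ^ n" using elim by (simp add: power_divide field_simps)
    also have "\<dots> = (sqrt (5 / 2) ^ n)\<^sup>2" by (simp flip: power_mult add: mult.commute[of n] power_mult)
    finally show ?case using power2_le_imp_le[of "f n" "sqrt (5 / 2) ^ n"] by simp
  qed
qed simp

section \<open>Positive definiteness of the limiting matrix\<close>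

context bar_path_lln
begin

text \<open>Algebraic properties of \<open>L\<close> are inherited from the empirical moments of
  which it is the limit; here symmetry, next semidefiniteness.\<close>

lemma L_sym: "L $ i $ j = L $ j $ i"
proof -
  have "gen_mean (\<lambda>k. YY k $ i * YY k $ j) \<longlonglongrightarrow> L $ j $ i" using Y_mean[of j i] by (simp add: mult.commute)
  from LIMSEQ_unique[OF Y_mean this] show ?thesis .
qed

lemma L_nonneg: "0 \<le> u \<bullet> (L *v u)"
  by (rule LIMSEQ_le_const[OF Y_form_mean]) (auto simp: gen_mean_def intro!: exI sum_nonneg divide_nonneg_nonneg)

text \<open>The adjoint of one step of the recursion: a linear form in the regressor of a daughter
  is the pulled back form in the regressor of the mother, plus the noise times the first state
  coefficient, as \<open>pull_back_inner\<close> states.\<close>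

definition pull_back :: "(nat \<Rightarrow> real) \<Rightarrow> real ^ ('p option) \<Rightarrow> real ^ ('p option)" where
  "pull_back c v = (let w = (\<chi> i. v $ Some i) in
     \<chi> j. case j of None \<Rightarrow> v $ None + c 0 * (w \<bullet> e1) | Some j \<Rightarrow> (transpose (companion c) *v w) $ j)"

lemma pull_back_inner:
  "v $ None + (\<chi> i. v $ Some i) \<bullet> (companion c *v XX k + (c 0 + h) *\<^sub>R e1) = pull_back c v \<bullet> YY k + h * ((\<chi> i. v $ Some i) \<bullet> e1)"
proof -
  let ?w = "(\<chi> i. v $ Some i) :: (real, 'p) vec"
  have "pull_back c v \<bullet> YY k = v $ None + c 0 * (?w \<bullet> e1) + (transpose (companion c) *v ?w) \<bullet> XX k"
    unfolding inner_Yvec by (simp add: pull_back_def Let_def)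
  then show ?thesis unfolding inner_transpose_left by (simp add: inner_add_right algebra_simps)
qed

lemma noise_inner: assumes "c \<in> {0, 1}" shows "gen_mean (\<lambda>k. (u \<bullet> YY k) * e (2 * k + c)) \<longlonglongrightarrow> 0"
proof -
  have "(\<lambda>l. u \<bullet> gen_mean (\<lambda>k. e (2 * k + c) *\<^sub>R YY k) l) \<longlonglongrightarrow> u \<bullet> 0"
    by (intro tendsto_inner tendsto_const noise1 assms)
  moreover have "u \<bullet> gen_mean (\<lambda>k. e (2 * k + c) *\<^sub>R YY k) l = gen_mean (\<lambda>k. (u \<bullet> YY k) * e (2 * k + c)) l" for l
    by (simp add: gen_mean_def inner_sum_right mult.commute)
  ultimately show ?thesis by simp
qed

text \<open>Stationarity of the limiting quadratic form. One generation of the recursion is squared,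
  averaged and taken to the limit: the cross terms with the noise vanish, and the squared noise
  contributes \<open>s2\<close>.\<close>

lemma L_quad_rec:
  "v \<bullet> (L *v v) = (1 / 2) * (pull_back a v \<bullet> (L *v pull_back a v) + pull_back b v \<bullet> (L *v pull_back b v)) + s2 * ((\<chi> i. v $ Some i) \<bullet> e1)\<^sup>2"
proof -
  let ?\<omega> = "((\<chi> i. v $ Some i) :: (real, 'p) vec) \<bullet> e1"
  define g where "g = (\<lambda>c0 c l. gen_mean (\<lambda>k. (pull_back c0 v \<bullet> YY k) * (pull_back c0 v \<bullet> YY k)) l
     + (2 * ?\<omega>) * gen_mean (\<lambda>k. (pull_back c0 v \<bullet> YY k) * e (2 * k + c)) l + ?\<omega>\<^sup>2 * (gen_mean (\<lambda>k. (e (2 * k + c))\<^sup>2 - s2) l + s2))"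
  have g: "gen_mean (\<lambda>k. (v $ None + (\<chi> i. v $ Some i) \<bullet> (companion c0 *v XX k + (c0 0 + e (2 * k + c)) *\<^sub>R e1))\<^sup>2) l = g c0 c l" for c0 c l
  proof -
    have "(v $ None + (\<chi> i. v $ Some i) \<bullet> (companion c0 *v XX k + (c0 0 + e (2 * k + c)) *\<^sub>R e1))\<^sup>2
      = (pull_back c0 v \<bullet> YY k) * (pull_back c0 v \<bullet> YY k) + (2 * ?\<omega>) * ((pull_back c0 v \<bullet> YY k) * e (2 * k + c)) + ?\<omega>\<^sup>2 * (((e (2 * k + c))\<^sup>2 - s2) + s2)" for k
      unfolding pull_back_inner by (simp add: power2_eq_square algebra_simps)
    then show ?thesis by (simp only: gen_mean_add gen_mean_mult gen_mean_const g_def)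
  qed
  have glim: "g c0 c \<longlonglongrightarrow> pull_back c0 v \<bullet> (L *v pull_back c0 v) + (2 * ?\<omega>) * 0 + ?\<omega>\<^sup>2 * (0 + s2)" if "c \<in> {0, 1}" for c0 c
    unfolding g_def by (intro tendsto_intros Y_form_mean noise_inner noise2 that)
  have "(\<lambda>l. (1 / 2) *\<^sub>R (g a 0 l + g b 1 l)) \<longlonglongrightarrow> (1 / 2) *\<^sub>R ((pull_back a v \<bullet> (L *v pull_back a v) + (2 * ?\<omega>) * 0 + ?\<omega>\<^sup>2 * (0 + s2))
      + (pull_back b v \<bullet> (L *v pull_back b v) + (2 * ?\<omega>) * 0 + ?\<omega>\<^sup>2 * (0 + s2)))"
    by (intro tendsto_intros glim) auto
  then have lim: "(\<lambda>l. (1 / 2) *\<^sub>R (g a 0 l + g b 1 l)) \<longlonglongrightarrow> (1 / 2) * (pull_back a v \<bullet> (L *v pull_back a v) + pull_back b v \<bullet> (L *v pull_back b v)) + s2 * ?\<omega>\<^sup>2"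
    by (simp add: algebra_simps)
  have ev: "eventually (\<lambda>l. (1 / 2) *\<^sub>R (g a 0 l + g b 1 l) = gen_mean (\<lambda>k. (v \<bullet> YY k) * (v \<bullet> YY k)) (Suc l)) sequentially"
    unfolding eventually_sequentially
  proof (intro exI allI impI)
    fix l assume l: "CARD('p) - 1 \<le> l"
    show "(1 / 2) *\<^sub>R (g a 0 l + g b 1 l) = gen_mean (\<lambda>k. (v \<bullet> YY k) * (v \<bullet> YY k)) (Suc l)"
      using gen_mean_XX_Suc[OF l, of "\<lambda>X. (v $ None + (\<chi> i. v $ Some i) \<bullet> X)\<^sup>2"]
      unfolding g inner_Yvec by (simp add: power2_eq_square)
  qed
  have "(\<lambda>l. gen_mean (\<lambda>k. (v \<bullet> YY k) * (v \<bullet> YY k)) (Suc l)) \<longlonglongrightarrow> v \<bullet> (L *v v)"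
    by (rule LIMSEQ_Suc[OF Y_form_mean])
  from LIMSEQ_unique[OF this Lim_transform_eventually[OF lim ev]] show ?thesis .
qed

text \<open>If the form vanishes at \<open>v\<close>, \<open>L_quad_rec\<close> forces the first
  state coefficient of \<open>v\<close> to be 0 and the form to vanish at the pulled back vector
  too. As pulling back shifts the coefficients, all state coefficients are 0, and the intercept is
  excluded by the entry 1 of \<open>L\<close>.\<close>

lemma L_definite:
  assumes s2: "0 < s2" and v: "v \<bullet> (L *v v) = 0"
  shows "v = 0"
proof -
  have step: "(\<chi> i. v $ Some i) \<bullet> e1 = 0 \<and> pull_back a v \<bullet> (L *v pull_back a v) = 0" if "v \<bullet> (L *v v) = 0" for v :: "real ^ ('p option)"
  proof -
    have "0 \<le> s2 * ((\<chi> i. v $ Some i) \<bullet> e1)\<^sup>2" using s2 by simp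
    moreover have "r = 0 \<and> p = 0" if "0 = (1 / 2) * (p + q) + r" "0 \<le> p" "0 \<le> q" "0 \<le> r" for p q r :: real
    proof -
      have "r \<le> 0" "p \<le> 0" using that by argo+
      with that show ?thesis by simp
    qed
    ultimately have "s2 * ((\<chi> i. v $ Some i) \<bullet> e1)\<^sup>2 = 0 \<and> pull_back a v \<bullet> (L *v pull_back a v) = 0"
      using L_quad_rec[of v, unfolded that] L_nonneg[of "pull_back a v"] L_nonneg[of "pull_back b v"] by blast
    then show ?thesis using s2 by simp
  qed
  have in_e1: "(w :: (real, 'p) vec) \<bullet> e1 = w $ i" if "pos i = 1" for w i
  proof -
    have "(pos j = 1) = (j = i)" for j using that by (metis pos_eq_iff)
    then show ?thesis by (simp add: inner_vec_def e1_def if_distrib cong: if_cong)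
  qed
  \<comment> \<open>The induction on positions is over all isotropic vectors at once, because the
    step applies it to \<open>pull_back a v\<close>.\<close>
  have "\<forall>v :: real ^ ('p option). v \<bullet> (L *v v) = 0 \<longrightarrow> (\<forall>i. pos i \<le> m \<longrightarrow> v $ Some i = 0)" for m
  proof (induction m)
    case 0
    then show ?case using pos_ge_1 by (metis not_one_le_zero One_nat_def le_trans)
  next
    case (Suc m)
    show ?case
    proof (intro allI impI)
      fix v :: "real ^ ('p option)" and i :: 'p
      assume v: "v \<bullet> (L *v v) = 0" and i: "pos i \<le> Suc m"
      note s = step[OF v]
      show "v $ Some i = 0"
      proof (cases "pos i = 1")
        case True
        then show ?thesis using s in_e1[OF True, of "\<chi> i. v $ Some i"] by simp
      next
        case False
        have h: "1 \<le> pos i - 1" "pos i - 1 \<le> CARD('p)"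
          using False pos_ge_1[of i] pos_le_CARD[of i] by linarith+
        obtain j :: 'p where j: "pos j = pos i - 1" using h by (rule pos_obtain)
        then have ij: "pos i = pos j + 1" using h by linarith
        \<comment> \<open>Once the first coefficient of \<open>v\<close> is 0, the parameters in the
          first row of the companion matrix drop out and coordinate \<open>j\<close> of the pulled
          back vector is coordinate j + 1 of \<open>v\<close>.\<close>
        have "pull_back a v $ Some j = 0" using Suc s i j by simp
        moreover have "pull_back a v $ Some j = (\<Sum>i'\<in>UNIV. companion a $ i' $ j * v $ Some i')"
          by (simp add: pull_back_def Let_def transpose_def matrix_vector_mult_def)
        moreover have "companion a $ i' $ j * v $ Some i' = (if i' = i then v $ Some i else 0)" for i'
        proof (cases "pos i' = 1")
          case True
          then have "v $ Some i' = 0" using s in_e1[OF True, of "\<chi> i. v $ Some i"] by simp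
          then show ?thesis by auto
        next
          case f: False
          have "(pos i' = pos j + 1) = (i' = i)" using ij by (metis pos_eq_iff)
          then show ?thesis using f by (simp add: companion_def)
        qed
        ultimately show ?thesis by simp
      qed
    qed
  qed
  from this[of "CARD('p)"] v have z: "v $ Some i = 0" for i by simp
  have LN: "L $ None $ None = 1" by (simp add: L_mat_def)
  have "v \<bullet> (L *v v) = v $ None * v $ None"
    by (simp add: inner_vec_def matrix_vector_mult_def sum_option z LN)
  with v z show ?thesis by (metis mult_eq_0_iff vec_eq_iff zero_index not_None_eq)
qed

end

section \<open>The least squares estimator along one trajectory\<close>

text \<open>The rate 2/5 is below 1/2, as \<open>martingale_growth\<close> requires, and above 1 /
  (2 sqrt 2), as \<open>residual_remainder\<close> requires. Scores of the whole tree govern the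
  estimator; scores of a single generation appear in the residuals.\<close>

locale bar_path_lse = bar_path_lln N a b s2 x e
  for N :: "real ^ 'p::{finite,linorder} \<Rightarrow> real" and a b :: "nat \<Rightarrow> real" and s2 :: real and x e :: "nat \<Rightarrow> real" +
  fixes \<theta>0 :: "real ^ (2 \<times> 'p option)"
  assumes s2: "0 < s2"
    and growth: "\<And>c. c \<in> {0, 1} \<Longrightarrow> (\<lambda>n. (norm (\<Sum>k\<in>tree_from n (CARD('p) - 1). e (2 * k + c) *\<^sub>R (Yvec x k :: real ^ ('p option))))\<^sup>2 * (2 / 5) ^ n) \<longlonglongrightarrow> 0"
    and growth': "\<And>c. c \<in> {0, 1} \<Longrightarrow> (\<lambda>n. (norm (\<Sum>k\<in>gen n. e (2 * k + c) *\<^sub>R (Yvec x k :: real ^ ('p option))))\<^sup>2 * (2 / 5) ^ n) \<longlonglongrightarrow> 0"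
begin

abbreviation Linv :: "real ^ ('p option) ^ ('p option)" where "Linv \<equiv> matrix_inv L"

definition S :: "nat \<Rightarrow> real ^ ('p option) ^ ('p option)" where
  "S n = (\<Sum>k\<in>tree_from n (CARD('p) - 1). outer (YY k) (YY k))"

definition Mt :: "nat \<Rightarrow> nat \<Rightarrow> real ^ ('p option)" where
  "Mt c n = (\<Sum>k\<in>tree_from n (CARD('p) - 1). e (2 * k + c) *\<^sub>R YY k)"

definition ix :: "nat \<Rightarrow> 2" where "ix c = (if c = 0 then 1 else 2)"

definition th :: "nat \<Rightarrow> nat \<Rightarrow> real ^ ('p option)" where
  "th c n = (\<chi> i. theta_hat \<theta>0 x n $ (ix c, i))"

definition tv :: "nat \<Rightarrow> real ^ ('p option)" where
  "tv c = (\<chi> i. (theta a b :: real ^ (2 \<times> 'p option)) $ (ix c, i))"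

lemma x_child:
  assumes c: "c \<in> {0, 1}" and n: "n \<ge> 2 ^ (CARD('p) - 1)"
  shows "x (2 * n + c) = tv c \<bullet> YY n + e (2 * n + c)"
proof -
  have *: "tv c \<bullet> YY n = d 0 + (\<Sum>k = 1..CARD('p). d k * x (n div 2 ^ (k - 1)))" if "d = (if c = 0 then a else b)" for d
    unfolding inner_Yvec that
    by (subst sum_pos[symmetric]) (use c in \<open>auto simp: tv_def theta_def ix_def inner_vec_def state_vec_def\<close>)
  show ?thesis using c even[OF n] odd[OF n] *[OF refl] by auto
qed

lemma invertible_L: "invertible L"
proof -
  have "v = 0" if "L *v v = 0" for v using L_definite[OF s2, of v] that by simp
  then show ?thesis by (simp add: invertible_left_inverse matrix_left_invertible_ker)
qed

lemma S_lim: "(\<lambda>n. (1 / 2 ^ (n + 1)) *\<^sub>R S n) \<longlonglongrightarrow> L"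
proof (intro vec_tendstoI)
  fix i j
  show "(\<lambda>n. ((1 / 2 ^ (n + 1)) *\<^sub>R S n) $ i $ j) \<longlonglongrightarrow> L $ i $ j"
    using tendsto_tree_mean[OF Y_mean[of i j], of "CARD('p) - 1"] by (simp add: S_def)
qed

lemma theta_hat_error:
  assumes c: "c \<in> {0, 1}" and n: "Suc n \<ge> CARD('p)" and inv: "invertible (S n)"
  shows "S n *v (th c (Suc n) - tv c) = Mt c n"
proof -
  \<comment> \<open>Invertibility rules out the fallback to S + I, so the normal equations are
    exact. The estimator of time n + 1 uses the matrix of time \<open>n\<close>.\<close>
  have Sm: "Smat x n = S n" using inv by (simp add: Smat_def S_def Let_def)
  have Z: "Zvec x k $ ix c = x (2 * k + c)" for k using c by (auto simp: Zvec_def ix_def)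
  let ?T = "tree_from n (CARD('p) - 1)"
  have "th c (Suc n) = matrix_inv (S n) *v (\<Sum>k\<in>?T. x (2 * k + c) *\<^sub>R YY k)"
    using n by (simp add: th_def theta_hat_def vec_stack_def Sm matrix_matrix_mult_def matrix_vector_mult_def vec_eq_iff Z mult.commute)
  moreover have "(\<Sum>k\<in>?T. x (2 * k + c) *\<^sub>R YY k) = S n *v tv c + Mt c n"
  proof -
    have "x (2 * k + c) *\<^sub>R YY k = outer (YY k) (YY k) *v tv c + e (2 * k + c) *\<^sub>R YY k" if "k \<in> ?T" for k
      using that x_child[OF c, of k] unfolding outer_mult_vec by (simp add: tree_from_eq scaleR_add_left inner_commute)
    then show ?thesis by (simp add: S_def Mt_def sum.distrib sum_matrix_vector_mult)
  qed
  ultimately have "S n *v th c (Suc n) = S n *v tv c + Mt c n"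
    by (simp add: matrix_vector_mul_assoc matrix_inv_mult[OF inv])
  then show ?thesis by (simp add: matrix_vector_mult_diff_distrib)
qed

text \<open>A perturbation argument: with \<open>R n\<close> the normalised matrix, y - Linv R y =
  Linv (L - R) y is small relative to \<open>y\<close>. Once the relative error is below 1/2,
  \<open>R n\<close> is bounded below, so \<open>S n\<close> is invertible and the normal equations
  can be inverted. All errors are measured against the norm of the scores.\<close>

lemma lse_asymptotics:
  "\<exists>\<delta> C. \<delta> \<longlonglongrightarrow> 0 \<and> 0 \<le> C \<and>
    (\<forall>c\<in>{0, 1}. eventually (\<lambda>n. norm (2 ^ (n + 1) *\<^sub>R (th c (Suc n) - tv c) - Linv *v Mt c n) \<le> \<delta> n * norm (Mt c n)) sequentially) \<and>
    (\<forall>c\<in>{0, 1}. eventually (\<lambda>n. norm (2 ^ (n + 1) *\<^sub>R (th c (Suc n) - tv c)) \<le> C * norm (Mt c n)) sequentially)"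
proof -
  obtain C1 where C1: "0 < C1" "\<And>v. norm (Linv *v v) \<le> C1 * norm v"
    using bounded_linear.pos_bounded[OF matrix_vector_mul_bounded_linear[of Linv]] by (auto simp: mult.commute)
  define q where "q = real CARD('p option) * real CARD('p option)"
  define R where "R = (\<lambda>n. (1 / 2 ^ (n + 1)) *\<^sub>R S n)"
  define \<epsilon> where "\<epsilon> = (\<lambda>n. C1 * (q * norm (L - R n)))"
  have "R \<longlonglongrightarrow> L" unfolding R_def by (rule S_lim)
  then have "\<epsilon> \<longlonglongrightarrow> C1 * (q * norm (L - L))" unfolding \<epsilon>_def by (intro tendsto_intros)
  then have \<epsilon>0: "\<epsilon> \<longlonglongrightarrow> 0" by simp
  have key: "norm (y - Linv *v (R n *v y)) \<le> \<epsilon> n * norm y" for n y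
  proof -
    have "y - Linv *v (R n *v y) = Linv *v (L *v y) - Linv *v (R n *v y)"
      by (simp add: matrix_vector_mul_assoc matrix_inv_mult[OF invertible_L])
    also have "\<dots> = Linv *v ((L - R n) *v y)" by (simp add: matrix_vector_mult_diff_distrib matrix_vector_mult_diff_rdistrib)
    also have "norm \<dots> \<le> C1 * norm ((L - R n) *v y)" by (rule C1)
    also have "\<dots> \<le> C1 * (q * norm (L - R n) * norm y)"
      unfolding q_def using C1 by (intro mult_left_mono norm_matrix_vector_mult_le) auto
    finally show ?thesis by (simp add: \<epsilon>_def mult_ac)
  qed
  have half: "norm y \<le> 2 * C1 * norm (R n *v y)" if "\<epsilon> n < 1 / 2" for n y
  proof -
    have "norm y \<le> norm (y - Linv *v (R n *v y)) + norm (Linv *v (R n *v y))"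
      using norm_triangle_ineq[of "y - Linv *v (R n *v y)" "Linv *v (R n *v y)"] by simp
    also have "\<dots> \<le> 1 / 2 * norm y + C1 * norm (R n *v y)"
      using key[of y n] C1(2)[of "R n *v y"] mult_right_mono[of "\<epsilon> n" "1 / 2" "norm y"] that by simp
    finally show ?thesis by simp
  qed
  have ev1: "eventually (\<lambda>n. \<epsilon> n < 1 / 2) sequentially" by (rule order_tendstoD(2)[OF \<epsilon>0]) simp
  have ev2: "eventually (\<lambda>n. Suc n \<ge> CARD('p)) sequentially"
    using eventually_ge_at_top[of "CARD('p)"] by eventually_elim simp
  note ev = eventually_conj[OF ev1 ev2]
  have Ry: "R n *v (2 ^ (n + 1) *\<^sub>R (th c (Suc n) - tv c)) = Mt c n"
    if "\<epsilon> n < 1 / 2" "Suc n \<ge> CARD('p)" "c \<in> {0, 1}" for n c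
  proof -
    have "v = 0" if v: "S n *v v = 0" for v
      using half[OF \<open>\<epsilon> n < 1 / 2\<close>, of v] v by (simp add: R_def scaleR_matrix_vector_assoc[symmetric])
    then have "invertible (S n)" by (simp add: invertible_left_inverse matrix_left_invertible_ker)
    from theta_hat_error[OF that(3,2) this] show ?thesis
      by (simp add: R_def scaleR_matrix_vector_assoc[symmetric] matrix_vector_mult_scaleR)
  qed
  show ?thesis
  proof (intro exI[of _ "\<lambda>n. \<epsilon> n * (2 * C1)"] exI[of _ "2 * C1"] conjI ballI)
    show "(\<lambda>n. \<epsilon> n * (2 * C1)) \<longlonglongrightarrow> 0" by (rule tendsto_mult_left_zero[OF \<epsilon>0])
    show "0 \<le> 2 * C1" using C1 by simp
    fix c :: nat assume c: "c \<in> {0, 1}"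
    show "eventually (\<lambda>n. norm (2 ^ (n + 1) *\<^sub>R (th c (Suc n) - tv c)) \<le> 2 * C1 * norm (Mt c n)) sequentially"
      using ev by eventually_elim (use half Ry c in metis)
    show "eventually (\<lambda>n. norm (2 ^ (n + 1) *\<^sub>R (th c (Suc n) - tv c) - Linv *v Mt c n) \<le> \<epsilon> n * (2 * C1) * norm (Mt c n)) sequentially"
      using ev
    proof eventually_elim
      case (elim n)
      let ?y = "2 ^ (n + 1) *\<^sub>R (th c (Suc n) - tv c)"
      have r: "R n *v ?y = Mt c n" using Ry elim c by blast
      have "0 \<le> \<epsilon> n" using C1 by (simp add: \<epsilon>_def q_def)
      moreover have "norm ?y \<le> 2 * C1 * norm (R n *v ?y)" using elim by (intro half) simp
      ultimately have "\<epsilon> n * norm ?y \<le> \<epsilon> n * (2 * C1 * norm (R n *v ?y))" by (intro mult_left_mono)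
      then show ?case using key[of ?y n] unfolding r by (simp add: mult_ac)
    qed
  qed
qed

end

section \<open>The effect of replacing the noise by residuals\<close>

context bar_path_lse
begin

definition dd :: "nat \<Rightarrow> nat \<Rightarrow> real ^ ('p option)" where "dd c n = th c n - tv c"

definition DM :: "nat \<Rightarrow> nat \<Rightarrow> real ^ ('p option)" where
  "DM c n = (\<Sum>k\<in>gen n. e (2 * k + c) *\<^sub>R YY k)"

lemma eps_hat_eq:
  assumes c: "c \<in> {0, 1}" and k: "k \<in> gen l" and l: "l \<ge> CARD('p) - 1"
  shows "eps_hat \<theta>0 x (2 * k + c) = e (2 * k + c) - dd c l \<bullet> YY k"
proof -
  have d: "(2 * k + c) div 2 = k" "even (2 * k + c) \<longleftrightarrow> c = 0" using c by auto
  have "eps_hat \<theta>0 x (2 * k + c) = x (2 * k + c) - th c l \<bullet> YY k"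
    unfolding eps_hat_def Let_def d generation_of_eq[OF k] inner_Yvec
    by (simp add: th_def ix_def inner_vec_def state_vec_def)
  then show ?thesis unfolding x_child[OF c gen_ge[OF k l]] by (simp add: dd_def inner_diff_left)
qed

text \<open>Within one generation the estimator does not change, so its error factors out of the
  cross terms and leaves the scores of that generation alone.\<close>

lemma gen_residual_diff:
  assumes c: "c \<in> {0, 1}" "c' \<in> {0, 1}" and l: "l \<ge> CARD('p) - 1"
  shows "(\<Sum>k\<in>gen l. eps_hat \<theta>0 x (2 * k + c) * eps_hat \<theta>0 x (2 * k + c') - e (2 * k + c) * e (2 * k + c'))
    = (\<Sum>k\<in>gen l. (dd c l \<bullet> YY k) * (dd c' l \<bullet> YY k)) - dd c l \<bullet> DM c' l - dd c' l \<bullet> DM c l"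
proof -
  have "(\<Sum>k\<in>gen l. eps_hat \<theta>0 x (2 * k + c) * eps_hat \<theta>0 x (2 * k + c') - e (2 * k + c) * e (2 * k + c'))
     = (\<Sum>k\<in>gen l. (dd c l \<bullet> YY k) * (dd c' l \<bullet> YY k) - e (2 * k + c') * (dd c l \<bullet> YY k) - e (2 * k + c) * (dd c' l \<bullet> YY k))"
    by (intro sum.cong refl) (simp only: eps_hat_eq[OF c(1) _ l] eps_hat_eq[OF c(2) _ l], simp add: algebra_simps)
  then show ?thesis by (simp add: sum_subtractf DM_def inner_sum_right)
qed

lemma Y_sq_bound: "\<exists>K\<ge>0. \<forall>l. (\<Sum>k\<in>gen l. (norm (YY k))\<^sup>2) \<le> K * 2 ^ l"
proof (rule eventually_le_imp_all_le)
  let ?t = "\<Sum>i\<in>UNIV. L $ i $ i"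
  have "(\<lambda>l. \<Sum>i\<in>UNIV. gen_mean (\<lambda>k. YY k $ i * YY k $ i) l) \<longlonglongrightarrow> ?t"
    by (intro tendsto_sum Y_mean)
  then have "eventually (\<lambda>l. (\<Sum>i\<in>UNIV. gen_mean (\<lambda>k. YY k $ i * YY k $ i) l) < ?t + 1) sequentially"
    by (rule order_tendstoD(2)) simp
  then show "eventually (\<lambda>l. (\<Sum>k\<in>gen l. (norm (YY k))\<^sup>2) \<le> (?t + 1) * 2 ^ l) sequentially"
  proof eventually_elim
    case (elim l)
    have "(\<Sum>i\<in>UNIV. gen_mean (\<lambda>k. YY k $ i * YY k $ i) l) = (\<Sum>k\<in>gen l. (norm (YY k))\<^sup>2) / 2 ^ l"
      by (simp add: gen_mean_def power2_norm_eq_inner inner_vec_def sum.swap[of _ UNIV] sum_divide_distrib)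
    then show ?case using elim by (simp add: divide_less_eq)
  qed
qed simp

text \<open>Up to constants, with g^2 = 5/2, the scores of generation l are at most g^l, the
  estimation error at most (g/2)^l, and the sum of squared regressors at most 2^l. Each term of
  \<open>gen_residual_diff\<close> is thus of order (5/4)^l, and so is the sum over all generations
  up to l, which is negligible against 2^(l/2) because 25/16 < 2.\<close>

lemma residual_remainder:
  assumes c: "c \<in> {0, 1}" "c' \<in> {0, 1}"
  shows "(\<lambda>n. (1 / sqrt (2 ^ (n + 1))) * (\<Sum>k\<in>tree_from n (CARD('p) - 1).
      eps_hat \<theta>0 x (2 * k + c) * eps_hat \<theta>0 x (2 * k + c') - e (2 * k + c) * e (2 * k + c'))) \<longlonglongrightarrow> 0"
proof -
  define g where "g = sqrt (5 / 2 :: real)"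
  have g: "0 < g" "g * g = 5 / 2" by (simp_all add: g_def)
  obtain Ky where Ky: "0 \<le> Ky" "\<And>l. (\<Sum>k\<in>gen l. (norm (YY k))\<^sup>2) \<le> Ky * 2 ^ l" using Y_sq_bound by blast
  have Dex: "\<exists>K\<ge>0. \<forall>l. norm (DM c l) \<le> K * g ^ l" if "c \<in> {0, 1}" for c
    unfolding g_def by (rule sq_growth_bound) (use growth'[OF that] in \<open>auto simp: DM_def\<close>)
  have Mex: "\<exists>K\<ge>0. \<forall>l. norm (Mt c l) \<le> K * g ^ l" if "c \<in> {0, 1}" for c
    unfolding g_def by (rule sq_growth_bound) (use growth[OF that] in \<open>auto simp: Mt_def\<close>)
  have dex: "\<exists>K\<ge>0. \<forall>l. norm (dd c l) \<le> K * (g / 2) ^ l" if c: "c \<in> {0, 1}" for c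
  proof -
    obtain C where C: "0 \<le> C"
      and ev: "eventually (\<lambda>n. norm (2 ^ (n + 1) *\<^sub>R (th c (Suc n) - tv c)) \<le> C * norm (Mt c n)) sequentially"
      using lse_asymptotics c by blast
    obtain K where K: "0 \<le> K" "\<And>l. norm (Mt c l) \<le> K * g ^ l" using Mex[OF c] by blast
    have "eventually (\<lambda>n. norm (dd c (Suc n)) \<le> (C * K / g) * (g / 2) ^ Suc n) sequentially"
      using ev
    proof eventually_elim
      case (elim n)
      have "2 ^ (n + 1) * norm (dd c (Suc n)) \<le> C * norm (Mt c n)" using elim by (simp add: dd_def)
      also have "\<dots> \<le> C * (K * g ^ n)" using K C by (intro mult_left_mono) auto
      finally show ?case using g by (simp add: power_divide field_simps)
    qed
    then have "eventually (\<lambda>n. norm (dd c n) \<le> (C * K / g) * (g / 2) ^ n) sequentially"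
      using eventually_sequentially_Suc[of "\<lambda>n. norm (dd c n) \<le> (C * K / g) * (g / 2) ^ n"] by simp
    \<comment> \<open>The arbitrary initial value \<open>\<theta>0\<close> affects only finitely
      many of the errors, and these are absorbed in the constant.\<close>
    then show ?thesis by (rule eventually_le_imp_all_le) (use g in simp)
  qed
  obtain D1 where D1: "0 \<le> D1" "\<And>l. norm (DM c l) \<le> D1 * g ^ l" using Dex[OF c(1)] by blast
  obtain D2 where D2: "0 \<le> D2" "\<And>l. norm (DM c' l) \<le> D2 * g ^ l" using Dex[OF c(2)] by blast
  obtain d1 where d1: "0 \<le> d1" "\<And>l. norm (dd c l) \<le> d1 * (g / 2) ^ l" using dex[OF c(1)] by blast
  obtain d2 where d2: "0 \<le> d2" "\<And>l. norm (dd c' l) \<le> d2 * (g / 2) ^ l" using dex[OF c(2)] by blast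
  have gg: "(g / 2) ^ l * g ^ l = (5 / 4) ^ l" "(g / 2) ^ l * (g / 2) ^ l * 2 ^ l = (5 / 4) ^ l" for l
  proof -
    have "g / 2 * g = 5 / 4" "g / 2 * (g / 2) * 2 = 5 / 4" using g by (simp_all add: field_simps)
    then show "(g / 2) ^ l * g ^ l = (5 / 4) ^ l" "(g / 2) ^ l * (g / 2) ^ l * 2 ^ l = (5 / 4) ^ l"
      by (simp_all only: power_mult_distrib[symmetric])
  qed
  define K where "K = d1 * d2 * Ky + d1 * D2 + d2 * D1"
  have K0: "0 \<le> K" using d1 d2 D1 D2 Ky by (simp add: K_def)
  let ?f = "\<lambda>k. eps_hat \<theta>0 x (2 * k + c) * eps_hat \<theta>0 x (2 * k + c') - e (2 * k + c) * e (2 * k + c')"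
  have genb: "\<bar>\<Sum>k\<in>gen l. ?f k\<bar> \<le> K * (5 / 4) ^ l" if l: "l \<ge> CARD('p) - 1" for l
  proof -
    have 1: "\<bar>\<Sum>k\<in>gen l. (dd c l \<bullet> YY k) * (dd c' l \<bullet> YY k)\<bar> \<le> d1 * d2 * Ky * (5 / 4) ^ l"
    proof -
      have "\<bar>\<Sum>k\<in>gen l. (dd c l \<bullet> YY k) * (dd c' l \<bullet> YY k)\<bar> \<le> (\<Sum>k\<in>gen l. \<bar>(dd c l \<bullet> YY k) * (dd c' l \<bullet> YY k)\<bar>)" by (rule sum_abs)
      also have "\<dots> \<le> (\<Sum>k\<in>gen l. (d1 * (g / 2) ^ l) * (d2 * (g / 2) ^ l) * (norm (YY k))\<^sup>2)"
      proof (intro sum_mono)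
        fix k
        have "\<bar>dd c l \<bullet> YY k\<bar> \<le> (d1 * (g / 2) ^ l) * norm (YY k)"
          by (rule order_trans[OF Cauchy_Schwarz_ineq2]) (intro mult_right_mono d1, simp)
        moreover have "\<bar>dd c' l \<bullet> YY k\<bar> \<le> (d2 * (g / 2) ^ l) * norm (YY k)"
          by (rule order_trans[OF Cauchy_Schwarz_ineq2]) (intro mult_right_mono d2, simp)
        ultimately have "\<bar>dd c l \<bullet> YY k\<bar> * \<bar>dd c' l \<bullet> YY k\<bar> \<le> ((d1 * (g / 2) ^ l) * norm (YY k)) * ((d2 * (g / 2) ^ l) * norm (YY k))"
          using d1(1) g by (intro mult_mono) auto
        then show "\<bar>(dd c l \<bullet> YY k) * (dd c' l \<bullet> YY k)\<bar> \<le> (d1 * (g / 2) ^ l) * (d2 * (g / 2) ^ l) * (norm (YY k))\<^sup>2"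
          by (simp add: abs_mult power2_eq_square mult_ac)
      qed
      also have "\<dots> = (d1 * (g / 2) ^ l) * (d2 * (g / 2) ^ l) * (\<Sum>k\<in>gen l. (norm (YY k))\<^sup>2)" by (simp add: sum_distrib_left)
      also have "\<dots> \<le> (d1 * (g / 2) ^ l) * (d2 * (g / 2) ^ l) * (Ky * 2 ^ l)"
        using d1 d2 g by (intro mult_left_mono Ky) auto
      also have "\<dots> = d1 * d2 * Ky * ((g / 2) ^ l * (g / 2) ^ l * 2 ^ l)" by (simp only: mult_ac)
      finally show ?thesis unfolding gg .
    qed
    have 2: "\<bar>u \<bullet> w\<bar> \<le> (du * Dw) * (5 / 4) ^ l" if "norm u \<le> du * (g / 2) ^ l" "norm w \<le> Dw * g ^ l" "0 \<le> du" for u w :: "real ^ ('p option)" and du Dw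
    proof -
      have "\<bar>u \<bullet> w\<bar> \<le> norm u * norm w" by (rule Cauchy_Schwarz_ineq2)
      also have "\<dots> \<le> (du * (g / 2) ^ l) * (Dw * g ^ l)" using that g by (intro mult_mono) auto
      also have "\<dots> = (du * Dw) * ((g / 2) ^ l * g ^ l)" by (simp only: mult_ac)
      finally show ?thesis unfolding gg .
    qed
    have "\<bar>\<Sum>k\<in>gen l. ?f k\<bar> \<le> d1 * d2 * Ky * (5 / 4) ^ l + (d1 * D2) * (5 / 4) ^ l + (d2 * D1) * (5 / 4) ^ l"
      unfolding gen_residual_diff[OF c l]
      using 1 2[OF d1(2) D2(2) d1(1)] 2[OF d2(2) D1(2) d2(1)] by linarith
    then show ?thesis by (simp add: K_def algebra_simps)
  qed
  have geo: "(\<Sum>l = m..n. (5 / 4 :: real) ^ l) \<le> 5 * (5 / 4) ^ n" for m n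
  proof -
    have "(\<Sum>l = m..n. (5 / 4 :: real) ^ l) \<le> (\<Sum>l\<le>n. (5 / 4) ^ l)" by (intro sum_mono2) auto
    also have "\<dots> \<le> 5 * (5 / 4) ^ n" by (induction n) auto
    finally show ?thesis .
  qed
  define s where "s = (5 / 4) / sqrt (2 :: real)"
  have s: "0 \<le> s" "s < 1"
  proof -
    have "(5 / 4 :: real) < sqrt 2" by (rule real_less_rsqrt) (simp add: power2_eq_square)
    then show "0 \<le> s" "s < 1" by (simp_all add: s_def)
  qed
  show ?thesis
  proof (rule tendsto_0_le[where K = 1])
    have "(\<lambda>n. (5 * K) * s ^ n) \<longlonglongrightarrow> (5 * K) * 0"
      using s by (intro tendsto_mult tendsto_const LIMSEQ_power_zero) auto
    then show "(\<lambda>n. (5 * K) * s ^ n) \<longlonglongrightarrow> 0" by simp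
    show "eventually (\<lambda>n. norm ((1 / sqrt (2 ^ (n + 1))) * (\<Sum>k\<in>tree_from n (CARD('p) - 1). ?f k)) \<le> norm ((5 * K) * s ^ n) * 1) sequentially"
      using eventually_ge_at_top[of "CARD('p)"]
    proof eventually_elim
      case (elim n)
      have "(\<Sum>k\<in>tree_from n (CARD('p) - 1). ?f k) = (\<Sum>l = CARD('p) - 1..n. \<Sum>k\<in>gen l. ?f k)"
        by (rule sum_tree_from_gen) (use elim in simp)
      also have "\<bar>\<dots>\<bar> \<le> (\<Sum>l = CARD('p) - 1..n. K * (5 / 4) ^ l)"
        by (rule order_trans[OF sum_abs sum_mono]) (rule genb, simp)
      also have "\<dots> \<le> K * (5 * (5 / 4) ^ n)"
        unfolding sum_distrib_left[symmetric] by (intro mult_left_mono geo K0)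
      finally have b: "\<bar>\<Sum>k\<in>tree_from n (CARD('p) - 1). ?f k\<bar> \<le> K * (5 * (5 / 4) ^ n)" .
      have "norm ((1 / sqrt (2 ^ (n + 1))) * (\<Sum>k\<in>tree_from n (CARD('p) - 1). ?f k))
         = (1 / sqrt (2 ^ (n + 1))) * \<bar>\<Sum>k\<in>tree_from n (CARD('p) - 1). ?f k\<bar>"
        by (simp add: abs_mult)
      also have "\<dots> \<le> (1 / sqrt (2 ^ n)) * (K * (5 * (5 / 4) ^ n))"
      proof (rule mult_mono[OF _ b])
        show "1 / sqrt (2 ^ (n + 1)) \<le> 1 / sqrt (2 ^ n)" by (intro divide_left_mono) auto
      qed auto
      also have "\<dots> = (5 * K) * s ^ n"
        by (simp add: s_def power_divide real_sqrt_power mult_ac)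
      finally show ?case by simp
    qed
  qed
qed

end

section \<open>The model\<close>

definition past :: "'w measure \<Rightarrow> (nat \<Rightarrow> 'w \<Rightarrow> real) \<Rightarrow> nat set \<Rightarrow> 'w measure" where
  "past M X J = sigma (space M) {X k -` S \<inter> space M | k S. k \<in> J \<and> S \<in> sets borel}"

lemma tree_sigma_eq_past: "tree_sigma M X n = past M X (tree n)"
  by (simp add: tree_sigma_def past_def)

lemma space_past [simp]: "space (past M X J) = space M"
  unfolding past_def by (rule space_measure_of) auto

lemma sets_past: "sets (past M X J) = sigma_sets (space M) {X k -` S \<inter> space M | k S. k \<in> J \<and> S \<in> sets borel}"
  unfolding past_def by (rule sets_measure_of) auto

lemma measurable_past: "i \<in> J \<Longrightarrow> X i \<in> borel_measurable (past M X J)"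
  by (rule measurableI) (auto simp: sets_past intro!: sigma_sets.Basic)

lemma subalgebra_past:
  assumes "\<And>i. i \<in> J \<Longrightarrow> X i \<in> borel_measurable M"
  shows "subalgebra M (past M X J)"
  unfolding subalgebra_def sets_past
  by (simp, rule sets.sigma_sets_subset) (use assms in \<open>auto intro: measurable_sets\<close>)

lemma sets_past_mono: "J \<subseteq> J' \<Longrightarrow> sets (past M X J) \<subseteq> sets (past M X J')"
  unfolding sets_past by (rule sigma_sets_mono') auto

lemma ex_gen: "1 \<le> k \<Longrightarrow> \<exists>l. k \<in> gen l"
proof -
  assume k: "1 \<le> k"
  have "k < 2 ^ (k + 1)" by (rule less_le_trans[OF less_exp]) simp
  then have "k \<in> tree k" using k by (simp add: tree_eq)
  then show ?thesis by (auto simp: tree_def)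
qed

lemma power4_add_le: "(x + y) ^ 4 \<le> 8 * (x ^ 4 + y ^ 4)" for x y :: real
proof -
  have s: "(u + v)\<^sup>2 \<le> 2 * (u\<^sup>2 + v\<^sup>2)" for u v :: real
    using zero_le_power2[of "u - v"] by (simp add: power2_eq_square algebra_simps)
  have "(x + y) ^ 4 = ((x + y)\<^sup>2)\<^sup>2" by (simp flip: power_mult)
  also have "\<dots> \<le> (2 * (x\<^sup>2 + y\<^sup>2))\<^sup>2" by (intro power_mono s) simp
  also have "\<dots> = 4 * (x\<^sup>2 + y\<^sup>2)\<^sup>2" unfolding power_mult_distrib by simp
  also have "\<dots> \<le> 4 * (2 * ((x\<^sup>2)\<^sup>2 + (y\<^sup>2)\<^sup>2))" by (intro mult_left_mono s) simp
  finally show ?thesis by (simp flip: power_mult)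
qed

lemma power8_add_le: "(x + y) ^ 8 \<le> 128 * (x ^ 8 + y ^ 8)" for x y :: real
proof -
  have "(x + y) ^ 8 = ((x + y) ^ 4)\<^sup>2" by (simp flip: power_mult)
  also have "\<dots> \<le> (8 * (x ^ 4 + y ^ 4))\<^sup>2" by (intro power_mono power4_add_le) simp
  also have "\<dots> = 64 * (x ^ 4 + y ^ 4)\<^sup>2" unfolding power_mult_distrib by simp
  also have "\<dots> \<le> 64 * (2 * ((x ^ 4)\<^sup>2 + (y ^ 4)\<^sup>2))"
    using zero_le_power2[of "x ^ 4 - y ^ 4"] by (simp add: power2_eq_square algebra_simps)
  finally show ?thesis by (simp flip: power_mult)
qed

text \<open>The class L^8. It is closed under linear combinations, hence contains the whole process,
  and products of fourth powers of two of its members are integrable.\<close>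

definition L8 :: "'w measure \<Rightarrow> ('w \<Rightarrow> real) \<Rightarrow> bool" where
  "L8 M f \<longleftrightarrow> f \<in> borel_measurable M \<and> integrable M (\<lambda>x. f x ^ 8)"

context prob_space
begin

lemma L8_const: "L8 M (\<lambda>_. c)"
  by (simp add: L8_def)

lemma L8_scale: "L8 M f \<Longrightarrow> L8 M (\<lambda>x. c * f x)"
  by (auto simp: L8_def power_mult_distrib)

lemma L8_add:
  assumes "L8 M f" "L8 M g" shows "L8 M (\<lambda>x. f x + g x)"
proof -
  have m: "f \<in> borel_measurable M" "g \<in> borel_measurable M" and i: "integrable M (\<lambda>x. f x ^ 8)" "integrable M (\<lambda>x. g x ^ 8)"
    using assms by (auto simp: L8_def)
  have "integrable M (\<lambda>x. (f x + g x) ^ 8)"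
  proof (rule Bochner_Integration.integrable_bound[of _ "\<lambda>x. 128 * (f x ^ 8 + g x ^ 8)"])
    show "AE x in M. norm ((f x + g x) ^ 8) \<le> norm (128 * (f x ^ 8 + g x ^ 8))"
      using power8_add_le by (intro AE_I2) (simp add: abs_le_iff order_trans[OF _ abs_ge_self])
  qed (use m i in auto)
  then show ?thesis using m by (simp add: L8_def)
qed

lemma L8_sum: "(\<And>i. i \<in> I \<Longrightarrow> L8 M (f i)) \<Longrightarrow> L8 M (\<lambda>x. \<Sum>i\<in>I. f i x)"
  by (induction I rule: infinite_finite_induct) (auto intro!: L8_add simp: L8_const)

lemma L8_cong: "L8 M f \<Longrightarrow> (\<And>x. x \<in> space M \<Longrightarrow> f x = g x) \<Longrightarrow> L8 M g"
  unfolding L8_def using measurable_cong[of M f g borel] Bochner_Integration.integrable_cong[of M M "\<lambda>x. f x ^ 8" "\<lambda>x. g x ^ 8"] by auto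

lemma L8_integrable_mult4:
  assumes "L8 M f" "L8 M g" shows "integrable M (\<lambda>x. f x ^ 4 * g x ^ 4)"
  using integrable_mult_sq[of "\<lambda>x. f x ^ 4" M "\<lambda>x. g x ^ 4"] assms by (auto simp: L8_def simp flip: power_mult)

lemma L8_integrable4:
  assumes "L8 M f" shows "integrable M (\<lambda>x. f x ^ 4)"
  using L8_integrable_mult4[OF assms L8_const[of 1]] by simp

lemma L8_integrable_mult2:
  assumes "L8 M f" "L8 M g" shows "integrable M (\<lambda>x. (f x)\<^sup>2 * (g x)\<^sup>2)"
  using integrable_mult_sq[of "\<lambda>x. (f x)\<^sup>2" M "\<lambda>x. (g x)\<^sup>2"] L8_integrable4[OF assms(1)] L8_integrable4[OF assms(2)] assms
  by (auto simp: L8_def simp flip: power_mult)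

lemma L8_integrable2:
  assumes "L8 M f" shows "integrable M (\<lambda>x. (f x)\<^sup>2)"
  using L8_integrable_mult2[OF assms L8_const[of 1]] by simp

lemma L8_integrable_mult:
  assumes "L8 M f" "L8 M g" shows "integrable M (\<lambda>x. f x * g x)"
  using integrable_mult_sq[of f M g] L8_integrable2[OF assms(1)] L8_integrable2[OF assms(2)] assms by (auto simp: L8_def)

lemma L8_integrable:
  assumes "L8 M f" shows "integrable M f"
  using L8_integrable_mult[OF assms L8_const[of 1]] by simp

end

locale bar_model = prob_space M + bar_coef N a b "\<sigma>\<^sup>2"
  for M :: "'w measure" and N :: "real ^ 'p::{finite,linorder} \<Rightarrow> real" and a b :: "nat \<Rightarrow> real" and \<sigma> :: real +
  fixes X \<epsilon> :: "nat \<Rightarrow> 'w \<Rightarrow> real" and \<rho> \<tau> \<nu> :: real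
  assumes X_rv: "\<And>n. n \<ge> 1 \<Longrightarrow> X n \<in> borel_measurable M"
    and eps_rv: "\<And>n. n \<ge> 2 ^ CARD('p) \<Longrightarrow> \<epsilon> n \<in> borel_measurable M"
    and bar_even: "\<And>n \<omega>. n \<ge> 2 ^ (CARD('p) - 1) \<Longrightarrow> \<omega> \<in> space M \<Longrightarrow>
      X (2 * n) \<omega> = a 0 + (\<Sum>k = 1..CARD('p). a k * X (n div 2 ^ (k - 1)) \<omega>) + \<epsilon> (2 * n) \<omega>"
    and bar_odd: "\<And>n \<omega>. n \<ge> 2 ^ (CARD('p) - 1) \<Longrightarrow> \<omega> \<in> space M \<Longrightarrow>
      X (2 * n + 1) \<omega> = b 0 + (\<Sum>k = 1..CARD('p). b k * X (n div 2 ^ (k - 1)) \<omega>) + \<epsilon> (2 * n + 1) \<omega>"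
    and initial: "\<And>k. 1 \<le> k \<Longrightarrow> k \<le> 2 ^ CARD('p) - 1 \<Longrightarrow> integrable M (\<lambda>\<omega>. X k \<omega> ^ 8)"
    and sigma_pos: "\<sigma>\<^sup>2 > 0" and rho_less: "\<bar>\<rho>\<bar> < \<sigma>\<^sup>2"
    and H1_mean: "\<And>n k. n \<ge> CARD('p) - 1 \<Longrightarrow> k \<in> gen (n + 1) \<Longrightarrow>
      AE \<omega> in M. real_cond_exp M (tree_sigma M X n) (\<epsilon> k) \<omega> = 0"
    and H1_var: "\<And>n k. n \<ge> CARD('p) - 1 \<Longrightarrow> k \<in> gen (n + 1) \<Longrightarrow>
      AE \<omega> in M. real_cond_exp M (tree_sigma M X n) (\<lambda>\<omega>. \<epsilon> k \<omega> ^ 2) \<omega> = \<sigma>\<^sup>2"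
    and H2_cov: "\<And>n k l. n \<ge> CARD('p) - 1 \<Longrightarrow> k \<in> gen (n + 1) \<Longrightarrow> l \<in> gen (n + 1) \<Longrightarrow>
      k \<noteq> l \<Longrightarrow> k div 2 = l div 2 \<Longrightarrow>
      AE \<omega> in M. real_cond_exp M (tree_sigma M X n) (\<lambda>\<omega>. \<epsilon> k \<omega> * \<epsilon> l \<omega>) \<omega> = \<rho>"
    and H2_indep: "\<And>n. n \<ge> CARD('p) - 1 \<Longrightarrow>
      cond_indep_vars M (tree_sigma M X n) (borel :: (real \<times> real) measure)
        (\<lambda>j \<omega>. (\<epsilon> (2 * j) \<omega>, \<epsilon> (2 * j + 1) \<omega>)) (gen n)"
    and H4_tau: "\<And>n k. n \<ge> CARD('p) - 1 \<Longrightarrow> k \<in> gen (n + 1) \<Longrightarrow>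
      AE \<omega> in M. real_cond_exp M (tree_sigma M X n) (\<lambda>\<omega>. \<epsilon> k \<omega> ^ 4) \<omega> = \<tau> ^ 4"
    and H4_nu: "\<And>n k l. n \<ge> CARD('p) - 1 \<Longrightarrow> k \<in> gen (n + 1) \<Longrightarrow> l \<in> gen (n + 1) \<Longrightarrow>
      k \<noteq> l \<Longrightarrow> k div 2 = l div 2 \<Longrightarrow>
      AE \<omega> in M. real_cond_exp M (tree_sigma M X n) (\<lambda>\<omega>. \<epsilon> k \<omega> ^ 2 * \<epsilon> l \<omega> ^ 2) \<omega> = \<nu>\<^sup>2"
    and H5_L8: "\<And>n k. n \<ge> CARD('p) - 1 \<Longrightarrow> k \<in> gen (n + 1) \<Longrightarrow> integrable M (\<lambda>\<omega>. \<epsilon> k \<omega> ^ 8)"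
    and H5_sup: "AE \<omega> in M. (SUP n \<in> {CARD('p) - 1..}. SUP k \<in> gen (n + 1).
      ereal (real_cond_exp M (tree_sigma M X n) (\<lambda>\<omega>. \<epsilon> k \<omega> ^ 8) \<omega>)) < \<infinity>"
begin

definition s0 :: nat where "s0 = 2 ^ (CARD('p) - 1)"

text \<open>The past before the daughters \<open>2 k\<close> and \<open>2 k + 1\<close> of \<open>k\<close> are born.  It contains the
  \<open>\<sigma>\<close>-algebra of the generations up to that of \<open>k\<close>, at which the hypotheses condition.\<close>

definition H :: "nat \<Rightarrow> 'w measure" where "H k = past M X {1..<2 * k}"

lemma s0_ge_1: "1 \<le> s0" by (simp add: s0_def)

lemma double_s0: "2 * s0 = 2 ^ CARD('p)"
  using one_le_CARD[where 'p='p] unfolding s0_def by (simp flip: power_Suc)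

lemma gen_obtain:
  assumes "s0 \<le> k" obtains l where "k \<in> gen l" "CARD('p) - 1 \<le> l"
proof -
  obtain l where l: "k \<in> gen l" using ex_gen[of k] assms s0_ge_1 by auto
  have "CARD('p) - 1 \<le> l"
  proof (rule ccontr)
    assume "\<not> CARD('p) - 1 \<le> l"
    then have "(2::nat) ^ (l + 1) \<le> s0" unfolding s0_def by (intro power_increasing) auto
    then show False using l assms by (auto simp: gen_def)
  qed
  with l that show thesis by blast
qed

lemma gen_ge_s0: "k \<in> gen l \<Longrightarrow> CARD('p) - 1 \<le> l \<Longrightarrow> s0 \<le> k"
  unfolding gen_def s0_def by (auto intro: order_trans[OF power_increasing])

lemma child_gen: "c \<in> {0, 1} \<Longrightarrow> k \<in> gen l \<Longrightarrow> 2 * k + c \<in> gen (l + 1)"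
  using gen_Suc_iff[of "2 * k + c" l] by auto

lemma subalg_H: "subalgebra M (H k)"
  unfolding H_def by (rule subalgebra_past) (use X_rv in auto)

sublocale filtered_prob_space M H
proof
  show "subalgebra M (H k)" for k by (rule subalg_H)
  show "sets (H j) \<subseteq> sets (H k)" if "j \<le> k" for j k
    unfolding H_def by (rule sets_past_mono) (use that in auto)
qed

lemma ancestor_bounds:
  assumes "s0 \<le> k" "i \<in> {1..CARD('p)}"
  shows "1 \<le> k div 2 ^ (i - 1)" "k div 2 ^ (i - 1) \<le> k"
proof -
  have "(2::nat) ^ (i - 1) \<le> s0" unfolding s0_def using assms(2) by (intro power_increasing) auto
  then have "2 ^ (i - 1) \<le> k" using assms(1) by (rule order_trans)
  then have "2 ^ (i - 1) div 2 ^ (i - 1) \<le> k div 2 ^ (i - 1)" by (rule div_le_mono)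
  then show "1 \<le> k div 2 ^ (i - 1)" by simp
qed simp

lemma X_H: "1 \<le> i \<Longrightarrow> i < 2 * k \<Longrightarrow> X i \<in> borel_measurable (H k)"
  unfolding H_def by (rule measurable_past) auto

lemma eps_eq:
  assumes "s0 \<le> k" "\<omega> \<in> space M" "c \<in> {0, 1}"
  shows "\<epsilon> (2 * k + c) \<omega> = X (2 * k + c) \<omega> - (if c = 0 then a 0 else b 0)
     - (\<Sum>i = 1..CARD('p). (if c = 0 then a i else b i) * X (k div 2 ^ (i - 1)) \<omega>)"
proof (cases "c = 0")
  case True
  then show ?thesis using bar_even[of k \<omega>] assms(1,2) by (simp add: s0_def)
next
  case False
  then have "c = 1" using assms(3) by simp
  then show ?thesis using bar_odd[of k \<omega>] assms(1,2) by (simp add: s0_def)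
qed

lemma eps_M: "s0 \<le> k \<Longrightarrow> \<epsilon> (2 * k + c) \<in> borel_measurable M"
  by (rule eps_rv) (simp flip: double_s0)

text \<open>The autoregressive equation, solved for the noise, expresses it through the trajectory
  up to the daughters of \<open>k\<close>.\<close>

lemma eps_H_Suc:
  assumes k: "s0 \<le> k" and c: "c \<in> {0, 1}"
  shows "\<epsilon> (2 * k + c) \<in> borel_measurable (H (Suc k))"
proof -
  have sp: "space (H (Suc k)) = space M" by (simp add: H_def)
  have [measurable]: "X (2 * k + c) \<in> borel_measurable (H (Suc k))" using s0_ge_1 k c by (intro X_H) auto
  have [measurable]: "X (k div 2 ^ (i - 1)) \<in> borel_measurable (H (Suc k))" if "i \<in> {1..CARD('p)}" for i
  proof (rule X_H)
    show "k div 2 ^ (i - 1) < 2 * Suc k" by (rule le_less_trans[OF ancestor_bounds(2)[OF k that]]) simp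
  qed (rule ancestor_bounds(1)[OF k that])
  have "(\<lambda>\<omega>. X (2 * k + c) \<omega> - (if c = 0 then a 0 else b 0)
     - (\<Sum>i = 1..CARD('p). (if c = 0 then a i else b i) * X (k div 2 ^ (i - 1)) \<omega>)) \<in> borel_measurable (H (Suc k))"
    by measurable
  then show ?thesis
    by (rule measurable_cong[THEN iffD2, rotated]) (use eps_eq[OF k _ c] sp in auto)
qed

text \<open>\<open>H k\<close> is generated by the generations up to \<open>l\<close> together with
  the noise pairs of the mothers before \<open>k\<close> in generation \<open>l\<close>. Conditional
  independence of the pairs lets \<open>real_cond_exp_enlarge\<close> discard the latter.\<close>

lemma real_cond_exp_H:
  fixes g :: "real \<times> real \<Rightarrow> real"
  assumes k: "k \<in> gen l" and l: "CARD('p) - 1 \<le> l" and g: "g \<in> borel_measurable borel"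
    and int: "integrable M (\<lambda>\<omega>. g (\<epsilon> (2 * k) \<omega>, \<epsilon> (2 * k + 1) \<omega>))"
  shows "AE \<omega> in M. real_cond_exp M (H k) (\<lambda>\<omega>. g (\<epsilon> (2 * k) \<omega>, \<epsilon> (2 * k + 1) \<omega>)) \<omega>
    = real_cond_exp M (tree_sigma M X l) (\<lambda>\<omega>. g (\<epsilon> (2 * k) \<omega>, \<epsilon> (2 * k + 1) \<omega>)) \<omega>"
proof (rule real_cond_exp_enlarge[where Y = "\<lambda>j \<omega>. (\<epsilon> (2 * j) \<omega>, \<epsilon> (2 * j + 1) \<omega>)" and Js = "{j \<in> gen l. j < k}", OF _ subalg_H H2_indep[OF l] k])
  let ?F = "tree_sigma M X l" and ?Y = "\<lambda>j \<omega>. (\<epsilon> (2 * j) \<omega>, \<epsilon> (2 * j + 1) \<omega>)"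
  show subF: "subalgebra M ?F" unfolding tree_sigma_eq_past by (rule subalgebra_past) (use X_rv in \<open>auto simp: tree_eq\<close>)
  have spF: "space ?F = space M" using subF by (simp add: subalgebra_def)
  show "sets ?F \<subseteq> sets (H k)" unfolding tree_sigma_eq_past H_def
    by (rule sets_past_mono) (use k in \<open>auto simp: tree_eq gen_def\<close>)
  define G where "G = {A \<inter> {\<omega> \<in> space M. \<forall>j\<in>J. ?Y j \<omega> \<in> B j} | A J B.
      A \<in> sets ?F \<and> J \<subseteq> {j \<in> gen l. j < k} \<and> finite J \<and> (\<forall>j\<in>J. B j \<in> sets (borel :: (real \<times> real) measure))}"
  have GP: "G \<subseteq> Pow (space M)" by (auto simp: G_def)
  define K where "K = sigma (space M) G"
  have spK: "space K = space M" and setsK: "sets K = sigma_sets (space M) G" unfolding K_def using GP by auto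
  have GK: "E \<in> sets K" if "E \<in> G" for E unfolding setsK using that by (rule sigma_sets.Basic)
  have FK: "sets ?F \<subseteq> sets K"
  proof
    fix A assume A: "A \<in> sets ?F"
    have "A \<subseteq> space M" using A subF sets.sets_into_space[of A ?F] by (simp add: subalgebra_def)
    then have "A = A \<inter> {\<omega> \<in> space M. \<forall>j\<in>{}. ?Y j \<omega> \<in> {}}" by auto
    then have "A \<in> G" unfolding G_def using A by blast
    then show "A \<in> sets K" by (rule GK)
  qed
  have XF: "X i \<in> borel_measurable K" if "i \<in> tree l" for i
  proof -
    have "X i \<in> borel_measurable ?F" unfolding tree_sigma_eq_past by (rule measurable_past[OF that])
    then show ?thesis by (rule measurable_from_subalg[rotated]) (use FK subF spK in \<open>auto simp: subalgebra_def\<close>)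
  qed
  have YK: "?Y j \<in> measurable K borel" if j: "j \<in> gen l" "j < k" for j
  proof (rule measurableI)
    fix B :: "(real \<times> real) set" assume B: "B \<in> sets borel"
    have "?Y j -` B \<inter> space K = space M \<inter> {\<omega> \<in> space M. \<forall>j\<in>{j}. ?Y j \<omega> \<in> B}" unfolding spK by auto
    moreover have "space M \<in> sets ?F" unfolding spF[symmetric] by (rule sets.top)
    ultimately have "?Y j -` B \<inter> space K \<in> G" unfolding G_def mem_Collect_eq
      by (intro exI[of _ "space M"] exI[of _ "{j}"] exI[of _ "\<lambda>_. B"]) (use B j in simp)
    then show "?Y j -` B \<inter> space K \<in> sets K" by (rule GK)
  qed auto
  have XK: "X i \<in> borel_measurable K" if i: "i \<in> {1..<2 * k}" for i
  proof (cases "i \<in> tree l")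
    case True then show ?thesis by (rule XF)
  next
    case False
    \<comment> \<open>A vertex beyond generation \<open>l\<close> but before the daughters of
      \<open>k\<close> has its mother \<open>j\<close> in generation \<open>l\<close> and before
      \<open>k\<close>; it is rebuilt from the ancestors and the noise pair of
      \<open>j\<close>.\<close>
    define j where "j = i div 2"
    define c where "c = i mod 2"
    have ij: "i = 2 * j + c" and c: "c \<in> {0, 1}" by (auto simp: j_def c_def)
    have jk: "j < k" using i by (auto simp: j_def)
    have jl: "j \<in> gen l" using False i k jk unfolding tree_eq gen_def j_def by auto
    have js: "s0 \<le> j" using gen_ge_s0[OF jl l] .
    have [measurable]: "X (j div 2 ^ (m - 1)) \<in> borel_measurable K" if "m \<in> {1..CARD('p)}" for m
    proof (rule XF)
      have "j div 2 ^ (m - 1) < 2 ^ (l + 1)"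
        by (rule le_less_trans[OF ancestor_bounds(2)[OF js that]]) (use jl in \<open>simp add: gen_def\<close>)
      then show "j div 2 ^ (m - 1) \<in> tree l" unfolding tree_eq atLeastLessThan_iff
        using ancestor_bounds(1)[OF js that] by blast
    qed
    have e01 [measurable]: "(\<lambda>\<omega>. \<epsilon> (2 * j) \<omega>) \<in> borel_measurable K" "(\<lambda>\<omega>. \<epsilon> (2 * j + 1) \<omega>) \<in> borel_measurable K"
      using measurable_compose[OF YK[OF jl jk] borel_measurable_continuous_onI[of fst]]
        measurable_compose[OF YK[OF jl jk] borel_measurable_continuous_onI[of snd]] continuous_on_fst[OF continuous_on_id, of "UNIV :: (real \<times> real) set"]
        continuous_on_snd[OF continuous_on_id, of "UNIV :: (real \<times> real) set"] by auto
    have "\<epsilon> i \<in> borel_measurable K" using ij c e01 by auto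
    then have "(\<lambda>\<omega>. \<epsilon> i \<omega> + (if c = 0 then a 0 else b 0)
     + (\<Sum>m = 1..CARD('p). (if c = 0 then a m else b m) * X (j div 2 ^ (m - 1)) \<omega>)) \<in> borel_measurable K"
      by measurable
    then show ?thesis
      by (rule measurable_cong[THEN iffD2, rotated]) (use eps_eq[OF js _ c] spK ij in auto)
  qed
  have XS: "X i -` S \<inter> space M \<in> sets K" if "i \<in> {1..<2 * k}" "S \<in> sets borel" for i S
    using measurable_sets[OF XK[OF that(1)] that(2)] by (simp add: spK)
  have "sets (H k) \<subseteq> sets K"
    unfolding H_def sets_past setsK[symmetric]
    by (rule sets.sigma_sets_subset[where M = K, unfolded spK]) (use XS in blast)
  then show "sets (H k) \<subseteq> sigma_sets (space M) {A \<inter> {\<omega> \<in> space M. \<forall>j\<in>J. ?Y j \<omega> \<in> B j} | A J B.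
      A \<in> sets ?F \<and> J \<subseteq> {j \<in> gen l. j < k} \<and> finite J \<and> (\<forall>j\<in>J. B j \<in> sets (borel :: (real \<times> real) measure))}"
    unfolding setsK G_def .
qed (use g int in auto)

end

lemma convex_power4:
  fixes x y t :: real
  assumes "0 \<le> t" "t \<le> 1"
  shows "(t * x + (1 - t) * y) ^ 4 \<le> t * x ^ 4 + (1 - t) * y ^ 4"
proof -
  have s: "(t * u + (1 - t) * v)\<^sup>2 \<le> t * u\<^sup>2 + (1 - t) * v\<^sup>2" for u v
  proof -
    have "t * u\<^sup>2 + (1 - t) * v\<^sup>2 - (t * u + (1 - t) * v)\<^sup>2 = t * (1 - t) * (u - v)\<^sup>2"
      by (simp add: power2_eq_square algebra_simps)
    moreover have "0 \<le> t * (1 - t) * (u - v)\<^sup>2" using assms by simp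
    ultimately show ?thesis by linarith
  qed
  have "(t * x + (1 - t) * y) ^ 4 = ((t * x + (1 - t) * y)\<^sup>2)\<^sup>2" by (simp flip: power_mult)
  also have "\<dots> \<le> (t * x\<^sup>2 + (1 - t) * y\<^sup>2)\<^sup>2" by (intro power_mono s) simp
  also have "\<dots> \<le> t * (x\<^sup>2)\<^sup>2 + (1 - t) * (y\<^sup>2)\<^sup>2" by (rule s)
  finally show ?thesis by (simp flip: power_mult)
qed

section \<open>Moments of the noise and of the process\<close>

context bar_model
begin

lemma eps_L8: assumes "s0 \<le> k" "c \<in> {0, 1}" shows "L8 M (\<epsilon> (2 * k + c))"
proof -
  obtain l where l: "k \<in> gen l" "CARD('p) - 1 \<le> l" using gen_obtain[OF assms(1)] .
  show ?thesis unfolding L8_def using eps_M[OF assms(1)] H5_L8[OF l(2) child_gen[OF assms(2) l(1)]] by auto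
qed

lemma X_L8: "1 \<le> n \<Longrightarrow> L8 M (X n)"
proof (induction n rule: less_induct)
  case (less n)
  show ?case
  proof (cases "n < 2 * s0")
    case True
    then have "n \<le> 2 ^ CARD('p) - 1" using double_s0 by linarith
    then show ?thesis unfolding L8_def using X_rv[OF less.prems] initial[OF less.prems] by auto
  next
    case False
    define k where "k = n div 2"
    define c where "c = n mod 2"
    have n: "n = 2 * k + c" and c: "c \<in> {0, 1}" and k: "s0 \<le> k" using False by (auto simp: k_def c_def)
    have kn: "k < n" using k s0_ge_1 n by linarith
    have L: "L8 M (X (k div 2 ^ (i - 1)))" if "i \<in> {1..CARD('p)}" for i
      by (rule less.IH[OF le_less_trans[OF ancestor_bounds(2)[OF k that] kn] ancestor_bounds(1)[OF k that]])
    have "L8 M (\<lambda>\<omega>. \<epsilon> (2 * k + c) \<omega> + ((if c = 0 then a 0 else b 0)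
     + (\<Sum>i = 1..CARD('p). (if c = 0 then a i else b i) * X (k div 2 ^ (i - 1)) \<omega>)))"
      by (intro L8_add L8_sum L8_scale L8_const eps_L8 L k c) 
    then show ?thesis by (rule L8_cong) (use eps_eq[OF k _ c] n in simp)
  qed
qed

text \<open>Presents the noise of one daughter as a function of the pair, the form in which
  \<open>real_cond_exp_H\<close> applies.\<close>

definition sel :: "nat \<Rightarrow> real \<times> real \<Rightarrow> real" where "sel c z = (if c = 0 then fst z else snd z)"

lemma sel_measurable [measurable]: "sel c \<in> borel_measurable borel"
  unfolding sel_def
  using continuous_on_fst[OF continuous_on_id, of "UNIV :: (real \<times> real) set"]
    continuous_on_snd[OF continuous_on_id, of "UNIV :: (real \<times> real) set"]
  by (cases "c = 0") (auto intro!: borel_measurable_continuous_onI)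

lemma sel_eps: "c \<in> {0, 1} \<Longrightarrow> sel c (\<epsilon> (2 * k) \<omega>, \<epsilon> (2 * k + 1) \<omega>) = \<epsilon> (2 * k + c) \<omega>"
  by (auto simp: sel_def)

lemma cond_mean:
  assumes k: "s0 \<le> k" and c: "c \<in> {0, 1}"
  shows "AE \<omega> in M. real_cond_exp M (H k) (\<epsilon> (2 * k + c)) \<omega> = 0"
proof -
  obtain l where l: "k \<in> gen l" "CARD('p) - 1 \<le> l" using gen_obtain[OF k] .
  show ?thesis
    using real_cond_exp_H[OF l sel_measurable[of c]] L8_integrable[OF eps_L8[OF k c]] H1_mean[OF l(2) child_gen[OF c l(1)]]
    unfolding sel_eps[OF c] by auto
qed

lemma cond_var:
  assumes k: "s0 \<le> k" and c: "c \<in> {0, 1}"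
  shows "AE \<omega> in M. real_cond_exp M (H k) (\<lambda>\<omega>. (\<epsilon> (2 * k + c) \<omega>)\<^sup>2) \<omega> = \<sigma>\<^sup>2"
proof -
  obtain l where l: "k \<in> gen l" "CARD('p) - 1 \<le> l" using gen_obtain[OF k] .
  have m: "(\<lambda>z. (sel c z)\<^sup>2) \<in> borel_measurable borel" by measurable
  show ?thesis
    using real_cond_exp_H[OF l m] L8_integrable2[OF eps_L8[OF k c]] H1_var[OF l(2) child_gen[OF c l(1)]]
    unfolding sel_eps[OF c] by auto
qed

lemma cond_4:
  assumes k: "s0 \<le> k" and c: "c \<in> {0, 1}"
  shows "AE \<omega> in M. real_cond_exp M (H k) (\<lambda>\<omega>. \<epsilon> (2 * k + c) \<omega> ^ 4) \<omega> = \<tau> ^ 4"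
proof -
  obtain l where l: "k \<in> gen l" "CARD('p) - 1 \<le> l" using gen_obtain[OF k] .
  have m: "(\<lambda>z. (sel c z) ^ 4) \<in> borel_measurable borel" by measurable
  show ?thesis
    using real_cond_exp_H[OF l m] L8_integrable4[OF eps_L8[OF k c]] H4_tau[OF l(2) child_gen[OF c l(1)]]
    unfolding sel_eps[OF c] by auto
qed

lemma cond_cov:
  assumes k: "s0 \<le> k"
  shows "AE \<omega> in M. real_cond_exp M (H k) (\<lambda>\<omega>. \<epsilon> (2 * k) \<omega> * \<epsilon> (2 * k + 1) \<omega>) \<omega> = \<rho>"
proof -
  obtain l where l: "k \<in> gen l" "CARD('p) - 1 \<le> l" using gen_obtain[OF k] .
  have m: "(\<lambda>z. sel 0 z * sel 1 z) \<in> borel_measurable borel" by measurable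
  have s: "sel 0 (\<epsilon> (2 * k) \<omega>, \<epsilon> (2 * k + 1) \<omega>) * sel 1 (\<epsilon> (2 * k) \<omega>, \<epsilon> (2 * k + 1) \<omega>) = \<epsilon> (2 * k) \<omega> * \<epsilon> (2 * k + 1) \<omega>" for \<omega>
    by (simp add: sel_def)
  have "2 * k \<in> gen (l + 1)" "2 * k + 1 \<in> gen (l + 1)" using child_gen[of 0 k l] child_gen[of 1 k l] l by auto
  then show ?thesis
    using real_cond_exp_H[OF l m] L8_integrable_mult[OF eps_L8[OF k, of 0] eps_L8[OF k, of 1]] H2_cov[OF l(2), of "2 * k" "2 * k + 1"]
    unfolding s by auto
qed

lemma cond_22:
  assumes k: "s0 \<le> k"
  shows "AE \<omega> in M. real_cond_exp M (H k) (\<lambda>\<omega>. (\<epsilon> (2 * k) \<omega>)\<^sup>2 * (\<epsilon> (2 * k + 1) \<omega>)\<^sup>2) \<omega> = \<nu>\<^sup>2"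
proof -
  obtain l where l: "k \<in> gen l" "CARD('p) - 1 \<le> l" using gen_obtain[OF k] .
  have m: "(\<lambda>z. (sel 0 z)\<^sup>2 * (sel 1 z)\<^sup>2) \<in> borel_measurable borel" by measurable
  have s: "(sel 0 (\<epsilon> (2 * k) \<omega>, \<epsilon> (2 * k + 1) \<omega>))\<^sup>2 * (sel 1 (\<epsilon> (2 * k) \<omega>, \<epsilon> (2 * k + 1) \<omega>))\<^sup>2 = (\<epsilon> (2 * k) \<omega>)\<^sup>2 * (\<epsilon> (2 * k + 1) \<omega>)\<^sup>2" for \<omega>
    by (simp add: sel_def)
  have "2 * k \<in> gen (l + 1)" "2 * k + 1 \<in> gen (l + 1)" using child_gen[of 0 k l] child_gen[of 1 k l] l by auto
  then show ?thesis
    using real_cond_exp_H[OF l m] L8_integrable_mult2[OF eps_L8[OF k, of 0] eps_L8[OF k, of 1]] H4_nu[OF l(2), of "2 * k" "2 * k + 1"]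
    unfolding s by auto
qed

text \<open>Countably many null sets are merged, so that one bound, which may depend on the outcome,
  serves for all vertices at once.\<close>

lemma cond_8_bounded:
  "AE \<omega> in M. \<exists>K. \<forall>k\<ge>s0. \<forall>c\<in>{0, 1}. real_cond_exp M (H k) (\<lambda>\<omega>. \<epsilon> (2 * k + c) \<omega> ^ 8) \<omega> \<le> K"
proof -
  have "AE \<omega> in M. \<forall>l\<in>{CARD('p) - 1..}. \<forall>k\<in>gen l. \<forall>c\<in>{0::nat, 1}. real_cond_exp M (H k) (\<lambda>\<omega>. \<epsilon> (2 * k + c) \<omega> ^ 8) \<omega>
      = real_cond_exp M (tree_sigma M X l) (\<lambda>\<omega>. \<epsilon> (2 * k + c) \<omega> ^ 8) \<omega>"
  proof (intro AE_ball_countable' countableI_type)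
    fix l k and c :: nat assume l: "l \<in> {CARD('p) - 1..}" and k: "k \<in> gen l" and c: "c \<in> {0, 1}"
    have m: "(\<lambda>z. (sel c z) ^ 8) \<in> borel_measurable borel" by measurable
    have "integrable M (\<lambda>\<omega>. \<epsilon> (2 * k + c) \<omega> ^ 8)"
      using eps_L8[OF gen_ge_s0[OF k] c] l by (auto simp: L8_def)
    then show "AE \<omega> in M. real_cond_exp M (H k) (\<lambda>\<omega>. \<epsilon> (2 * k + c) \<omega> ^ 8) \<omega>
      = real_cond_exp M (tree_sigma M X l) (\<lambda>\<omega>. \<epsilon> (2 * k + c) \<omega> ^ 8) \<omega>"
      using real_cond_exp_H[OF k _ m] l unfolding sel_eps[OF c] by auto
  qed
  with H5_sup show ?thesis
  proof eventually_elim
    case (elim \<omega>)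
    let ?S = "SUP n \<in> {CARD('p) - 1..}. SUP k \<in> gen (n + 1).
      ereal (real_cond_exp M (tree_sigma M X n) (\<lambda>\<omega>. \<epsilon> k \<omega> ^ 8) \<omega>)"
    obtain K :: nat where K: "?S < ereal (real K)" using elim(1) less_PInf_Ex_of_nat[of ?S] by auto
    have "real_cond_exp M (H k) (\<lambda>\<omega>. \<epsilon> (2 * k + c) \<omega> ^ 8) \<omega> \<le> real K" if k: "k \<ge> s0" and c: "c \<in> {0, 1}" for k c
    proof -
      obtain l where l: "k \<in> gen l" "CARD('p) - 1 \<le> l" using gen_obtain[OF k] .
      have "ereal (real_cond_exp M (tree_sigma M X l) (\<lambda>\<omega>. \<epsilon> (2 * k + c) \<omega> ^ 8) \<omega>)
        \<le> (SUP k \<in> gen (l + 1). ereal (real_cond_exp M (tree_sigma M X l) (\<lambda>\<omega>. \<epsilon> k \<omega> ^ 8) \<omega>))"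
        using child_gen[OF c l(1)] by (rule SUP_upper)
      also have "\<dots> \<le> ?S" using l(2) by (intro SUP_upper) simp
      finally have "ereal (real_cond_exp M (tree_sigma M X l) (\<lambda>\<omega>. \<epsilon> (2 * k + c) \<omega> ^ 8) \<omega>) < ereal (real K)"
        using K by (rule le_less_trans)
      then show ?thesis using elim(2) l c by auto
    qed
    then show ?case by blast
  qed
qed

definition YX :: "nat \<Rightarrow> 'p option \<Rightarrow> 'w \<Rightarrow> real" where
  "YX k i \<omega> = (Yvec (\<lambda>j. X j \<omega>) k :: real ^ ('p option)) $ i"

lemma YX_None: "YX k None = (\<lambda>\<omega>. 1)" and YX_Some: "YX k (Some i) = X (k div 2 ^ (pos i - 1))"
  by (auto simp: YX_def Yvec_def state_vec_def)

lemma YX_H: assumes "s0 \<le> k" shows "YX k i \<in> borel_measurable (H k)"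
proof (cases i)
  case (Some j)
  have j: "pos j \<in> {1..CARD('p)}" by (simp add: Suc_leI)
  have "1 \<le> k div 2 ^ (pos j - 1)" "k div 2 ^ (pos j - 1) < 2 * k"
    using ancestor_bounds(1)[OF assms j] le_less_trans[OF ancestor_bounds(2)[OF assms j], of "2 * k"] assms s0_ge_1 by auto
  then show ?thesis unfolding Some YX_Some by (rule X_H)
qed (simp add: YX_None)

lemma YX_L8: assumes "s0 \<le> k" shows "L8 M (YX k i)"
proof (cases i)
  case (Some j)
  have j: "pos j \<in> {1..CARD('p)}" by (simp add: Suc_leI)
  show ?thesis unfolding Some YX_Some by (rule X_L8[OF ancestor_bounds(1)[OF assms j]])
qed (simp add: YX_None L8_const)

lemma path: "\<omega> \<in> space M \<Longrightarrow> bar_path N a b (\<lambda>k. X k \<omega>) (\<lambda>k. \<epsilon> k \<omega>)"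
  by unfold_locales (use bar_even bar_odd in auto)

lemma integral_eps4: assumes "s0 \<le> k" "c \<in> {0, 1}" shows "(\<integral>\<omega>. \<epsilon> (2 * k + c) \<omega> ^ 4 \<partial>M) = \<tau> ^ 4"
proof -
  have "(\<integral>\<omega>. 1 * \<epsilon> (2 * k + c) \<omega> ^ 4 \<partial>M) = (\<integral>\<omega>. 1 * \<tau> ^ 4 \<partial>M)"
    by (rule cond_exp_intg(2)[OF cond_4[OF assms], symmetric]) (use L8_integrable4[OF eps_L8[OF assms]] in auto)
  then show ?thesis by (simp add: prob_space)
qed

text \<open>The norm of a daughter's state is at most a convex combination, with weights
  \<open>\<beta>\<close> and 1 - \<open>\<beta>\<close>, of the norm of the mother's state and a
  multiple of the size of the input. Convexity of the fourth power carries this over to fourth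
  moments, and a bound above \<open>K\<close> then propagates along lineages.\<close>

lemma YX_moment4: "\<exists>C\<ge>0. \<forall>k\<ge>s0. \<forall>i. (\<integral>\<omega>. YX k i \<omega> ^ 4 \<partial>M) \<le> C"
proof -
  obtain C1 where C1: "0 < C1" "\<And>u. N u \<le> C1 * norm u" using N_upper by blast
  obtain c0 where c0: "0 < c0" "\<And>u. c0 * norm u \<le> N u" using N_lower by blast
  define S where "S = (\<lambda>k \<omega>. state_vec (\<lambda>j. X j \<omega>) k :: (real, 'p) vec)"
  have S_nth: "S k \<omega> $ i = YX k (Some i) \<omega>" for k \<omega> i by (simp add: S_def YX_Some state_vec_def)
  define F where "F = (\<lambda>k \<omega>. N (S k \<omega>) ^ 4)"
  have Fm: "F k \<in> borel_measurable M" if k: "s0 \<le> k" for k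
  proof -
    have "S k \<in> borel_measurable M"
      by (subst borel_measurable_euclidean_space)
         (use YX_L8[OF k] in \<open>auto simp: Basis_vec_eq inner_axis S_nth L8_def\<close>)
    then have "(\<lambda>\<omega>. N (S k \<omega>)) \<in> borel_measurable M"
      by (rule measurable_compose) (rule borel_measurable_continuous_onI[OF N_continuous])
    then show ?thesis unfolding F_def by measurable
  qed
  have Fi: "integrable M (F k)" if k: "s0 \<le> k" for k
  proof (rule Bochner_Integration.integrable_bound[OF _ Fm[OF k]])
    show "integrable M (\<lambda>\<omega>. C1 ^ 4 * (real CARD('p) * (\<Sum>i\<in>UNIV. YX k (Some i) \<omega> ^ 4)))"
      using L8_integrable4[OF YX_L8[OF k]] by auto
    show "AE \<omega> in M. norm (F k \<omega>) \<le> norm (C1 ^ 4 * (real CARD('p) * (\<Sum>i\<in>UNIV. YX k (Some i) \<omega> ^ 4)))"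
    proof (rule AE_I2)
      fix \<omega>
      have "F k \<omega> \<le> (C1 * norm (S k \<omega>)) ^ 4" unfolding F_def by (intro power_mono C1 N_nonneg)
      also have "\<dots> = C1 ^ 4 * ((norm (S k \<omega>))\<^sup>2)\<^sup>2" by (simp add: power_mult_distrib flip: power_mult)
      also have "(norm (S k \<omega>))\<^sup>2 = (\<Sum>i\<in>UNIV. (YX k (Some i) \<omega>)\<^sup>2)"
        unfolding power2_norm_eq_inner inner_vec_def S_nth by (simp add: power2_eq_square)
      also have "(\<Sum>i\<in>UNIV. (YX k (Some i) \<omega>)\<^sup>2)\<^sup>2 \<le> (\<Sum>i\<in>UNIV. ((YX k (Some i) \<omega>)\<^sup>2)\<^sup>2) * real CARD('p)"
        by (rule sum_squared_le_sum_of_squares)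
      finally have "F k \<omega> \<le> C1 ^ 4 * (real CARD('p) * (\<Sum>i\<in>UNIV. YX k (Some i) \<omega> ^ 4))"
        using C1 by (simp add: mult.commute flip: power_mult)
      moreover have "0 \<le> F k \<omega>" by (simp add: F_def)
      ultimately show "norm (F k \<omega>) \<le> norm (C1 ^ 4 * (real CARD('p) * (\<Sum>i\<in>UNIV. YX k (Some i) \<omega> ^ 4)))" by simp
    qed
  qed
  \<comment> \<open>The division by 1 - \<open>\<beta>\<close> turns the additive input into a term
    of weight 1 - \<open>\<beta>\<close> in a convex combination.\<close>
  define g where "g = N e1 / (1 - \<beta>)"
  have g0: "0 \<le> g" unfolding g_def using N_nonneg \<beta>_bounds by simp
  define K where "K = 8 * g ^ 4 * (a 0 ^ 4 + b 0 ^ 4 + \<tau> ^ 4)"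
  have K0: "0 \<le> K" using g0 by (simp add: K_def)
  have Frec: "(\<integral>\<omega>. F (2 * k + c) \<omega> \<partial>M) \<le> \<beta> * (\<integral>\<omega>. F k \<omega> \<partial>M) + (1 - \<beta>) * K" if k: "s0 \<le> k" and c: "c \<in> {0, 1}" for k c
  proof -
    have k2: "s0 \<le> 2 * k + c" using k by simp
    let ?c0 = "if c = 0 then a 0 else b 0"
    have pt: "F (2 * k + c) \<omega> \<le> \<beta> * F k \<omega> + (1 - \<beta>) * (8 * g ^ 4 * (?c0 ^ 4 + \<epsilon> (2 * k + c) \<omega> ^ 4))" if \<omega>: "\<omega> \<in> space M" for \<omega>
    proof -
      interpret P: bar_path N a b "\<sigma>\<^sup>2" "\<lambda>k. X k \<omega>" "\<lambda>k. \<epsilon> k \<omega>" by (rule path[OF \<omega>])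
      have "S (2 * k + c) \<omega> = (if c = 0 then A else B) *v S k \<omega> + (?c0 + \<epsilon> (2 * k + c) \<omega>) *\<^sub>R e1"
        using P.state_even[of k] P.state_odd[of k] k c by (auto simp: S_def s0_def)
      then have "N (S (2 * k + c) \<omega>) \<le> N ((if c = 0 then A else B) *v S k \<omega>) + N ((?c0 + \<epsilon> (2 * k + c) \<omega>) *\<^sub>R e1)"
        by (metis N_add)
      also have "\<dots> \<le> \<beta> * N (S k \<omega>) + \<bar>?c0 + \<epsilon> (2 * k + c) \<omega>\<bar> * N e1"
        unfolding N_scale using N_A N_B by (intro add_right_mono) simp
      also have "\<dots> = \<beta> * N (S k \<omega>) + (1 - \<beta>) * (g * \<bar>?c0 + \<epsilon> (2 * k + c) \<omega>\<bar>)"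
        using \<beta>_bounds by (simp add: g_def)
      finally have "F (2 * k + c) \<omega> \<le> (\<beta> * N (S k \<omega>) + (1 - \<beta>) * (g * \<bar>?c0 + \<epsilon> (2 * k + c) \<omega>\<bar>)) ^ 4"
        unfolding F_def by (intro power_mono N_nonneg)
      also have "\<dots> \<le> \<beta> * F k \<omega> + (1 - \<beta>) * (g * \<bar>?c0 + \<epsilon> (2 * k + c) \<omega>\<bar>) ^ 4"
        unfolding F_def using \<beta>_bounds by (intro convex_power4) auto
      also have "(g * \<bar>?c0 + \<epsilon> (2 * k + c) \<omega>\<bar>) ^ 4 = g ^ 4 * (?c0 + \<epsilon> (2 * k + c) \<omega>) ^ 4"
        by (simp add: power_mult_distrib power_even_abs)
      also have "\<beta> * F k \<omega> + (1 - \<beta>) * \<dots> \<le> \<beta> * F k \<omega> + (1 - \<beta>) * (g ^ 4 * (8 * (?c0 ^ 4 + \<epsilon> (2 * k + c) \<omega> ^ 4)))"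
        using \<beta>_bounds g0 by (intro add_left_mono mult_left_mono power4_add_le) auto
      finally show ?thesis by (simp only: mult_ac)
    qed
    have ei: "integrable M (\<lambda>\<omega>. \<epsilon> (2 * k + c) \<omega> ^ 4)" by (rule L8_integrable4[OF eps_L8[OF k c]])
    have "(\<integral>\<omega>. F (2 * k + c) \<omega> \<partial>M) \<le> (\<integral>\<omega>. \<beta> * F k \<omega> + (1 - \<beta>) * (8 * g ^ 4 * (?c0 ^ 4 + \<epsilon> (2 * k + c) \<omega> ^ 4)) \<partial>M)"
      by (intro integral_mono pt Fi k2) (use Fi[OF k] ei in auto)
    also have "\<dots> = \<beta> * (\<integral>\<omega>. F k \<omega> \<partial>M) + (1 - \<beta>) * (8 * g ^ 4 * (?c0 ^ 4 + \<tau> ^ 4))"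
      using Fi[OF k] ei by (simp add: integral_eps4[OF k c] prob_space)
    also have "\<dots> \<le> \<beta> * (\<integral>\<omega>. F k \<omega> \<partial>M) + (1 - \<beta>) * K"
      unfolding K_def using \<beta>_bounds g0 by (intro add_left_mono mult_left_mono) auto
    finally show ?thesis .
  qed
  \<comment> \<open>The first generation is covered by brute summation, every later vertex by the
    recursion, since \<open>K\<close> is at most \<open>C\<close>.\<close>
  define C where "C = K + (\<Sum>k\<in>{s0..<2 * s0}. \<integral>\<omega>. F k \<omega> \<partial>M)"
  have F0: "0 \<le> (\<integral>\<omega>. F k \<omega> \<partial>M)" for k by (simp add: F_def)
  have C0: "0 \<le> C" "K \<le> C" using K0 F0 by (auto simp: C_def intro!: add_nonneg_nonneg sum_nonneg)
  have FC: "s0 \<le> k \<Longrightarrow> (\<integral>\<omega>. F k \<omega> \<partial>M) \<le> C" for k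
  proof (induction k rule: less_induct)
    case (less k)
    show ?case
    proof (cases "k < 2 * s0")
      case True
      then have "(\<integral>\<omega>. F k \<omega> \<partial>M) \<le> (\<Sum>k\<in>{s0..<2 * s0}. \<integral>\<omega>. F k \<omega> \<partial>M)"
        using less.prems F0 by (intro member_le_sum) auto
      then show ?thesis using K0 by (simp add: C_def)
    next
      case False
      define j where "j = k div 2"
      define c where "c = k mod 2"
      have kj: "k = 2 * j + c" and c: "c \<in> {0, 1}" and j: "s0 \<le> j" using False by (auto simp: j_def c_def)
      have "j < k" using j s0_ge_1 kj by linarith
      have "(\<integral>\<omega>. F k \<omega> \<partial>M) \<le> \<beta> * (\<integral>\<omega>. F j \<omega> \<partial>M) + (1 - \<beta>) * K" unfolding kj by (rule Frec[OF j c])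
      also have "\<dots> \<le> \<beta> * C + (1 - \<beta>) * C"
        using less.IH[OF \<open>j < k\<close> j] C0 \<beta>_bounds by (intro add_mono mult_left_mono) auto
      finally show ?thesis by (simp add: algebra_simps)
    qed
  qed
  have "(\<integral>\<omega>. YX k i \<omega> ^ 4 \<partial>M) \<le> 1 + C / c0 ^ 4" if k: "s0 \<le> k" for k i
  proof (cases i)
    case None
    then show ?thesis using C0 c0 by (simp add: YX_None prob_space)
  next
    case (Some j)
    have "YX k (Some j) \<omega> ^ 4 \<le> F k \<omega> / c0 ^ 4" for \<omega>
    proof -
      have "\<bar>YX k (Some j) \<omega>\<bar> \<le> N (S k \<omega>) / c0"
        using component_le_norm_cart[of "S k \<omega>" j] c0(2)[of "S k \<omega>"] c0(1)
        unfolding S_nth by (simp add: field_simps) (metis mult_left_mono less_imp_le order_trans mult.commute)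
      then have "\<bar>YX k (Some j) \<omega>\<bar> ^ 4 \<le> (N (S k \<omega>) / c0) ^ 4" by (intro power_mono) auto
      then show ?thesis by (simp add: F_def power_divide power_even_abs)
    qed
    then have "(\<integral>\<omega>. YX k i \<omega> ^ 4 \<partial>M) \<le> (\<integral>\<omega>. F k \<omega> / c0 ^ 4 \<partial>M)"
      unfolding Some using L8_integrable4[OF YX_L8[OF k]] Fi[OF k] by (intro integral_mono) auto
    also have "\<dots> \<le> C / c0 ^ 4" using FC[OF k] c0 by (simp add: divide_right_mono)
    finally show ?thesis by simp
  qed
  moreover have "0 \<le> 1 + C / c0 ^ 4" using C0 c0 by simp
  ultimately show ?thesis by blast
qed

end

section \<open>Conditional moments and almost sure control of the noise sums\<close>

context filtered_prob_space
begin

lemma real_cond_exp_const: "AE x in M. real_cond_exp M (H k) (\<lambda>_. c) x = c"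
proof -
  interpret F: sigma_finite_subalgebra M "H k" by (rule sigma_finite_subalgebra_H)
  show ?thesis by (rule F.real_cond_exp_F_meas) auto
qed

lemma real_cond_exp_mult_const:
  assumes f: "f \<in> borel_measurable (H k)" and g: "g \<in> borel_measurable M" and int: "integrable M (\<lambda>x. f x * g x)"
    and c: "AE x in M. real_cond_exp M (H k) g x = c"
  shows "AE x in M. real_cond_exp M (H k) (\<lambda>x. f x * g x) x = f x * c"
proof -
  interpret F: sigma_finite_subalgebra M "H k" by (rule sigma_finite_subalgebra_H)
  show ?thesis using F.real_cond_exp_mult[OF f g int] c by eventually_elim simp
qed

lemma real_cond_exp_add_eq:
  assumes "integrable M f" "integrable M g" "AE x in M. real_cond_exp M (H k) f x = c x" "AE x in M. real_cond_exp M (H k) g x = d x"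
  shows "AE x in M. real_cond_exp M (H k) (\<lambda>x. f x + g x) x = c x + d x"
proof -
  interpret F: sigma_finite_subalgebra M "H k" by (rule sigma_finite_subalgebra_H)
  show ?thesis using F.real_cond_exp_add[OF assms(1,2)] assms(3,4) by eventually_elim simp
qed

end

text \<open>The weight (1/4)^l makes the squared sum the square of the generation mean; thus the
  rate 1/4 in \<open>martingale_growth\<close> amounts to a law of large numbers.\<close>

lemma gen_mean_tendsto_0:
  fixes f :: "nat \<Rightarrow> real"
  assumes "(\<lambda>l. (\<Sum>k\<in>gen l. f k)\<^sup>2 * (1 / 4) ^ l) \<longlonglongrightarrow> 0"
  shows "gen_mean f \<longlonglongrightarrow> 0"
proof -
  have "(\<lambda>l. sqrt ((\<Sum>k\<in>gen l. f k)\<^sup>2 * (1 / 4) ^ l)) \<longlonglongrightarrow> sqrt 0" by (intro tendsto_intros assms)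
  moreover have "sqrt ((\<Sum>k\<in>gen l. f k)\<^sup>2 * (1 / 4) ^ l) = \<bar>gen_mean f l\<bar>" for l
  proof -
    have "(1 / 4 :: real) ^ l = (1 / 2 ^ l)\<^sup>2" 
      by (simp add: power2_eq_square power_divide flip: power_mult_distrib)
    then have "(\<Sum>k\<in>gen l. f k)\<^sup>2 * (1 / 4) ^ l = (gen_mean f l)\<^sup>2" by (simp add: gen_mean_def power_divide)
    then show ?thesis by simp
  qed
  ultimately show ?thesis by (simp add: tendsto_rabs_zero_iff)
qed

lemma mult_sq_le: "x\<^sup>2 * y\<^sup>2 \<le> x ^ 4 + y ^ 4" for x y :: real
proof -
  have "0 \<le> (x\<^sup>2 - y\<^sup>2)\<^sup>2 + x ^ 4 + y ^ 4" by simp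
  then show ?thesis by (simp add: power2_diff flip: power_mult)
qed

lemma power4_sum_le:
  fixes f :: "'i \<Rightarrow> real"
  shows "(\<Sum>i\<in>I. f i) ^ 4 \<le> real (card I) ^ 3 * (\<Sum>i\<in>I. f i ^ 4)"
proof -
  have "(\<Sum>i\<in>I. f i) ^ 4 = ((\<Sum>i\<in>I. f i)\<^sup>2)\<^sup>2" by (simp flip: power_mult)
  also have "\<dots> \<le> ((\<Sum>i\<in>I. (f i)\<^sup>2) * real (card I))\<^sup>2"
    by (intro power_mono sum_squared_le_sum_of_squares) simp
  also have "\<dots> = (\<Sum>i\<in>I. (f i)\<^sup>2)\<^sup>2 * (real (card I))\<^sup>2" by (rule power_mult_distrib)
  also have "\<dots> \<le> ((\<Sum>i\<in>I. ((f i)\<^sup>2)\<^sup>2) * real (card I)) * (real (card I))\<^sup>2"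
    by (intro mult_right_mono sum_squared_le_sum_of_squares) simp
  also have "\<dots> = real (card I) ^ 3 * (\<Sum>i\<in>I. f i ^ 4)"
    by (simp add: power2_eq_square power3_eq_cube power4_eq_xxxx mult_ac)
  finally show ?thesis .
qed

context bar_model
begin

text \<open>The increments of coordinate \<open>i\<close> of the scores, continued by 0 below
  \<open>s0\<close> so that the martingale may be indexed by all natural numbers.\<close>

definition DY :: "nat \<Rightarrow> 'p option \<Rightarrow> nat \<Rightarrow> 'w \<Rightarrow> real" where
  "DY c i k \<omega> = (if s0 \<le> k then YX k i \<omega> * \<epsilon> (2 * k + c) \<omega> else 0)"

definition DE :: "nat \<Rightarrow> nat \<Rightarrow> 'w \<Rightarrow> real" where
  "DE c k \<omega> = (if s0 \<le> k then (\<epsilon> (2 * k + c) \<omega>)\<^sup>2 - \<sigma>\<^sup>2 else 0)"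

lemma YX_M: "s0 \<le> k \<Longrightarrow> YX k i \<in> borel_measurable M"
  by (rule measurable_H_M[OF YX_H])

lemma DY_mart_diff:
  assumes c: "c \<in> {0, 1}"
  shows "\<exists>C. \<forall>k. DY c i k \<in> borel_measurable (H (Suc k)) \<and> integrable M (\<lambda>\<omega>. (DY c i k \<omega>)\<^sup>2) \<and>
    (AE \<omega> in M. real_cond_exp M (H k) (DY c i k) \<omega> = 0) \<and> (\<integral>\<omega>. (DY c i k \<omega>)\<^sup>2 \<partial>M) \<le> C"
proof -
  obtain C where C: "0 \<le> C" "\<And>k i. s0 \<le> k \<Longrightarrow> (\<integral>\<omega>. YX k i \<omega> ^ 4 \<partial>M) \<le> C" using YX_moment4 by blast
  show ?thesis
  proof (intro exI[of _ "C + \<tau> ^ 4"] allI conjI)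
    fix k
    show "DY c i k \<in> borel_measurable (H (Suc k))"
    proof (cases "s0 \<le> k")
      case True
      have [measurable]: "YX k i \<in> borel_measurable (H (Suc k))" by (rule measurable_H_mono[OF YX_H[OF True]]) simp
      note [measurable] = eps_H_Suc[OF True c]
      show ?thesis unfolding DY_def[abs_def] using True by simp
    qed (simp add: DY_def[abs_def])
    show sq: "integrable M (\<lambda>\<omega>. (DY c i k \<omega>)\<^sup>2)"
    proof (cases "s0 \<le> k")
      case True
      then show ?thesis using L8_integrable_mult2[OF YX_L8[OF True, of i] eps_L8[OF True c]] by (simp add: DY_def power_mult_distrib)
    qed (simp add: DY_def)
    show "AE \<omega> in M. real_cond_exp M (H k) (DY c i k) \<omega> = 0"
    proof (cases "s0 \<le> k")
      case True
      have "AE \<omega> in M. real_cond_exp M (H k) (\<lambda>\<omega>. YX k i \<omega> * \<epsilon> (2 * k + c) \<omega>) \<omega> = YX k i \<omega> * 0"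
        by (rule real_cond_exp_mult_const[OF YX_H[OF True] eps_M[OF True] L8_integrable_mult[OF YX_L8[OF True] eps_L8[OF True c]] cond_mean[OF True c]])
      moreover have "DY c i k = (\<lambda>\<omega>. YX k i \<omega> * \<epsilon> (2 * k + c) \<omega>)" using True by (auto simp: DY_def)
      ultimately show ?thesis by simp
    next
      case False
      then have "DY c i k = (\<lambda>\<omega>. 0)" by (auto simp: DY_def)
      then show ?thesis using real_cond_exp_const[of k 0] by simp
    qed
    show "(\<integral>\<omega>. (DY c i k \<omega>)\<^sup>2 \<partial>M) \<le> C + \<tau> ^ 4"
    proof (cases "s0 \<le> k")
      case True
      have i4: "integrable M (\<lambda>\<omega>. YX k i \<omega> ^ 4)" "integrable M (\<lambda>\<omega>. \<epsilon> (2 * k + c) \<omega> ^ 4)"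
        using L8_integrable4[OF YX_L8[OF True]] L8_integrable4[OF eps_L8[OF True c]] by auto
      have "(\<integral>\<omega>. (DY c i k \<omega>)\<^sup>2 \<partial>M) \<le> (\<integral>\<omega>. YX k i \<omega> ^ 4 + \<epsilon> (2 * k + c) \<omega> ^ 4 \<partial>M)"
        using sq i4 True by (intro integral_mono) (auto simp: DY_def power_mult_distrib mult_sq_le)
      also have "\<dots> \<le> C + \<tau> ^ 4" using i4 C(2)[OF True, of i] integral_eps4[OF True c] by simp
      finally show ?thesis .
    qed (use C in \<open>simp add: DY_def\<close>)
  qed
qed

lemma DY_growth:
  assumes c: "c \<in> {0, 1}" and Q: "\<And>l. Q l \<subseteq> {..<2 ^ Suc l}" and q: "0 < q" "q < 1 / 2"
  shows "AE \<omega> in M. (\<lambda>l. (\<Sum>k\<in>Q l. DY c i k \<omega>)\<^sup>2 * q ^ l) \<longlonglongrightarrow> 0"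
proof -
  obtain C where "\<And>k. DY c i k \<in> borel_measurable (H (Suc k))" "\<And>k. integrable M (\<lambda>\<omega>. (DY c i k \<omega>)\<^sup>2)"
    "\<And>k. AE \<omega> in M. real_cond_exp M (H k) (DY c i k) \<omega> = 0" "\<And>k. (\<integral>\<omega>. (DY c i k \<omega>)\<^sup>2 \<partial>M) \<le> C"
    using DY_mart_diff[OF c] by blast
  then show ?thesis by (rule martingale_growth[OF _ _ _ _ Q q])
qed

text \<open>Bounds the normalised scores in L^2, as the weighted Slutsky lemma requires.\<close>

lemma DY_sum_sq:
  assumes c: "c \<in> {0, 1}"
  shows "\<exists>C\<ge>0. \<forall>n. integrable M (\<lambda>\<omega>. (\<Sum>k\<in>tree_from n (CARD('p) - 1). DY c i k \<omega>)\<^sup>2) \<and>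
    (\<integral>\<omega>. (\<Sum>k\<in>tree_from n (CARD('p) - 1). DY c i k \<omega>)\<^sup>2 \<partial>M) \<le> C * 2 ^ (n + 1)"
proof -
  obtain C where D: "\<And>k. DY c i k \<in> borel_measurable (H (Suc k))" "\<And>k. integrable M (\<lambda>\<omega>. (DY c i k \<omega>)\<^sup>2)"
    "\<And>k. AE \<omega> in M. real_cond_exp M (H k) (DY c i k) \<omega> = 0" and C: "\<And>k. (\<integral>\<omega>. (DY c i k \<omega>)\<^sup>2 \<partial>M) \<le> C"
    using DY_mart_diff[OF c] by blast
  have C0: "0 \<le> C" using order_trans[OF Bochner_Integration.integral_nonneg C] by simp
  note o = orthogonal_sum[OF D finite_tree_from]
  have "(\<integral>\<omega>. (\<Sum>k\<in>tree_from n (CARD('p) - 1). DY c i k \<omega>)\<^sup>2 \<partial>M) \<le> C * 2 ^ (n + 1)" for n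
  proof -
    have "(\<Sum>k\<in>tree_from n (CARD('p) - 1). \<integral>\<omega>. (DY c i k \<omega>)\<^sup>2 \<partial>M) \<le> real (card (tree_from n (CARD('p) - 1))) * C"
      by (rule sum_bounded_above) (rule C)
    also have "\<dots> \<le> 2 ^ (n + 1) * C"
    proof (rule mult_right_mono[OF _ C0])
      have "card (tree_from n (CARD('p) - 1)) \<le> 2 ^ (n + 1)" unfolding tree_from_eq by simp
      then show "real (card (tree_from n (CARD('p) - 1))) \<le> 2 ^ (n + 1)" by (metis of_nat_le_iff of_nat_numeral of_nat_power)
    qed
    finally show ?thesis using o(2) by (simp add: mult.commute)
  qed
  with C0 o(1) show ?thesis by blast
qed

lemma DE_growth:
  assumes c: "c \<in> {0, 1}"
  shows "AE \<omega> in M. (\<lambda>l. (\<Sum>k\<in>gen l. DE c k \<omega>)\<^sup>2 * (1 / 4) ^ l) \<longlonglongrightarrow> 0"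
proof (rule martingale_growth[where C = "2 * \<tau> ^ 4 + 2 * (\<sigma>\<^sup>2)\<^sup>2", OF _ _ _ _ gen_subset])
  fix k
  show "DE c k \<in> borel_measurable (H (Suc k))"
  proof (cases "s0 \<le> k")
    case True
    note [measurable] = eps_H_Suc[OF True c]
    show ?thesis unfolding DE_def[abs_def] using True by simp
  qed (simp add: DE_def[abs_def])
  have i24: "integrable M (\<lambda>\<omega>. (\<epsilon> (2 * k + c) \<omega>)\<^sup>2)" "integrable M (\<lambda>\<omega>. \<epsilon> (2 * k + c) \<omega> ^ 4)" if "s0 \<le> k"
    using L8_integrable2[OF eps_L8[OF that c]] L8_integrable4[OF eps_L8[OF that c]] by auto
  have sqe: "(DE c k \<omega>)\<^sup>2 = \<epsilon> (2 * k + c) \<omega> ^ 4 + (- 2 * \<sigma>\<^sup>2) * (\<epsilon> (2 * k + c) \<omega>)\<^sup>2 + (\<sigma>\<^sup>2)\<^sup>2" if "s0 \<le> k" for \<omega>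
    using that by (simp add: DE_def power2_diff flip: power_mult)
  show sq: "integrable M (\<lambda>\<omega>. (DE c k \<omega>)\<^sup>2)"
  proof (cases "s0 \<le> k")
    case True
    show ?thesis unfolding sqe[OF True] using i24[OF True] by (intro Bochner_Integration.integrable_add integrable_mult_right) auto
  qed (simp add: DE_def)
  show "AE \<omega> in M. real_cond_exp M (H k) (DE c k) \<omega> = 0"
  proof (cases "s0 \<le> k")
    case True
    have "AE \<omega> in M. real_cond_exp M (H k) (\<lambda>\<omega>. (\<epsilon> (2 * k + c) \<omega>)\<^sup>2 + - \<sigma>\<^sup>2) \<omega> = \<sigma>\<^sup>2 + - \<sigma>\<^sup>2"
      by (rule real_cond_exp_add_eq[OF i24(1)[OF True] _ cond_var[OF True c] real_cond_exp_const]) simp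
    moreover have "DE c k = (\<lambda>\<omega>. (\<epsilon> (2 * k + c) \<omega>)\<^sup>2 + - \<sigma>\<^sup>2)" using True by (auto simp: DE_def)
    ultimately show ?thesis by simp
  next
    case False
    then have "DE c k = (\<lambda>\<omega>. 0)" by (auto simp: DE_def)
    then show ?thesis using real_cond_exp_const[of k 0] by simp
  qed
  show "(\<integral>\<omega>. (DE c k \<omega>)\<^sup>2 \<partial>M) \<le> 2 * \<tau> ^ 4 + 2 * (\<sigma>\<^sup>2)\<^sup>2"
  proof (cases "s0 \<le> k")
    case True
    have "(DE c k \<omega>)\<^sup>2 \<le> 2 * \<epsilon> (2 * k + c) \<omega> ^ 4 + 2 * (\<sigma>\<^sup>2)\<^sup>2" for \<omega>
    proof -
      have "0 \<le> ((\<epsilon> (2 * k + c) \<omega>)\<^sup>2 + \<sigma>\<^sup>2)\<^sup>2" by simp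
      moreover have "((\<epsilon> (2 * k + c) \<omega>)\<^sup>2)\<^sup>2 = \<epsilon> (2 * k + c) \<omega> ^ 4" by (simp flip: power_mult)
      ultimately show ?thesis unfolding sqe[OF True] power2_sum by (simp add: algebra_simps)
    qed
    then have "(\<integral>\<omega>. (DE c k \<omega>)\<^sup>2 \<partial>M) \<le> (\<integral>\<omega>. 2 * \<epsilon> (2 * k + c) \<omega> ^ 4 + 2 * (\<sigma>\<^sup>2)\<^sup>2 \<partial>M)"
      using sq i24[OF True] by (intro integral_mono) auto
    also have "\<dots> = 2 * \<tau> ^ 4 + 2 * (\<sigma>\<^sup>2)\<^sup>2" using i24[OF True] by (simp add: prob_space integral_eps4[OF True c])
    finally show ?thesis .
  qed (simp add: DE_def)
qed auto

lemma sum_tree_from_s0: "(\<Sum>k<2 ^ (n + 1). if s0 \<le> k then f k else 0) = (\<Sum>k\<in>tree_from n (CARD('p) - 1). f k)"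
  for f :: "nat \<Rightarrow> 'b::comm_monoid_add"
proof -
  have "(\<Sum>k<2 ^ (n + 1). if s0 \<le> k then f k else 0) = (\<Sum>k\<in>{..<2 ^ (n + 1)} \<inter> {k. s0 \<le> k}. f k)"
    by (simp add: sum.inter_restrict flip: sum.inter_filter)
  also have "{..<2 ^ (n + 1)} \<inter> {k. s0 \<le> k} = tree_from n (CARD('p) - 1)"
    by (auto simp: tree_from_eq s0_def)
  finally show ?thesis .
qed

text \<open>The passage from probability to trajectories: finitely many almost sure limits, one per
  coordinate and daughter, yield the assumptions of the deterministic part.\<close>

lemma AE_lse: "AE \<omega> in M. bar_path_lse N a b (\<sigma>\<^sup>2) (\<lambda>k. X k \<omega>) (\<lambda>k. \<epsilon> k \<omega>)"
proof -
  let ?P = "\<lambda>Q q \<omega>. \<forall>c\<in>{0, 1}. \<forall>i. (\<lambda>l. (\<Sum>k\<in>Q l. DY c i k \<omega>)\<^sup>2 * q ^ l) \<longlonglongrightarrow> 0"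
  \<comment> \<open>Rate 1/4 gives vanishing generation means, rate 2/5 the growth bounds.\<close>
  have 1: "AE \<omega> in M. ?P gen (1 / 4) \<omega>" "AE \<omega> in M. ?P gen (2 / 5) \<omega>"
    "AE \<omega> in M. ?P (\<lambda>l. tree_from l (CARD('p) - 1)) (2 / 5) \<omega>"
    by (intro AE_ball_countable' AE_all_countable[THEN iffD2] allI DY_growth gen_subset tree_from_subset; simp)+
  have 2: "AE \<omega> in M. \<forall>c\<in>{0, 1}. (\<lambda>l. (\<Sum>k\<in>gen l. DE c k \<omega>)\<^sup>2 * (1 / 4) ^ l) \<longlonglongrightarrow> 0"
    by (intro AE_ball_countable' DE_growth) auto
  from 1 2 AE_space[of M] show ?thesis
  proof eventually_elim
    case (elim \<omega>)
    let ?x = "\<lambda>k. X k \<omega>" and ?e = "\<lambda>k. \<epsilon> k \<omega>"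
    interpret P: bar_path N a b "\<sigma>\<^sup>2" ?x ?e by (rule path[OF elim(5)])
    have DYg: "DY c i k \<omega> = (?e (2 * k + c) *\<^sub>R (Yvec ?x k :: real ^ ('p option))) $ i" if "s0 \<le> k" for c i k
      using that by (simp add: DY_def YX_def mult.commute)
    have gs: "gen_mean (\<lambda>k. f k) l = gen_mean g l" if "\<And>k. s0 \<le> k \<Longrightarrow> f k = g k" "CARD('p) - 1 \<le> l" for f g :: "nat \<Rightarrow> real" and l
      using that gen_ge_s0 by (intro gen_mean_cong) auto
    have ev: "eventually (\<lambda>l. CARD('p) - 1 \<le> l) sequentially" by (rule eventually_ge_at_top)
    have norm_sum: "(norm (\<Sum>k\<in>Q. ?e (2 * k + c) *\<^sub>R (Yvec ?x k :: real ^ ('p option))))\<^sup>2 = (\<Sum>i\<in>UNIV. (\<Sum>k\<in>Q. DY c i k \<omega>)\<^sup>2)"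
      if "\<And>k. k \<in> Q \<Longrightarrow> s0 \<le> k" for Q c
    proof -
      have "(\<Sum>k\<in>Q. ?e (2 * k + c) *\<^sub>R (Yvec ?x k :: real ^ ('p option))) $ i = (\<Sum>k\<in>Q. DY c i k \<omega>)" for i
        unfolding sum_component by (intro sum.cong refl) (simp only: DYg[OF that])
      then show ?thesis unfolding power2_norm_eq_inner inner_vec_def by (simp add: power2_eq_square)
    qed
    show ?case
    proof unfold_locales
      fix c :: nat assume c: "c \<in> {0, 1}"
      show "gen_mean (\<lambda>k. ?e (2 * k + c) *\<^sub>R (Yvec ?x k :: real ^ ('p option))) \<longlonglongrightarrow> 0"
      proof (rule vec_tendstoI)
        fix i
        have "gen_mean (\<lambda>k. DY c i k \<omega>) \<longlonglongrightarrow> 0" using elim(1) c by (intro gen_mean_tendsto_0) auto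
        moreover have "eventually (\<lambda>l. gen_mean (\<lambda>k. DY c i k \<omega>) l = gen_mean (\<lambda>k. ?e (2 * k + c) *\<^sub>R (Yvec ?x k :: real ^ ('p option))) l $ i) sequentially"
          using ev by eventually_elim (simp only: gen_mean_nth, rule gs[OF DYg], simp_all)
        ultimately show "(\<lambda>l. gen_mean (\<lambda>k. ?e (2 * k + c) *\<^sub>R (Yvec ?x k :: real ^ ('p option))) l $ i) \<longlonglongrightarrow> 0 $ i"
          unfolding zero_index by (rule Lim_transform_eventually)
      qed
      show "gen_mean (\<lambda>k. (?e (2 * k + c))\<^sup>2 - \<sigma>\<^sup>2) \<longlonglongrightarrow> 0"
      proof -
        have "gen_mean (\<lambda>k. DE c k \<omega>) \<longlonglongrightarrow> 0" using elim(4) c by (intro gen_mean_tendsto_0) auto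
        moreover have "eventually (\<lambda>l. gen_mean (\<lambda>k. DE c k \<omega>) l = gen_mean (\<lambda>k. (?e (2 * k + c))\<^sup>2 - \<sigma>\<^sup>2) l) sequentially"
          using ev by eventually_elim (rule gs, simp_all add: DE_def)
        ultimately show ?thesis by (rule Lim_transform_eventually)
      qed
      show "(\<lambda>n. (norm (\<Sum>k\<in>tree_from n (CARD('p) - 1). ?e (2 * k + c) *\<^sub>R (Yvec ?x k :: real ^ ('p option))))\<^sup>2 * (2 / 5) ^ n) \<longlonglongrightarrow> 0"
      proof -
        have "(\<lambda>n. \<Sum>i\<in>UNIV. (\<Sum>k\<in>tree_from n (CARD('p) - 1). DY c i k \<omega>)\<^sup>2 * (2 / 5) ^ n) \<longlonglongrightarrow> (\<Sum>i\<in>(UNIV :: 'p option set). 0)"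
          using elim(3) c by (intro tendsto_sum) auto
        moreover have "(norm (\<Sum>k\<in>tree_from n (CARD('p) - 1). ?e (2 * k + c) *\<^sub>R (Yvec ?x k :: real ^ ('p option))))\<^sup>2
          = (\<Sum>i\<in>UNIV. (\<Sum>k\<in>tree_from n (CARD('p) - 1). DY c i k \<omega>)\<^sup>2)" for n
          by (rule norm_sum) (simp add: tree_from_eq s0_def)
        ultimately show ?thesis by (simp add: sum_distrib_right)
      qed
      show "(\<lambda>n. (norm (\<Sum>k\<in>gen n. ?e (2 * k + c) *\<^sub>R (Yvec ?x k :: real ^ ('p option))))\<^sup>2 * (2 / 5) ^ n) \<longlonglongrightarrow> 0"
      proof -
        have "(\<lambda>n. \<Sum>i\<in>UNIV. (\<Sum>k\<in>gen n. DY c i k \<omega>)\<^sup>2 * (2 / 5) ^ n) \<longlonglongrightarrow> (\<Sum>i\<in>(UNIV :: 'p option set). 0)"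
          using elim(2) c by (intro tendsto_sum) auto
        then have lim: "(\<lambda>n. \<Sum>i\<in>UNIV. (\<Sum>k\<in>gen n. DY c i k \<omega>)\<^sup>2 * (2 / 5) ^ n) \<longlonglongrightarrow> 0" by simp
        have "eventually (\<lambda>n. (\<Sum>i\<in>UNIV. (\<Sum>k\<in>gen n. DY c i k \<omega>)\<^sup>2 * (2 / 5) ^ n)
          = (norm (\<Sum>k\<in>gen n. ?e (2 * k + c) *\<^sub>R (Yvec ?x k :: real ^ ('p option))))\<^sup>2 * (2 / 5) ^ n) sequentially"
          using ev
        proof eventually_elim
          case (elim n)
          have "(norm (\<Sum>k\<in>gen n. ?e (2 * k + c) *\<^sub>R (Yvec ?x k :: real ^ ('p option))))\<^sup>2 = (\<Sum>i\<in>UNIV. (\<Sum>k\<in>gen n. DY c i k \<omega>)\<^sup>2)"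
            by (rule norm_sum) (rule gen_ge_s0[OF _ elim])
          then show ?case by (simp only: sum_distrib_right)
        qed
        from Lim_transform_eventually[OF lim this] show ?thesis .
      qed
    qed (rule sigma_pos)
  qed
qed

end

section \<open>Central limit theorems for noise functionals and scores\<close>

context bar_model
begin

text \<open>For a centred function of the sister pair alone, the conditional variance is the
  constant \<open>w\<close>, so the bracket is deterministic. Only the fourth moment condition is
  random, and it is met because the conditional eighth moments of the noise are bounded along almost
  every trajectory.\<close>

lemma noise_clt:
  fixes G :: "real \<times> real \<Rightarrow> real"
  assumes G [measurable]: "G \<in> borel_measurable borel"
    and c1: "\<And>k. s0 \<le> k \<Longrightarrow> AE \<omega> in M. real_cond_exp M (H k) (\<lambda>\<omega>. G (\<epsilon> (2 * k) \<omega>, \<epsilon> (2 * k + 1) \<omega>)) \<omega> = 0"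
    and c2: "\<And>k. s0 \<le> k \<Longrightarrow> AE \<omega> in M. real_cond_exp M (H k) (\<lambda>\<omega>. (G (\<epsilon> (2 * k) \<omega>, \<epsilon> (2 * k + 1) \<omega>))\<^sup>2) \<omega> = w"
    and bound: "\<And>z. G z ^ 4 \<le> K * (1 + fst z ^ 8 + snd z ^ 8)" and K: "0 \<le> K"
  shows "0 \<le> w"
    and "(\<lambda>n. \<integral>\<omega>. iexp (t * (1 / sqrt (2 ^ (n + 1)) * (\<Sum>k\<in>tree_from n (CARD('p) - 1). G (\<epsilon> (2 * k) \<omega>, \<epsilon> (2 * k + 1) \<omega>)))) \<partial>M)
      \<longlonglongrightarrow> of_real (exp (- (t\<^sup>2 * w / 2)))"
    and "integrable M (\<lambda>\<omega>. (\<Sum>k\<in>tree_from n (CARD('p) - 1). G (\<epsilon> (2 * k) \<omega>, \<epsilon> (2 * k + 1) \<omega>))\<^sup>2)"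
    and "(\<integral>\<omega>. (\<Sum>k\<in>tree_from n (CARD('p) - 1). G (\<epsilon> (2 * k) \<omega>, \<epsilon> (2 * k + 1) \<omega>))\<^sup>2 \<partial>M) \<le> 2 ^ (n + 1) * w"
proof -
  define g where "g = (\<lambda>k \<omega>. G (\<epsilon> (2 * k) \<omega>, \<epsilon> (2 * k + 1) \<omega>))"
  define c8 where "c8 = (\<lambda>c k \<omega>. real_cond_exp M (H k) (\<lambda>\<omega>. \<epsilon> (2 * k + c) \<omega> ^ 8) \<omega>)"
  define D where "D = (\<lambda>k \<omega>. if s0 \<le> k then g k \<omega> else 0)"
  define v where "v = (\<lambda>k (\<omega>::'w). if s0 \<le> k then w else 0)"
  \<comment> \<open>The summand w^2 provides the required bound on the squared variance. Absolute
    values are taken because conditional expectations of nonnegative functions are nonnegative only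
    almost everywhere, while \<open>mart_diff\<close> compares v^2 with \<open>r\<close> at every
    point.\<close>
  define r where "r = (\<lambda>k \<omega>. if s0 \<le> k then w\<^sup>2 + K * (1 + \<bar>c8 0 k \<omega>\<bar> + \<bar>c8 1 k \<omega>\<bar>) else 0)"
  have e8: "L8 M (\<epsilon> (2 * k))" "L8 M (\<epsilon> (2 * k + 1))" if "s0 \<le> k" for k
    using eps_L8[OF that, of 0] eps_L8[OF that, of 1] by auto
  have e8i: "integrable M (\<lambda>\<omega>. \<epsilon> (2 * k) \<omega> ^ 8)" "integrable M (\<lambda>\<omega>. \<epsilon> (2 * k + 1) \<omega> ^ 8)" if "s0 \<le> k" for k
    using e8[OF that] by (auto simp: L8_def)
  have gm: "g k \<in> borel_measurable M" if "s0 \<le> k" for k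
  proof -
    have [measurable]: "\<epsilon> (2 * k) \<in> borel_measurable M" "\<epsilon> (2 * k + 1) \<in> borel_measurable M" using e8[OF that] by (auto simp: L8_def)
    show ?thesis unfolding g_def by measurable
  qed
  have gH: "g k \<in> borel_measurable (H (Suc k))" if "s0 \<le> k" for k
  proof -
    have [measurable]: "\<epsilon> (2 * k) \<in> borel_measurable (H (Suc k))" "\<epsilon> (2 * k + 1) \<in> borel_measurable (H (Suc k))"
      using eps_H_Suc[OF that, of 0] eps_H_Suc[OF that, of 1] by auto
    show ?thesis unfolding g_def by measurable
  qed
  have gb: "g k \<omega> ^ 4 \<le> K * (1 + \<epsilon> (2 * k) \<omega> ^ 8 + \<epsilon> (2 * k + 1) \<omega> ^ 8)" for k \<omega>
    using bound[of "(\<epsilon> (2 * k) \<omega>, \<epsilon> (2 * k + 1) \<omega>)"] by (simp add: g_def)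
  have bi: "integrable M (\<lambda>\<omega>. K * (1 + \<epsilon> (2 * k) \<omega> ^ 8 + \<epsilon> (2 * k + 1) \<omega> ^ 8))" if "s0 \<le> k" for k
    using e8i[OF that] by auto
  have g4: "integrable M (\<lambda>\<omega>. g k \<omega> ^ 4)" if "s0 \<le> k" for k
  proof (rule Bochner_Integration.integrable_bound[OF bi[OF that]])
    show "(\<lambda>\<omega>. g k \<omega> ^ 4) \<in> borel_measurable M" using gm[OF that] by measurable
    show "AE \<omega> in M. norm (g k \<omega> ^ 4) \<le> norm (K * (1 + \<epsilon> (2 * k) \<omega> ^ 8 + \<epsilon> (2 * k + 1) \<omega> ^ 8))"
      using gb by (intro AE_I2) (simp add: order_trans[OF _ abs_ge_self])
  qed
  interpret D: mart_diff M H D v r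
  proof
    fix k and x :: 'w
    show "D k \<in> borel_measurable (H (Suc k))" using gH[of k] by (cases "s0 \<le> k") (simp_all add: D_def)
    show "v k \<in> borel_measurable (H k)" by (simp add: v_def)
    show "r k \<in> borel_measurable (H k)"
      unfolding r_def c8_def by (cases "s0 \<le> k") simp_all
    show "integrable M (\<lambda>x. D k x ^ 4)" using g4[of k] by (cases "s0 \<le> k") (simp_all add: D_def)
    show c1': "AE x in M. real_cond_exp M (H k) (D k) x = 0"
    proof (cases "s0 \<le> k")
      case True then show ?thesis using c1[OF True] by (simp add: D_def g_def)
    next
      case False then show ?thesis using real_cond_exp_const[of k 0] by (simp add: D_def)
    qed
    show c2': "AE x in M. real_cond_exp M (H k) (\<lambda>x. (D k x)\<^sup>2) x = v k x"
    proof (cases "s0 \<le> k")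
      case True then show ?thesis using c2[OF True] by (simp add: D_def g_def v_def)
    next
      case False then show ?thesis using real_cond_exp_const[of k 0] by (simp add: D_def v_def)
    qed
    show "AE x in M. real_cond_exp M (H k) (\<lambda>x. D k x ^ 4) x \<le> r k x"
    proof (cases "s0 \<le> k")
      case True
      interpret F: sigma_finite_subalgebra M "H k" by (rule sigma_finite_subalgebra_H)
      have "AE x in M. real_cond_exp M (H k) (\<lambda>x. 1 + \<epsilon> (2 * k) x ^ 8) x = 1 + c8 0 k x"
        by (rule real_cond_exp_add_eq[OF _ e8i(1)[OF True] real_cond_exp_const]) (auto simp: c8_def)
      then have "AE x in M. real_cond_exp M (H k) (\<lambda>x. 1 + \<epsilon> (2 * k) x ^ 8 + \<epsilon> (2 * k + 1) x ^ 8) x = 1 + c8 0 k x + c8 1 k x"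
        by (intro real_cond_exp_add_eq) (use e8i[OF True] in \<open>auto simp: c8_def\<close>)
      moreover have "AE x in M. real_cond_exp M (H k) (\<lambda>x. K * (1 + \<epsilon> (2 * k) x ^ 8 + \<epsilon> (2 * k + 1) x ^ 8)) x
          = K * real_cond_exp M (H k) (\<lambda>x. 1 + \<epsilon> (2 * k) x ^ 8 + \<epsilon> (2 * k + 1) x ^ 8) x"
        by (rule F.real_cond_exp_cmult) (use e8i[OF True] in auto)
      moreover have "AE x in M. real_cond_exp M (H k) (\<lambda>x. g k x ^ 4) x \<le> real_cond_exp M (H k) (\<lambda>x. K * (1 + \<epsilon> (2 * k) x ^ 8 + \<epsilon> (2 * k + 1) x ^ 8)) x"
        by (rule F.real_cond_exp_mono[OF _ g4[OF True] bi[OF True]]) (use gb in auto)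
      ultimately have "AE x in M. real_cond_exp M (H k) (\<lambda>x. g k x ^ 4) x \<le> r k x"
      proof eventually_elim
        case (elim x)
        then have "real_cond_exp M (H k) (\<lambda>x. g k x ^ 4) x \<le> K * (1 + c8 0 k x + c8 1 k x)" by simp
        also have "\<dots> \<le> K * (1 + \<bar>c8 0 k x\<bar> + \<bar>c8 1 k x\<bar>)" using K by (intro mult_left_mono) auto
        also have "\<dots> \<le> r k x" using True by (simp add: r_def)
        finally show ?case .
      qed
      then show ?thesis using True by (simp add: D_def)
    next
      case False then show ?thesis using real_cond_exp_const[of k 0] by (auto simp: D_def r_def elim!: eventually_mono)
    qed
    show "(v k x)\<^sup>2 \<le> r k x" using K by (simp add: v_def r_def)
    show "0 \<le> v k x"
    proof (cases "s0 \<le> k")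
      case True
      have i2: "integrable M (\<lambda>\<omega>. (g k \<omega>)\<^sup>2)"
        using integrable_mult_sq[of "\<lambda>\<omega>. (g k \<omega>)\<^sup>2" M "\<lambda>_. 1"] g4[OF True] gm[OF True] by (simp flip: power_mult)
      have "(\<integral>\<omega>. 1 * (g k \<omega>)\<^sup>2 \<partial>M) = (\<integral>\<omega>. 1 * w \<partial>M)"
        unfolding g_def
        by (rule cond_exp_intg(2)[OF c2[OF True], symmetric]) (use i2 gm[OF True] in \<open>auto simp: g_def\<close>)
      then have "w = (\<integral>\<omega>. (g k \<omega>)\<^sup>2 \<partial>M)" by (simp add: prob_space)
      then show ?thesis by (simp add: v_def)
    qed (simp add: v_def)
  qed
  show w0: "0 \<le> w" using D.v_nonneg[of s0] by (simp add: v_def)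
  have Dsum: "(\<Sum>k<2 ^ (n + 1). D k \<omega>) = (\<Sum>k\<in>tree_from n (CARD('p) - 1). g k \<omega>)" for n \<omega>
    unfolding D_def by (rule sum_tree_from_s0)
  have "(\<lambda>n. \<integral>\<omega>. iexp (t * (1 / sqrt (2 ^ (n + 1)) * (\<Sum>k<2 ^ (n + 1). D k \<omega>))) \<partial>M) \<longlonglongrightarrow> of_real (exp (- (t\<^sup>2 * w / 2)))"
  proof (rule D.martingale_clt)
    have sq: "(1 / sqrt (2 ^ (n + 1)))\<^sup>2 = 1 / 2 ^ (n + 1)" for n by (simp add: power_divide)
    have q4: "(1 / sqrt (2 ^ (n + 1))) ^ 4 = 1 / (2 ^ (n + 1) * 2 ^ (n + 1))" for n
    proof -
      have "(1 / sqrt (2 ^ (n + 1))) ^ 4 = ((1 / sqrt (2 ^ (n + 1)))\<^sup>2)\<^sup>2" by (simp flip: power_mult)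
      then show ?thesis unfolding sq by (simp add: power2_eq_square)
    qed
    show "AE x in M. (\<lambda>n. (1 / sqrt (2 ^ (n + 1)))\<^sup>2 * (\<Sum>k<2 ^ (n + 1). v k x)) \<longlonglongrightarrow> w"
    proof (rule AE_I2)
      fix x
      have "gen_mean (\<lambda>_. w) \<longlonglongrightarrow> w" by (simp add: gen_mean_const[abs_def])
      from tendsto_tree_mean[OF this, of "CARD('p) - 1"]
      show "(\<lambda>n. (1 / sqrt (2 ^ (n + 1)))\<^sup>2 * (\<Sum>k<2 ^ (n + 1). v k x)) \<longlonglongrightarrow> w"
        unfolding sq v_def sum_tree_from_s0 by simp
    qed
    show "AE x in M. (\<lambda>n. (1 / sqrt (2 ^ (n + 1))) ^ 4 * (\<Sum>k<2 ^ (n + 1). r k x)) \<longlonglongrightarrow> 0"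
    proof -
      have "AE x in M. \<forall>k\<ge>s0. 0 \<le> c8 0 k x \<and> 0 \<le> c8 1 k x"
      proof -
        have "AE x in M. 0 \<le> c8 c k x" if "s0 \<le> k" "c \<in> {0, 1}" for k c
        proof -
          interpret F: sigma_finite_subalgebra M "H k" by (rule sigma_finite_subalgebra_H)
          show ?thesis unfolding c8_def by (rule F.real_cond_exp_pos) (use eps_L8[OF that] in \<open>auto simp: L8_def\<close>)
        qed
        then show ?thesis by (auto simp: AE_all_countable)
      qed
      with cond_8_bounded show ?thesis
      proof eventually_elim
        case (elim x)
        then obtain B where B: "\<And>k c. s0 \<le> k \<Longrightarrow> c \<in> {0, 1} \<Longrightarrow> c8 c k x \<le> B" unfolding c8_def by blast
        define R where "R = w\<^sup>2 + K * (1 + 2 * \<bar>B\<bar>)"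
        have rR: "r k x \<le> R" for k
        proof (cases "s0 \<le> k")
          case True
          have "\<bar>c8 0 k x\<bar> \<le> \<bar>B\<bar>" "\<bar>c8 1 k x\<bar> \<le> \<bar>B\<bar>" using B[OF True, of 0] B[OF True, of 1] elim(2) True by auto
          then have "K * (1 + \<bar>c8 0 k x\<bar> + \<bar>c8 1 k x\<bar>) \<le> K * (1 + 2 * \<bar>B\<bar>)" using K by (intro mult_left_mono) auto
          then show ?thesis using True by (simp add: r_def R_def)
        next
          case False
          then show ?thesis using K by (simp add: r_def R_def)
        qed
        show ?case
        proof (rule tendsto_0_le[where K = 1])
          show "(\<lambda>n. R * (1 / 2) ^ (n + 1)) \<longlonglongrightarrow> 0"
            using LIMSEQ_ignore_initial_segment[OF LIMSEQ_power_zero[of "1 / 2 :: real"], of 1] by (intro tendsto_mult_right_zero) simp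
          show "\<forall>\<^sub>F n in sequentially. norm ((1 / sqrt (2 ^ (n + 1))) ^ 4 * (\<Sum>k<2 ^ (n + 1). r k x)) \<le> norm (R * (1 / 2) ^ (n + 1)) * 1"
          proof (rule always_eventually, rule allI)
            fix n
            have "(\<Sum>k<2 ^ (n + 1). r k x) \<le> 2 ^ (n + 1) * R"
              using sum_bounded_above[of "{..<2 ^ (n + 1)}" "\<lambda>k. r k x" R] rR by simp
            then have "1 / (2 ^ (n + 1) * 2 ^ (n + 1)) * (\<Sum>k<2 ^ (n + 1). r k x) \<le> 1 / (2 ^ (n + 1) * 2 ^ (n + 1)) * (2 ^ (n + 1) * R)"
              by (intro mult_left_mono) auto
            also have "\<dots> = R * (1 / 2) ^ (n + 1)" by (simp add: power_divide field_simps)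
            finally have le: "(1 / sqrt (2 ^ (n + 1))) ^ 4 * (\<Sum>k<2 ^ (n + 1). r k x) \<le> R * (1 / 2) ^ (n + 1)" unfolding q4 .
            have "0 \<le> (1 / sqrt (2 ^ (n + 1))) ^ 4 * (\<Sum>k<2 ^ (n + 1). r k x)"
              using D.r_nonneg by (intro mult_nonneg_nonneg sum_nonneg) auto
            then show "norm ((1 / sqrt (2 ^ (n + 1))) ^ 4 * (\<Sum>k<2 ^ (n + 1). r k x)) \<le> norm (R * (1 / 2) ^ (n + 1)) * 1"
              using le by (simp only: real_norm_def abs_of_nonneg mult_1_right order_trans[OF le abs_ge_self])
          qed
        qed
      qed
    qed
  qed
  then show "(\<lambda>n. \<integral>\<omega>. iexp (t * (1 / sqrt (2 ^ (n + 1)) * (\<Sum>k\<in>tree_from n (CARD('p) - 1). G (\<epsilon> (2 * k) \<omega>, \<epsilon> (2 * k + 1) \<omega>)))) \<partial>M)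
      \<longlonglongrightarrow> of_real (exp (- (t\<^sup>2 * w / 2)))"
    unfolding Dsum g_def .
  note o = orthogonal_sum[OF D.D_meas D.D2 D.cond1 finite_lessThan[of "2 ^ (n + 1)"], unfolded Dsum]
  show "integrable M (\<lambda>\<omega>. (\<Sum>k\<in>tree_from n (CARD('p) - 1). G (\<epsilon> (2 * k) \<omega>, \<epsilon> (2 * k + 1) \<omega>))\<^sup>2)"
    using o(1) unfolding g_def .
  have "(\<integral>\<omega>. (D k \<omega>)\<^sup>2 \<partial>M) \<le> w" for k
  proof -
    have "(\<integral>\<omega>. 1 * (D k \<omega>)\<^sup>2 \<partial>M) = (\<integral>\<omega>. 1 * v k \<omega> \<partial>M)"
      by (rule cond_exp_intg(2)[OF D.cond2, symmetric]) (use D.D2 D.D_meas_M in auto)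
    then show ?thesis using w0 by (simp add: v_def prob_space)
  qed
  then have "(\<Sum>k<2 ^ (n + 1). \<integral>\<omega>. (D k \<omega>)\<^sup>2 \<partial>M) \<le> 2 ^ (n + 1) * w"
    using sum_bounded_above[of "{..<2 ^ (n + 1)}" "\<lambda>k. \<integral>\<omega>. (D k \<omega>)\<^sup>2 \<partial>M" w] by simp
  then show "(\<integral>\<omega>. (\<Sum>k\<in>tree_from n (CARD('p) - 1). G (\<epsilon> (2 * k) \<omega>, \<epsilon> (2 * k + 1) \<omega>))\<^sup>2 \<partial>M) \<le> 2 ^ (n + 1) * w"
    using o(2) unfolding g_def by simp
qed

definition dotY :: "real ^ ('p option) \<Rightarrow> nat \<Rightarrow> 'w \<Rightarrow> real" where
  "dotY w k \<omega> = w \<bullet> Yvec (\<lambda>j. X j \<omega>) k"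

lemma dotY_eq: "dotY w k = (\<lambda>\<omega>. \<Sum>i\<in>UNIV. w $ i * YX k i \<omega>)"
  by (simp add: dotY_def[abs_def] YX_def inner_vec_def)

lemma dotY_L8: "s0 \<le> k \<Longrightarrow> L8 M (dotY w k)"
  unfolding dotY_eq by (intro L8_sum L8_scale YX_L8)

lemma dotY_H: assumes "s0 \<le> k" shows "dotY w k \<in> borel_measurable (H k)"
proof -
  note [measurable] = YX_H[OF assms]
  show ?thesis unfolding dotY_eq by measurable
qed

lemma dotY_moment4: "\<exists>C\<ge>0. \<forall>k\<ge>s0. (\<integral>\<omega>. dotY w k \<omega> ^ 4 \<partial>M) \<le> C"
proof -
  obtain C where C: "0 \<le> C" "\<And>k i. s0 \<le> k \<Longrightarrow> (\<integral>\<omega>. YX k i \<omega> ^ 4 \<partial>M) \<le> C" using YX_moment4 by blast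
  let ?n = "real (card (UNIV :: 'p option set)) ^ 3"
  have "(\<integral>\<omega>. dotY w k \<omega> ^ 4 \<partial>M) \<le> ?n * (\<Sum>i\<in>UNIV. w $ i ^ 4 * C)" if k: "s0 \<le> k" for k
  proof -
    have i: "integrable M (\<lambda>\<omega>. ?n * (\<Sum>i\<in>UNIV. w $ i ^ 4 * YX k i \<omega> ^ 4))"
      using L8_integrable4[OF YX_L8[OF k]] by (intro integrable_mult_right Bochner_Integration.integrable_sum)
    have "(\<integral>\<omega>. dotY w k \<omega> ^ 4 \<partial>M) \<le> (\<integral>\<omega>. ?n * (\<Sum>i\<in>UNIV. w $ i ^ 4 * YX k i \<omega> ^ 4) \<partial>M)"
    proof (rule integral_mono[OF L8_integrable4[OF dotY_L8[OF k]] i])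
      fix \<omega>
      show "dotY w k \<omega> ^ 4 \<le> ?n * (\<Sum>i\<in>UNIV. w $ i ^ 4 * YX k i \<omega> ^ 4)"
        unfolding dotY_eq power_mult_distrib[symmetric] by (rule power4_sum_le)
    qed
    also have "\<dots> = ?n * (\<Sum>i\<in>UNIV. w $ i ^ 4 * (\<integral>\<omega>. YX k i \<omega> ^ 4 \<partial>M))"
      using L8_integrable4[OF YX_L8[OF k]] by simp
    also have "\<dots> \<le> ?n * (\<Sum>i\<in>UNIV. w $ i ^ 4 * C)"
      using C k by (intro mult_left_mono sum_mono) auto
    finally show ?thesis .
  qed
  moreover have "0 \<le> ?n * (\<Sum>i\<in>UNIV. w $ i ^ 4 * C)" using C by (intro mult_nonneg_nonneg sum_nonneg) auto
  ultimately show ?thesis by blast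
qed

text \<open>The conditional variance of an increment is a quadratic form in the two linear
  functionals of the regressor, so \<open>Y_form_mean\<close> gives the limit of the bracket.
  Arbitrary \<open>w1\<close> and \<open>w2\<close> are allowed because characteristic functions in
  2 (p + 1) dimensions probe every linear combination of the scores.\<close>

lemma linear_clt:
  fixes w1 w2 :: "real ^ ('p option)"
  shows "(\<lambda>n. \<integral>\<omega>. iexp (t * (1 / sqrt (2 ^ (n + 1)) * (\<Sum>k\<in>tree_from n (CARD('p) - 1).
        dotY w1 k \<omega> * \<epsilon> (2 * k) \<omega> + dotY w2 k \<omega> * \<epsilon> (2 * k + 1) \<omega>))) \<partial>M)
      \<longlonglongrightarrow> of_real (exp (- (t\<^sup>2 * (\<sigma>\<^sup>2 * (w1 \<bullet> (L *v w1) + w2 \<bullet> (L *v w2)) + 2 * \<rho> * (w1 \<bullet> (L *v w2))) / 2)))"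
proof -
  define D where "D = (\<lambda>k \<omega>. if s0 \<le> k then dotY w1 k \<omega> * \<epsilon> (2 * k) \<omega> + dotY w2 k \<omega> * \<epsilon> (2 * k + 1) \<omega> else 0)"
  define V where "V = (\<lambda>p q. \<sigma>\<^sup>2 * (p\<^sup>2 + q\<^sup>2) + 2 * \<rho> * (p * q))"
  \<comment> \<open>The part 8 tau^4 bounds the conditional fourth moment of an increment, by
    \<open>power4_add_le\<close>; the part 8 sigma^4 bounds the squared conditional
    variance.\<close>
  define K where "K = 8 * (\<tau> ^ 4 + (\<sigma>\<^sup>2)\<^sup>2)"
  define v where "v = (\<lambda>k \<omega>. if s0 \<le> k then V (dotY w1 k \<omega>) (dotY w2 k \<omega>) else 0)"
  define r where "r = (\<lambda>k \<omega>. if s0 \<le> k then K * (dotY w1 k \<omega> ^ 4 + dotY w2 k \<omega> ^ 4) else 0)"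
  have K0: "0 \<le> K" by (simp add: K_def)
  have V0: "0 \<le> V p q" and V2: "(V p q)\<^sup>2 \<le> K * (p ^ 4 + q ^ 4)" for p q
  proof -
    have "\<bar>2 * \<rho> * (p * q)\<bar> \<le> \<sigma>\<^sup>2 * (p\<^sup>2 + q\<^sup>2)"
    proof -
      have "2 * \<bar>p * q\<bar> \<le> p\<^sup>2 + q\<^sup>2"
        using zero_le_power2[of "\<bar>p\<bar> - \<bar>q\<bar>"] by (simp add: power2_diff abs_mult)
      then have "\<bar>\<rho>\<bar> * (2 * \<bar>p * q\<bar>) \<le> \<sigma>\<^sup>2 * (p\<^sup>2 + q\<^sup>2)"
        using rho_less by (intro mult_mono) auto
      then show ?thesis by (simp add: abs_mult mult_ac)
    qed
    then have b: "0 \<le> V p q" "V p q \<le> 2 * \<sigma>\<^sup>2 * (p\<^sup>2 + q\<^sup>2)" unfolding V_def by linarith+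
    then show "0 \<le> V p q" by simp
    have "(V p q)\<^sup>2 \<le> (2 * \<sigma>\<^sup>2 * (p\<^sup>2 + q\<^sup>2))\<^sup>2" using b by (intro power_mono)
    also have "\<dots> = 4 * (\<sigma>\<^sup>2)\<^sup>2 * (p\<^sup>2 + q\<^sup>2)\<^sup>2" unfolding power_mult_distrib by simp
    also have "\<dots> \<le> 4 * (\<sigma>\<^sup>2)\<^sup>2 * (2 * (p ^ 4 + q ^ 4))"
    proof (rule mult_left_mono)
      have "(u + v)\<^sup>2 \<le> 2 * (u\<^sup>2 + v\<^sup>2)" for u v :: real
        using zero_le_power2[of "u - v"] by (simp add: power2_eq_square algebra_simps)
      from this[of "p\<^sup>2" "q\<^sup>2"] show "(p\<^sup>2 + q\<^sup>2)\<^sup>2 \<le> 2 * (p ^ 4 + q ^ 4)" by (simp flip: power_mult)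
    qed simp
    also have "\<dots> = (8 * (\<sigma>\<^sup>2)\<^sup>2) * (p ^ 4 + q ^ 4)" by simp
    also have "\<dots> \<le> K * (p ^ 4 + q ^ 4)" by (intro mult_right_mono) (simp_all add: K_def)
    finally show "(V p q)\<^sup>2 \<le> K * (p ^ 4 + q ^ 4)" .
  qed
  have e: "L8 M (\<epsilon> (2 * k))" "L8 M (\<epsilon> (2 * k + 1))" if "s0 \<le> k" for k
    using eps_L8[OF that, of 0] eps_L8[OF that, of 1] by auto
  interpret D: mart_diff M H D v r
  proof
    fix k and x :: 'w
    show "D k \<in> borel_measurable (H (Suc k))"
    proof (cases "s0 \<le> k")
      case True
      have [measurable]: "dotY w k \<in> borel_measurable (H (Suc k))" for w by (rule measurable_H_mono[OF dotY_H[OF True]]) simp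
      have [measurable]: "\<epsilon> (2 * k) \<in> borel_measurable (H (Suc k))" "\<epsilon> (2 * k + 1) \<in> borel_measurable (H (Suc k))"
        using eps_H_Suc[OF True, of 0] eps_H_Suc[OF True, of 1] by auto
      have Dk: "D k = (\<lambda>x. dotY w1 k x * \<epsilon> (2 * k) x + dotY w2 k x * \<epsilon> (2 * k + 1) x)" using True by (auto simp: D_def)
      show ?thesis unfolding Dk by measurable
    qed (simp add: D_def)
    show "v k \<in> borel_measurable (H k)" "r k \<in> borel_measurable (H k)"
    proof -
      have "v k \<in> borel_measurable (H k) \<and> r k \<in> borel_measurable (H k)"
      proof (cases "s0 \<le> k")
        case True
        note [measurable] = dotY_H[OF True]
        show ?thesis unfolding v_def r_def V_def using True by simp
      qed (simp add: v_def r_def)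
      then show "v k \<in> borel_measurable (H k)" "r k \<in> borel_measurable (H k)" by auto
    qed
    show "0 \<le> v k x" using V0 by (simp add: v_def)
    show "(v k x)\<^sup>2 \<le> r k x" using V2 by (simp add: v_def r_def)
    show "integrable M (\<lambda>x. D k x ^ 4)"
      "AE x in M. real_cond_exp M (H k) (D k) x = 0"
      "AE x in M. real_cond_exp M (H k) (\<lambda>x. (D k x)\<^sup>2) x = v k x"
      "AE x in M. real_cond_exp M (H k) (\<lambda>x. D k x ^ 4) x \<le> r k x"
    proof -
      have "integrable M (\<lambda>x. D k x ^ 4) \<and> (AE x in M. real_cond_exp M (H k) (D k) x = 0)
        \<and> (AE x in M. real_cond_exp M (H k) (\<lambda>x. (D k x)\<^sup>2) x = v k x)
        \<and> (AE x in M. real_cond_exp M (H k) (\<lambda>x. D k x ^ 4) x \<le> r k x)"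
      proof (cases "s0 \<le> k")
        case True
        interpret F: sigma_finite_subalgebra M "H k" by (rule sigma_finite_subalgebra_H)
        let ?p = "dotY w1 k" and ?q = "dotY w2 k" and ?e = "\<epsilon> (2 * k)" and ?f = "\<epsilon> (2 * k + 1)"
        note e = e[OF True] and pL = dotY_L8[OF True, of w1] and qL = dotY_L8[OF True, of w2]
        have em [measurable]: "?e \<in> borel_measurable M" "?f \<in> borel_measurable M" "?p \<in> borel_measurable M" "?q \<in> borel_measurable M"
          using e pL qL by (auto simp: L8_def)
        have pH [measurable]: "?p \<in> borel_measurable (H k)" "?q \<in> borel_measurable (H k)" using dotY_H[OF True] by auto
        have Dk: "D k = (\<lambda>x. ?p x * ?e x + ?q x * ?f x)" using True by (auto simp: D_def)
        have m0: "AE x in M. real_cond_exp M (H k) (D k) x = ?p x * 0 + ?q x * 0"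
          unfolding Dk
          by (intro real_cond_exp_add_eq real_cond_exp_mult_const L8_integrable_mult pL qL e pH)
             (use cond_mean[OF True, of 0] cond_mean[OF True, of 1] em in auto)
        have i4: "integrable M (\<lambda>x. ?p x ^ 4 * ?e x ^ 4)" "integrable M (\<lambda>x. ?q x ^ 4 * ?f x ^ 4)"
          by (intro L8_integrable_mult4 pL qL e)+
        have D4le: "D k x ^ 4 \<le> 8 * (?p x ^ 4 * ?e x ^ 4 + ?q x ^ 4 * ?f x ^ 4)" for x
          unfolding Dk using power4_add_le[of "?p x * ?e x" "?q x * ?f x"] by (simp add: power_mult_distrib)
        have D4: "integrable M (\<lambda>x. D k x ^ 4)"
        proof (rule Bochner_Integration.integrable_bound[of _ "\<lambda>x. 8 * (?p x ^ 4 * ?e x ^ 4 + ?q x ^ 4 * ?f x ^ 4)"])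
          show "AE x in M. norm (D k x ^ 4) \<le> norm (8 * (?p x ^ 4 * ?e x ^ 4 + ?q x ^ 4 * ?f x ^ 4))"
            using D4le by (intro AE_I2) (simp add: order_trans[OF _ abs_ge_self])
          show "integrable M (\<lambda>x. 8 * (?p x ^ 4 * ?e x ^ 4 + ?q x ^ 4 * ?f x ^ 4))"
            by (intro integrable_mult_right Bochner_Integration.integrable_add i4)
          show "(\<lambda>x. D k x ^ 4) \<in> borel_measurable M" unfolding Dk by measurable
        qed
        have ipq: "integrable M (\<lambda>x. (2 * (?p x * ?q x)) * (?e x * ?f x))"
        proof -
          have m: "(\<lambda>x. ?p x * ?e x) \<in> borel_measurable M" "(\<lambda>x. ?q x * ?f x) \<in> borel_measurable M" by measurable
          have "integrable M (\<lambda>x. (?p x * ?e x) * (?q x * ?f x))"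
            by (rule integrable_mult_sq[OF m]) (unfold power_mult_distrib, (rule L8_integrable_mult2[OF pL e(1)] L8_integrable_mult2[OF qL e(2)])+)
          then have "integrable M (\<lambda>x. 2 * ((?p x * ?e x) * (?q x * ?f x)))" by (rule integrable_mult_right)
          then show ?thesis by (simp only: mult_ac)
        qed
        have i2: "integrable M (\<lambda>x. (?p x)\<^sup>2 * (?e x)\<^sup>2)" "integrable M (\<lambda>x. (?q x)\<^sup>2 * (?f x)\<^sup>2)"
          by (intro L8_integrable_mult2 pL qL e)+
        have D2: "(D k x)\<^sup>2 = (?p x)\<^sup>2 * (?e x)\<^sup>2 + (?q x)\<^sup>2 * (?f x)\<^sup>2 + (2 * (?p x * ?q x)) * (?e x * ?f x)" for x
          unfolding Dk by (simp add: power2_sum power_mult_distrib)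
        have h2: "AE x in M. real_cond_exp M (H k) (\<lambda>x. (D k x)\<^sup>2) x = (?p x)\<^sup>2 * \<sigma>\<^sup>2 + (?q x)\<^sup>2 * \<sigma>\<^sup>2 + (2 * (?p x * ?q x)) * \<rho>"
          unfolding D2
        proof (intro real_cond_exp_add_eq real_cond_exp_mult_const Bochner_Integration.integrable_add i2 ipq)
          show "AE x in M. real_cond_exp M (H k) (\<lambda>x. (?e x)\<^sup>2) x = \<sigma>\<^sup>2" using cond_var[OF True, of 0] by simp
          show "AE x in M. real_cond_exp M (H k) (\<lambda>x. (?f x)\<^sup>2) x = \<sigma>\<^sup>2" using cond_var[OF True, of 1] by simp
          show "AE x in M. real_cond_exp M (H k) (\<lambda>x. ?e x * ?f x) x = \<rho>" by (rule cond_cov[OF True])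
        qed measurable
        have h4: "AE x in M. real_cond_exp M (H k) (\<lambda>x. ?p x ^ 4 * ?e x ^ 4 + ?q x ^ 4 * ?f x ^ 4) x = ?p x ^ 4 * \<tau> ^ 4 + ?q x ^ 4 * \<tau> ^ 4"
        proof (intro real_cond_exp_add_eq real_cond_exp_mult_const i4)
          show "AE x in M. real_cond_exp M (H k) (\<lambda>x. ?e x ^ 4) x = \<tau> ^ 4" using cond_4[OF True, of 0] by simp
          show "AE x in M. real_cond_exp M (H k) (\<lambda>x. ?f x ^ 4) x = \<tau> ^ 4" using cond_4[OF True, of 1] by simp
        qed measurable
        have "AE x in M. real_cond_exp M (H k) (\<lambda>x. 8 * (?p x ^ 4 * ?e x ^ 4 + ?q x ^ 4 * ?f x ^ 4)) x = 8 * real_cond_exp M (H k) (\<lambda>x. ?p x ^ 4 * ?e x ^ 4 + ?q x ^ 4 * ?f x ^ 4) x"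
          by (rule F.real_cond_exp_cmult) (use i4 in auto)
        moreover have "AE x in M. real_cond_exp M (H k) (\<lambda>x. D k x ^ 4) x \<le> real_cond_exp M (H k) (\<lambda>x. 8 * (?p x ^ 4 * ?e x ^ 4 + ?q x ^ 4 * ?f x ^ 4)) x"
          by (rule F.real_cond_exp_mono[OF _ D4]) (use D4le i4 in auto)
        ultimately have "AE x in M. real_cond_exp M (H k) (\<lambda>x. D k x ^ 4) x \<le> r k x"
          using h4
        proof eventually_elim
          case (elim x)
          then have "real_cond_exp M (H k) (\<lambda>x. D k x ^ 4) x \<le> (8 * \<tau> ^ 4) * (?p x ^ 4 + ?q x ^ 4)" by (simp add: algebra_simps)
          also have "\<dots> \<le> K * (?p x ^ 4 + ?q x ^ 4)" by (intro mult_right_mono) (simp_all add: K_def)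
          finally show ?case using True by (simp add: r_def)
        qed
        moreover have "AE x in M. real_cond_exp M (H k) (\<lambda>x. (D k x)\<^sup>2) x = v k x"
          using h2 by eventually_elim (use True in \<open>simp add: v_def V_def algebra_simps\<close>)
        ultimately show ?thesis using D4 m0 by simp
      next
        case False
        then have "D k = (\<lambda>_. 0)" "v k = (\<lambda>_. 0)" "r k = (\<lambda>_. 0)" by (auto simp: D_def v_def r_def)
        then show ?thesis using real_cond_exp_const[of k 0] by (auto elim!: eventually_mono)
      qed
      then show "integrable M (\<lambda>x. D k x ^ 4)"
        "AE x in M. real_cond_exp M (H k) (D k) x = 0"
        "AE x in M. real_cond_exp M (H k) (\<lambda>x. (D k x)\<^sup>2) x = v k x"
        "AE x in M. real_cond_exp M (H k) (\<lambda>x. D k x ^ 4) x \<le> r k x" by auto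
    qed
  qed
  have sq: "(1 / sqrt (2 ^ (n + 1)))\<^sup>2 = 1 / 2 ^ (n + 1)" for n by (simp add: power_divide)
  have q4: "(1 / sqrt (2 ^ (n + 1))) ^ 4 = 1 / (2 ^ (n + 1) * 2 ^ (n + 1))" for n
  proof -
    have "(1 / sqrt (2 ^ (n + 1))) ^ 4 = ((1 / sqrt (2 ^ (n + 1)))\<^sup>2)\<^sup>2" by (simp flip: power_mult)
    then show ?thesis unfolding sq by (simp add: power2_eq_square)
  qed
  let ?V = "\<sigma>\<^sup>2 * (w1 \<bullet> (L *v w1) + w2 \<bullet> (L *v w2)) + 2 * \<rho> * (w1 \<bullet> (L *v w2))"
  have "(\<lambda>n. \<integral>\<omega>. iexp (t * (1 / sqrt (2 ^ (n + 1)) * (\<Sum>k<2 ^ (n + 1). D k \<omega>))) \<partial>M) \<longlonglongrightarrow> of_real (exp (- (t\<^sup>2 * ?V / 2)))"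
  proof (rule D.martingale_clt)
    show "AE \<omega> in M. (\<lambda>n. (1 / sqrt (2 ^ (n + 1)))\<^sup>2 * (\<Sum>k<2 ^ (n + 1). v k \<omega>)) \<longlonglongrightarrow> ?V"
      using AE_lse
    proof eventually_elim
      case (elim \<omega>)
      interpret P: bar_path_lse N a b "\<sigma>\<^sup>2" "\<lambda>k. X k \<omega>" "\<lambda>k. \<epsilon> k \<omega>" 0 by (rule elim)
      have "gen_mean (\<lambda>k. V (dotY w1 k \<omega>) (dotY w2 k \<omega>)) = (\<lambda>l. \<sigma>\<^sup>2 * (gen_mean (\<lambda>k. dotY w1 k \<omega> * dotY w1 k \<omega>) l + gen_mean (\<lambda>k. dotY w2 k \<omega> * dotY w2 k \<omega>) l)
         + 2 * \<rho> * gen_mean (\<lambda>k. dotY w1 k \<omega> * dotY w2 k \<omega>) l)"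
        unfolding V_def power2_eq_square by (simp add: gen_mean_add[abs_def] gen_mean_mult[abs_def] fun_eq_iff gen_mean_def algebra_simps sum.distrib sum_distrib_left add_divide_distrib)
      moreover have "(\<lambda>l. \<sigma>\<^sup>2 * (gen_mean (\<lambda>k. dotY w1 k \<omega> * dotY w1 k \<omega>) l + gen_mean (\<lambda>k. dotY w2 k \<omega> * dotY w2 k \<omega>) l)
         + 2 * \<rho> * gen_mean (\<lambda>k. dotY w1 k \<omega> * dotY w2 k \<omega>) l) \<longlonglongrightarrow> ?V"
        unfolding dotY_def by (intro tendsto_intros P.Y_form_mean)
      ultimately have "gen_mean (\<lambda>k. V (dotY w1 k \<omega>) (dotY w2 k \<omega>)) \<longlonglongrightarrow> ?V" by simp
      from tendsto_tree_mean[OF this, of "CARD('p) - 1"] show ?case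
        unfolding sq v_def sum_tree_from_s0 by simp
    qed
    obtain C1 where C1: "0 \<le> C1" "\<And>k. s0 \<le> k \<Longrightarrow> (\<integral>\<omega>. dotY w1 k \<omega> ^ 4 \<partial>M) \<le> C1" using dotY_moment4 by blast
    obtain C2 where C2: "0 \<le> C2" "\<And>k. s0 \<le> k \<Longrightarrow> (\<integral>\<omega>. dotY w2 k \<omega> ^ 4 \<partial>M) \<le> C2" using dotY_moment4 by blast
    have ri: "integrable M (r k)" and rE: "(\<integral>\<omega>. r k \<omega> \<partial>M) \<le> K * (C1 + C2)" for k
    proof -
      have "integrable M (r k) \<and> (\<integral>\<omega>. r k \<omega> \<partial>M) \<le> K * (C1 + C2)"
      proof (cases "s0 \<le> k")
        case True
        note i = L8_integrable4[OF dotY_L8[OF True]]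
        have "r k = (\<lambda>\<omega>. K * (dotY w1 k \<omega> ^ 4 + dotY w2 k \<omega> ^ 4))" using True by (auto simp: r_def)
        then show ?thesis using i C1(2)[OF True] C2(2)[OF True] K0 by (auto intro!: mult_left_mono)
      next
        case False
        then have "r k = (\<lambda>_. 0)" by (auto simp: r_def)
        then show ?thesis using K0 C1 C2 by simp
      qed
      then show "integrable M (r k)" "(\<integral>\<omega>. r k \<omega> \<partial>M) \<le> K * (C1 + C2)" by auto
    qed
    \<comment> \<open>Here \<open>r\<close> involves fourth powers of the regressors, which are
      controlled through their means only. The uniform moment bound makes the expectations decay
      like 2^(-n), so summability gives almost sure convergence.\<close>
    show "AE x in M. (\<lambda>n. (1 / sqrt (2 ^ (n + 1))) ^ 4 * (\<Sum>k<2 ^ (n + 1). r k x)) \<longlonglongrightarrow> 0"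
    proof (rule AE_tendsto_zero_if_summable[where C = "K * (C1 + C2)" and q = "1 / 2"])
      fix n
      show "0 \<le> (1 / sqrt (2 ^ (n + 1))) ^ 4 * (\<Sum>k<2 ^ (n + 1). r k x)" for x
        using D.r_nonneg by (intro mult_nonneg_nonneg sum_nonneg) auto
      show "integrable M (\<lambda>x. (1 / sqrt (2 ^ (n + 1))) ^ 4 * (\<Sum>k<2 ^ (n + 1). r k x))"
        using ri by (intro integrable_mult_right Bochner_Integration.integrable_sum)
      have "(\<integral>x. (1 / sqrt (2 ^ (n + 1))) ^ 4 * (\<Sum>k<2 ^ (n + 1). r k x) \<partial>M) = 1 / (2 ^ (n + 1) * 2 ^ (n + 1)) * (\<Sum>k<2 ^ (n + 1). \<integral>x. r k x \<partial>M)"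
        unfolding q4 using ri by simp
      also have "\<dots> \<le> 1 / (2 ^ (n + 1) * 2 ^ (n + 1)) * (2 ^ (n + 1) * (K * (C1 + C2)))"
        using sum_bounded_above[of "{..<2 ^ (n + 1)}" "\<lambda>k. \<integral>x. r k x \<partial>M" "K * (C1 + C2)"] rE by (intro mult_left_mono) auto
      also have "\<dots> \<le> K * (C1 + C2) * (1 / 2) ^ n"
        using K0 C1 C2 by (simp add: power_divide field_simps)
      finally show "(\<integral>x. (1 / sqrt (2 ^ (n + 1))) ^ 4 * (\<Sum>k<2 ^ (n + 1). r k x) \<partial>M) \<le> K * (C1 + C2) * (1 / 2) ^ n" .
    qed auto
  qed
  then show ?thesis unfolding D_def sum_tree_from_s0 .
qed

end

section \<open>Slutsky's lemma for characteristic functions\<close>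

lemma norm_iexp_diff_le: "norm (iexp x - iexp y) \<le> \<bar>x - y\<bar>" for x y :: real
proof -
  have "iexp x - iexp y = iexp y * (iexp (x - y) - 1)"
    by (simp add: algebra_simps flip: exp_add)
  then have "norm (iexp x - iexp y) = norm (iexp (x - y) - 1)" by (simp add: norm_mult)
  also have "\<dots> \<le> \<bar>x - y\<bar>" using iexp_approx1[of "x - y" 0] by simp
  finally show ?thesis .
qed

text \<open>The difference of \<open>f\<close> and \<open>g\<close> is small only relative to 1 +
  \<open>\<xi>\<close>, with \<open>\<xi>\<close> bounded in L^2. Young's inequality splits the
  product into a part that vanishes almost surely and a small multiple of the squared
  \<open>\<xi>\<close>, which is controlled in mean.\<close>

lemma (in prob_space) slutsky_char:
  fixes f g \<xi> :: "nat \<Rightarrow> 'a \<Rightarrow> real"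
  assumes [measurable]: "\<And>n. f n \<in> borel_measurable M" "\<And>n. g n \<in> borel_measurable M" "\<And>n. \<xi> n \<in> borel_measurable M"
    and \<xi>: "\<And>n x. 0 \<le> \<xi> n x" "\<And>n. integrable M (\<lambda>x. (\<xi> n x)\<^sup>2)" "\<And>n. (\<integral>x. (\<xi> n x)\<^sup>2 \<partial>M) \<le> C"
    and lim0: "AE x in M. (\<lambda>n. (f n x - g n x) / (1 + \<xi> n x)) \<longlonglongrightarrow> 0"
    and lim: "(\<lambda>n. \<integral>x. iexp (t * g n x) \<partial>M) \<longlonglongrightarrow> z"
  shows "(\<lambda>n. \<integral>x. iexp (t * f n x) \<partial>M) \<longlonglongrightarrow> z"
proof -
  have C: "0 \<le> C" using order_trans[OF Bochner_Integration.integral_nonneg \<xi>(3)] by simp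
  define d where "d = (\<lambda>n x. \<bar>t\<bar> * \<bar>(f n x - g n x) / (1 + \<xi> n x)\<bar>)"
  have dm [measurable]: "d n \<in> borel_measurable M" for n unfolding d_def by measurable
  have d0: "0 \<le> d n x" for n x by (simp add: d_def)
  have dx: "\<bar>t * f n x - t * g n x\<bar> = d n x * (1 + \<xi> n x)" for n x
    using \<xi>(1)[of n x] by (simp add: d_def abs_mult right_diff_distrib[symmetric])
  have ifi: "integrable M (\<lambda>x. iexp (t * f n x))" "integrable M (\<lambda>x. iexp (t * g n x))" for n
    by (rule integrable_const_bound[of _ 1]; simp)+
  have "(\<lambda>n. (\<integral>x. iexp (t * f n x) \<partial>M) - (\<integral>x. iexp (t * g n x) \<partial>M)) \<longlonglongrightarrow> 0"
  proof (rule LIMSEQ_I)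
    fix e :: real assume e: "0 < e"
    define \<eta> where "\<eta> = e / (C + 1)"
    have \<eta>: "0 < \<eta>" using e C by (simp add: \<eta>_def)
    have \<eta>C: "\<eta> * C / 2 < e / 2" using e C by (simp add: \<eta>_def field_simps)
    \<comment> \<open>A difference of two characters never exceeds 2; this cap makes dominated
      convergence applicable although the relative error \<open>d\<close> has no uniform
      bound.\<close>
    define h where "h = (\<lambda>n x. min 2 (d n x + (d n x)\<^sup>2 / (2 * \<eta>)))"
    have h0: "0 \<le> h n x" "h n x \<le> 2" for n x using d0[of n x] \<eta> by (auto simp: h_def)
    have hm [measurable]: "h n \<in> borel_measurable M" for n unfolding h_def by measurable
    have hi: "integrable M (h n)" for n by (rule integrable_const_bound[of _ 2]) (use h0 in auto)
    have "(\<lambda>n. \<integral>x. h n x \<partial>M) \<longlonglongrightarrow> (\<integral>x. 0 \<partial>M)"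
    proof (rule integral_dominated_convergence[where w = "\<lambda>_. 2"])
      show "AE x in M. (\<lambda>n. h n x) \<longlonglongrightarrow> 0"
        using lim0
      proof eventually_elim
        case (elim x)
        have dl: "(\<lambda>n. d n x) \<longlonglongrightarrow> 0" unfolding d_def by (intro tendsto_mult_right_zero tendsto_rabs_zero elim)
        have "(\<lambda>n. h n x) \<longlonglongrightarrow> min 2 (0 + 0\<^sup>2 / (2 * \<eta>))"
          unfolding h_def by (intro tendsto_intros dl) (use \<eta> in auto)
        then show ?case by simp
      qed
    qed (use h0 in auto)
    then have "eventually (\<lambda>n. (\<integral>x. h n x \<partial>M) < e / 2) sequentially"
      by (rule order_tendstoD(2)) (use e in simp)
    then obtain n0 where n0: "\<And>n. n \<ge> n0 \<Longrightarrow> (\<integral>x. h n x \<partial>M) < e / 2" by (auto simp: eventually_sequentially)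
    have "norm ((\<integral>x. iexp (t * f n x) \<partial>M) - (\<integral>x. iexp (t * g n x) \<partial>M) - 0) < e" if n: "n \<ge> n0" for n
    proof -
      have pt: "norm (iexp (t * f n x) - iexp (t * g n x)) \<le> h n x + \<eta> / 2 * (\<xi> n x)\<^sup>2" for x
      proof -
        let ?d = "d n x" and ?k = "\<xi> n x"
        have "norm (iexp (t * f n x) - iexp (t * g n x)) \<le> norm (iexp (t * f n x)) + norm (iexp (t * g n x))" by (rule norm_triangle_ineq4)
        then have a: "norm (iexp (t * f n x) - iexp (t * g n x)) \<le> 2" by simp
        have b: "norm (iexp (t * f n x) - iexp (t * g n x)) \<le> ?d * (1 + ?k)"
          using norm_iexp_diff_le[of "t * f n x" "t * g n x"] unfolding dx .
        \<comment> \<open>Young's inequality with weight \<open>\<eta>\<close>.\<close>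
        have "0 \<le> (?d - \<eta> * ?k)\<^sup>2 / (2 * \<eta>)" using \<eta> by simp
        also have "\<dots> = ?d\<^sup>2 / (2 * \<eta>) - ?d * ?k + \<eta> / 2 * ?k\<^sup>2"
          using \<eta> by (simp add: field_simps power2_eq_square)
        finally have "?d * (1 + ?k) \<le> (?d + ?d\<^sup>2 / (2 * \<eta>)) + \<eta> / 2 * ?k\<^sup>2" by (simp add: algebra_simps)
        moreover have "0 \<le> \<eta> / 2 * ?k\<^sup>2" using \<eta> by simp
        ultimately show ?thesis using a b unfolding h_def by linarith
      qed
      have "(\<integral>x. iexp (t * f n x) \<partial>M) - (\<integral>x. iexp (t * g n x) \<partial>M) = (\<integral>x. iexp (t * f n x) - iexp (t * g n x) \<partial>M)"
        using ifi by (simp only: Bochner_Integration.integral_diff)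
      also have "norm \<dots> \<le> (\<integral>x. norm (iexp (t * f n x) - iexp (t * g n x)) \<partial>M)" by (rule integral_norm_bound)
      also have "\<dots> \<le> (\<integral>x. h n x + \<eta> / 2 * (\<xi> n x)\<^sup>2 \<partial>M)"
        by (rule integral_mono[OF integrable_norm[OF Bochner_Integration.integrable_diff[OF ifi]] _ pt])
           (use hi \<xi>(2) in auto)
      also have "\<dots> = (\<integral>x. h n x \<partial>M) + \<eta> / 2 * (\<integral>x. (\<xi> n x)\<^sup>2 \<partial>M)" using hi \<xi>(2) by simp
      also have "\<dots> < e / 2 + e / 2"
      proof (rule add_less_le_mono[OF n0[OF n]])
        have "\<eta> / 2 * (\<integral>x. (\<xi> n x)\<^sup>2 \<partial>M) \<le> \<eta> / 2 * C" using \<eta> by (intro mult_left_mono \<xi>) auto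
        then show "\<eta> / 2 * (\<integral>x. (\<xi> n x)\<^sup>2 \<partial>M) \<le> e / 2" using \<eta>C by simp
      qed
      finally show ?thesis by simp
    qed
    then show "\<exists>n0. \<forall>n\<ge>n0. norm ((\<integral>x. iexp (t * f n x) \<partial>M) - (\<integral>x. iexp (t * g n x) \<partial>M) - 0) < e" by blast
  qed
  from tendsto_add[OF this lim] show ?thesis by simp
qed

section \<open>Measurability of the estimators\<close>

text \<open>Cramer's rule makes the entries of the inverse rational functions of the entries of the
  matrix, from which measurability follows.\<close>

lemma matrix_inv_nth:
  fixes A :: "real ^ 'n ^ 'n"
  assumes "invertible A"
  shows "matrix_inv A $ i $ j = det (\<chi> r s. if s = i then (if r = j then 1 else 0) else A $ r $ s) / det A"
proof -
  have d: "det A \<noteq> 0" using assms by (simp add: invertible_det_nz)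
  have "A *v (matrix_inv A *v axis j 1) = axis j 1"
    by (simp add: matrix_vector_mul_assoc matrix_inv_mult[OF assms])
  then have "matrix_inv A *v axis j 1 = (\<chi> k. det (\<chi> r s. if s = k then (axis j 1 :: real ^ 'n) $ r else A $ r $ s) / det A)"
    using cramer[OF d] by blast
  then have "(matrix_inv A *v axis j 1) $ i = det (\<chi> r s. if s = i then (axis j 1 :: real ^ 'n) $ r else A $ r $ s) / det A" by simp
  moreover have "(matrix_inv A *v axis j 1) $ i = matrix_inv A $ i $ j"
    by (simp add: matrix_vector_mult_basis column_def)
  moreover have "(\<chi> r s. if s = i then (axis j 1 :: real ^ 'n) $ r else A $ r $ s) = (\<chi> r s. if s = i then (if r = j then 1 else 0) else A $ r $ s)"
    by (simp add: vec_eq_iff axis_def)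
  ultimately show ?thesis by simp
qed

lemma borel_measurable_det:
  fixes F :: "'w \<Rightarrow> real ^ 'n ^ 'n"
  assumes [measurable]: "\<And>i j. (\<lambda>\<omega>. F \<omega> $ i $ j) \<in> borel_measurable M"
  shows "(\<lambda>\<omega>. det (F \<omega>)) \<in> borel_measurable M"
  unfolding det_def by measurable

lemma borel_measurable_matrix_inv:
  fixes F :: "'w \<Rightarrow> real ^ 'n ^ 'n"
  assumes m [measurable]: "\<And>i j. (\<lambda>\<omega>. F \<omega> $ i $ j) \<in> borel_measurable M"
    and inv: "\<And>\<omega>. \<omega> \<in> space M \<Longrightarrow> invertible (F \<omega>)"
  shows "(\<lambda>\<omega>. matrix_inv (F \<omega>) $ i $ j) \<in> borel_measurable M"
proof -
  have [measurable]: "(\<lambda>\<omega>. det (F \<omega>)) \<in> borel_measurable M" by (rule borel_measurable_det) (rule m)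
  have "(\<lambda>\<omega>. (\<chi> r s. if s = i then (if r = j then 1 else 0) else F \<omega> $ r $ s) $ r' $ s') \<in> borel_measurable M" for r' s'
    by simp
  then have [measurable]: "(\<lambda>\<omega>. det (\<chi> r s. if s = i then (if r = j then 1 else 0) else F \<omega> $ r $ s)) \<in> borel_measurable M"
    by (rule borel_measurable_det)
  have "(\<lambda>\<omega>. det (\<chi> r s. if s = i then (if r = j then 1 else 0) else F \<omega> $ r $ s) / det (F \<omega>)) \<in> borel_measurable M"
    by measurable
  then show ?thesis by (rule measurable_cong[THEN iffD2, rotated]) (rule matrix_inv_nth[OF inv])
qed

lemma borel_measurable_vec:
  fixes f :: "'w \<Rightarrow> real ^ 'n"
  assumes "\<And>i. (\<lambda>\<omega>. f \<omega> $ i) \<in> borel_measurable M"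
  shows "f \<in> borel_measurable M"
  by (subst borel_measurable_euclidean_space) (use assms in \<open>auto simp: Basis_vec_eq inner_axis\<close>)

text \<open>A sum of outer squares is positive semidefinite, so adding the identity makes it
  definite. The matrix in the estimator is thus invertible for every outcome, and Cramer's formula
  for its inverse holds everywhere.\<close>

lemma invertible_Smat: "invertible (Smat x n :: real ^ ('p::{finite,linorder} option) ^ ('p option))"
proof -
  define S :: "real ^ ('p option) ^ ('p option)" where "S = (\<Sum>k \<in> tree_from n (CARD('p) - 1). outer (Yvec x k) (Yvec x k))"
  have "invertible (S + mat 1)"
  proof -
    have "v = 0" if v: "(S + mat 1) *v v = 0" for v
    proof -
      have "v \<bullet> (S *v v) = (\<Sum>k \<in> tree_from n (CARD('p) - 1). (Yvec x k \<bullet> v) * (v \<bullet> Yvec x k))"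
        by (simp add: S_def sum_matrix_vector_mult outer_mult_vec inner_sum_right)
      also have "0 \<le> \<dots>" by (intro sum_nonneg) (simp add: inner_commute)
      finally have "0 \<le> v \<bullet> (S *v v)" .
      moreover have "v \<bullet> (S *v v) + v \<bullet> v = 0"
        using v by (simp add: matrix_vector_mult_add_rdistrib inner_add_right[symmetric])
      moreover have "0 \<le> v \<bullet> v" by simp
      ultimately have "v \<bullet> v = 0" by linarith
      then show ?thesis by simp
    qed
    then show ?thesis by (simp add: invertible_left_inverse matrix_left_invertible_ker)
  qed
  then show ?thesis unfolding Smat_def S_def[symmetric] Let_def by simp
qed

context bar_model
begin

lemma X_M: "s0 \<le> k \<Longrightarrow> X (2 * k + c) \<in> borel_measurable M"
  using s0_ge_1 by (intro X_rv) simp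

lemma Smat_measurable:
  "(\<lambda>\<omega>. (Smat (\<lambda>k. X k \<omega>) n :: real ^ ('p option) ^ ('p option)) $ i $ j) \<in> borel_measurable M"
proof -
  let ?S = "\<lambda>\<omega>. (\<Sum>k \<in> tree_from n (CARD('p) - 1). outer (Yvec (\<lambda>k. X k \<omega>) k) (Yvec (\<lambda>k. X k \<omega>) k)) :: real ^ ('p option) ^ ('p option)"
  have Y: "(\<lambda>\<omega>. (Yvec (\<lambda>k. X k \<omega>) k :: real ^ ('p option)) $ i) \<in> borel_measurable M" if "k \<in> tree_from n (CARD('p) - 1)" for k i
    using YX_M[of k i] that by (simp add: YX_def[abs_def] tree_from_eq s0_def)
  have Sm: "(\<lambda>\<omega>. ?S \<omega> $ i $ j) \<in> borel_measurable M" for i j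
    unfolding sum_component outer_nth by (intro borel_measurable_sum borel_measurable_times Y)
  note [measurable] = Sm
  have [measurable]: "(\<lambda>\<omega>. det (?S \<omega>)) \<in> borel_measurable M" by (rule borel_measurable_det) (rule Sm)
  have eq: "(Smat (\<lambda>k. X k \<omega>) n :: real ^ ('p option) ^ ('p option)) $ i $ j
      = (if det (?S \<omega>) \<noteq> 0 then ?S \<omega> $ i $ j else ?S \<omega> $ i $ j + (if i = j then 1 else 0))" for \<omega>
    by (simp add: Smat_def Let_def invertible_det_nz mat_def)
  show ?thesis unfolding eq by measurable
qed

lemma theta_hat_measurable:
  "(\<lambda>\<omega>. (theta_hat \<theta>0 (\<lambda>k. X k \<omega>) n :: real ^ (2 \<times> 'p option)) $ ci) \<in> borel_measurable M"
proof (cases "n < CARD('p)")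
  case False
  have inv: "(\<lambda>\<omega>. matrix_inv (Smat (\<lambda>k. X k \<omega>) (n - 1) :: real ^ ('p option) ^ ('p option)) $ i $ j) \<in> borel_measurable M" for i j
    by (rule borel_measurable_matrix_inv[OF Smat_measurable invertible_Smat])
  have Y: "(\<lambda>\<omega>. (Yvec (\<lambda>k. X k \<omega>) k :: real ^ ('p option)) $ i) \<in> borel_measurable M" if "k \<in> tree_from (n - 1) (CARD('p) - 1)" for k i
    using YX_M[of k i] that by (simp add: YX_def[abs_def] tree_from_eq s0_def)
  have Z: "(\<lambda>\<omega>. Zvec (\<lambda>k. X k \<omega>) k $ c) \<in> borel_measurable M" if "k \<in> tree_from (n - 1) (CARD('p) - 1)" for k c
  proof -
    have k: "s0 \<le> k" using that by (simp add: tree_from_eq s0_def)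
    have "c = 1 \<or> c = 2" by (rule exhaust_2)
    then show ?thesis using X_M[OF k, of 0] X_M[OF k, of 1] by (auto simp: Zvec_def)
  qed
  have "(theta_hat \<theta>0 (\<lambda>k. X k \<omega>) n :: real ^ (2 \<times> 'p option)) $ ci = (\<Sum>j\<in>UNIV. matrix_inv (Smat (\<lambda>k. X k \<omega>) (n - 1) :: real ^ ('p option) ^ ('p option)) $ snd ci $ j *
      (\<Sum>k \<in> tree_from (n - 1) (CARD('p) - 1). (Yvec (\<lambda>k. X k \<omega>) k :: real ^ ('p option)) $ j * Zvec (\<lambda>k. X k \<omega>) k $ fst ci))" for \<omega>
    using False by (simp add: theta_hat_def vec_stack_def matrix_matrix_mult_def)
  then show ?thesis by (simp only:) (intro borel_measurable_sum borel_measurable_times inv Y Z)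
qed (simp add: theta_hat_def)

lemma eps_hat_measurable:
  assumes k: "s0 \<le> k" and c: "c \<in> {0, 1}"
  shows "(\<lambda>\<omega>. eps_hat (\<theta>0 :: real ^ (2 \<times> 'p option)) (\<lambda>k. X k \<omega>) (2 * k + c)) \<in> borel_measurable M"
proof -
  have d: "(2 * k + c) div 2 = k" using c by auto
  have "X (k div 2 ^ (pos (i :: 'p) - 1)) \<in> borel_measurable M" for i
    using YX_M[OF k, of "Some i"] by (simp add: YX_Some)
  note [measurable] = this theta_hat_measurable X_M[OF k]
  show ?thesis unfolding eps_hat_def Let_def d by measurable
qed

lemma residual_sum_measurable:
  assumes "c \<in> {0, 1}" "c' \<in> {0, 1}"
  shows "(\<lambda>\<omega>. \<Sum>k\<in>tree_from n (CARD('p) - 1). eps_hat (\<theta>0 :: real ^ (2 \<times> 'p option)) (\<lambda>k. X k \<omega>) (2 * k + c)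
      * eps_hat \<theta>0 (\<lambda>k. X k \<omega>) (2 * k + c')) \<in> borel_measurable M"
  by (intro borel_measurable_sum borel_measurable_times eps_hat_measurable assms) (auto simp: tree_from_eq s0_def)

end

section \<open>The limits of the variance and covariance estimators\<close>

lemma tree_ratio: "(\<lambda>n. sqrt (real (card (tree n))) / sqrt (2 ^ (n + 1))) \<longlonglongrightarrow> 1"
proof -
  have "sqrt (real (card (tree n))) / sqrt (2 ^ (n + 1)) = sqrt (1 - (1 / 2) ^ Suc n)" for n
  proof -
    have "real (card (tree n)) = 2 ^ (n + 1) - 1" by (simp add: card_tree of_nat_diff)
    then have "real (card (tree n)) / 2 ^ (n + 1) = 1 - (1 / 2) ^ Suc n" by (simp add: field_simps)
    then show ?thesis by (simp only: real_sqrt_divide[symmetric])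
  qed
  moreover have "(\<lambda>n. sqrt (1 - (1 / 2) ^ Suc n)) \<longlonglongrightarrow> sqrt (1 - 0)"
    by (intro tendsto_intros LIMSEQ_Suc LIMSEQ_power_zero) simp
  ultimately show ?thesis by simp
qed

context bar_model
begin

text \<open>The centred noise functionals behind both residual estimators, and their squares, are
  all polynomials of this shape, so this computes their conditional means and variances
  alike.\<close>

lemma cond_polynomial:
  assumes k: "s0 \<le> k"
  defines "x \<equiv> \<epsilon> (2 * k)" and "y \<equiv> \<epsilon> (2 * k + 1)"
  shows "AE \<omega> in M. real_cond_exp M (H k) (\<lambda>\<omega>. c0 + (c1 * ((x \<omega>)\<^sup>2 + (y \<omega>)\<^sup>2) + (c2 * (x \<omega> * y \<omega>) + (c3 * (x \<omega> ^ 4 + y \<omega> ^ 4) + c4 * ((x \<omega>)\<^sup>2 * (y \<omega>)\<^sup>2))))) \<omega>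
    = c0 + (c1 * (\<sigma>\<^sup>2 + \<sigma>\<^sup>2) + (c2 * \<rho> + (c3 * (\<tau> ^ 4 + \<tau> ^ 4) + c4 * \<nu>\<^sup>2)))"
proof -
  have L8: "L8 M x" "L8 M y" using eps_L8[OF k, of 0] eps_L8[OF k, of 1] by (auto simp: x_def y_def)
  note i = L8_integrable2[OF L8(1)] L8_integrable2[OF L8(2)] L8_integrable_mult[OF L8] L8_integrable4[OF L8(1)] L8_integrable4[OF L8(2)] L8_integrable_mult2[OF L8]
  have scale: "AE \<omega> in M. real_cond_exp M (H k) (\<lambda>\<omega>. d * f \<omega>) \<omega> = d * r"
    if "integrable M f" "AE \<omega> in M. real_cond_exp M (H k) f \<omega> = r" for d f r
    by (rule real_cond_exp_mult_const[OF _ _ _ that(2)]) (use that(1) in auto)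
  have c: "AE \<omega> in M. real_cond_exp M (H k) (\<lambda>\<omega>. (x \<omega>)\<^sup>2) \<omega> = \<sigma>\<^sup>2" "AE \<omega> in M. real_cond_exp M (H k) (\<lambda>\<omega>. (y \<omega>)\<^sup>2) \<omega> = \<sigma>\<^sup>2"
    "AE \<omega> in M. real_cond_exp M (H k) (\<lambda>\<omega>. x \<omega> ^ 4) \<omega> = \<tau> ^ 4" "AE \<omega> in M. real_cond_exp M (H k) (\<lambda>\<omega>. y \<omega> ^ 4) \<omega> = \<tau> ^ 4"
    using cond_var[OF k, of 0] cond_var[OF k, of 1] cond_4[OF k, of 0] cond_4[OF k, of 1] by (simp_all add: x_def y_def)
  show ?thesis
    by (intro real_cond_exp_add_eq scale real_cond_exp_const c cond_cov[OF k, folded x_def y_def] cond_22[OF k, folded x_def y_def]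
        Bochner_Integration.integrable_add integrable_mult_right i integrable_const)
qed

text \<open>The common part of the two residual estimators: \<open>R n\<close> is the sum over
  residuals, \<open>c0\<close> the parameter to be estimated, and \<open>G\<close> the centred
  functional of the noise for which \<open>R n\<close> stands. \<open>noise_clt\<close> applies to
  \<open>G\<close>; replacing noise by residuals and adjusting the normalisation are absorbed by
  \<open>slutsky_char\<close>.\<close>

lemma residual_clt:
  fixes G :: "real \<times> real \<Rightarrow> real" and R :: "nat \<Rightarrow> 'w \<Rightarrow> real"
  assumes G [measurable]: "G \<in> borel_measurable borel"
    and c1: "\<And>k. s0 \<le> k \<Longrightarrow> AE \<omega> in M. real_cond_exp M (H k) (\<lambda>\<omega>. G (\<epsilon> (2 * k) \<omega>, \<epsilon> (2 * k + 1) \<omega>)) \<omega> = 0"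
    and c2: "\<And>k. s0 \<le> k \<Longrightarrow> AE \<omega> in M. real_cond_exp M (H k) (\<lambda>\<omega>. (G (\<epsilon> (2 * k) \<omega>, \<epsilon> (2 * k + 1) \<omega>))\<^sup>2) \<omega> = w"
    and bound: "\<And>z. G z ^ 4 \<le> K * (1 + fst z ^ 8 + snd z ^ 8)" and K: "0 \<le> K"
    and R [measurable]: "\<And>n. R n \<in> borel_measurable M"
    and rem: "AE \<omega> in M. (\<lambda>n. 1 / sqrt (2 ^ (n + 1)) * (R n \<omega> - (\<Sum>k\<in>tree_from n (CARD('p) - 1). G (\<epsilon> (2 * k) \<omega>, \<epsilon> (2 * k + 1) \<omega>) + c0))) \<longlonglongrightarrow> 0"
  shows "weak_conv_m (\<lambda>n. distr M borel (\<lambda>\<omega>. sqrt (real (card (tree (n - 1)))) * (1 / real (card (tree (n - 1))) * R (n - 1) \<omega> - c0)))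
    (normal_dist 0 w)"
proof -
  note clt = noise_clt[OF G c1 c2 bound K]
  define s where "s = (\<lambda>n. sqrt (2 ^ (n + 1) :: real))"
  define N' where "N' = (\<lambda>n. real (card (tree n)))"
  define S where "S = (\<lambda>n \<omega>. \<Sum>k\<in>tree_from n (CARD('p) - 1). G (\<epsilon> (2 * k) \<omega>, \<epsilon> (2 * k + 1) \<omega>))"
  define g where "g = (\<lambda>n \<omega>. 1 / s n * S n \<omega>)"
  define f where "f = (\<lambda>n \<omega>. sqrt (N' n) * (1 / N' n * R n \<omega> - c0))"
  define m where "m = (\<lambda>n. real (card (tree_from n (CARD('p) - 1))))"
  define q where "q = (\<lambda>n. s n / sqrt (N' n))"
  have s: "0 < s n" "s n * s n = 2 ^ (n + 1)" for n by (simp_all add: s_def)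
  have N'_eq: "N' n = 2 ^ (n + 1) - 1" for n by (simp add: N'_def card_tree of_nat_diff)
  have "(1::real) < 2 ^ (n + 1)" for n by (rule one_less_power) auto
  then have N': "0 < N' n" for n by (simp add: N'_eq del: power_Suc)
  have q: "q \<longlonglongrightarrow> 1"
    using tendsto_inverse[OF tree_ratio] by (simp add: q_def s_def N'_def inverse_eq_divide)
  have s_inf: "(\<lambda>n. 1 / s n) \<longlonglongrightarrow> 0"
  proof -
    have "1 / s n = sqrt ((1 / 2) ^ Suc n)" for n by (simp add: s_def real_sqrt_divide power_one_over)
    moreover have "(\<lambda>n. sqrt ((1 / 2) ^ Suc n)) \<longlonglongrightarrow> sqrt 0"
      by (intro tendsto_real_sqrt LIMSEQ_Suc LIMSEQ_power_zero) simp
    ultimately show ?thesis by simp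
  qed
  \<comment> \<open>The sum runs over the vertices from \<open>s0\<close> on, but is divided by the
    size of the whole tree. The s0 - 1 missing vertices leave a bias of fixed size before
    normalisation.\<close>
  have "(\<lambda>n. c0 * (1 - real s0) * (1 / s n)) \<longlonglongrightarrow> 0" by (rule tendsto_mult_right_zero[OF s_inf])
  moreover have "eventually (\<lambda>n. c0 * (1 - real s0) * (1 / s n) = c0 * (m n - N' n) / s n) sequentially"
  proof (rule eventually_sequentiallyI[of "CARD('p)"])
    fix n assume n: "CARD('p) \<le> n"
    have le: "s0 \<le> 2 ^ (n + 1)" unfolding s0_def using n by (intro power_increasing) auto
    have "m n = real (2 ^ (n + 1) - s0)" by (simp add: m_def tree_from_eq s0_def)
    also have "\<dots> = 2 ^ (n + 1) - real s0" using of_nat_diff[OF le, where 'a = real] by simp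
    finally have "m n - N' n = 1 - real s0" by (simp add: N'_eq)
    then show "c0 * (1 - real s0) * (1 / s n) = c0 * (m n - N' n) / s n" by simp
  qed
  ultimately have \<kappa>: "(\<lambda>n. c0 * (m n - N' n) / s n) \<longlonglongrightarrow> 0" by (rule Lim_transform_eventually)
  have em: "\<epsilon> (2 * k) \<in> borel_measurable M" "\<epsilon> (2 * k + 1) \<in> borel_measurable M" if "s0 \<le> k" for k
    using eps_M[OF that, of 0] eps_M[OF that, of 1] by auto
  have "(\<lambda>\<omega>. G (\<epsilon> (2 * k) \<omega>, \<epsilon> (2 * k + 1) \<omega>)) \<in> borel_measurable M" if "k \<in> tree_from n (CARD('p) - 1)" for k n
  proof -
    have "s0 \<le> k" using that by (simp add: tree_from_eq s0_def)
    note [measurable] = em[OF this]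
    show ?thesis by measurable
  qed
  then have Sm [measurable]: "S n \<in> borel_measurable M" for n unfolding S_def by (intro borel_measurable_sum)
  have fm [measurable]: "f n \<in> borel_measurable M" and gm [measurable]: "g n \<in> borel_measurable M" for n
    unfolding f_def g_def by measurable
  have g2: "(g n \<omega>)\<^sup>2 = 1 / 2 ^ (n + 1) * (S n \<omega>)\<^sup>2" for n \<omega>
    unfolding g_def power_mult_distrib power_divide using s(2)[of n] by (simp add: power2_eq_square)
  have "(\<lambda>n. \<integral>\<omega>. iexp (t * f n \<omega>) \<partial>M) \<longlonglongrightarrow> of_real (exp (- (t\<^sup>2 * w / 2)))" for t
  proof (rule slutsky_char[where \<xi> = "\<lambda>n \<omega>. \<bar>g n \<omega>\<bar>" and C = w and g = g])
    show "integrable M (\<lambda>\<omega>. \<bar>g n \<omega>\<bar>\<^sup>2)" for n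
      unfolding power2_abs g2 using clt(3)[of n] by (intro integrable_mult_right) (simp add: S_def)
    have "(\<integral>\<omega>. (g n \<omega>)\<^sup>2 \<partial>M) = 1 / 2 ^ (n + 1) * (\<integral>\<omega>. (S n \<omega>)\<^sup>2 \<partial>M)" for n
      unfolding g2 by simp
    also have "\<dots> n \<le> 1 / 2 ^ (n + 1) * (2 ^ (n + 1) * w)" for n
      using clt(4)[of n] by (intro mult_left_mono) (simp_all add: S_def)
    finally show "(\<integral>\<omega>. \<bar>g n \<omega>\<bar>\<^sup>2 \<partial>M) \<le> w" for n by simp
    show "(\<lambda>n. \<integral>\<omega>. iexp (t * g n \<omega>) \<partial>M) \<longlonglongrightarrow> of_real (exp (- (t\<^sup>2 * w / 2)))"
      unfolding g_def S_def s_def by (rule clt(2))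
    show "AE \<omega> in M. (\<lambda>n. (f n \<omega> - g n \<omega>) / (1 + \<bar>g n \<omega>\<bar>)) \<longlonglongrightarrow> 0"
      using rem
    proof eventually_elim
      case (elim \<omega>)
      define r where "r = (\<lambda>n. 1 / s n * (R n \<omega> - (\<Sum>k\<in>tree_from n (CARD('p) - 1). G (\<epsilon> (2 * k) \<omega>, \<epsilon> (2 * k + 1) \<omega>) + c0)))"
      define k where "k = (\<lambda>n. r n + c0 * (m n - N' n) / s n)"
      have "r \<longlonglongrightarrow> 0" using elim by (simp add: r_def s_def)
      from tendsto_add[OF this \<kappa>] have k: "k \<longlonglongrightarrow> 0" by (simp add: k_def)
      \<comment> \<open>\<open>q n\<close> corrects the normalisation and tends to 1;
        \<open>k n\<close> gathers the residual remainder and the bias of the missing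
        vertices.\<close>
      have fq: "f n \<omega> = q n * (g n \<omega> + k n)" for n
      proof -
        have "s n * (g n \<omega> + k n) = S n \<omega> + (R n \<omega> - (S n \<omega> + m n * c0)) + c0 * (m n - N' n)"
          using s(1)[of n] by (simp add: k_def r_def g_def S_def sum.distrib m_def distrib_left)
        then have "s n * (g n \<omega> + k n) = R n \<omega> - c0 * N' n" by (simp add: algebra_simps)
        then have "q n * (g n \<omega> + k n) = (R n \<omega> - c0 * N' n) / sqrt (N' n)" by (simp add: q_def)
        also have "\<dots> = sqrt (N' n) * ((R n \<omega> - c0 * N' n) / (sqrt (N' n) * sqrt (N' n)))" using N'[of n] by (simp del: real_sqrt_mult_self)
        also have "\<dots> = f n \<omega>" using N'[of n] by (simp add: f_def diff_divide_distrib)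
        finally show ?thesis ..
      qed
      show ?case
      proof (rule Lim_null_comparison)
        show "eventually (\<lambda>n. norm ((f n \<omega> - g n \<omega>) / (1 + \<bar>g n \<omega>\<bar>)) \<le> \<bar>q n - 1\<bar> + \<bar>q n\<bar> * \<bar>k n\<bar>) sequentially"
        proof (rule always_eventually, rule allI)
          fix n
          have "\<bar>f n \<omega> - g n \<omega>\<bar> = \<bar>(q n - 1) * g n \<omega> + q n * k n\<bar>" by (simp add: fq algebra_simps)
          also have "\<dots> \<le> \<bar>q n - 1\<bar> * \<bar>g n \<omega>\<bar> + \<bar>q n\<bar> * \<bar>k n\<bar>"
            by (rule order_trans[OF abs_triangle_ineq]) (simp add: abs_mult)
          also have "\<dots> \<le> \<bar>q n - 1\<bar> * (1 + \<bar>g n \<omega>\<bar>) + \<bar>q n\<bar> * \<bar>k n\<bar> * (1 + \<bar>g n \<omega>\<bar>)"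
            by (simp add: distrib_left)
          finally show "norm ((f n \<omega> - g n \<omega>) / (1 + \<bar>g n \<omega>\<bar>)) \<le> \<bar>q n - 1\<bar> + \<bar>q n\<bar> * \<bar>k n\<bar>"
            by (simp add: divide_le_eq distrib_right[symmetric])
        qed
        have "(\<lambda>n. \<bar>q n - 1\<bar> + \<bar>q n\<bar> * \<bar>k n\<bar>) \<longlonglongrightarrow> \<bar>1 - 1\<bar> + \<bar>1\<bar> * \<bar>0\<bar>" by (intro tendsto_intros q k)
        then show "(\<lambda>n. \<bar>q n - 1\<bar> + \<bar>q n\<bar> * \<bar>k n\<bar>) \<longlonglongrightarrow> 0" by simp
      qed
    qed
  qed auto
  moreover have ch: "char (distr M borel (f n)) t = (\<integral>\<omega>. iexp (t * f n \<omega>) \<partial>M)" for n t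
    unfolding char_def by (rule integral_distr) simp_all
  moreover have w: "0 \<le> w" by (rule clt(1))
  moreover have "char (normal_dist 0 w) t = of_real (exp (- (t\<^sup>2 * w / 2)))" for t
    unfolding normal_dist_props(2)[OF w] exp_of_real[symmetric] by simp
  ultimately have "(\<lambda>n. char (distr M borel (f n)) t) \<longlonglongrightarrow> char (normal_dist 0 w) t" for t
    by (simp only:)
  \<comment> \<open>The estimator of time \<open>n\<close> sums over the tree of depth n - 1; the
    truncated value at n = 0 is harmless in the limit.\<close>
  then have "(\<lambda>n. char (distr M borel (f (n - 1))) t) \<longlonglongrightarrow> char (normal_dist 0 w) t" for t
    by (intro LIMSEQ_imp_Suc[where f = "\<lambda>n. char (distr M borel (f (n - 1))) t"]) simp
  then have "weak_conv_m (\<lambda>n. distr M borel (f (n - 1))) (normal_dist 0 w)"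
    by (intro levy_continuity normal_dist_props(1)[OF w] real_distribution_distr) auto
  then show ?thesis by (simp add: f_def N'_def)
qed

lemma residual_products:
  "AE \<omega> in M. \<forall>c\<in>{0, 1}. \<forall>c'\<in>{0, 1}. (\<lambda>n. 1 / sqrt (2 ^ (n + 1)) * (\<Sum>k\<in>tree_from n (CARD('p) - 1).
      eps_hat (\<theta>0 :: real ^ (2 \<times> 'p option)) (\<lambda>k. X k \<omega>) (2 * k + c) * eps_hat \<theta>0 (\<lambda>k. X k \<omega>) (2 * k + c') - \<epsilon> (2 * k + c) \<omega> * \<epsilon> (2 * k + c') \<omega>)) \<longlonglongrightarrow> 0"
  using AE_lse
proof eventually_elim
  case (elim \<omega>)
  interpret P: bar_path_lse N a b "\<sigma>\<^sup>2" "\<lambda>k. X k \<omega>" "\<lambda>k. \<epsilon> k \<omega>" \<theta>0 by fact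
  show ?case using P.residual_remainder by blast
qed

lemma sigma2_hat_clt:
  "weak_conv_m (\<lambda>n. distr M borel (\<lambda>\<omega>. sqrt (real (card (tree (n - 1)))) * (sigma2_hat (\<theta>0 :: real ^ (2 \<times> 'p option)) (\<lambda>k. X k \<omega>) n - \<sigma>\<^sup>2)))
    (normal_dist 0 ((\<tau> ^ 4 - 2 * \<sigma> ^ 4 + \<nu>\<^sup>2) / 2))"
proof -
  let ?E = "\<lambda>\<omega>. eps_hat \<theta>0 (\<lambda>k. X k \<omega>)" and ?T = "\<lambda>n. tree_from n (CARD('p) - 1)"
  let ?G = "\<lambda>z :: real \<times> real. - \<sigma>\<^sup>2 + 1 / 2 * ((fst z)\<^sup>2 + (snd z)\<^sup>2)"
  define R where "R = (\<lambda>n \<omega>. 1 / 2 * ((\<Sum>k\<in>?T n. ?E \<omega> (2 * k + 0) * ?E \<omega> (2 * k + 0)) + (\<Sum>k\<in>?T n. ?E \<omega> (2 * k + 1) * ?E \<omega> (2 * k + 1))))"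
  have "weak_conv_m (\<lambda>n. distr M borel (\<lambda>\<omega>. sqrt (real (card (tree (n - 1)))) * (1 / real (card (tree (n - 1))) * R (n - 1) \<omega> - \<sigma>\<^sup>2)))
      (normal_dist 0 ((\<tau> ^ 4 - 2 * \<sigma> ^ 4 + \<nu>\<^sup>2) / 2))"
  \<comment> \<open>Any \<open>K\<close> above both 4 and 8 sigma^8 would serve; this one is
    generous.\<close>
  proof (rule residual_clt[where G = ?G and K = "108 + 108 * \<sigma> ^ 8"])
    show "?G \<in> borel_measurable borel" by (simp add: borel_prod[symmetric])
    fix k assume k: "s0 \<le> k"
    show "AE \<omega> in M. real_cond_exp M (H k) (\<lambda>\<omega>. ?G (\<epsilon> (2 * k) \<omega>, \<epsilon> (2 * k + 1) \<omega>)) \<omega> = 0"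
      using cond_polynomial[OF k, of "- \<sigma>\<^sup>2" "1 / 2" 0 0 0] by simp
    have e: "(?G (x, y))\<^sup>2 = \<sigma> ^ 4 + (- \<sigma>\<^sup>2 * ((x)\<^sup>2 + (y)\<^sup>2) + (0 * (x * y) + (1 / 4 * (x ^ 4 + y ^ 4) + 1 / 2 * ((x)\<^sup>2 * (y)\<^sup>2))))" for x y
      by (simp add: algebra_simps power2_eq_square power4_eq_xxxx)
    have v: "\<sigma> ^ 4 + (- \<sigma>\<^sup>2 * (\<sigma>\<^sup>2 + \<sigma>\<^sup>2) + (0 * \<rho> + (1 / 4 * (\<tau> ^ 4 + \<tau> ^ 4) + 1 / 2 * \<nu>\<^sup>2))) = (\<tau> ^ 4 - 2 * \<sigma> ^ 4 + \<nu>\<^sup>2) / 2"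
      by (simp add: algebra_simps power2_eq_square power4_eq_xxxx)
    show "AE \<omega> in M. real_cond_exp M (H k) (\<lambda>\<omega>. (?G (\<epsilon> (2 * k) \<omega>, \<epsilon> (2 * k + 1) \<omega>))\<^sup>2) \<omega> = (\<tau> ^ 4 - 2 * \<sigma> ^ 4 + \<nu>\<^sup>2) / 2"
      unfolding e v[symmetric] by (rule cond_polynomial[OF k])
  next
    fix z :: "real \<times> real"
    obtain x y where z: "z = (x, y)" by force
    have "?G z ^ 4 \<le> 8 * ((- \<sigma>\<^sup>2) ^ 4 + (1 / 2 * (x\<^sup>2 + y\<^sup>2)) ^ 4)" unfolding z fst_conv snd_conv by (rule power4_add_le)
    also have "\<dots> = 8 * \<sigma> ^ 8 + 1 / 2 * (x\<^sup>2 + y\<^sup>2) ^ 4" unfolding power_mult_distrib by (simp add: power_divide flip: power_mult)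
    also have "\<dots> \<le> 8 * \<sigma> ^ 8 + 1 / 2 * (8 * ((x\<^sup>2) ^ 4 + (y\<^sup>2) ^ 4))" using power4_add_le[of "x\<^sup>2" "y\<^sup>2"] by linarith
    also have "\<dots> = 8 * \<sigma> ^ 8 + 4 * (x ^ 8 + y ^ 8)" by (simp flip: power_mult)
    also have "\<dots> \<le> 108 * \<sigma> ^ 8 + 108 * \<sigma> ^ 8 * (x ^ 8 + y ^ 8) + 108 * (1 + x ^ 8 + y ^ 8)"
    proof -
      have "0 \<le> \<sigma> ^ 8" "0 \<le> x ^ 8" "0 \<le> y ^ 8" by simp_all
      moreover from this have "0 \<le> \<sigma> ^ 8 * (x ^ 8 + y ^ 8)" by simp
      ultimately show ?thesis by (simp only: mult.assoc) argo
    qed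
    finally show "?G z ^ 4 \<le> (108 + 108 * \<sigma> ^ 8) * (1 + fst z ^ 8 + snd z ^ 8)"
      by (simp add: z algebra_simps)
  next
    show "R n \<in> borel_measurable M" for n
      unfolding R_def by (intro borel_measurable_times borel_measurable_add borel_measurable_const residual_sum_measurable) auto
    show "AE \<omega> in M. (\<lambda>n. 1 / sqrt (2 ^ (n + 1)) * (R n \<omega> - (\<Sum>k\<in>?T n. ?G (\<epsilon> (2 * k) \<omega>, \<epsilon> (2 * k + 1) \<omega>) + \<sigma>\<^sup>2))) \<longlonglongrightarrow> 0"
      using residual_products[of \<theta>0]
    proof eventually_elim
      case (elim \<omega>)
      let ?D = "\<lambda>c n. 1 / sqrt (2 ^ (n + 1)) * (\<Sum>k\<in>?T n. ?E \<omega> (2 * k + c) * ?E \<omega> (2 * k + c) - \<epsilon> (2 * k + c) \<omega> * \<epsilon> (2 * k + c) \<omega>)"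
      have "(\<lambda>n. 1 / 2 * (?D 0 n + ?D 1 n)) \<longlonglongrightarrow> 0"
        by (intro tendsto_mult_right_zero tendsto_add_zero) (use elim in auto)
      moreover have "1 / sqrt (2 ^ (n + 1)) * (R n \<omega> - (\<Sum>k\<in>?T n. ?G (\<epsilon> (2 * k) \<omega>, \<epsilon> (2 * k + 1) \<omega>) + \<sigma>\<^sup>2)) = 1 / 2 * (?D 0 n + ?D 1 n)" for n
      proof -
        have "(\<Sum>k\<in>?T n. ?G (\<epsilon> (2 * k) \<omega>, \<epsilon> (2 * k + 1) \<omega>) + \<sigma>\<^sup>2) = 1 / 2 * ((\<Sum>k\<in>?T n. \<epsilon> (2 * k + 0) \<omega> * \<epsilon> (2 * k + 0) \<omega>) + (\<Sum>k\<in>?T n. \<epsilon> (2 * k + 1) \<omega> * \<epsilon> (2 * k + 1) \<omega>))"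
          unfolding sum.distrib[symmetric] sum_distrib_left by (rule sum.cong) (simp_all add: power2_eq_square)
        then show ?thesis unfolding R_def sum_subtractf by (simp only:) argo
      qed
      ultimately show ?case by (simp only:)
    qed
  qed simp
  moreover have "sigma2_hat \<theta>0 (\<lambda>k. X k \<omega>) n = 1 / real (card (tree (n - 1))) * R (n - 1) \<omega>" for n \<omega>
    by (simp add: sigma2_hat_def R_def sum.distrib power2_eq_square)
  ultimately show ?thesis by simp
qed

lemma rho_hat_clt:
  "weak_conv_m (\<lambda>n. distr M borel (\<lambda>\<omega>. sqrt (real (card (tree (n - 1)))) * (rho_hat (\<theta>0 :: real ^ (2 \<times> 'p option)) (\<lambda>k. X k \<omega>) n - \<rho>)))
    (normal_dist 0 (\<nu>\<^sup>2 - \<rho>\<^sup>2))"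
proof -
  let ?E = "\<lambda>\<omega>. eps_hat \<theta>0 (\<lambda>k. X k \<omega>)" and ?T = "\<lambda>n. tree_from n (CARD('p) - 1)"
  let ?G = "\<lambda>z :: real \<times> real. - \<rho> + fst z * snd z"
  define R where "R = (\<lambda>n \<omega>. \<Sum>k\<in>?T n. ?E \<omega> (2 * k + 0) * ?E \<omega> (2 * k + 1))"
  have "weak_conv_m (\<lambda>n. distr M borel (\<lambda>\<omega>. sqrt (real (card (tree (n - 1)))) * (1 / real (card (tree (n - 1))) * R (n - 1) \<omega> - \<rho>)))
      (normal_dist 0 (\<nu>\<^sup>2 - \<rho>\<^sup>2))"
  proof (rule residual_clt[where G = ?G and K = "8 + 8 * \<rho> ^ 4"])
    show "?G \<in> borel_measurable borel" by (simp add: borel_prod[symmetric])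
    fix k assume k: "s0 \<le> k"
    show "AE \<omega> in M. real_cond_exp M (H k) (\<lambda>\<omega>. ?G (\<epsilon> (2 * k) \<omega>, \<epsilon> (2 * k + 1) \<omega>)) \<omega> = 0"
      using cond_polynomial[OF k, of "- \<rho>" 0 1 0 0] by simp
    have e: "(?G (x, y))\<^sup>2 = \<rho>\<^sup>2 + (0 * ((x)\<^sup>2 + (y)\<^sup>2) + (- 2 * \<rho> * (x * y) + (0 * (x ^ 4 + y ^ 4) + 1 * ((x)\<^sup>2 * (y)\<^sup>2))))" for x y
      by (simp add: algebra_simps power2_eq_square)
    have v: "\<rho>\<^sup>2 + (0 * (\<sigma>\<^sup>2 + \<sigma>\<^sup>2) + (- 2 * \<rho> * \<rho> + (0 * (\<tau> ^ 4 + \<tau> ^ 4) + 1 * \<nu>\<^sup>2))) = \<nu>\<^sup>2 - \<rho>\<^sup>2"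
      by (simp add: algebra_simps power2_eq_square)
    show "AE \<omega> in M. real_cond_exp M (H k) (\<lambda>\<omega>. (?G (\<epsilon> (2 * k) \<omega>, \<epsilon> (2 * k + 1) \<omega>))\<^sup>2) \<omega> = \<nu>\<^sup>2 - \<rho>\<^sup>2"
      unfolding e v[symmetric] by (rule cond_polynomial[OF k])
  next
    fix z :: "real \<times> real"
    obtain x y where z: "z = (x, y)" by force
    have "?G z ^ 4 \<le> 8 * ((- \<rho>) ^ 4 + (x * y) ^ 4)" unfolding z fst_conv snd_conv by (rule power4_add_le)
    also have "\<dots> = 8 * \<rho> ^ 4 + 8 * (x ^ 4 * y ^ 4)" by (simp add: power_mult_distrib)
    also have "\<dots> \<le> 8 * \<rho> ^ 4 + 8 * \<rho> ^ 4 * (x ^ 8 + y ^ 8) + 8 * (1 + x ^ 8 + y ^ 8)"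
    proof -
      have "0 \<le> (x ^ 4 - y ^ 4)\<^sup>2" by simp
      also have "\<dots> = x ^ 8 + y ^ 8 - 2 * (x ^ 4 * y ^ 4)" by (simp add: power2_diff flip: power_mult)
      finally have "2 * (x ^ 4 * y ^ 4) \<le> x ^ 8 + y ^ 8" by simp
      moreover have "0 \<le> x ^ 8" "0 \<le> y ^ 8" "0 \<le> \<rho> ^ 4" by simp_all
      moreover from this have "0 \<le> \<rho> ^ 4 * (x ^ 8 + y ^ 8)" by simp
      ultimately show ?thesis by (simp only: mult.assoc) argo
    qed
    finally show "?G z ^ 4 \<le> (8 + 8 * \<rho> ^ 4) * (1 + fst z ^ 8 + snd z ^ 8)"
      by (simp add: z algebra_simps)
  next
    show "R n \<in> borel_measurable M" for n
      unfolding R_def by (intro residual_sum_measurable) auto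
    show "AE \<omega> in M. (\<lambda>n. 1 / sqrt (2 ^ (n + 1)) * (R n \<omega> - (\<Sum>k\<in>?T n. ?G (\<epsilon> (2 * k) \<omega>, \<epsilon> (2 * k + 1) \<omega>) + \<rho>))) \<longlonglongrightarrow> 0"
      using residual_products[of \<theta>0]
    proof eventually_elim
      case (elim \<omega>)
      have "R n \<omega> - (\<Sum>k\<in>?T n. ?G (\<epsilon> (2 * k) \<omega>, \<epsilon> (2 * k + 1) \<omega>) + \<rho>)
          = (\<Sum>k\<in>?T n. ?E \<omega> (2 * k + 0) * ?E \<omega> (2 * k + 1) - \<epsilon> (2 * k + 0) \<omega> * \<epsilon> (2 * k + 1) \<omega>)" for n
        by (simp add: R_def sum_subtractf)
      then show ?case using elim by simp
    qed
  qed simp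
  moreover have "rho_hat \<theta>0 (\<lambda>k. X k \<omega>) n = 1 / real (card (tree (n - 1))) * R (n - 1) \<omega>" for n \<omega>
    by (simp add: rho_hat_def R_def)
  ultimately show ?thesis by simp
qed

end

section \<open>The limit of the least squares estimator\<close>

definition blk :: "2 \<Rightarrow> real ^ (2 \<times> 'k) \<Rightarrow> real ^ 'k" where "blk c u = (\<chi> i. u $ (c, i))"

lemma sum_blocks: "(\<Sum>i\<in>UNIV. f i) = (\<Sum>i\<in>UNIV. f (1, i)) + (\<Sum>i\<in>UNIV. f (2, i))"
  for f :: "2 \<times> 'k::finite \<Rightarrow> real"
proof -
  have "(\<Sum>i\<in>UNIV. f i) = (\<Sum>c\<in>UNIV. \<Sum>i\<in>UNIV. f (c, i))" by (simp add: sum.cartesian_product)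
  then show ?thesis by (simp add: sum_2)
qed

lemma inner_blocks: "u \<bullet> v = blk 1 u \<bullet> blk 1 v + blk 2 u \<bullet> blk 2 v"
  by (simp add: inner_vec_def blk_def sum_blocks)

lemma kronecker_form:
  "u \<bullet> (kronecker (Gamma_mat s r) W *v v) = s * (blk 1 u \<bullet> (W *v blk 1 v) + blk 2 u \<bullet> (W *v blk 2 v))
    + r * (blk 1 u \<bullet> (W *v blk 2 v) + blk 2 u \<bullet> (W *v blk 1 v))"
  by (simp add: inner_vec_def matrix_vector_mult_def sum_blocks kronecker_def Gamma_mat_def blk_def sum_distrib_left sum.distrib algebra_simps)

lemma (in bar_path_lse) Linv_inner: "u \<bullet> (Linv *v v) = (Linv *v u) \<bullet> v"
proof -
  have t: "transpose L = L" by (simp add: vec_eq_iff transpose_def L_sym)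
  have i: "L *v (Linv *v x) = x" for x
    by (simp add: matrix_vector_mul_assoc matrix_inv_mult[OF invertible_L])
  have "u \<bullet> (Linv *v v) = (L *v (Linv *v u)) \<bullet> (Linv *v v)" by (simp only: i)
  also have "\<dots> = (Linv *v u) \<bullet> (L *v (Linv *v v))" using inner_transpose_left[of L "Linv *v u" "Linv *v v"] by (simp only: t)
  finally show ?thesis by (simp only: i)
qed

text \<open>Two errors are made: the square root of the tree size against that of 2^(n+1), and the
  estimator against \<open>Linv\<close> times the scores. Both are vanishing multiples of the
  normalised scores, which is why the denominator contains their norm.\<close>

lemma (in bar_path_lse) estimator_form_asymptotics:
  fixes u :: "real ^ (2 \<times> 'p option)"
  shows "(\<lambda>n. (u \<bullet> (sqrt (real (card (tree n))) *\<^sub>R (theta_hat \<theta>0 x (Suc n) - theta a b))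
      - 1 / sqrt (2 ^ (n + 1)) * ((Linv *v blk 1 u) \<bullet> Mt 0 n + (Linv *v blk 2 u) \<bullet> Mt 1 n))
    / (1 + 1 / sqrt (2 ^ (n + 1)) * (norm (Mt 0 n) + norm (Mt 1 n)))) \<longlonglongrightarrow> 0"
proof -
  obtain \<delta> C where \<delta>: "\<delta> \<longlonglongrightarrow> 0" and C: "0 \<le> C"
    and 1: "\<And>c. c \<in> {0, 1} \<Longrightarrow> eventually (\<lambda>n. norm (2 ^ (n + 1) *\<^sub>R (th c (Suc n) - tv c) - Linv *v Mt c n) \<le> \<delta> n * norm (Mt c n)) sequentially"
    and 2: "\<And>c. c \<in> {0, 1} \<Longrightarrow> eventually (\<lambda>n. norm (2 ^ (n + 1) *\<^sub>R (th c (Suc n) - tv c)) \<le> C * norm (Mt c n)) sequentially"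
    using lse_asymptotics by blast
  define s where "s = (\<lambda>n. sqrt (2 ^ (n + 1) :: real))"
  define r where "r = (\<lambda>n. sqrt (real (card (tree n))) / s n)"
  define U where "U = norm (blk 1 u) + norm (blk 2 u)"
  define w where "w = (\<lambda>n. \<bar>r n - 1\<bar> * C + \<bar>\<delta> n\<bar>)"
  have s: "0 < s n" "s n * s n = 2 ^ (n + 1)" for n by (simp_all add: s_def)
  have r: "r \<longlonglongrightarrow> 1" unfolding r_def s_def by (rule tree_ratio)
  have alg: "i * (p * (q * m)) + i * (p * (q * m')) = p * q * (i * (m + m'))" for i p q m m' :: real
    by (simp add: algebra_simps)
  have w0: "0 \<le> w n" for n using C by (simp add: w_def)
  have b: "\<bar>v \<bullet> (sqrt (real (card (tree n))) *\<^sub>R (th c (Suc n) - tv c)) - 1 / s n * (v \<bullet> (Linv *v Mt c n))\<bar> \<le> 1 / s n * (norm v * (w n * norm (Mt c n)))"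
    if "norm (2 ^ (n + 1) *\<^sub>R (th c (Suc n) - tv c) - Linv *v Mt c n) \<le> \<delta> n * norm (Mt c n)"
      "norm (2 ^ (n + 1) *\<^sub>R (th c (Suc n) - tv c)) \<le> C * norm (Mt c n)" for v c n
  proof -
    let ?d = "th c (Suc n) - tv c"
    \<comment> \<open>The factor 2^(n+1) of \<open>lse_asymptotics\<close> is recovered from the
      square root normalisation, at the price of the ratio \<open>r n\<close>.\<close>
    have "sqrt (real (card (tree n))) = 1 / s n * (r n * 2 ^ (n + 1))"
      using s(1)[of n] by (simp only: s(2)[symmetric]) (simp add: r_def)
    then have eq: "v \<bullet> (sqrt (real (card (tree n))) *\<^sub>R ?d) - 1 / s n * (v \<bullet> (Linv *v Mt c n))
        = 1 / s n * (v \<bullet> ((r n - 1) *\<^sub>R (2 ^ (n + 1) *\<^sub>R ?d) + (2 ^ (n + 1) *\<^sub>R ?d - Linv *v Mt c n)))"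
      by (simp only:) (simp add: inner_diff_right inner_add_right algebra_simps del: power_Suc)
    have "\<bar>v \<bullet> (sqrt (real (card (tree n))) *\<^sub>R ?d) - 1 / s n * (v \<bullet> (Linv *v Mt c n))\<bar> = 1 / s n * \<bar>v \<bullet> ((r n - 1) *\<^sub>R (2 ^ (n + 1) *\<^sub>R ?d) + (2 ^ (n + 1) *\<^sub>R ?d - Linv *v Mt c n))\<bar>"
      unfolding eq abs_mult using s(1)[of n] by simp
    also have "\<dots> \<le> 1 / s n * (norm v * (w n * norm (Mt c n)))"
    proof (rule mult_left_mono)
      have "norm ((r n - 1) *\<^sub>R (2 ^ (n + 1) *\<^sub>R ?d) + (2 ^ (n + 1) *\<^sub>R ?d - Linv *v Mt c n))
          \<le> norm ((r n - 1) *\<^sub>R (2 ^ (n + 1) *\<^sub>R ?d)) + norm (2 ^ (n + 1) *\<^sub>R ?d - Linv *v Mt c n)" by (rule norm_triangle_ineq)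
      also have "\<dots> = \<bar>r n - 1\<bar> * norm (2 ^ (n + 1) *\<^sub>R ?d) + norm (2 ^ (n + 1) *\<^sub>R ?d - Linv *v Mt c n)" by (simp only: norm_scaleR)
      also have "\<dots> \<le> \<bar>r n - 1\<bar> * (C * norm (Mt c n)) + \<bar>\<delta> n\<bar> * norm (Mt c n)"
        by (intro add_mono mult_left_mono that(2) abs_ge_zero order_trans[OF that(1)] mult_right_mono abs_ge_self norm_ge_zero)
      finally have "norm ((r n - 1) *\<^sub>R (2 ^ (n + 1) *\<^sub>R ?d) + (2 ^ (n + 1) *\<^sub>R ?d - Linv *v Mt c n)) \<le> w n * norm (Mt c n)"
        by (simp only: w_def distrib_right mult.assoc)
      then show "\<bar>v \<bullet> ((r n - 1) *\<^sub>R (2 ^ (n + 1) *\<^sub>R ?d) + (2 ^ (n + 1) *\<^sub>R ?d - Linv *v Mt c n))\<bar> \<le> norm v * (w n * norm (Mt c n))"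
        by (rule order_trans[OF Cauchy_Schwarz_ineq2 mult_left_mono[OF _ norm_ge_zero]])
    qed (use s(1)[of n] in auto)
    finally show ?thesis .
  qed
  have ev: "eventually (\<lambda>n. \<forall>c\<in>{0, 1}. norm (2 ^ (n + 1) *\<^sub>R (th c (Suc n) - tv c) - Linv *v Mt c n) \<le> \<delta> n * norm (Mt c n)
      \<and> norm (2 ^ (n + 1) *\<^sub>R (th c (Suc n) - tv c)) \<le> C * norm (Mt c n)) sequentially"
    by (intro eventually_ball_finite ballI eventually_conj 1 2) auto
  show ?thesis
  proof (rule Lim_null_comparison)
    show "eventually (\<lambda>n. norm ((u \<bullet> (sqrt (real (card (tree n))) *\<^sub>R (theta_hat \<theta>0 x (Suc n) - theta a b))
        - 1 / sqrt (2 ^ (n + 1)) * ((Linv *v blk 1 u) \<bullet> Mt 0 n + (Linv *v blk 2 u) \<bullet> Mt 1 n))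
      / (1 + 1 / sqrt (2 ^ (n + 1)) * (norm (Mt 0 n) + norm (Mt 1 n)))) \<le> U * w n) sequentially"
      using ev
    proof eventually_elim
      case (elim n)
      let ?q = "sqrt (real (card (tree n)))"
      let ?m0 = "norm (Mt 0 n)" and ?m1 = "norm (Mt 1 n)"
      have bl: "blk 1 (?q *\<^sub>R (theta_hat \<theta>0 x (Suc n) - theta a b)) = ?q *\<^sub>R (th 0 (Suc n) - tv 0)"
        "blk 2 (?q *\<^sub>R (theta_hat \<theta>0 x (Suc n) - theta a b)) = ?q *\<^sub>R (th 1 (Suc n) - tv 1)"
        by (simp_all add: vec_eq_iff blk_def th_def tv_def ix_def)
      let ?p = "\<lambda>v c. v \<bullet> (?q *\<^sub>R (th c (Suc n) - tv c)) - 1 / s n * (v \<bullet> (Linv *v Mt c n))"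
      have eq: "u \<bullet> (?q *\<^sub>R (theta_hat \<theta>0 x (Suc n) - theta a b)) - 1 / s n * ((Linv *v blk 1 u) \<bullet> Mt 0 n + (Linv *v blk 2 u) \<bullet> Mt 1 n)
          = ?p (blk 1 u) 0 + ?p (blk 2 u) 1"
        unfolding inner_blocks[of u] bl Linv_inner[symmetric] by (simp only: distrib_left)
      have "\<bar>?p (blk 1 u) 0 + ?p (blk 2 u) 1\<bar> \<le> 1 / s n * (norm (blk 1 u) * (w n * ?m0)) + 1 / s n * (norm (blk 2 u) * (w n * ?m1))"
        using elim by (intro order_trans[OF abs_triangle_ineq] add_mono b) (use elim in blast)+
      also have "\<dots> \<le> 1 / s n * (U * (w n * ?m0)) + 1 / s n * (U * (w n * ?m1))"
        using s(1)[of n] w0[of n] by (intro add_mono mult_left_mono mult_right_mono) (auto simp: U_def)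
      also have "\<dots> = U * w n * (1 / s n * (?m0 + ?m1))" by (rule alg)
      also have "\<dots> \<le> U * w n * (1 + 1 / s n * (?m0 + ?m1))"
        using w0[of n] by (intro mult_left_mono) (auto simp: U_def)
      finally have *: "\<bar>u \<bullet> (?q *\<^sub>R (theta_hat \<theta>0 x (Suc n) - theta a b)) - 1 / s n * ((Linv *v blk 1 u) \<bullet> Mt 0 n + (Linv *v blk 2 u) \<bullet> Mt 1 n)\<bar>
        \<le> U * w n * (1 + 1 / s n * (?m0 + ?m1))" unfolding eq .
      have pos: "0 < 1 + 1 / s n * (?m0 + ?m1)" using s(1)[of n] by (intro add_pos_nonneg) auto
      have sf: "sqrt (2 ^ (n + 1)) = s n" by (simp only: s_def)
      show ?case unfolding sf real_norm_def abs_divide abs_of_pos[OF pos] pos_divide_le_eq[OF pos] by (rule *)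
    qed
    have "(\<lambda>n. U * w n) \<longlonglongrightarrow> U * (\<bar>1 - 1\<bar> * C + \<bar>0\<bar>)" unfolding w_def by (intro tendsto_intros r \<delta>)
    then show "(\<lambda>n. U * w n) \<longlonglongrightarrow> 0" by simp
  qed
qed

context bar_model
begin

abbreviation V :: "real ^ (2 \<times> 'p option) ^ (2 \<times> 'p option)" where
  "V \<equiv> kronecker (Gamma_mat (\<sigma>\<^sup>2) \<rho>) (matrix_inv L)"

text \<open>Statements about \<open>L\<close> are deterministic, so a single good trajectory
  suffices to import them.\<close>

lemma lse_path_exists: "\<exists>\<omega>. bar_path_lse N a b (\<sigma>\<^sup>2) (\<lambda>k. X k \<omega>) (\<lambda>k. \<epsilon> k \<omega>)"
proof (rule ccontr)
  assume "\<not> ?thesis"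
  then have "AE \<omega> in M. False" using AE_lse by simp
  then show False by simp
qed

text \<open>With \<open>w1\<close> and \<open>w2\<close> the inverse of \<open>L\<close> applied to
  the two blocks of \<open>u\<close>, the covariance form becomes the limiting variance of
  \<open>linear_clt\<close>. It is nonnegative because semidefiniteness of \<open>L\<close> bounds
  the mixed term and |rho| < sigma^2.\<close>

lemma V_form:
  fixes u :: "real ^ (2 \<times> 'p option)"
  defines "w1 \<equiv> matrix_inv L *v blk 1 u" and "w2 \<equiv> matrix_inv L *v blk 2 u"
  shows "u \<bullet> (V *v u) = \<sigma>\<^sup>2 * (w1 \<bullet> (L *v w1) + w2 \<bullet> (L *v w2)) + 2 * \<rho> * (w1 \<bullet> (L *v w2))" "0 \<le> u \<bullet> (V *v u)"
proof -
  obtain \<omega> where "bar_path_lse N a b (\<sigma>\<^sup>2) (\<lambda>k. X k \<omega>) (\<lambda>k. \<epsilon> k \<omega>)" using lse_path_exists ..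
  then interpret P: bar_path_lse N a b "\<sigma>\<^sup>2" "\<lambda>k. X k \<omega>" "\<lambda>k. \<epsilon> k \<omega>" 0 .
  have i: "L *v (matrix_inv L *v x) = x" for x
    by (simp add: matrix_vector_mul_assoc matrix_inv_mult[OF P.invertible_L])
  have "w2 \<bullet> (L *v w1) = w1 \<bullet> (L *v w2)"
    unfolding w1_def w2_def i using P.Linv_inner[of "blk 1 u" "blk 2 u"] by (simp add: inner_commute)
  moreover have "w1 \<bullet> (L *v w1) = blk 1 u \<bullet> (matrix_inv L *v blk 1 u)" "w2 \<bullet> (L *v w2) = blk 2 u \<bullet> (matrix_inv L *v blk 2 u)"
    "w2 \<bullet> (L *v w1) = blk 1 u \<bullet> (matrix_inv L *v blk 2 u)" "w1 \<bullet> (L *v w2) = blk 2 u \<bullet> (matrix_inv L *v blk 1 u)"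
    unfolding w1_def w2_def i by (simp_all add: inner_commute)
  ultimately show eq: "u \<bullet> (V *v u) = \<sigma>\<^sup>2 * (w1 \<bullet> (L *v w1) + w2 \<bullet> (L *v w2)) + 2 * \<rho> * (w1 \<bullet> (L *v w2))"
    unfolding kronecker_form by simp
  let ?m = "w1 \<bullet> (L *v w2)" and ?q = "w1 \<bullet> (L *v w1) + w2 \<bullet> (L *v w2)"
  have "0 \<le> (w1 + w2) \<bullet> (L *v (w1 + w2))" "0 \<le> (w1 - w2) \<bullet> (L *v (w1 - w2))" by (rule P.L_nonneg)+
  then have "\<bar>2 * ?m\<bar> \<le> ?q"
    using \<open>w2 \<bullet> (L *v w1) = w1 \<bullet> (L *v w2)\<close>
    by (simp add: matrix_vector_right_distrib matrix_vector_mult_diff_distrib inner_add_left inner_add_right inner_diff_left inner_diff_right abs_le_iff)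
  then have "\<bar>\<rho>\<bar> * \<bar>2 * ?m\<bar> \<le> \<sigma>\<^sup>2 * ?q" using rho_less by (intro mult_mono) auto
  moreover have "- \<bar>\<rho> * (2 * ?m)\<bar> \<le> \<rho> * (2 * ?m)" by linarith
  then have "- (\<bar>\<rho>\<bar> * \<bar>2 * ?m\<bar>) \<le> 2 * \<rho> * ?m" by (simp only: abs_mult mult.commute mult.left_commute mult.assoc)
  ultimately show "0 \<le> u \<bullet> (V *v u)" unfolding eq by linarith
qed

text \<open>Makes the choice of a square root in \<open>mv_normal\<close> meaningful.\<close>

lemma V_sqrt: "\<exists>C :: real ^ (2 \<times> 'p option) ^ (2 \<times> 'p option). C ** transpose C = V"
proof (rule psd_sqrt_exists)
  obtain \<omega> where "bar_path_lse N a b (\<sigma>\<^sup>2) (\<lambda>k. X k \<omega>) (\<lambda>k. \<epsilon> k \<omega>)" using lse_path_exists ..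
  then interpret P: bar_path_lse N a b "\<sigma>\<^sup>2" "\<lambda>k. X k \<omega>" "\<lambda>k. \<epsilon> k \<omega>" 0 .
  have e: "matrix_inv L $ i $ j = axis i 1 \<bullet> (matrix_inv L *v axis j 1)" for i j
    by (simp add: matrix_vector_mult_basis column_def inner_axis')
  have "matrix_inv L $ i $ j = matrix_inv L $ j $ i" for i j
    unfolding e using P.Linv_inner[of "axis i 1" "axis j 1"] by (simp only: inner_commute)
  moreover have "Gamma_mat s r $ i $ j = Gamma_mat s r $ j $ i" for s r i j
    using exhaust_2[of i] exhaust_2[of j] by (auto simp: Gamma_mat_def)
  ultimately show "transpose V = V" unfolding vec_eq_iff transpose_def kronecker_def by simp
qed (rule V_form(2))

definition MX :: "nat \<Rightarrow> nat \<Rightarrow> 'w \<Rightarrow> real ^ ('p option)" where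
  "MX c n \<omega> = (\<Sum>k\<in>tree_from n (CARD('p) - 1). \<epsilon> (2 * k + c) \<omega> *\<^sub>R Yvec (\<lambda>j. X j \<omega>) k)"

lemma MX_nth: "MX c n \<omega> $ i = (\<Sum>k\<in>tree_from n (CARD('p) - 1). DY c i k \<omega>)"
  unfolding MX_def sum_component by (rule sum.cong) (auto simp: DY_def YX_def tree_from_eq s0_def)

lemma MX_measurable: "MX c n \<in> borel_measurable M"
proof (rule borel_measurable_vec)
  fix i
  have "(\<lambda>\<omega>. YX k i \<omega> * \<epsilon> (2 * k + c) \<omega>) \<in> borel_measurable M" if "s0 \<le> k" for k
    by (intro borel_measurable_times YX_M eps_M that)
  then show "(\<lambda>\<omega>. MX c n \<omega> $ i) \<in> borel_measurable M"
    unfolding MX_nth DY_def by (intro borel_measurable_sum) (auto simp: tree_from_eq s0_def)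
qed

lemma MX_sq:
  assumes c: "c \<in> {0, 1}"
  shows "\<exists>C\<ge>0. \<forall>n. integrable M (\<lambda>\<omega>. (norm (MX c n \<omega>))\<^sup>2) \<and> (\<integral>\<omega>. (norm (MX c n \<omega>))\<^sup>2 \<partial>M) \<le> C * 2 ^ (n + 1)"
proof -
  have "\<forall>i. \<exists>C\<ge>0. \<forall>n. integrable M (\<lambda>\<omega>. (MX c n \<omega> $ i)\<^sup>2) \<and> (\<integral>\<omega>. (MX c n \<omega> $ i)\<^sup>2 \<partial>M) \<le> C * 2 ^ (n + 1)"
    unfolding MX_nth using DY_sum_sq[OF c] by blast
  then obtain D where D: "\<And>i. 0 \<le> D i" "\<And>i n. integrable M (\<lambda>\<omega>. (MX c n \<omega> $ i)\<^sup>2)"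
    "\<And>i n. (\<integral>\<omega>. (MX c n \<omega> $ i)\<^sup>2 \<partial>M) \<le> D i * 2 ^ (n + 1)" by metis
  have n: "(norm v)\<^sup>2 = (\<Sum>i\<in>UNIV. (v $ i)\<^sup>2)" for v :: "real ^ ('p option)"
    unfolding power2_norm_eq_inner inner_vec_def by (simp add: power2_eq_square)
  have "(\<integral>\<omega>. (norm (MX c n \<omega>))\<^sup>2 \<partial>M) \<le> (\<Sum>i\<in>UNIV. D i) * 2 ^ (n + 1)" for n
  proof -
    have "(\<integral>\<omega>. (norm (MX c n \<omega>))\<^sup>2 \<partial>M) = (\<Sum>i\<in>UNIV. \<integral>\<omega>. (MX c n \<omega> $ i)\<^sup>2 \<partial>M)" unfolding n using D(2) by simp
    also have "\<dots> \<le> (\<Sum>i\<in>UNIV. D i * 2 ^ (n + 1))" by (intro sum_mono D)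
    finally show ?thesis unfolding sum_distrib_right .
  qed
  moreover have "integrable M (\<lambda>\<omega>. (norm (MX c n \<omega>))\<^sup>2)" for n unfolding n using D(2) by simp
  moreover have "0 \<le> (\<Sum>i\<in>UNIV. D i)" using D(1) by (simp add: sum_nonneg)
  ultimately show ?thesis by blast
qed

text \<open>For each \<open>u\<close> the characteristic function of the normalised error is that of
  a real linear functional, which is asymptotically a linear combination of the scores;
  \<open>linear_clt\<close> gives its limit and \<open>weak_conv_vec_char\<close> concludes.\<close>

lemma theta_hat_clt:
  "weak_conv_vec (\<lambda>n. distr M borel (\<lambda>\<omega>. sqrt (real (card (tree (n - 1)))) *\<^sub>R (theta_hat (\<theta>0 :: real ^ (2 \<times> 'p option)) (\<lambda>k. X k \<omega>) n - theta a b)))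
    (mv_normal 0 V)"
proof -
  define F where "F = (\<lambda>n \<omega>. sqrt (real (card (tree (n - 1)))) *\<^sub>R (theta_hat \<theta>0 (\<lambda>k. X k \<omega>) n - theta a b))"
  have "(\<lambda>\<omega>. F n \<omega> $ i) \<in> borel_measurable M" for n i
    using theta_hat_measurable[of \<theta>0 n i] unfolding F_def by simp
  then have Fm [measurable]: "F n \<in> borel_measurable M" for n by (rule borel_measurable_vec)
  note [measurable] = MX_measurable
  obtain C0 where C0: "0 \<le> C0" "\<And>n. integrable M (\<lambda>\<omega>. (norm (MX 0 n \<omega>))\<^sup>2)" "\<And>n. (\<integral>\<omega>. (norm (MX 0 n \<omega>))\<^sup>2 \<partial>M) \<le> C0 * 2 ^ (n + 1)"
    using MX_sq[of 0] by auto
  obtain C1 where C1: "0 \<le> C1" "\<And>n. integrable M (\<lambda>\<omega>. (norm (MX 1 n \<omega>))\<^sup>2)" "\<And>n. (\<integral>\<omega>. (norm (MX 1 n \<omega>))\<^sup>2 \<partial>M) \<le> C1 * 2 ^ (n + 1)"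
    using MX_sq[of 1] by auto
  \<comment> \<open>The denominator produced by \<open>estimator_form_asymptotics\<close> is one
    plus this size of the normalised scores, which is bounded in L^2 uniformly in
    \<open>n\<close>.\<close>
  define \<xi> where "\<xi> = (\<lambda>n \<omega>. 1 / sqrt (2 ^ (n + 1)) * (norm (MX 0 n \<omega>) + norm (MX 1 n \<omega>)))"
  have \<xi>m [measurable]: "\<xi> n \<in> borel_measurable M" for n unfolding \<xi>_def by measurable
  let ?b = "\<lambda>n \<omega>. 2 / 2 ^ (n + 1) * ((norm (MX 0 n \<omega>))\<^sup>2 + (norm (MX 1 n \<omega>))\<^sup>2)"
  have \<xi>b: "(\<xi> n \<omega>)\<^sup>2 \<le> ?b n \<omega>" for n \<omega>
  proof -
    have "(\<xi> n \<omega>)\<^sup>2 = 1 / 2 ^ (n + 1) * (norm (MX 0 n \<omega>) + norm (MX 1 n \<omega>))\<^sup>2"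
      unfolding \<xi>_def power_mult_distrib power_divide by (simp del: power_Suc)
    also have "\<dots> \<le> 1 / 2 ^ (n + 1) * (2 * ((norm (MX 0 n \<omega>))\<^sup>2 + (norm (MX 1 n \<omega>))\<^sup>2))"
      using zero_le_power2[of "norm (MX 0 n \<omega>) - norm (MX 1 n \<omega>)"] by (intro mult_left_mono) (auto simp: power2_diff power2_sum)
    finally show ?thesis by (simp add: mult.assoc del: power_Suc)
  qed
  have bi: "integrable M (?b n)" for n using C0(2) C1(2) by (intro integrable_mult_right Bochner_Integration.integrable_add)
  have \<xi>i: "integrable M (\<lambda>\<omega>. (\<xi> n \<omega>)\<^sup>2)" for n
    by (rule Bochner_Integration.integrable_bound[OF bi[of n]]) (use \<xi>b[of n] in \<open>auto intro!: AE_I2 order_trans[OF _ abs_ge_self] simp del: power_Suc\<close>)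
  have \<xi>E: "(\<integral>\<omega>. (\<xi> n \<omega>)\<^sup>2 \<partial>M) \<le> 2 * (C0 + C1)" for n
  proof -
    have "(\<integral>\<omega>. (\<xi> n \<omega>)\<^sup>2 \<partial>M) \<le> (\<integral>\<omega>. ?b n \<omega> \<partial>M)" by (rule integral_mono[OF \<xi>i bi \<xi>b])
    also have "\<dots> = 2 / 2 ^ (n + 1) * ((\<integral>\<omega>. (norm (MX 0 n \<omega>))\<^sup>2 \<partial>M) + (\<integral>\<omega>. (norm (MX 1 n \<omega>))\<^sup>2 \<partial>M))"
      using C0(2) C1(2) by (simp only: integral_mult_right_zero Bochner_Integration.integral_add)
    also have "\<dots> \<le> 2 / 2 ^ (n + 1) * (C0 * 2 ^ (n + 1) + C1 * 2 ^ (n + 1))"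
      by (intro mult_left_mono add_mono C0 C1) auto
    also have "\<dots> = 2 * (C0 + C1)" by (simp add: field_simps)
    finally show ?thesis .
  qed
  have "(\<lambda>n. \<integral>\<omega>. iexp (u \<bullet> F n \<omega>) \<partial>M) \<longlonglongrightarrow> exp (- of_real (u \<bullet> (V *v u)) / 2)" for u
  proof -
    let ?w1 = "matrix_inv L *v blk 1 u" and ?w2 = "matrix_inv L *v blk 2 u"
    define g where "g = (\<lambda>n \<omega>. 1 / sqrt (2 ^ (n + 1)) * (?w1 \<bullet> MX 0 n \<omega> + ?w2 \<bullet> MX 1 n \<omega>))"
    have gm: "g n \<in> borel_measurable M" for n unfolding g_def by measurable
    have "(\<lambda>n. \<integral>\<omega>. iexp (1 * (u \<bullet> F (Suc n) \<omega>)) \<partial>M) \<longlonglongrightarrow> exp (- of_real (u \<bullet> (V *v u)) / 2)"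
    proof (rule slutsky_char[OF _ gm \<xi>m _ \<xi>i \<xi>E])
      show "0 \<le> \<xi> n \<omega>" for n \<omega> by (simp add: \<xi>_def)
      show "AE \<omega> in M. (\<lambda>n. (u \<bullet> F (Suc n) \<omega> - g n \<omega>) / (1 + \<xi> n \<omega>)) \<longlonglongrightarrow> 0"
        using AE_lse
      proof eventually_elim
        case (elim \<omega>)
        interpret P: bar_path_lse N a b "\<sigma>\<^sup>2" "\<lambda>k. X k \<omega>" "\<lambda>k. \<epsilon> k \<omega>" \<theta>0 by fact
        have "P.Mt c n = MX c n \<omega>" for c n by (simp add: P.Mt_def MX_def)
        with P.estimator_form_asymptotics[of u] show ?case by (simp add: F_def g_def \<xi>_def)
      qed
      have "g n \<omega> = 1 / sqrt (2 ^ (n + 1)) * (\<Sum>k\<in>tree_from n (CARD('p) - 1). dotY ?w1 k \<omega> * \<epsilon> (2 * k) \<omega> + dotY ?w2 k \<omega> * \<epsilon> (2 * k + 1) \<omega>)" for n \<omega>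
        by (simp add: g_def MX_def dotY_def inner_sum_right sum.distrib mult.commute)
      moreover have "of_real (exp (- (1\<^sup>2 * r / 2))) = (exp (- of_real r / 2) :: complex)" for r :: real
        unfolding exp_of_real[symmetric] by simp
      ultimately show "(\<lambda>n. \<integral>\<omega>. iexp (1 * g n \<omega>) \<partial>M) \<longlonglongrightarrow> exp (- of_real (u \<bullet> (V *v u)) / 2)"
        using linear_clt[of 1 ?w1 ?w2] unfolding V_form(1)[symmetric] by (simp only:)
    qed measurable
    then show ?thesis by (intro LIMSEQ_imp_Suc[where f = "\<lambda>n. \<integral>\<omega>. iexp (u \<bullet> F n \<omega>) \<partial>M"]) simp
  qed
  moreover have "(\<integral>x. iexp (u \<bullet> x) \<partial>distr M borel (F n)) = (\<integral>\<omega>. iexp (u \<bullet> F n \<omega>) \<partial>M)" for u n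
    by (rule integral_distr) simp_all
  ultimately have "weak_conv_vec (\<lambda>n. distr M borel (F n)) (mv_normal 0 V)"
    by (intro weak_conv_vec_char) (auto simp: mv_normal_props[OF V_sqrt] intro!: prob_space_distr)
  then show ?thesis by (simp add: F_def)
qed

end

theorem theorem5p4:
  fixes M :: "'w measure"
    and X \<epsilon> :: "nat \<Rightarrow> 'w \<Rightarrow> real"
    and a b :: "nat \<Rightarrow> real"
    and N :: "real ^ ('p::{finite,linorder}) \<Rightarrow> real"
    and \<theta>0 :: "real ^ (2 \<times> 'p option)"
    and \<sigma> \<rho> \<tau> \<nu> :: real
  assumes "prob_space M"
    and X_rv: "\<And>n. n \<ge> 1 \<Longrightarrow> X n \<in> borel_measurable M"
    and eps_rv: "\<And>n. n \<ge> 2 ^ CARD('p) \<Longrightarrow> \<epsilon> n \<in> borel_measurable M"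
    and bar_even: "\<And>n \<omega>. n \<ge> 2 ^ (CARD('p) - 1) \<Longrightarrow> \<omega> \<in> space M \<Longrightarrow>
      X (2 * n) \<omega> = a 0 + (\<Sum>k = 1..CARD('p). a k * X (n div 2 ^ (k - 1)) \<omega>) + \<epsilon> (2 * n) \<omega>"
    and bar_odd: "\<And>n \<omega>. n \<ge> 2 ^ (CARD('p) - 1) \<Longrightarrow> \<omega> \<in> space M \<Longrightarrow>
      X (2 * n + 1) \<omega> = b 0 + (\<Sum>k = 1..CARD('p). b k * X (n div 2 ^ (k - 1)) \<omega>) + \<epsilon> (2 * n + 1) \<omega>"
    and initial: "\<And>k. 1 \<le> k \<Longrightarrow> k \<le> 2 ^ CARD('p) - 1 \<Longrightarrow> integrable M (\<lambda>\<omega>. X k \<omega> ^ 8)"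
    and norm: "is_norm N"
    and stable: "max (op_norm N (companion a)) (op_norm N (companion b)) < 1"
    and sigma_pos: "\<sigma>\<^sup>2 > 0" and rho_less: "\<bar>\<rho>\<bar> < \<sigma>\<^sup>2"
    and H1_L2: "\<And>n k. n \<ge> CARD('p) - 1 \<Longrightarrow> k \<in> gen (n + 1) \<Longrightarrow> integrable M (\<lambda>\<omega>. \<epsilon> k \<omega> ^ 2)"
    and H1_mean: "\<And>n k. n \<ge> CARD('p) - 1 \<Longrightarrow> k \<in> gen (n + 1) \<Longrightarrow>
      AE \<omega> in M. real_cond_exp M (tree_sigma M X n) (\<epsilon> k) \<omega> = 0"
    and H1_var: "\<And>n k. n \<ge> CARD('p) - 1 \<Longrightarrow> k \<in> gen (n + 1) \<Longrightarrow>
      AE \<omega> in M. real_cond_exp M (tree_sigma M X n) (\<lambda>\<omega>. \<epsilon> k \<omega> ^ 2) \<omega> = \<sigma>\<^sup>2"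
    and H2_cov: "\<And>n k l. n \<ge> CARD('p) - 1 \<Longrightarrow> k \<in> gen (n + 1) \<Longrightarrow> l \<in> gen (n + 1) \<Longrightarrow>
      k \<noteq> l \<Longrightarrow> k div 2 = l div 2 \<Longrightarrow>
      AE \<omega> in M. real_cond_exp M (tree_sigma M X n) (\<lambda>\<omega>. \<epsilon> k \<omega> * \<epsilon> l \<omega>) \<omega> = \<rho>"
    and H2_indep: "\<And>n. n \<ge> CARD('p) - 1 \<Longrightarrow>
      cond_indep_vars M (tree_sigma M X n) (borel :: (real \<times> real) measure)
        (\<lambda>j \<omega>. (\<epsilon> (2 * j) \<omega>, \<epsilon> (2 * j + 1) \<omega>)) (gen n)"
    and H3_L4: "\<And>n k. n \<ge> CARD('p) - 1 \<Longrightarrow> k \<in> gen (n + 1) \<Longrightarrow> integrable M (\<lambda>\<omega>. \<epsilon> k \<omega> ^ 4)"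
    and H3_sup: "AE \<omega> in M. (SUP n \<in> {CARD('p) - 1..}. SUP k \<in> gen (n + 1).
      ereal (real_cond_exp M (tree_sigma M X n) (\<lambda>\<omega>. \<epsilon> k \<omega> ^ 4) \<omega>)) < \<infinity>"
    and tau_pos: "\<tau> ^ 4 > 0" and nu_less: "\<nu>\<^sup>2 < \<tau> ^ 4"
    and H4_tau: "\<And>n k. n \<ge> CARD('p) - 1 \<Longrightarrow> k \<in> gen (n + 1) \<Longrightarrow>
      AE \<omega> in M. real_cond_exp M (tree_sigma M X n) (\<lambda>\<omega>. \<epsilon> k \<omega> ^ 4) \<omega> = \<tau> ^ 4"
    and H4_nu: "\<And>n k l. n \<ge> CARD('p) - 1 \<Longrightarrow> k \<in> gen (n + 1) \<Longrightarrow> l \<in> gen (n + 1) \<Longrightarrow>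
      k \<noteq> l \<Longrightarrow> k div 2 = l div 2 \<Longrightarrow>
      AE \<omega> in M. real_cond_exp M (tree_sigma M X n) (\<lambda>\<omega>. \<epsilon> k \<omega> ^ 2 * \<epsilon> l \<omega> ^ 2) \<omega> = \<nu>\<^sup>2"
    and H5_L8: "\<And>n k. n \<ge> CARD('p) - 1 \<Longrightarrow> k \<in> gen (n + 1) \<Longrightarrow> integrable M (\<lambda>\<omega>. \<epsilon> k \<omega> ^ 8)"
    and H5_sup: "AE \<omega> in M. (SUP n \<in> {CARD('p) - 1..}. SUP k \<in> gen (n + 1).
      ereal (real_cond_exp M (tree_sigma M X n) (\<lambda>\<omega>. \<epsilon> k \<omega> ^ 8) \<omega>)) < \<infinity>"
  shows "weak_conv_vec
           (\<lambda>n. distr M borel (\<lambda>\<omega>. sqrt (real (card (tree (n - 1)))) *\<^sub>R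
              (theta_hat \<theta>0 (\<lambda>k. X k \<omega>) n - theta a b)))
           (mv_normal 0 (kronecker (Gamma_mat (\<sigma>\<^sup>2) \<rho>) (matrix_inv (L_mat a b (\<sigma>\<^sup>2)))))
       \<and> weak_conv_m
           (\<lambda>n. distr M borel (\<lambda>\<omega>. sqrt (real (card (tree (n - 1)))) *
              (sigma2_hat \<theta>0 (\<lambda>k. X k \<omega>) n - \<sigma>\<^sup>2)))
           (normal_dist 0 ((\<tau> ^ 4 - 2 * \<sigma> ^ 4 + \<nu>\<^sup>2) / 2))
       \<and> weak_conv_m
           (\<lambda>n. distr M borel (\<lambda>\<omega>. sqrt (real (card (tree (n - 1)))) *
              (rho_hat \<theta>0 (\<lambda>k. X k \<omega>) n - \<rho>)))
           (normal_dist 0 (\<nu>\<^sup>2 - \<rho>\<^sup>2))"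
proof -
  interpret prob_space M by fact
  interpret bar_model M N a b \<sigma> X \<epsilon> \<rho> \<tau> \<nu>
    by unfold_locales fact+
  show ?thesis using theta_hat_clt sigma2_hat_clt rho_hat_clt by blast
qed

end
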